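(* Let $N\ge 2$, let $\Omega\subset\mathbb{R}^N$ be a smooth bounded domain with boundary $\partial\Omega$, and let $1<q<p$. Assume that one of the following assumptions is satisfied: (i) $p\in I(q)$; (ii) $p\le q+1$ and $\Omega$ is an $N$-ball. Then the problem $$-\Delta_p u-\Delta_q u=\lambda_1(p)|u|^{p-2}u+\mu|u|^{q-2}u\ \text{ in }\Omega,\qquad u=0\ \text{ on }\partial\Omega,$$ has no positive solution for $\mu>\beta_*$, where $$\beta_*=\frac{\int_\Omega|\nabla\varphi_p|^q\,dx}{\int_\Omega\varphi_p^q\,dx}.$$ Moreover, if $p<q+1$ and $\Omega$ is an $N$-ball, then this problem has no positive solution also for $\mu=\beta_*$.
   Context: For $q>1$, $$I(q):=\{p>1:\ (q-1)s^p+qs^{p-1}-(p-q)s+(q-p+1)\ge 0\ \text{ for all } s\ge 0\}.$$ $\Delta_r u=\mathrm{div}(|\nabla u|^{r-2}\nabla u)$ is the $r$-Laplacian. $\lambda_1(p)=\inf\left\{\frac{\int_\Omega|\nabla u|^p\,dx}{\int_\Omega|u|^p\,dx}:\ u\in W_0^{1,p}(\Omega)\setminus\{0\}\right\}$ is the first eigenvalue of the Dirichlet $p$-Laplacian in $\Omega$, which is simple, and $\varphi_p$ is the corresponding first eigenfunction, chosen positive and normalized by $\|\nabla\varphi_p\|_p=1$, where $\|\cdot\|_p$ is the $L^p(\Omega)$ norm. A solution is understood in the weak sense: $u\in W_0^{1,p}(\Omega)$ with $$\int_\Omega|\nabla u|^{p-2}\nabla u\nabla\varphi\,dx+\int_\Omega|\nabla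 u|^{q-2}\nabla u\nabla\varphi\,dx=\lambda_1(p)\int_\Omega|u|^{p-2}u\varphi\,dx+\mu\int_\Omega|u|^{q-2}u\varphi\,dx\quad\text{for all }\varphi\in W_0^{1,p}(\Omega);$$ it is positive if $u>0$ in $\Omega$. An $N$-ball is an open ball in $\mathbb{R}^N$. *)

theory Defs
  imports "HOL-Analysis.Analysis"
begin

primrec Ck :: "nat \<Rightarrow> ('a::euclidean_space \<Rightarrow> real) \<Rightarrow> bool" where
  "Ck 0 f \<longleftrightarrow> continuous_on UNIV f"
| "Ck (Suc k) f \<longleftrightarrow> (\<forall>x. f differentiable (at x)) \<and>
     (\<forall>v. Ck k (\<lambda>x. frechet_derivative f (at x) v))"

definition smooth_fun :: "('a::euclidean_space \<Rightarrow> real) \<Rightarrow> bool" where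
  "smooth_fun f \<longleftrightarrow> (\<forall>k. Ck k f)"

text \<open>Near each boundary point, the domain is the strict epigraph of a smooth function \<open>\<gamma>\<close> in the
  direction of a unit vector \<open>\<nu>\<close>. The function \<open>\<gamma>\<close> is evaluated only on the hyperplane orthogonal
  to \<open>\<nu>\<close>, in place of Euclidean \<open>(N - 1)\<close>-space; a smooth function on that hyperplane extends smoothly
  to the whole space by composition with the orthogonal projection.\<close>

definition smooth_boundary :: "'a::euclidean_space set \<Rightarrow> bool" where
  "smooth_boundary \<Omega> \<longleftrightarrow> (\<forall>x0\<in>frontier \<Omega>. \<exists>r>0. \<exists>\<nu> \<gamma>. norm \<nu> = 1 \<and> smooth_fun \<gamma> \<and>
     \<Omega> \<inter> ball x0 r = {x \<in> ball x0 r. \<gamma> (x - (x \<bullet> \<nu>) *\<^sub>R \<nu>) < x \<bullet> \<nu>})"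

definition smooth_bounded_domain :: "'a::euclidean_space set \<Rightarrow> bool" where
  "smooth_bounded_domain \<Omega> \<longleftrightarrow>
     open \<Omega> \<and> connected \<Omega> \<and> \<Omega> \<noteq> {} \<and> bounded \<Omega> \<and> smooth_boundary \<Omega>"

definition is_N_ball :: "'a::euclidean_space set \<Rightarrow> bool" where
  "is_N_ball \<Omega> \<longleftrightarrow> (\<exists>x r. 0 < r \<and> \<Omega> = ball x r)"

text \<open>Elements of these spaces are represented by functions on the whole space; their values outside
  \<open>\<Omega>\<close> and on null sets are irrelevant.\<close>

definition Lp_space ::
    "'a::euclidean_space set \<Rightarrow> real \<Rightarrow> ('a \<Rightarrow> 'b::euclidean_space) set" where
  "Lp_space \<Omega> p = {f \<in> borel_measurable (lebesgue_on \<Omega>).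
     integrable (lebesgue_on \<Omega>) (\<lambda>x. norm (f x) powr p)}"

definition Lp_norm ::
    "'a::euclidean_space set \<Rightarrow> real \<Rightarrow> ('a \<Rightarrow> 'b::euclidean_space) \<Rightarrow> real" where
  "Lp_norm \<Omega> p f = (LINT x|lebesgue_on \<Omega>. norm (f x) powr p) powr (1 / p)"

definition locally_integrable ::
    "'a::euclidean_space set \<Rightarrow> ('a \<Rightarrow> 'b::euclidean_space) \<Rightarrow> bool" where
  "locally_integrable \<Omega> f \<longleftrightarrow> (\<forall>K. compact K \<and> K \<subseteq> \<Omega> \<longrightarrow> integrable (lebesgue_on K) f)"

definition test_functions :: "'a::euclidean_space set \<Rightarrow> ('a \<Rightarrow> real) set" where
  "test_functions \<Omega> =
     {\<phi>. smooth_fun \<phi> \<and> compact (closure {x. \<phi> x \<noteq> 0}) \<and> closure {x. \<phi> x \<noteq> 0} \<subseteq> \<Omega>}"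

definition has_weak_gradient ::
    "'a::euclidean_space set \<Rightarrow> ('a \<Rightarrow> real) \<Rightarrow> ('a \<Rightarrow> 'a) \<Rightarrow> bool" where
  "has_weak_gradient \<Omega> u g \<longleftrightarrow> locally_integrable \<Omega> u \<and> locally_integrable \<Omega> g \<and>
     (\<forall>\<phi>\<in>test_functions \<Omega>. \<forall>v.
        (LINT x|lebesgue_on \<Omega>. u x * frechet_derivative \<phi> (at x) v) =
        - (LINT x|lebesgue_on \<Omega>. (g x \<bullet> v) * \<phi> x))"

text \<open>Weak gradients are unique only up to null sets; \<open>weak_grad\<close> selects one of them.\<close>

definition weak_grad :: "'a::euclidean_space set \<Rightarrow> ('a \<Rightarrow> real) \<Rightarrow> 'a \<Rightarrow> 'a" where
  "weak_grad \<Omega> u = (SOME g. has_weak_gradient \<Omega> u g)"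

definition W1p :: "'a::euclidean_space set \<Rightarrow> real \<Rightarrow> ('a \<Rightarrow> real) set" where
  "W1p \<Omega> p = {u \<in> Lp_space \<Omega> p. \<exists>g \<in> Lp_space \<Omega> p. has_weak_gradient \<Omega> u g}"

definition W1p_norm :: "'a::euclidean_space set \<Rightarrow> real \<Rightarrow> ('a \<Rightarrow> real) \<Rightarrow> real" where
  "W1p_norm \<Omega> p u = (Lp_norm \<Omega> p u powr p + Lp_norm \<Omega> p (weak_grad \<Omega> u) powr p) powr (1 / p)"

text \<open>The closure of the test functions in \<open>W1p \<Omega> p\<close>.\<close>

definition W01p :: "'a::euclidean_space set \<Rightarrow> real \<Rightarrow> ('a \<Rightarrow> real) set" where
  "W01p \<Omega> p = {u \<in> W1p \<Omega> p. \<forall>\<epsilon>>0. \<exists>\<phi>\<in>test_functions \<Omega>. W1p_norm \<Omega> p (\<lambda>x. u x - \<phi> x) < \<epsilon>}"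

text \<open>The weak forms of minus the \<open>r\<close>-Laplacian of \<open>u\<close>, and of the power \<open>|u|\<^sup>r\<^sup>-\<^sup>2 u\<close>, tested
  against \<open>v\<close>. Where \<open>\<nabla>u\<close> or \<open>u\<close> vanishes the integrands are \<open>0\<close>, also for \<open>r < 2\<close>.\<close>

definition r_laplacian_form ::
    "'a::euclidean_space set \<Rightarrow> real \<Rightarrow> ('a \<Rightarrow> real) \<Rightarrow> ('a \<Rightarrow> real) \<Rightarrow> real" where
  "r_laplacian_form \<Omega> r u v = (LINT x|lebesgue_on \<Omega>.
     norm (weak_grad \<Omega> u x) powr (r - 2) * (weak_grad \<Omega> u x \<bullet> weak_grad \<Omega> v x))"

definition r_power_form ::
    "'a::euclidean_space set \<Rightarrow> real \<Rightarrow> ('a \<Rightarrow> real) \<Rightarrow> ('a \<Rightarrow> real) \<Rightarrow> real" where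
  "r_power_form \<Omega> r u v = (LINT x|lebesgue_on \<Omega>. \<bar>u x\<bar> powr (r - 2) * u x * v x)"

definition rayleigh_quotient ::
    "'a::euclidean_space set \<Rightarrow> real \<Rightarrow> ('a \<Rightarrow> real) \<Rightarrow> real" where
  "rayleigh_quotient \<Omega> r u =
     (LINT x|lebesgue_on \<Omega>. norm (weak_grad \<Omega> u x) powr r) /
     (LINT x|lebesgue_on \<Omega>. \<bar>u x\<bar> powr r)"

definition lambda1 :: "'a::euclidean_space set \<Rightarrow> real \<Rightarrow> real" where
  "lambda1 \<Omega> p =
     Inf {rayleigh_quotient \<Omega> p u |u. u \<in> W01p \<Omega> p \<and> \<not> (AE x in lebesgue_on \<Omega>. u x = 0)}"

definition positive_in :: "'a::euclidean_space set \<Rightarrow> ('a \<Rightarrow> real) \<Rightarrow> bool" where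
  "positive_in \<Omega> u \<longleftrightarrow> (AE x in lebesgue_on \<Omega>. 0 < u x)"

definition first_eigenfunction ::
    "'a::euclidean_space set \<Rightarrow> real \<Rightarrow> ('a \<Rightarrow> real) \<Rightarrow> bool" where
  "first_eigenfunction \<Omega> p u \<longleftrightarrow> u \<in> W01p \<Omega> p \<and> \<not> (AE x in lebesgue_on \<Omega>. u x = 0) \<and>
     (\<forall>v\<in>W01p \<Omega> p. r_laplacian_form \<Omega> p u v = lambda1 \<Omega> p * r_power_form \<Omega> p u v)"

definition weak_solution ::
    "'a::euclidean_space set \<Rightarrow> real \<Rightarrow> real \<Rightarrow> real \<Rightarrow> ('a \<Rightarrow> real) \<Rightarrow> bool" where
  "weak_solution \<Omega> p q \<mu> u \<longleftrightarrow> u \<in> W01p \<Omega> p \<and>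
     (\<forall>v\<in>W01p \<Omega> p. r_laplacian_form \<Omega> p u v + r_laplacian_form \<Omega> q u v =
        lambda1 \<Omega> p * r_power_form \<Omega> p u v + \<mu> * r_power_form \<Omega> q u v)"

definition Iset :: "real \<Rightarrow> real set" where
  "Iset q = {p. 1 < p \<and> (\<forall>s\<ge>0.
     0 \<le> (q - 1) * s powr p + q * s powr (p - 1) - (p - q) * s + (q - p + 1))}"

text \<open>For the positive, normalized first eigenfunction \<open>\<phi>\<close> of the \<open>p\<close>-Laplacian this is \<open>\<beta>\<^sub>*\<close>.\<close>

definition beta_star :: "'a::euclidean_space set \<Rightarrow> real \<Rightarrow> ('a \<Rightarrow> real) \<Rightarrow> real" where
  "beta_star \<Omega> q \<phi> =
     (LINT x|lebesgue_on \<Omega>. norm (weak_grad \<Omega> \<phi> x) powr q) /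
     (LINT x|lebesgue_on \<Omega>. \<phi> x powr q)"

end

theory Submission
  imports Defs "HOL-Complex_Analysis.Complex_Analysis"
begin

text \<open>Testing the equation of a positive solution \<open>u\<close> with \<open>ph\<^sup>q u\<^sup>1\<^sup>-\<^sup>q\<close>, where \<open>ph\<close> is the first eigenfunction, and
  the eigenvalue equation of \<open>ph\<close> with \<open>ph\<^sup>q\<^sup>-\<^sup>p\<^sup>+\<^sup>1 u\<^sup>p\<^sup>-\<^sup>q\<close> gives \<open>mu (\<integral> ph\<^sup>q) \<le> \<integral> |\<nabla>ph|\<^sup>q\<close>, provided that a pointwise
  expression \<open>core\<close> in \<open>\<nabla>u\<close> and \<open>\<nabla>ph\<close> is nonnegative. For \<open>p \<in> I(q)\<close> it always is; for \<open>p \<le> q + 1\<close> it is when the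
  two gradients form an acute angle.

  In a ball \<open>ph\<close> is radially decreasing, and \<open>u\<close> is replaced by the limit of an increasing sequence of radially
  decreasing functions below it: each solves the radial equation whose source is computed from its predecessor, and stays
  below \<open>u\<close> by comparison. The iteration starts from a positive lower bound for \<open>u\<close> near the centre. No regularity theory
  is used for this bound: if minima of many translates of \<open>u\<close> could be small, Picone's inequality for such a minimum, which
  is a supersolution too, would be violated; a radial barrier then carries the bound to the centre.
  If \<open>mu (\<integral> ph\<^sup>q) \<ge> \<integral> |\<nabla>ph|\<^sup>q\<close>, the equality case makes the limit profile proportional to \<open>ph\<close>,
  so that one profile solves both a \<open>p\<close>- and a \<open>q\<close>-Laplacian radial equation, which is impossible for \<open>N \<ge> 2\<close>.\<close>

text \<open>With these two test functions both terms containing the first eigenvalue become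
  multiples of the integral of ph^q u^(p-q) and cancel, so that only \<open>mu\<close> remains. The
  exponent q - p + 1 of ph must be nonnegative; this is where p <= q + 1 enters. For fixed norms
  \<open>core\<close> is affine in the inner product of the gradients, so its sign is decided at the
  extreme angles. For opposite gradients it is the expression defining I(q); outside I(q) the angle
  has to be controlled, and in a ball nothing is known about the symmetry of u. Hence the passage to
  radial functions below u, for which the comparison works because the source is increasing in u.
  The iteration cannot start from 0, which is one of its fixed points; this is why a positive lower
  bound is indispensable. Neither u nor ph is known to be bounded. Truncating u as min(u, m) keeps a
  supersolution with source 0 where u > m, and truncating ph causes an error that vanishes in the
  limit because p > q. Both functions are positive only almost everywhere, so quotients are
  regularised by small shifts.\<close>

abbreviation lebesgue_int :: "('a::euclidean_space => 'b::{banach, second_countable_topology}) => 'b" (binder "LI " [60] 60)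
 where "lebesgue_int f == integral\<^sup>L lebesgue f"

abbreviation lebesgue_ae :: "('a::euclidean_space => bool) => bool" (binder "AL " 10)
 where "lebesgue_ae P == almost_everywhere lebesgue P"

abbreviation lmeas :: "('a::euclidean_space => 'b::topological_space) set" where "lmeas == borel_measurable lebesgue"

abbreviation lint :: "('a::euclidean_space => 'b::{banach, second_countable_topology}) => bool" where "lint == integrable lebesgue"

abbreviation lebesgue_nn :: "('a::euclidean_space => ennreal) => ennreal" (binder "NI " [60] 60)
 where "lebesgue_nn f == integral\<^sup>N lebesgue f"

notation inner (infixl "*." 70)
notation scaleR (infixr "*R" 75)
notation abs ("<|_|>")

abbreviation contU :: "('a::topological_space => 'b::topological_space) => bool" where "contU == continuous_on UNIV"

abbreviation seq_lim :: "(nat => 'b::topological_space) => 'b => bool" ("((_)/ ----> (_))" [60, 60] 60)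
 where "X ----> l == filterlim X (nhds l) sequentially"

lemmas con_sub = continuous_on_subset
 and con_comp = continuous_on_compose2
 and intb_bound = Bochner_Integration.integrable_bound
 and int_dom = integral_dominated_convergence
 and intb_cont = integrable_continuous_interval
 and real_vec_deriv = has_real_derivative_iff_has_vector_derivative
 and lint_cong = Bochner_Integration.integral_cong
 and intb_add = Bochner_Integration.integrable_add
 and con_at = continuous_at_imp_continuous_on
 and hk_combine = Henstock_Kurzweil_Integration.integral_combine
 and deriv_eqs = derivative_eq_intros
 and con_intros = continuous_intros
 and deriv_transform = has_field_derivative_transform_within
 and isCont_lim = isCont_tendsto_compose
 and con_eq_at = continuous_on_eq_continuous_at
 and mult_lm = mult_left_mono
 and mult_rm = mult_right_mono
 and nn_eq_lint = nn_integral_eq_integral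
 and meas_con = borel_measurable_continuous_onI
 and cpt_bounded = compact_imp_bounded
 and cpt_image = compact_continuous_image

subsection \<open>Smooth functions\<close>

text \<open>Derivatives are unique, so an explicit candidate may replace
  \<open>frechet_derivative\<close> in the recursion.\<close>

lemma Ck_SucI:
 assumes "!!x. (f has_derivative f' x) (at x)" "!!v. Ck k (%x. f' x v)"
 shows "Ck (Suc k) f"
proof -
 have "frechet_derivative f (at x) = f' x" for x
  using frechet_derivative_at[OF assms(1)] by metis
 then show ?thesis
  using assms by (auto simp: differentiable_def)
qed

lemma Ck_continuous: "Ck k f ==> contU f"
 by (cases k) (auto intro!: con_at differentiable_imp_continuous_within)

text \<open>The recursion for \<open>Suc k\<close> speaks of the derivatives of \<open>f\<close>
  only, so this inclusion needs an induction of its own.\<close>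

lemma Ck_SucD: "Ck (Suc k) f ==> Ck k f"
proof (induction k arbitrary: f)
 case 0
 then show ?case using Ck_continuous[of "Suc 0" f] by simp
next
 case (Suc k)
 show ?case
  unfolding Ck.simps(2)[of k]
 proof (intro conjI allI)
  show "f differentiable at x" for x using Suc.prems by simp
  show "Ck k (%x. frechet_derivative f (at x) v)" for v
  using Suc.prems Suc.IH by (metis Ck.simps(2))
 qed
qed

lemma Ck_const: "Ck k (%x. c)"
proof (induction k arbitrary: c)
 case (Suc k)
 show ?case by (rule Ck_SucI[where f' = "%x v. 0"]) (auto simp: Suc)
qed auto

lemma Ck_inner_left: "Ck k (%x. x *. v)"
proof (cases k)
 case (Suc m)
 show ?thesis unfolding Suc
  by (rule Ck_SucI[where f' = "%x h. h *. v"])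
  (auto intro!: deriv_eqs Ck_const)
qed (auto intro!: con_intros)

lemma Ck_has_derivative:
 "Ck (Suc k) f ==> (f has_derivative frechet_derivative f (at x)) (at x)"
 by (simp add: frechet_derivative_works[symmetric])

lemma Ck_add: "Ck k f ==> Ck k g ==> Ck k (%x. f x + g x)"
proof (induction k arbitrary: f g)
 case (Suc k)
 show ?case
  by (rule Ck_SucI[where f' = "%x v. frechet_derivative f (at x) v + frechet_derivative g (at x) v"])
  (use Suc in \<open>auto intro!: has_derivative_add Ck_has_derivative simp del: Ck.simps\<close>, simp add: Suc.IH)
qed (auto intro: con_intros)

lemma Ck_mult: "Ck k f ==> Ck k g ==> Ck k (%x. f x * g x)"
proof (induction k arbitrary: f g)
 case (Suc k)
 show ?case
 proof (rule Ck_SucI[where f' = "%x v. f x * frechet_derivative g (at x) v + frechet_derivative f (at x) v * g x"])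
  show "((%x. f x * g x) has_derivative
  (%v. f x * frechet_derivative g (at x) v + frechet_derivative f (at x) v * g x)) (at x)" for x
  by (rule has_derivative_mult) (use Suc.prems in "auto intro: Ck_has_derivative simp del: Ck.simps")
  show "Ck k (%x. f x * frechet_derivative g (at x) v + frechet_derivative f (at x) v * g x)" for v
  by (intro Ck_add Suc.IH) (use Suc.prems Ck_SucD in "auto")
 qed
qed (auto intro: con_intros)

text \<open>For \<open>m = 0\<close> this is the classical flat function exp(-1/t). The factor
  \<open>t ^ m\<close> in the denominator makes the family closed under differentiation: the
  derivative of a member is a combination of the members \<open>m + 1\<close> and
  \<open>m + 2\<close>.\<close>

definition flat_exp :: "nat => real => real" where
 "flat_exp m t = (if 0 < t then exp (- 1 / t) / t ^ m else 0)"

text \<open>One term of the exponential series at 1/t already beats every power of 1/t. A quadratic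
  bound is exactly what makes the difference quotient at 0 vanish.\<close>

lemma flat_exp_bound:
 assumes "0 < t" shows "flat_exp m t <= fact (m + 2) * t\<^sup>2"
proof -
 have "(1 / t) ^ (m + 2) / fact (m + 2) <= exp (1 / t)"
 proof -
  have "(\<Sum>n\<in>{m+2}. (1 / t) ^ n /\<^sub>R fact n) <= (\<Sum>n. (1 / t) ^ n /\<^sub>R fact n)"
  by (rule sum_le_suminf) (use assms summable_exp_generic[of "1 / t"] in simp_all)
  then show ?thesis by (simp add: exp_def divide_inverse mult.commute)
 qed
 moreover define c :: real where "c = fact (m + 2)"
 moreover have "c > 0" by (simp add: c_def del: fact_Suc)
 ultimately have "exp (- 1 / t) <= c * t ^ (m + 2)"
  using assms by (simp add: exp_minus field_simps power_divide del: fact_Suc power_Suc power_add)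
 then have "exp (- 1 / t) <= fact (m + 2) * t ^ (m + 2)" by (simp only: c_def)
 then have "exp (- 1 / t) / t ^ m <= fact (m + 2) * t ^ (m + 2) / t ^ m"
  using assms by (intro divide_right_mono) auto
 also have "... = fact (m + 2) * t\<^sup>2"
  using assms by (simp add: power_add power2_eq_square)
 finally show ?thesis using assms by (simp add: flat_exp_def)
qed

lemma flat_exp_nonneg: "0 <= flat_exp m t"
 by (simp add: flat_exp_def)

lemma flat_exp_has_derivative:
 "(flat_exp m has_real_derivative (flat_exp (m + 2) t - m * flat_exp (m + 1) t)) (at t)"
proof (cases t "0::real" rule: linorder_cases)
 case less
 have "((%t. 0) has_real_derivative 0) (at t)" by simp
 then have "(flat_exp m has_real_derivative 0) (at t)"
  by (rule deriv_transform[where d = "-t"])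
  (use less in "auto simp: flat_exp_def dist_real_def")
 then show ?thesis using less by (simp add: flat_exp_def)
next
 case greater
 have "((%t. exp (- 1 / t) / t ^ m) has_real_derivative
  (exp (- 1 / t) * (1 / t\<^sup>2) * t ^ m - exp (- 1 / t) * (m * t ^ (m - 1))) / (t ^ m * t ^ m)) (at t)"
  using greater by (auto intro!: deriv_eqs simp: power2_eq_square)
 also have "(exp (- 1 / t) * (1 / t\<^sup>2) * t ^ m - exp (- 1 / t) * (m * t ^ (m - 1))) / (t ^ m * t ^ m)
  = flat_exp (m + 2) t - m * flat_exp (m + 1) t"
  using greater by (cases m) (auto simp: flat_exp_def field_simps power2_eq_square)
 finally show ?thesis
  by (rule deriv_transform[where d = t])
  (use greater in "auto simp: flat_exp_def dist_real_def abs_if split: if_splits")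
next
 case equal
 have "((%h. (flat_exp m (0 + h) - flat_exp m 0) / h) \<longlongrightarrow> 0) (at 0)"
 proof (rule Lim_null_comparison[where g = "%h. fact (m + 2) * <|h|>"])
  have "norm ((flat_exp m (0 + h) - flat_exp m 0) / h) <= fact (m + 2) * <|h|>" if "h ~= 0" for h
  proof (cases "h > 0")
  case True
  then have "flat_exp m h / h <= fact (m + 2) * h\<^sup>2 / h"
  by (intro divide_right_mono flat_exp_bound) auto
  moreover have "0 <= flat_exp m h / h" using True flat_exp_nonneg[of m h] by simp
  ultimately show ?thesis using True
  by (simp add: flat_exp_def[of m 0] power2_eq_square del: fact_Suc)
  qed (simp add: flat_exp_def mult_le_0_iff del: fact_Suc)
  then show "\<forall>\<^sub>F h in at 0. norm ((flat_exp m (0 + h) - flat_exp m 0) / h) <= fact (m + 2) * <|h|>"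
  by (auto simp: eventually_at_filter)
  show "((%h::real. fact (m + 2) * <|h|>) \<longlongrightarrow> 0) (at 0)"
  by (rule tendsto_mult_right_zero, rule tendsto_rabs_zero, rule tendsto_ident_at)
 qed
 then show ?thesis unfolding DERIV_def equal by (simp add: flat_exp_def)
qed

text \<open>The induction must leave \<open>m\<close> free, since each derivative raises it. The
  argument is a quadratic polynomial in \<open>x\<close> and not the norm, so the centre causes no
  loss of smoothness.\<close>

lemma Ck_flat_exp_bump:
 fixes a :: "'a::euclidean_space"
 shows "Ck k (%x. flat_exp m (c - (x - a) *. (x - a)))"
proof (induction k arbitrary: m)
 case 0
 have "contU (flat_exp m)"
  using flat_exp_has_derivative DERIV_isCont con_at by blast
 then show ?case
  unfolding Ck.simps by (rule con_comp) (intro con_intros, auto)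
next
 case (Suc k)
 show ?case
 proof (rule Ck_SucI)
  show "((%x. flat_exp m (c - (x - a) *. (x - a))) has_derivative
  (%v. (flat_exp (m + 2) (c - (x - a) *. (x - a)) + (- real m) * flat_exp (m + 1) (c - (x - a) *. (x - a)))
  * ((-2) * (x *. v + - (a *. v))))) (at x)" for x
  proof -
  have "((%x. c - (x - a) *. (x - a)) has_derivative (%v. (-2) * (x *. v + - (a *. v)))) (at x)"
  by (auto intro!: deriv_eqs simp: algebra_simps inner_commute)
  from has_derivative_compose[OF this, of "flat_exp m"] flat_exp_has_derivative
  show ?thesis by (simp add: has_field_derivative_def)
  qed
  show "Ck k (%x. (flat_exp (m + 2) (c - (x - a) *. (x - a)) + (- real m) * flat_exp (m + 1) (c - (x - a) *. (x - a)))
  * ((-2) * (x *. v + - (a *. v))))" for v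
  by (intro Ck_mult Ck_add Suc.IH Ck_const Ck_inner_left)
 qed
qed

subsection \<open>Continuously differentiable functions with compact support\<close>

text \<open>Continuously differentiable functions of compact support, with the gradient carried
  along as data. Unlike test functions they are stable under composition with C1 functions vanishing
  at 0, which all truncations require.\<close>

definition c1c :: "'a::euclidean_space set => ('a => real) => ('a => 'a) => bool" where
 "c1c Om ph G \<longleftrightarrow> (ALL x. (ph has_derivative (%v. G x *. v)) (at x)) & contU G &
  (EX K. compact K & K <= Om & (ALL x. x ~: K --> ph x = 0 & G x = 0))"

lemma c1c_con: "c1c Om ph G ==> contU ph"
 unfolding c1c_def by (meson con_at has_derivative_continuous)

lemma c1c_mono: "c1c Om ph G ==> Om <= Om' ==> c1c Om' ph G"
 unfolding c1c_def by blast

lemma intb_compact: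
 fixes f :: "'a::euclidean_space => 'b::euclidean_space"
 assumes "contU f" "compact K" "!!x. x ~: K ==> f x = 0"
 shows "lint f"
proof -
 have "integrable lborel (%x. indicator K x *R f x)"
  by (rule borel_integrable_compact) (use assms con_sub[OF assms(1)] in auto)
 also have "(%x. indicator K x *R f x) = f" using assms(3) by (auto simp: indicator_def)
 finally show ?thesis by (simp add: integrable_completion)
qed

lemma bdd_compact:
 fixes f :: "'a::euclidean_space => 'b::real_normed_vector"
 assumes "contU f" "compact K" "!!x. x ~: K ==> f x = 0"
 shows "EX B>0. ALL x. norm (f x) <= B"
proof -
 have "bounded (f ` K)"
  by (intro cpt_bounded cpt_image con_sub[OF assms(1)] assms(2)) auto
 then obtain B where "B > 0" "!!x. x : K ==> norm (f x) <= B" by (auto simp: bounded_pos)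
 then show ?thesis using assms(3) by (metis norm_zero less_imp_le)
qed

text \<open>The gradient is uniformly continuous on a ball around its support, so the first-order
  expansion has an error uniform in \<open>x\<close>. Difference quotients under an integral are
  controlled in this way.\<close>

lemma c1c_uniform:
 assumes "c1c Om ph G" "e > 0"
 shows "EX d>0. ALL x h. norm h < d --> norm (G (x + h) - G x) <= e & <|ph (x + h) - ph x - G x *. h|> <= e * norm h"
proof -
 obtain K where K: "compact K" "!!x. x ~: K ==> ph x = 0 & G x = 0"
  and der: "!!x. (ph has_derivative (%v. G x *. v)) (at x)" and cont: "contU G"
  using assms(1) unfolding c1c_def by auto
 obtain R where R: "!!x. x : K ==> norm x <= R"
  using cpt_bounded[OF K(1)] unfolding bounded_iff by blast
 have "uniformly_continuous_on (cball 0 (R + 2)) G"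
  by (intro compact_uniformly_continuous con_sub[OF cont]) auto
 then obtain d0 where d0: "d0 > 0"
  "!!x x'. x : cball 0 (R+2) ==> x' : cball 0 (R+2) ==> dist x' x < d0 ==> dist (G x') (G x) < e"
  unfolding uniformly_continuous_on_def using assms(2) by metis
 \<comment> \<open>With steps of length at most 1, either both points lie in the ball of radius
   \<open>R + 2\<close>, or both lie outside \<open>K\<close>.\<close>
 define d where "d = min d0 1"
 have *: "norm (G (x + h) - G x) <= e" if "norm h < d" for x h
 proof (cases "norm x <= R + 1")
  case True
  then have "norm (x + h) <= R + 2" using that norm_triangle_ineq[of x h] by (simp add: d_def)
  then have "dist (G (x + h)) (G x) < e"
  using True that by (intro d0) (auto simp: d_def dist_norm[of "x + h" x])
  then show ?thesis by (simp add: dist_norm)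
 next
  case False
  then have "norm (x + h) > R" using that norm_triangle_ineq4[of "x + h" h] by (simp add: d_def)
  then have "x ~: K" "x + h ~: K" using False R by force+
  then show ?thesis using K(2) assms(2) by simp
 qed
 have "<|ph (x + h) - ph x - G x *. h|> <= e * norm h" if h: "norm h < d" for x h
 proof -
  have "norm (ph (x + h) - ph x - G x *. (x + h - x)) <= norm (x + h - x) * e"
  proof (rule differentiable_bound_linearization[where S = "ball x d" and f' = "%x v. G x *. v"])
  show "x + t *R (x + h - x) : ball x d" if "t : {0..1}" for t
  using that h mult_rm[of t 1 "norm h"] by (auto simp: dist_norm)
  show "(ph has_derivative (*.) (G z)) (at z within ball x d)" for z
  using der has_derivative_at_withinI by blast
  show "onorm ((%v. G z *. v) - (%v. G x *. v)) <= e" if "z : ball x d" for z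
  proof -
  have "(%v. G z *. v) - (%v. G x *. v) = (%v. (G z - G x) *. v)" by (auto simp: inner_diff_left)
  moreover have "onorm (%v. (G z - G x) *. v) <= norm (G z - G x)"
  by (rule onorm_bound) (auto simp: Cauchy_Schwarz_ineq2)
  moreover have "norm (G z - G x) <= e"
  using *[of "z - x" x] that by (simp add: dist_norm norm_minus_commute)
  ultimately show ?thesis by simp
  qed
  show "x : ball x d" using h by (auto intro: le_less_trans[OF norm_ge_zero])
  qed
  then show ?thesis by (simp add: mult.commute)
 qed
 then show ?thesis using * d0(1) by (intro exI[of _ d]) (auto simp: d_def)
qed

section \<open>Translation invariance of the completed Lebesgue measure\<close>

lemma distr_trans: "distr lebesgue lebesgue (%x::'a::euclidean_space. a + x) = lebesgue"
 and measurable_translation_lebesgue: "(%x::'a. a + x) : lebesgue \<rightarrow>\<^sub>M lebesgue"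
proof -
 have "(%x. a + (\<Sum>j\<in>Basis. (1 * (x *. j)) *R j)) = (%x. a + x)"
  by (simp add: euclidean_representation)
 then show "distr lebesgue lebesgue (%x. a + x) = lebesgue" "(%x. a + x) : lebesgue \<rightarrow>\<^sub>M lebesgue"
  using lebesgue_affine_euclidean[of "%_. 1" a] lebesgue_affine_measurable[of "%_. 1" a]
  by (auto simp: density_1)
qed

lemma nn_trans:
 fixes f :: "'a::euclidean_space => ennreal"
 assumes "f : lmeas"
 shows "(NI x. f (a + x)) = (NI x. f x)"
 using nn_integral_distr[OF measurable_translation_lebesgue[of a], of f] assms
 by (simp add: distr_trans)

lemma lint_trans:
 fixes f :: "'a::euclidean_space => 'b::{banach,second_countable_topology}"
 assumes "f : lmeas"
 shows "(LI x. f (a + x)) = (LI x. f x)"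
 using integral_distr[OF measurable_translation_lebesgue[of a], of f] assms
 by (simp add: distr_trans)

lemma intb_trans:
 fixes f :: "'a::euclidean_space => 'b::{banach,second_countable_topology}"
 assumes "lint f"
 shows "lint (%x. f (a + x))"
 using integrable_distr_eq[OF measurable_translation_lebesgue[of a], of f] assms
 by (simp add: distr_trans)

lemma AE_trans:
 fixes P :: "'a::euclidean_space => bool"
 assumes "AL x. P x" shows "AL x. P (a + x)"
proof -
 have "AE x in distr lebesgue lebesgue (%x. a + x). P x"
  using assms unfolding distr_trans .
 then show ?thesis by (rule AE_distrD[OF measurable_translation_lebesgue])
qed

text \<open>A function that is not integrable has Bochner integral 0 by convention, so the bound is
  trivial in that case.\<close>

lemma LINT_abs_bound:
 fixes f g :: "'a => real"
 assumes "integrable M g" "AE x in M. <|f x|> <= g x"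
 shows "<|LINT x|M. f x|> <= (LINT x|M. g x)"
proof (cases "integrable M f")
 case True
 have "<|LINT x|M. f x|> <= (LINT x|M. <|f x|>)" by (rule integral_abs_bound)
 also have "... <= (LINT x|M. g x)"
  by (rule integral_mono_AE) (use True assms in auto)
 finally show ?thesis .
next
 case False
 have "0 <= (LINT x|M. g x)"
  by (rule integral_nonneg_AE) (use assms(2) in eventually_elim, auto)
 then show ?thesis using False by (simp add: not_integrable_integral_eq)
qed

text \<open>By translation invariance the integral of ph(x + t v) - ph(x) is 0, and by the uniform
  expansion it differs from t times the claimed integral by at most t times an arbitrarily small
  number.\<close>

lemma c1c_integral_derivative:
 fixes ph :: "'a::euclidean_space => real"
 assumes "c1c Om ph G"
 shows "(LI x. G x *. v) = 0"
proof -
 obtain K where K: "compact K" "!!x. x ~: K ==> ph x = 0 & G x = 0" and cont: "contU G"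
  using assms(1) unfolding c1c_def by auto
 have cphi: "contU ph" using assms c1c_con by auto
 obtain R where R: "!!x. x : K ==> norm x <= R"
  using cpt_bounded[OF K(1)] unfolding bounded_iff by blast
 have intG: "lint (%x. G x *. v)"
  by (rule intb_compact[of _ K]) (use K cont in "auto intro!: con_intros")
 have intphi: "lint ph"
  by (rule intb_compact[of _ K]) (use K cphi in auto)
 define M where "M = measure lebesgue (cball (0::'a) (R + 1))"
 have "<|LI x. G x *. v|> <= e * (norm v * M)" if "e > 0" for e
 proof -
  obtain d where d: "d > 0" "!!x h. norm h < d ==> <|ph (x + h) - ph x - G x *. h|> <= e * norm h"
  using c1c_uniform[OF assms \<open>e > 0\<close>] by blast
  \<comment> \<open>The shift \<open>t *R v\<close> is then shorter than \<open>d\<close>, where the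
    expansion holds, and shorter than 1, which keeps the moved support inside the ball of radius
    \<open>R + 1\<close>.\<close>
  define t where "t = min d 1 / (2 * (norm v + 1))"
  have t: "t > 0" "norm (t *R v) < d" "norm (t *R v) <= 1"
  proof -
  show "t > 0" using d(1) by (auto simp: t_def intro!: divide_pos_pos add_nonneg_pos)
  have "norm (t *R v) = min d 1 * (norm v / (2 * (norm v + 1)))"
  using d(1) by (simp add: t_def)
  also have "norm v / (2 * (norm v + 1)) <= 1/2"
  using norm_ge_zero[of v] by (simp add: divide_simps del: norm_ge_zero)
  then have "min d 1 * (norm v / (2 * (norm v + 1))) <= min d 1 * (1/2)"
  using d(1) by (intro mult_lm) auto
  finally show "norm (t *R v) < d" "norm (t *R v) <= 1" using d(1) by linarith+
  qed
  let ?h = "t *R v"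
  have int2: "lint (%x. ph (?h + x))"
  using intb_trans intphi by blast
  have z: "(LI x. ph (?h + x) - ph x) = 0"
  using lint_trans[of ph ?h] intphi int2 by (simp add: Bochner_Integration.integral_diff)
  have "<|LI x. t * (G x *. v)|> = <|LI x. (ph (?h + x) - ph x) - t * (G x *. v)|>"
  by (subst Bochner_Integration.integral_diff) (use intG intphi int2 z in auto)
  also have "... <= (LI x. indicator (cball (0::'a) (R + 1)) x * (e * norm ?h))"
  proof (rule LINT_abs_bound)
  show "lint (%x. indicator (cball (0::'a) (R + 1)) x * (e * norm ?h))"
  using lmeasurable_cball[of 0 "R+1"] by (auto simp: fmeasurable_def less_top)
  have "<|ph (?h + x) - ph x - t * (G x *. v)|> <= indicator (cball (0::'a) (R + 1)) x * (e * norm ?h)" for x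
  proof (cases "norm x <= R + 1")
  case True
  then show ?thesis using d(2)[OF t(2), of x] by (simp add: add.commute)
  next
  case False
  then have "norm (?h + x) > R" using t(3) norm_triangle_ineq4[of "?h + x" ?h] by simp
  then have "x ~: K" "?h + x ~: K" using False R by force+
  then show ?thesis using K(2) False by simp
  qed
  then show "AL x. <|ph (?h + x) - ph x - t * (G x *. v)|> <= indicator (cball (0::'a) (R + 1)) x * (e * norm ?h)"
  by simp
  qed
  also have "... = t * (e * (norm v * M))" using t(1) by (simp add: M_def)
  finally show ?thesis using t(1) by (simp add: abs_mult mult_le_cancel_left)
 qed
 note * = this
 have "<|LI x. G x *. v|> <= 0 + e" if "e > 0" for e
 proof -
  have M: "0 <= norm v * M" by (simp add: M_def)
  then have "<|LI x. G x *. v|> <= (e / (norm v * M + 1)) * (norm v * M)"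
  using that by (intro *) auto
  also have "... = e * (norm v * M) / (norm v * M + 1)" by simp
  also have "... <= e * (norm v * M + 1) / (norm v * M + 1)"
  using that M by (intro divide_right_mono mult_lm) auto
  also have "... = e" using M by simp
  finally show ?thesis by simp
 qed
 then have "<|LI x. G x *. v|> <= 0" by (rule field_le_epsilon)
 then show ?thesis by simp
qed

lemma c1c_mult:
 assumes "c1c Om ph G" "!!x. (ps has_derivative (%v. H x *. v)) (at x)" "contU H"
 shows "c1c Om (%x. ph x * ps x) (%x. ps x *R G x + ph x *R H x)"
proof -
 obtain K where K: "compact K" "K <= Om" "!!x. x ~: K ==> ph x = 0 & G x = 0"
  and der: "!!x. (ph has_derivative (%v. G x *. v)) (at x)" and cont: "contU G"
  using assms(1) unfolding c1c_def by auto
 have cpsi: "contU ps"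
  using assms(2) by (meson con_at has_derivative_continuous)
 show ?thesis unfolding c1c_def
 proof (intro conjI allI exI[of _ K])
  show "((%x. ph x * ps x) has_derivative (*.) (ps x *R G x + ph x *R H x)) (at x)" for x
  by (rule has_derivative_eq_rhs[OF has_derivative_mult[OF der assms(2)]])
  (auto simp: inner_add_left algebra_simps)
  show "contU (%x. ps x *R G x + ph x *R H x)"
  by (intro con_intros cpsi cont assms(3) c1c_con[OF assms(1)])
 qed (use K in auto)
qed

lemma c1c_ibp:
 assumes "c1c Om ph G" "!!x. (ps has_derivative (%v. H x *. v)) (at x)" "contU H"
 shows "(LI x. ph x * (H x *. v)) = - (LI x. (G x *. v) * ps x)"
proof -
 obtain K where K: "compact K" "K <= Om" "!!x. x ~: K ==> ph x = 0 & G x = 0"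
  and cont: "contU G" using assms(1) unfolding c1c_def by auto
 have cpsi: "contU ps"
  using assms(2) by (meson con_at has_derivative_continuous)
 have "contU (%x. ph x * (H x *. v))"
  by (intro con_intros cont cpsi assms(3) c1c_con[OF assms(1)])
 then have 1: "lint (%x. ph x * (H x *. v))"
  by (rule intb_compact[OF _ K(1)]) (simp add: K(3))
 have "contU (%x. (G x *. v) * ps x)"
  by (intro con_intros cont cpsi assms(3) c1c_con[OF assms(1)])
 then have "lint (%x. (G x *. v) * ps x)"
  by (rule intb_compact[OF _ K(1)]) (simp add: K(3))
 with 1 have "(LI x. ph x * (H x *. v)) + (LI x. (G x *. v) * ps x)
  = (LI x. ph x * (H x *. v) + (G x *. v) * ps x)" by simp
 also have "... = (LI x. (ps x *R G x + ph x *R H x) *. v)"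
  by (intro lint_cong) (auto simp: inner_add_left algebra_simps)
 also have "... = 0" using c1c_integral_derivative[OF c1c_mult[OF assms]] .
 finally show ?thesis by simp
qed

subsection \<open>Mollification\<close>

definition grad :: "('a::euclidean_space => real) => 'a => 'a" where
 "grad ph x = (\<Sum>i\<in>Basis. frechet_derivative ph (at x) i *R i)"

lemma grad_inner:
 assumes "ph differentiable (at x)"
 shows "grad ph x *. v = frechet_derivative ph (at x) v"
proof -
 interpret linear "frechet_derivative ph (at x)"
  using assms linear_frechet_derivative by blast
 have "frechet_derivative ph (at x) v = frechet_derivative ph (at x) (\<Sum>i\<in>Basis. (v *. i) *R i)"
  by (simp add: euclidean_representation)
 also have "... = grad ph x *. v"
  by (simp add: sum scaleR grad_def inner_sum_left inner_commute[of v] mult.commute)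
 finally show ?thesis by simp
qed

lemma grad_eqI:
 assumes "(ph has_derivative (%v. g *. v)) (at x)"
 shows "grad ph x = g"
proof -
 have "frechet_derivative ph (at x) = (%v. g *. v)"
  using frechet_derivative_at[OF assms] by simp
 then show ?thesis by (simp add: grad_def euclidean_representation)
qed

lemma test_c1c:
 assumes "ph : test_functions Om"
 shows "c1c Om ph (grad ph)"
proof -
 have sm: "Ck k ph" for k using assms by (auto simp: test_functions_def smooth_fun_def)
 have d: "ph differentiable (at x)" for x using sm[of "Suc 0"] by simp
 have der: "(ph has_derivative (%v. grad ph x *. v)) (at x)" for x
  using d by (simp add: grad_inner frechet_derivative_works[symmetric])
 have "contU (%x. frechet_derivative ph (at x) v)" for v
  using sm[of "Suc 0"] by simp
 then have cont: "contU (grad ph)"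
  unfolding grad_def by (intro con_intros)
 let ?K = "closure {x. ph x ~= 0}"
 have z0: "ph x = 0" if "x ~: ?K" for x
  using that closure_subset[of "{x. ph x ~= 0}"] by auto
 have z: "ph x = 0 & grad ph x = 0" if "x ~: ?K" for x
 proof
  show "ph x = 0" by (rule z0[OF that])
  have "((%x. 0) has_derivative (%v. 0 *. v)) (at x)" by simp
  then have "(ph has_derivative (%v. 0 *. v)) (at x)"
  proof (rule has_derivative_transform_within_open[where s = "- ?K"])
  show "open (- ?K)" by (simp add: open_Compl)
  show "x : - ?K" using that by blast
  show "0 = ph y" if "y : - ?K" for y using z0[of y] that by (metis ComplD)
  qed
  then show "grad ph x = 0" by (rule grad_eqI)
 qed
 have K: "compact ?K" "?K <= Om" using assms by (auto simp: test_functions_def)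
 show ?thesis unfolding c1c_def
  by (intro conjI allI exI[of _ ?K] impI) (fact der cont K | (drule z, simp))+
qed

lemma c1c_grad_eq: "c1c Om ph G ==> grad ph = G"
 unfolding c1c_def by (auto intro!: grad_eqI)

lemma test_functionI:
 assumes "!!k. Ck k ph" "compact K" "K <= Om" "!!x. x ~: K ==> ph x = 0"
 shows "ph : test_functions Om"
proof -
 have *: "{x. ph x ~= 0} <= K" using assms(4) by auto
 then have "closure {x. ph x ~= 0} <= K"
  using assms(2) by (simp add: closure_minimal compact_imp_closed)
 moreover have "compact (closure {x. ph x ~= 0})"
  using * assms(2) by (meson bounded_subset compact_closure cpt_bounded)
 ultimately show ?thesis using assms by (auto simp: test_functions_def smooth_fun_def)
qed

lemma test_function_derivative:
 assumes "ph : test_functions Om"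
 shows "(%x. grad ph x *. v) : test_functions Om"
proof -
 obtain K where K: "compact K" "K <= Om" "!!x. x ~: K ==> ph x = 0 & grad ph x = 0"
  using test_c1c[OF assms] unfolding c1c_def by auto
 have sm: "Ck (Suc k) ph" for k using assms by (auto simp: test_functions_def smooth_fun_def)
 have "grad ph x *. v = frechet_derivative ph (at x) v" for x
  using sm[of 0] by (intro grad_inner) simp
 then have "Ck k (%x. grad ph x *. v)" for k using sm[of k] by simp
 then show ?thesis by (rule test_functionI[OF _ K(1,2)]) (use K in auto)
qed

definition conv :: "('a::euclidean_space => real) => ('a => real) => 'a => real" where
 "conv ph rh x = (LINT y|lebesgue. ph y * rh (x - y))"

lemma intb_mult_con:
 fixes ph rh :: "'a::euclidean_space => real"
 assumes "lint ph" "contU rh" "!!x. <|rh x|> <= B"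
 shows "lint (%y. ph y * rh y)"
proof (rule intb_bound[of _ "%y. B * ph y"])
 have "rh : borel_measurable borel" using assms(2) meas_con by blast
 then have "rh : lmeas" by (simp add: measurable_completion)
 then show "(%y. ph y * rh y) : lmeas" using assms(1) by auto
 have "0 <= B" using assms(3)[of undefined] by simp
 then have "norm (ph y * rh y) <= norm (B * ph y)" for y
  using mult_rm[OF assms(3), of "<|ph y|>" y] by (simp add: abs_mult mult.commute)
 then show "AL y. norm (ph y * rh y) <= norm (B * ph y)" by simp
qed (use assms in auto)

text \<open>Differentiation under the integral sign: the error of the uniform expansion of
  \<open>rh\<close> is multiplied by the L1 norm \<open>I\<close> of \<open>ph\<close>, hence the
  tolerance \<open>e / (I + 1)\<close>.\<close>

lemma conv_has_derivative:
 assumes phi: "lint ph" and rho: "c1c UNIV rh H"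
 shows "(conv ph rh has_derivative (%v. LINT y|lebesgue. ph y * (H (x - y) *. v))) (at x)"
proof -
 obtain K where K: "compact K" "!!x. x ~: K ==> rh x = 0 & H x = 0" and cH: "contU H"
  using rho unfolding c1c_def by auto
 have crho: "contU rh" using rho c1c_con by auto
 obtain B where B: "!!x. norm (rh x) <= B" using bdd_compact[OF crho K(1)] K(2) by blast
 obtain C where C: "!!x. norm (H x) <= C" using bdd_compact[OF cH K(1)] K(2) by blast
 have i1: "lint (%y. ph y * rh (x - y))" for x
  by (rule intb_mult_con[OF phi, where B = B])
  (use B in "auto intro!: con_comp[OF crho] con_intros")
 have i2: "lint (%y. ph y * (H (x - y) *. v))" for v x
 proof (rule intb_mult_con[OF phi, where B = "C * norm v"])
  show "contU (%y. H (x - y) *. v)"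
  by (intro continuous_on_inner con_comp[OF cH] con_intros) auto
  show "<|H (x - y) *. v|> <= C * norm v" for y
  by (rule order_trans[OF Cauchy_Schwarz_ineq2]) (simp add: C mult_rm)
 qed
 let ?D = "%v. LINT y|lebesgue. ph y * (H (x - y) *. v)"
 have bl: "bounded_linear ?D"
 proof (rule linear_conv_bounded_linear[THEN iffD1], rule linearI)
  show "?D (v + w) = ?D v + ?D w" for v w
  by (simp add: inner_add_right distrib_left i2)
  show "?D (r *R v) = r *R ?D v" for r v
  by (simp add: mult.left_commute)
 qed
 define I where "I = (LINT y|lebesgue. <|ph y|>)"
 have I0: "0 <= I" by (simp add: I_def)
 show ?thesis unfolding has_derivative_at_alt
 proof (intro conjI bl allI impI)
  fix e :: real assume e: "e > 0"
  obtain d where d: "d > 0" "!!z h. norm h < d ==> <|rh (z + h) - rh z - H z *. h|> <= e / (I + 1) * norm h"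
  using c1c_uniform[OF rho, of "e / (I + 1)"] e I0 by auto
  show "EX d>0. ALL x'. norm (x' - x) < d --> norm (conv ph rh x' - conv ph rh x - ?D (x' - x)) <= e * norm (x' - x)"
  proof (intro exI[of _ d] conjI allI impI d(1))
  fix x' assume x': "norm (x' - x) < d"
  have "conv ph rh x' - conv ph rh x - ?D (x' - x) =
  (LINT y|lebesgue. ph y * rh (x' - y) - ph y * rh (x - y) - ph y * (H (x - y) *. (x' - x)))"
  unfolding conv_def by (simp add: i1 i2)
  also have "<|...|> <= (LINT y|lebesgue. <|ph y|> * (e / (I + 1) * norm (x' - x)))"
  proof (rule LINT_abs_bound)
  have "<|ph y * rh (x' - y) - ph y * rh (x - y) - ph y * (H (x - y) *. (x' - x))|>
  <= <|ph y|> * (e / (I + 1) * norm (x' - x))" for y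
  proof -
  have "ph y * rh (x' - y) - ph y * rh (x - y) - ph y * (H (x - y) *. (x' - x))
  = ph y * (rh ((x - y) + (x' - x)) - rh (x - y) - H (x - y) *. (x' - x))"
  by (simp add: algebra_simps)
  then show ?thesis
  using mult_lm[OF d(2)[OF x', of "x - y"], of "<|ph y|>"] by (simp add: abs_mult)
  qed
  then show "AL y. <|ph y * rh (x' - y) - ph y * rh (x - y) - ph y * (H (x - y) *. (x' - x))|>
  <= <|ph y|> * (e / (I + 1) * norm (x' - x))" by simp
  qed (use phi in auto)
  also have "... = I * (e / (I + 1) * norm (x' - x))" by (simp add: I_def)
  also have "... = (I / (I + 1)) * (e * norm (x' - x))" by simp
  also have "... <= 1 * (e * norm (x' - x))"
  using I0 e by (intro mult_rm) auto
  finally show "norm (conv ph rh x' - conv ph rh x - ?D (x' - x)) <= e * norm (x' - x)" by simp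
  qed
 qed
qed

text \<open>Every derivative falls on the mollifier, and directional derivatives of test functions
  are test functions, so the induction runs over \<open>rh\<close>.\<close>

lemma Ck_conv:
 assumes phi: "lint ph"
 shows "rh : test_functions UNIV ==> Ck k (conv ph rh)"
proof (induction k arbitrary: rh)
 case 0
 have "(conv ph rh has_derivative (%v. LINT y|lebesgue. ph y * (grad rh (x - y) *. v))) (at x)" for x
  by (rule conv_has_derivative[OF phi test_c1c[OF 0]])
 then show ?case
  by (auto intro!: con_at has_derivative_continuous)
next
 case (Suc k)
 show ?case
 proof (rule Ck_SucI)
  show "(conv ph rh has_derivative (%v. LINT y|lebesgue. ph y * (grad rh (x - y) *. v))) (at x)" for x
  by (rule conv_has_derivative[OF phi test_c1c[OF Suc.prems]])
  show "Ck k (%x. LINT y|lebesgue. ph y * (grad rh (x - y) *. v))" for v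
  using Suc.IH[OF test_function_derivative[OF Suc.prems, of v]] by (simp add: conv_def[abs_def])
 qed
qed

lemma mollifier_exists:
 assumes "s > 0"
 obtains rh :: "'a::euclidean_space => real" where
  "rh : test_functions UNIV" "!!z. 0 <= rh z" "!!z. norm z >= s ==> rh z = 0"
  "!!x. lint (%y. rh (x - y))" "!!x. (LINT y|lebesgue. rh (x - y)) = 1"
proof -
 define b where "b = (%z::'a. flat_exp 0 (s\<^sup>2 - z *. z))"
 have zz: "b z = 0" if "norm z >= s" for z
  using power_mono[OF that, of 2] assms by (simp add: b_def flat_exp_def dot_square_norm not_less)
 have Ckb: "Ck k b" for k using Ck_flat_exp_bump[of k 0 "s\<^sup>2" 0] by (simp add: b_def)
 have cb: "contU b" using Ck_continuous[OF Ckb[of 0]] .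
 have ib: "lint b"
  by (rule intb_compact[OF cb compact_cball[of 0 s]]) (simp add: zz)
 have pos: "b z > 0" if "z : ball 0 s" for z
 proof -
  have "(norm z)^2 < s\<^sup>2" using that by (intro power_strict_mono) auto
  then show ?thesis by (simp add: b_def flat_exp_def dot_square_norm)
 qed
 define c where "c = (LINT z|lebesgue. b z)"
 have "c ~= 0"
 proof
  assume "c = 0"
  then have "AE z in lebesgue. b z = 0"
  using integral_nonneg_eq_0_iff_AE[OF ib] by (simp add: c_def b_def flat_exp_nonneg)
  then have "emeasure lebesgue (ball (0::'a) s) = 0"
  proof -
  have "ball (0::'a) s : null_sets lebesgue \<longleftrightarrow> (AE z in lebesgue. z ~: ball (0::'a) s)"
  by (rule AE_iff_null_sets) auto
  moreover have "AE z in lebesgue. z ~: ball (0::'a) s"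
  using \<open>AE z in lebesgue. b z = 0\<close> by eventually_elim (use pos in force)
  ultimately show ?thesis by auto
  qed
  then show False using open_not_negligible[of "ball (0::'a) s"] assms
  by (auto simp: negligible_iff_null_sets null_sets_def)
 qed
 moreover have "c >= 0" by (simp add: c_def b_def flat_exp_nonneg)
 ultimately have c: "c > 0" by simp
 define rh where "rh = (%z. (1 / c) * b z)"
 \<comment> \<open>Evenness turns the reflected kernel into a translate of \<open>rh\<close>, so
   translation invariance alone yields its integrability and its integral.\<close>
 have even: "rh (x - y) = rh (- x + y)" for x y
  by (simp add: rh_def b_def inner_diff inner_commute algebra_simps)
 show ?thesis
 proof (rule that[of rh])
  show "rh : test_functions UNIV"
  by (rule test_functionI[of _ "cball 0 s"])
  (auto simp: rh_def zz intro!: Ck_mult[of _ "%_. 1/c"] Ck_const Ckb simp del: times_divide_eq_left)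
  show "0 <= rh z" for z using c by (simp add: rh_def b_def flat_exp_nonneg)
  show "rh z = 0" if "norm z >= s" for z using zz[OF that] by (simp add: rh_def)
  show "lint (%y. rh (x - y))" for x
  unfolding even by (rule intb_trans) (use ib in "simp add: rh_def")
  show "(LINT y|lebesgue. rh (x - y)) = 1" for x
  unfolding even using lint_trans[of rh "-x"] ib c
  by (simp add: rh_def c_def)
 qed
qed

lemma mollifier_average_bound:
 fixes f :: "'a::euclidean_space => real"
 assumes f: "contU f" "!!y. <|f y|> <= B"
  and rho: "!!z. 0 <= rh z" "!!z. norm z >= s ==> rh z = 0"
  "lint (%y. rh (x - y))" "(LINT y|lebesgue. rh (x - y)) = 1"
  and close: "!!y. norm (y - x) < s ==> <|f y - c|> <= e"
 shows "<|(LINT y|lebesgue. f y * rh (x - y)) - c|> <= e"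
proof -
 have i: "lint (%y. rh (x - y) * f y)"
  by (rule intb_mult_con[OF rho(3) f])
 have "(LINT y|lebesgue. f y * rh (x - y)) - c = (LINT y|lebesgue. rh (x - y) * f y - c * rh (x - y))"
  using i rho(3,4) by (simp add: mult.commute)
 also have "<|...|> <= (LINT y|lebesgue. e * rh (x - y))"
 proof (rule LINT_abs_bound)
  have "<|rh (x - y) * f y - c * rh (x - y)|> <= e * rh (x - y)" for y
  proof (cases "norm (y - x) < s")
  case True
  have "rh (x - y) * f y - c * rh (x - y) = (f y - c) * rh (x - y)" by (simp add: algebra_simps)
  then show ?thesis using close[OF True] rho(1) by (simp add: abs_mult mult_rm)
  qed (use rho(2)[of "x - y"] in "simp add: norm_minus_commute")
  then show "AL y. <|rh (x - y) * f y - c * rh (x - y)|> <= e * rh (x - y)" by simp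
 qed (use rho(3) in auto)
 also have "... = e" using rho(4) by simp
 finally show ?thesis .
qed

lemma ucont_compact:
 fixes f :: "'a::euclidean_space => real"
 assumes "contU f" "compact K" "!!x. x ~: K ==> f x = 0" "e > 0"
 shows "EX d>0. ALL x y. norm (y - x) < d --> <|f y - f x|> <= e"
proof -
 obtain R where R: "!!x. x : K ==> norm x <= R"
  using cpt_bounded[OF assms(2)] unfolding bounded_iff by blast
 have "uniformly_continuous_on (cball 0 (R + 2)) f"
  by (intro compact_uniformly_continuous con_sub[OF assms(1)]) auto
 then obtain d0 where d0: "d0 > 0"
  "!!x x'. x : cball 0 (R+2) ==> x' : cball 0 (R+2) ==> dist x' x < d0 ==> dist (f x') (f x) < e"
  unfolding uniformly_continuous_on_def using assms(4) by metis
 have "<|f y - f x|> <= e" if "norm (y - x) < min d0 1" for x y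
 proof (cases "norm x <= R + 1")
  case True
  then have "norm y <= R + 2" using that norm_triangle_ineq[of x "y - x"] by simp
  then have "dist (f y) (f x) < e"
  using True that by (intro d0) (auto simp: dist_norm[of y x])
  then show ?thesis by (simp add: dist_norm)
 next
  case False
  then have "norm y > R" using that norm_triangle_ineq4[of y "y - x"] by simp
  then have "x ~: K" "y ~: K" using False R by force+
  then show ?thesis using assms(3,4) by simp
 qed
 then show ?thesis using d0(1) by (intro exI[of _ "min d0 1"]) auto
qed

text \<open>One compact \<open>K'\<close> serves all \<open>e\<close>, so that uniform closeness
  gives closeness of integrals. The gradient clause is conditional because the approximation is
  applied both to merely continuous functions and to C1 functions.\<close>

lemma mollify:
 fixes ph :: "'a::euclidean_space => real"
 assumes phi: "contU ph" and K: "compact K" "!!x. x ~: K ==> ph x = 0"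
  and Om: "open Om" "K <= Om"
 obtains K' where "compact K'" "K <= K'" "K' <= Om"
  "!!e. e > 0 ==> EX et:test_functions Om. (ALL x. x ~: K' --> et x = 0 & grad et x = 0) & (ALL x. <|et x - ph x|> <= e) &
  (ALL G. c1c Om ph G --> (ALL x v. <|grad et x *. v - G x *. v|> <= e * norm v))"
proof -
 obtain r where r: "r > 0" "(\<Union>x\<in>K. cball x r) <= Om"
  using compact_subset_open_imp_cball_epsilon_subset[OF K(1) Om] by blast
 define K' where "K' = {x + y |x y. x : K & y : cball 0 r}"
 have K'1: "compact K'" unfolding K'_def by (intro compact_sums K(1) compact_cball)
 have K'2: "K <= K'" using r(1) by (force simp: K'_def)
 have K'3: "K' <= Om" using r(2) by (force simp: K'_def dist_norm)
 obtain B where B: "!!x. norm (ph x) <= B" using bdd_compact[OF phi K] by blast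
 have iphi: "lint ph" by (rule intb_compact[OF phi K])
 show ?thesis
 proof (rule that[OF K'1 K'2 K'3])
  fix e :: real assume e: "e > 0"
  obtain d1 where d1: "d1 > 0" "!!x y. norm (y - x) < d1 ==> <|ph y - ph x|> <= e"
  using ucont_compact[OF phi K e] by blast
  \<comment> \<open>The gradient of \<open>ph\<close> is unique if it exists, so a single
    \<open>d2\<close> can be fixed before the quantifier over \<open>G\<close>.\<close>
  have "EX d2>0. ALL G. c1c Om ph G --> (ALL x y. norm (y - x) < d2 --> norm (G y - G x) <= e)"
  proof (cases "EX G. c1c Om ph G")
  case True
  then obtain G where G: "c1c Om ph G" by blast
  obtain d where "d > 0" "!!x h. norm h < d ==> norm (G (x + h) - G x) <= e"
  using c1c_uniform[OF G e] by blast
  then have "norm (G y - G x) <= e" if "norm (y - x) < d" for x y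
  using that by (metis add.commute diff_add_cancel)
  moreover have "G' = G" if "c1c Om ph G'" for G' using c1c_grad_eq that G by blast
  ultimately show ?thesis using \<open>d > 0\<close> by metis
  qed (use zero_less_one in blast)
  then obtain d2 where d2: "d2 > 0"
  "!!G x y. c1c Om ph G ==> norm (y - x) < d2 ==> norm (G y - G x) <= e" by blast
  define s where "s = min r (min d1 d2)"
  have s: "s > 0" using r d1 d2 by (simp add: s_def)
  obtain rh :: "'a => real" where rh: "rh : test_functions UNIV" "!!z. 0 <= rh z" "!!z. norm z >= s ==> rh z = 0"
  "!!x. lint (%y. rh (x - y))" "!!x. (LINT y|lebesgue. rh (x - y)) = 1"
  using mollifier_exists[OF s] by blast
  define et where "et = conv ph rh"
  have z: "et x = 0" if "x ~: K'" for x
  proof -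
  have "(%y. ph y * rh (x - y)) = (%y. 0)"
  proof
  fix y show "ph y * rh (x - y) = 0"
  proof (cases "y : K")
  case True
  have "norm (x - y) > r"
  proof (rule ccontr)
  assume "\<not> norm (x - y) > r"
  then have "x = y + (x - y) & y : K & x - y : cball 0 r" using True by simp
  then show False using that unfolding K'_def by blast
  qed
  then show ?thesis using rh(3)[of "x - y"] by (simp add: s_def)
  qed (simp add: K)
  qed
  then show ?thesis by (simp add: et_def conv_def)
  qed
  have der: "(et has_derivative (%v. LINT y|lebesgue. ph y * (grad rh (x - y) *. v))) (at x)" for x
  unfolding et_def by (rule conv_has_derivative[OF iphi test_c1c[OF rh(1)]])
  have test: "et : test_functions Om"
  by (rule test_functionI[OF _ K'1 K'3 z]) (simp_all add: et_def Ck_conv[OF iphi rh(1)])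
  show "EX et:test_functions Om. (ALL x. x ~: K' --> et x = 0 & grad et x = 0) & (ALL x. <|et x - ph x|> <= e) &
  (ALL G. c1c Om ph G --> (ALL x v. <|grad et x *. v - G x *. v|> <= e * norm v))"
  proof (intro bexI[OF _ test] conjI allI impI z)
  fix x
  show "<|et x - ph x|> <= e"
  unfolding et_def conv_def
  by (rule mollifier_average_bound[OF phi, of B]) (use B rh d1 in "auto simp: s_def")
  next
  fix G x v assume G: "c1c Om ph G"
  have cG: "contU G" using G by (auto simp: c1c_def)
  obtain KG where "compact KG" "!!x. x ~: KG ==> G x = 0" using G by (auto simp: c1c_def)
  then obtain C where C: "!!x. norm (G x) <= C" using bdd_compact[OF cG] by blast
  have "grad et x *. v = (LINT y|lebesgue. ph y * (grad rh (x - y) *. v))"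
  using grad_inner[of et x v] der[of x] frechet_derivative_at[OF der[of x]]
  by (metis differentiable_def)
  \<comment> \<open>Integration by parts moves the derivative from the kernel to \<open>ph\<close>:
    the gradient of the mollified function is the mollified gradient.\<close>
  also have "... = (LINT y|lebesgue. (G y *. v) * rh (x - y))"
  proof -
  have "(LINT y|lebesgue. ph y * (- grad rh (x - y) *. v)) = - (LINT y|lebesgue. (G y *. v) * rh (x - y))"
  proof (rule c1c_ibp[OF G, where ps = "%y. rh (x - y)"])
  show "((%y. rh (x - y)) has_derivative (*.) (- grad rh (x - y))) (at y)" for y
  proof -
  have "(rh has_derivative (%v. grad rh (x - y) *. v)) (at (x - y))"
  using test_c1c[OF rh(1)] by (simp add: c1c_def)
  moreover have "((%y. x - y) has_derivative (%v. - v)) (at y)"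
  by (auto intro!: deriv_eqs)
  ultimately have "((%y. rh (x - y)) has_derivative (%v. grad rh (x - y) *. (- v))) (at y)"
  by (rule has_derivative_compose[rotated])
  then show ?thesis by (rule has_derivative_eq_rhs) (simp add: fun_eq_iff)
  qed
  have "contU (grad rh)" using test_c1c[OF rh(1)] by (simp add: c1c_def)
  then show "contU (%y. - grad rh (x - y))"
  by (rule continuous_on_minus[OF con_comp[where f = "%y. x - y"]])
  (auto intro: continuous_on_diff continuous_on_const continuous_on_id)
  qed
  then show ?thesis by simp
  qed
  finally have eq: "grad et x *. v = (LINT y|lebesgue. (G y *. v) * rh (x - y))" .
  show "<|grad et x *. v - G x *. v|> <= e * norm v"
  unfolding eq
  proof (rule mollifier_average_bound[where B = "C * norm v" and s = s])
  show "contU (%y. G y *. v)" by (intro con_intros cG)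
  show "<|G y *. v|> <= C * norm v" for y
  by (rule order_trans[OF Cauchy_Schwarz_ineq2]) (simp add: C mult_rm)
  show "<|G y *. v - G x *. v|> <= e * norm v" if "norm (y - x) < s" for y
  proof -
  have "<|(G y - G x) *. v|> <= norm (G y - G x) * norm v" by (rule Cauchy_Schwarz_ineq2)
  also have "... <= e * norm v"
  using d2(2)[OF G, of y x] that by (intro mult_rm) (auto simp: s_def)
  finally show ?thesis by (simp add: inner_diff_left)
  qed
  qed (use rh in auto)
  next
  fix x assume x: "x ~: K'"
  have "((%x. 0) has_derivative (%v. 0 *. v)) (at x)" by simp
  then have "(et has_derivative (%v. 0 *. v)) (at x)"
  by (rule has_derivative_transform_within_open[where s = "- K'"])
  (use x z K'1 in "auto simp: compact_imp_closed open_Compl")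
  then show "grad et x = 0" by (rule grad_eqI)
  qed
 qed
qed

subsection \<open>Sobolev pairs\<close>

lemma powr_norm_add_le:
 fixes a b :: "'a::real_normed_vector"
 assumes "0 <= p"
 shows "norm (a + b) powr p <= 2 powr p * (norm a powr p + norm b powr p)"
proof -
 have "norm (a + b) powr p <= (2 * max (norm a) (norm b)) powr p"
  using norm_triangle_ineq[of a b] assms by (intro powr_mono2) auto
 also have "... = 2 powr p * max (norm a) (norm b) powr p"
  by (simp add: powr_mult)
 also have "max (norm a) (norm b) powr p <= norm a powr p + norm b powr p"
  by (auto simp: max_def)
 finally show ?thesis by (simp add: mult_lm)
qed

text \<open>The density of the p-th power of the Sobolev norm. Estimating it pointwise, with
  constants \<open>2 powr p\<close>, replaces the triangle inequality for the norm itself.\<close>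

definition pdens :: "real => ('a::euclidean_space => real) => ('a => 'a) => 'a => real" where
 "pdens p u g x = <|u x|> powr p + norm (g x) powr p"

lemma pdens_nonneg [simp]: "0 <= pdens p u g x"
 by (simp add: pdens_def)

lemma pdens_diff_commute: "pdens p (%x. u x - v x) (%x. g x - h x) = pdens p (%x. v x - u x) (%x. h x - g x)"
 by (auto simp: pdens_def norm_minus_commute abs_minus_commute)

lemma pdens_triangle:
 assumes "0 <= p"
 shows "pdens p (%x. u x - w x) (%x. g x - k x) x <=
  2 powr p * (pdens p (%x. u x - v x) (%x. g x - h x) x + pdens p (%x. v x - w x) (%x. h x - k x) x)"
 using powr_norm_add_le[OF assms, of "u x - v x" "v x - w x"] powr_norm_add_le[OF assms, of "g x - h x" "h x - k x"]
 by (simp add: pdens_def algebra_simps)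

lemma pdens_bound:
 assumes "0 <= p"
 shows "pdens p u g x <= 2 powr p * (pdens p (%x. u x - v x) (%x. g x - h x) x + pdens p v h x)"
 using pdens_triangle[OF assms, of u "%_. 0" g "%_. 0" x v h] by (simp add: pdens_def)

text \<open>The space of \<open>W01p\<close>, as pairs of a function and its gradient, both extended
  by 0 to the whole space. Having the gradient as an argument avoids the choice made in
  \<open>weak_grad\<close>, and the nonnegative integral measures distance without prior
  integrability.\<close>

definition sob :: "'a::euclidean_space set => real => ('a => real) => ('a => 'a) => bool" where
 "sob Om p u g \<longleftrightarrow> u : lmeas & g : lmeas &
  (ALL e>0. EX ph G. c1c Om ph G &
  (NI x. ennreal (pdens p (%x. ph x - u x) (%x. G x - g x) x)) < ennreal e)"

lemma sob_meas:
 assumes "sob Om p u g" shows "u : lmeas" "g : lmeas"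
 using assms by (auto simp: sob_def)

lemma sob_mono: "sob Om p u g ==> Om <= Om' ==> sob Om' p u g"
 unfolding sob_def by (meson c1c_mono)

lemma pdens_measurable [measurable]:
 assumes [measurable]: "u : borel_measurable M" "g : borel_measurable M"
 shows "pdens p u g : borel_measurable M"
 unfolding pdens_def[abs_def] by measurable

lemma con_meas:
 fixes f :: "'a::euclidean_space => 'b::topological_space"
 assumes "contU f" shows "f : lmeas"
 using meas_con[OF assms] by (simp add: measurable_completion)

lemma c1c_meas:
 assumes "c1c Om ph G" shows "ph : lmeas" "G : lmeas"
 using c1c_con[OF assms] assms unfolding c1c_def by (auto intro: con_meas)

lemma c1c_pdens_integrable:
 assumes "c1c Om ph G" "0 < p" shows "lint (pdens p ph G)"
proof -
 obtain K where K: "compact K" "!!x. x ~: K ==> ph x = 0 & G x = 0" and cont: "contU G"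
  using assms(1) unfolding c1c_def by auto
 have "contU (pdens p ph G)"
  unfolding pdens_def[abs_def] using assms(2)
  by (intro continuous_on_add continuous_on_powr' continuous_on_norm continuous_on_rabs
  c1c_con[OF assms(1)] cont continuous_on_const) auto
 then show ?thesis by (rule intb_compact[OF _ K(1)]) (use K(2) in "simp add: pdens_def")
qed

lemma c1c_sob: "c1c Om ph G ==> sob Om p ph G"
 unfolding sob_def using c1c_meas[of Om ph G]
 by (auto intro!: exI[of _ ph] exI[of _ G] simp: pdens_def)

text \<open>As in the Riesz-Fischer theorem: approximants with errors below (1/2)^n have summable
  error densities, so they converge almost everywhere, and the sum of the densities yields one
  integrable majorant for all of them.\<close>

lemma sob_dominated:
 assumes s: "sob Om p u g" and p: "0 < p"
 obtains Ph G h where "!!n. c1c Om (Ph n) (G n)" "AL x. (%n. Ph n x) ----> u x"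
  "AL x. (%n. G n x) ----> g x" "lint h"
  "!!x. 0 <= h x" "AL x. ALL n. pdens p (Ph n) (G n) x <= h x" "AL x. pdens p u g x <= h x"
proof -
 note [measurable] = sob_meas[OF s]
 have "ALL n. EX ph G. c1c Om ph G &
  (NI x. ennreal (pdens p (%x. ph x - u x) (%x. G x - g x) x)) < ennreal ((1/2)^n)"
  using s unfolding sob_def by simp
 then obtain Ph G where c: "!!n. c1c Om (Ph n) (G n)"
  and small: "!!n. (NI x. ennreal (pdens p (%x. Ph n x - u x) (%x. G n x - g x) x)) < ennreal ((1/2)^n)"
  by metis
 note [measurable] = c1c_meas[OF c]
 define d where "d = (%n. pdens p (%x. Ph n x - u x) (%x. G n x - g x))"
 have dm[measurable]: "d n : lmeas" for n unfolding d_def by measurable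
 have d0: "0 <= d n x" for n x by (simp add: d_def)
 define S where "S = (%x. \<Sum>n. ennreal (d n x))"
 have "(NI x. S x) = (\<Sum>n. NI x. ennreal (d n x))"
  unfolding S_def by (rule nn_integral_suminf) measurable
 also have "... <= (\<Sum>n. ennreal ((1/2)^n))"
  by (intro suminf_le) (use small in "auto simp: d_def less_imp_le")
 also have "... = ennreal (\<Sum>n. (1/2)^n)"
  by (rule suminf_ennreal2) (auto intro: summable_geometric)
 finally have Sfin: "(NI x. S x) < \<infinity>"
  using le_less_trans by fastforce
 have Sm[measurable]: "S : lmeas" unfolding S_def by measurable
 have AES: "AL x. S x ~= \<infinity>"
  by (rule nn_integral_PInf_AE) (use Sfin in auto)
 define T where "T = (%x. enn2real (S x))"
 have Tm[measurable]: "T : lmeas" unfolding T_def by measurable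
 have T0: "0 <= T x" for x by (simp add: T_def)
 have Tint: "lint T"
 proof (rule integrableI_nonneg)
  have "(NI x. ennreal (T x)) <= (NI x. S x)"
  by (intro nn_integral_mono) (simp add: T_def ennreal_enn2real_if)
  then show "(NI x. ennreal (T x)) < \<infinity>" using Sfin by (rule le_less_trans)
 qed (auto simp: T0)
 have dT: "(%n. d n x) ----> 0 & (ALL n. d n x <= T x)" if "S x ~= \<infinity>" for x
 proof -
  have sm: "summable (%n. d n x)"
  by (rule summable_suminf_not_top) (use that d0 in "auto simp: S_def")
  then have "S x = ennreal (\<Sum>n. d n x)" unfolding S_def using d0 by (intro suminf_ennreal2) auto
  then have "T x = (\<Sum>n. d n x)" using d0 by (simp add: T_def suminf_nonneg sm)
  moreover have "d n x <= (\<Sum>n. d n x)" for n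
  using sum_le_suminf[OF sm, of "{n}"] d0 by auto
  ultimately show ?thesis using summable_LIMSEQ_zero[OF sm] by auto
 qed
 define C where "C = (2::real) powr p"
 have C: "C >= 1" using p by (simp add: C_def ge_one_powr_ge_zero)
 \<comment> \<open>The triangle inequality is used twice, from the first approximant to
   \<open>u\<close> and from \<open>u\<close> to an arbitrary approximant; each use costs a factor
   \<open>C\<close>, and each error density is at most \<open>T\<close>.\<close>
 define h where "h = (%x. C * (T x + C * (T x + pdens p (Ph 0) (G 0) x)))"
 have hi: "lint h"
  unfolding h_def using Tint c1c_pdens_integrable[OF c[of 0] p] by (intro integrable_mult_right intb_add)
 have ub: "pdens p u g x <= C * (T x + pdens p (Ph 0) (G 0) x)" if "S x ~= \<infinity>" for x
 proof -
  have "pdens p u g x <= C * (d 0 x + pdens p (Ph 0) (G 0) x)"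
  using pdens_bound[of p u g x "Ph 0" "G 0"] p pdens_diff_commute[of p u "Ph 0" g "G 0"]
  by (simp add: C_def d_def)
  also have "... <= C * (T x + pdens p (Ph 0) (G 0) x)"
  using dT[OF that] C by (intro mult_lm add_right_mono) auto
  finally show ?thesis .
 qed
 have uh: "pdens p u g x <= h x" if "S x ~= \<infinity>" for x
 proof -
  let ?Y = "C * (T x + pdens p (Ph 0) (G 0) x)"
  have "0 <= ?Y" using C T0[of x] by (intro mult_nonneg_nonneg add_nonneg_nonneg) auto
  then have "?Y <= T x + ?Y & 0 <= T x + ?Y" using T0[of x] by simp
  then have "?Y <= C * (T x + ?Y)" using mult_rm[OF C, of "T x + ?Y"] by simp
  then show ?thesis using ub[OF that] by (simp add: h_def)
 qed
 have Ph: "pdens p (Ph n) (G n) x <= h x" if "S x ~= \<infinity>" for n x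
 proof -
  have "pdens p (Ph n) (G n) x <= C * (d n x + pdens p u g x)"
  using pdens_bound[of p "Ph n" "G n" x u g] p by (simp add: C_def d_def)
  also have "... <= h x"
  unfolding h_def using C dT[OF that] ub[OF that] by (intro mult_lm add_mono) auto
  finally show ?thesis .
 qed
 have conv: "(%n. Ph n x) ----> u x & (%n. G n x) ----> g x" if "S x ~= \<infinity>" for x
 proof -
  have d: "(%n. (d n x) powr (1/p)) ----> 0"
  by (rule tendsto_zero_powrI[OF _ tendsto_const]) (use dT[OF that] p d0 in auto)
  have b1: "norm (Ph n x - u x) <= (d n x) powr (1/p)" for n
  proof -
  have "<|Ph n x - u x|> powr p <= d n x" by (simp add: d_def pdens_def)
  then have "(<|Ph n x - u x|> powr p) powr (1/p) <= (d n x) powr (1/p)"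
  using p by (intro powr_mono2) auto
  then show ?thesis using p by (simp add: powr_powr)
  qed
  have b2: "norm (G n x - g x) <= (d n x) powr (1/p)" for n
  proof -
  have "norm (G n x - g x) powr p <= d n x" by (simp add: d_def pdens_def)
  then have "(norm (G n x - g x) powr p) powr (1/p) <= (d n x) powr (1/p)"
  using p by (intro powr_mono2) auto
  then show ?thesis using p by (simp add: powr_powr)
  qed
  have "(%n. Ph n x - u x) ----> 0"
  by (rule Lim_null_comparison[OF always_eventually d]) (use b1 in blast)
  moreover have "(%n. G n x - g x) ----> 0"
  by (rule Lim_null_comparison[OF always_eventually d]) (use b2 in blast)
  ultimately show ?thesis by (auto dest: LIM_zero_cancel)
 qed
 show ?thesis
 proof (rule that[of Ph G h])
  show "AL x. (%n. Ph n x) ----> u x" "AL x. (%n. G n x) ----> g x"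
  "AL x. ALL n. pdens p (Ph n) (G n) x <= h x" "AL x. pdens p u g x <= h x"
  using AES by (eventually_elim, use conv Ph uh in blast)+
  show "0 <= h x" for x unfolding h_def using C T0 by (intro mult_nonneg_nonneg add_nonneg_nonneg) auto
 qed (use c hi in auto)
qed

lemma sob_pdens_intb:
 assumes "sob Om p u g" "0 < p" shows "lint (pdens p u g)"
proof -
 note [measurable] = sob_meas[OF assms(1)]
 obtain h where h: "lint h" "AL x. pdens p u g x <= h x"
  by (rule sob_dominated[OF assms]) blast
 show ?thesis by (rule intb_bound[OF h(1)]) (use h(2) in auto)
qed

lemma sob_intb:
 assumes "sob Om p u g" "0 < p"
 shows "lint (%x. <|u x|> powr p)" "lint (%x. norm (g x) powr p)"
proof -
 note [measurable] = sob_meas[OF assms(1)]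
 show "lint (%x. <|u x|> powr p)" "lint (%x. norm (g x) powr p)"
  by (rule intb_bound[OF sob_pdens_intb[OF assms]],
  measurable, simp add: pdens_def)+
qed

lemma integrable_nn_integral_finite:
 fixes f :: "'a => real"
 assumes "integrable M f" shows "(\<integral>\<^sup>+x. ennreal (f x) \<partial>M) < \<infinity>"
proof -
 have "(\<integral>\<^sup>+x. ennreal (f x) \<partial>M) <= (\<integral>\<^sup>+x. norm (f x) \<partial>M)"
  by (intro nn_integral_mono ennreal_leI) auto
 then show ?thesis using assms by (auto simp: integrable_iff_bounded intro: le_less_trans)
qed

text \<open>Counterpart of \<open>sob_dominated\<close>. Together they reduce each closure property
  of Sobolev pairs to pointwise limits with an integrable majorant.\<close>

lemma sob_limit:
 fixes u :: "'a::euclidean_space => real"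
 assumes s: "!!n. sob Om p (U n) (G n)" and p: "0 < p"
  and m[measurable]: "u : lmeas" "g : lmeas"
  and l1: "AL x. (%n. U n x) ----> u x" and l2: "AL x. (%n. G n x) ----> g x"
  and h: "lint h" "AL x. ALL n. pdens p (U n) (G n) x <= h x"
 shows "sob Om p u g"
proof -
 note [measurable] = sob_meas[OF s]
 define d where "d = (%n x. pdens p (%x. U n x - u x) (%x. G n x - g x) x)"
 define C where "C = (2::real) powr p"
 have C: "C >= 1" using p by (simp add: C_def ge_one_powr_ge_zero)
 have hm[measurable]: "h : lmeas" using h(1) by auto
 have lim: "(%n. NI x. ennreal (d n x)) ----> (\<integral>\<^sup>+(x::'a). 0 \<partial>lebesgue)"
 proof (rule nn_integral_dominated_convergence[where w = "%x. ennreal (C * (2 * h x))"])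
  show "(%x. ennreal (d n x)) : lmeas" for n unfolding d_def by measurable
  have "lint (%x. C * (2 * h x))" using h(1) by simp
  then show "(NI x. ennreal (C * (2 * h x))) < \<infinity>"
  by (rule integrable_nn_integral_finite)
  have lim_p: "(%n. pdens p (U n) (G n) x) ----> pdens p u g x"
  if "(%n. U n x) ----> u x" "(%n. G n x) ----> g x" for x
  unfolding pdens_def by (intro tendsto_add tendsto_powr' tendsto_rabs tendsto_norm that tendsto_const) (use p in auto)
  show "AL x. ennreal (d n x) <= ennreal (C * (2 * h x))" for n
  using l1 l2 h(2)
  proof eventually_elim
  case (elim x)
  have "pdens p u g x <= h x"
  by (rule LIMSEQ_le_const2[OF lim_p[OF elim(1,2)]]) (use elim(3) in auto)
  then have "d n x <= C * (h x + h x)"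
  using pdens_triangle[of p "U n" u "G n" g x "%_. 0" "%_. 0"] p elim(3) C
  by (simp add: d_def C_def pdens_def)
  (smt (verit, best) mult_lm powr_ge_zero)
  then show ?case by (intro ennreal_leI) (simp add: algebra_simps)
  qed
  show "AL x. (%n. ennreal (d n x)) ----> 0"
  using l1 l2
  proof eventually_elim
  case (elim x)
  have "(%n. d n x) ----> <|0|> powr p + norm (0::'a) powr p"
  unfolding d_def pdens_def
  by (intro tendsto_add tendsto_powr' tendsto_rabs tendsto_norm tendsto_const LIM_zero elim) (use p in auto)
  then have "(%n. d n x) ----> 0" using p by simp
  then have "(%n. ennreal (d n x)) ----> ennreal 0" by (rule tendsto_ennrealI)
  then show ?case by simp
  qed
 qed measurable
 show ?thesis unfolding sob_def
 proof (intro conjI m allI impI)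
  fix e :: real assume e: "e > 0"
  have "ennreal (e / (2 * C)) > 0" using e C by simp
  then obtain n where n: "(NI x. ennreal (d n x)) < ennreal (e / (2 * C))"
  using order_tendstoD(2)[OF lim, of "ennreal (e / (2 * C))"] by (auto simp: eventually_sequentially)
  obtain ph H where ph: "c1c Om ph H"
  "(NI x. ennreal (pdens p (%x. ph x - U n x) (%x. H x - G n x) x)) < ennreal (e / (2 * C))"
  using s[of n] e C unfolding sob_def by (metis divide_pos_pos mult_pos_pos zero_less_numeral less_le_trans zero_less_one)
  note [measurable] = c1c_meas[OF ph(1)]
  have "(NI x. ennreal (pdens p (%x. ph x - u x) (%x. H x - g x) x)) <=
  (NI x. ennreal C * (ennreal (pdens p (%x. ph x - U n x) (%x. H x - G n x) x) + ennreal (d n x)))"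
  proof (rule nn_integral_mono)
  fix x
  have "pdens p (%x. ph x - u x) (%x. H x - g x) x
  <= C * (pdens p (%x. ph x - U n x) (%x. H x - G n x) x + d n x)"
  unfolding d_def C_def using p by (intro pdens_triangle) auto
  also have "ennreal ... = ennreal C * (ennreal (pdens p (%x. ph x - U n x) (%x. H x - G n x) x) + ennreal (d n x))"
  using C by (simp add: ennreal_mult' d_def ennreal_plus)
  finally show "ennreal (pdens p (%x. ph x - u x) (%x. H x - g x) x) <=
  ennreal C * (ennreal (pdens p (%x. ph x - U n x) (%x. H x - G n x) x) + ennreal (d n x))"
  using ennreal_leI by blast
  qed
  also have "... = ennreal C * ((NI x. ennreal (pdens p (%x. ph x - U n x) (%x. H x - G n x) x))
  + (NI x. ennreal (d n x)))"
  unfolding d_def by (subst nn_integral_cmult, measurable, subst nn_integral_add, measurable)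
  also have "... < ennreal C * (ennreal (e / (2 * C)) + ennreal (e / (2 * C)))"
  using ph(2) n C by (intro ennreal_mult_strict_left_mono add_strict_mono) auto
  also have "... = ennreal e"
  using e C by (simp add: ennreal_plus[symmetric] ennreal_mult'[symmetric] field_simps del: ennreal_plus)
  finally show "EX ph G. c1c Om ph G &
  (NI x. ennreal (pdens p (%x. ph x - u x) (%x. G x - g x) x)) < ennreal e"
  using ph(1) by blast
 qed
qed

section \<open>Calculus rules and truncations for Sobolev pairs\<close>

lemma c1c_add: "c1c Om ph G ==> c1c Om ps H ==> c1c Om (%x. ph x + ps x) (%x. G x + H x)"
proof -
 assume a: "c1c Om ph G" "c1c Om ps H"
 then obtain K L where KL: "compact K" "K <= Om" "!!x. x ~: K ==> ph x = 0 & G x = 0"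
  "compact L" "L <= Om" "!!x. x ~: L ==> ps x = 0 & H x = 0" unfolding c1c_def by metis
 show ?thesis unfolding c1c_def
 proof (intro conjI allI exI[of _ "K \<union> L"])
  fix x
  have "(ph has_derivative (%v. G x *. v)) (at x)" "(ps has_derivative (%v. H x *. v)) (at x)"
  using a by (auto simp: c1c_def)
  from has_derivative_add[OF this]
  show "((%x. ph x + ps x) has_derivative (*.) (G x + H x)) (at x)"
  by (rule has_derivative_eq_rhs) (auto simp: inner_add_left)
 qed (use a KL in "auto simp: c1c_def compact_Un intro: continuous_on_add")
qed

lemma c1c_compose:
 assumes c: "c1c Om ph G" and F: "!!t. (F has_real_derivative F' t) (at t)" "contU F'" "F 0 = 0"
 shows "c1c Om (%x. F (ph x)) (%x. F' (ph x) *R G x)"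
proof -
 obtain K where K: "compact K" "K <= Om" "!!x. x ~: K ==> ph x = 0 & G x = 0"
  and der: "!!x. (ph has_derivative (%v. G x *. v)) (at x)" and cont: "contU G"
  using c unfolding c1c_def by auto
 show ?thesis unfolding c1c_def
 proof (intro conjI allI exI[of _ K])
  fix x
  have "((%x. F (ph x)) has_derivative (%v. F' (ph x) * (G x *. v))) (at x)"
  using has_derivative_compose[OF der F(1)[unfolded has_field_derivative_def]] .
  then show "((%x. F (ph x)) has_derivative (*.) (F' (ph x) *R G x)) (at x)"
  by (rule has_derivative_eq_rhs) auto
  show "contU (%x. F' (ph x) *R G x)"
  by (intro continuous_on_scaleR cont con_comp[OF F(2) c1c_con[OF c]]) auto
 qed (use K F(3) in auto)
qed

lemma sob_add:
 assumes "sob Om p u g" "sob Om p v k" "0 < p"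
 shows "sob Om p (%x. u x + v x) (%x. g x + k x)"
proof -
 note [measurable] = sob_meas[OF assms(1)] sob_meas[OF assms(2)]
 obtain Ph G h where 1: "!!n. c1c Om (Ph n) (G n)" "AL x. (%n. Ph n x) ----> u x"
  "AL x. (%n. G n x) ----> g x" "lint h" "!!x. 0 <= h x"
  "AL x. ALL n. pdens p (Ph n) (G n) x <= h x" "AL x. pdens p u g x <= h x"
  by (rule sob_dominated[OF assms(1,3)]) blast
 obtain Ps H h' where 2: "!!n. c1c Om (Ps n) (H n)" "AL x. (%n. Ps n x) ----> v x"
  "AL x. (%n. H n x) ----> k x" "lint h'" "!!x. 0 <= h' x"
  "AL x. ALL n. pdens p (Ps n) (H n) x <= h' x" "AL x. pdens p v k x <= h' x"
  by (rule sob_dominated[OF assms(2,3)]) blast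
 show ?thesis
 proof (rule sob_limit)
  show "sob Om p (%x. Ph n x + Ps n x) (%x. G n x + H n x)" for n by (intro c1c_sob c1c_add 1 2)
  show "AL x. (%n. Ph n x + Ps n x) ----> u x + v x"
  using 1(2) 2(2) by eventually_elim (rule tendsto_add)
  show "AL x. (%n. G n x + H n x) ----> g x + k x"
  using 1(3) 2(3) by eventually_elim (rule tendsto_add)
  show "lint (%x. 2 powr p * (h x + h' x))" using 1 2 by simp
  show "AL x. ALL n. pdens p (%x. Ph n x + Ps n x) (%x. G n x + H n x) x <= 2 powr p * (h x + h' x)"
  using 1(6) 2(6)
  proof eventually_elim
  case (elim x)
  have "pdens p (%x. Ph n x + Ps n x) (%x. G n x + H n x) x <= 2 powr p * (pdens p (Ph n) (G n) x + pdens p (Ps n) (H n) x)" for n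
  using powr_norm_add_le[of p "Ph n x" "Ps n x"] powr_norm_add_le[of p "G n x" "H n x"] assms(3)
  by (simp add: pdens_def algebra_simps)
  moreover have "2 powr p * (pdens p (Ph n) (G n) x + pdens p (Ps n) (H n) x) <= 2 powr p * (h x + h' x)" for n
  using elim by (intro mult_lm add_mono) auto
  ultimately show ?case by (meson order_trans)
  qed
 qed (use assms in auto)
qed

lemma sob_chain:
 assumes s: "sob Om p u g" and p: "0 < p"
  and F: "!!t. (F has_real_derivative F' t) (at t)" "contU F'" "F 0 = 0" "!!t. <|F' t|> <= L"
 shows "sob Om p (%x. F (u x)) (%x. F' (u x) *R g x)"
proof -
 note [measurable] = sob_meas[OF s]
 have L: "0 <= L" using F(4)[of 0] by simp
 have Fc: "contU F" using F(1) DERIV_isCont con_at by blast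
 have [measurable]: "F : borel_measurable borel" "F' : borel_measurable borel"
  using Fc F(2) meas_con by blast+
 have lip: "<|F t|> <= L * <|t|>" for t
 proof -
  have "norm (F t - F 0) <= L * norm (t - 0)"
  by (rule field_differentiable_bound[of UNIV F F']) (use F in "auto intro: has_field_derivative_at_within")
  then show ?thesis using F(3) by simp
 qed
 obtain Ph G h where 1: "!!n. c1c Om (Ph n) (G n)" "AL x. (%n. Ph n x) ----> u x"
  "AL x. (%n. G n x) ----> g x" "lint h" "!!x. 0 <= h x"
  "AL x. ALL n. pdens p (Ph n) (G n) x <= h x" "AL x. pdens p u g x <= h x"
  by (rule sob_dominated[OF s p]) blast
 have tF: "isCont F t" "isCont F' t" for t
  using Fc F(2) by (auto simp: con_eq_at)
 show ?thesis
 proof (rule sob_limit)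
  show "sob Om p (%x. F (Ph n x)) (%x. F' (Ph n x) *R G n x)" for n
  by (intro c1c_sob c1c_compose 1 F)
  show "AL x. (%n. F (Ph n x)) ----> F (u x)"
  using 1(2) by eventually_elim (rule isCont_lim[OF tF(1)])
  show "AL x. (%n. F' (Ph n x) *R G n x) ----> F' (u x) *R g x"
  using 1(2,3) by eventually_elim (intro tendsto_scaleR isCont_lim[OF tF(2)])
  show "lint (%x. L powr p * h x)" using 1 by simp
  show "AL x. ALL n. pdens p (%x. F (Ph n x)) (%x. F' (Ph n x) *R G n x) x <= L powr p * h x"
  using 1(6)
  proof eventually_elim
  case (elim x)
  have "pdens p (%x. F (Ph n x)) (%x. F' (Ph n x) *R G n x) x <= L powr p * pdens p (Ph n) (G n) x" for n
  proof -
  have "<|F (Ph n x)|> powr p <= (L * <|Ph n x|>) powr p"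
  using lip p by (intro powr_mono2) auto
  moreover have "norm (F' (Ph n x) *R G n x) powr p <= (L * norm (G n x)) powr p"
  using F(4)[of "Ph n x"] p by (intro powr_mono2) (auto intro: mult_rm)
  ultimately show ?thesis using L by (simp add: pdens_def powr_mult distrib_left)
  qed
  moreover have "L powr p * pdens p (Ph n) (G n) x <= L powr p * h x" for n
  using elim by (intro mult_lm) auto
  ultimately show ?case by (meson order_trans)
  qed
 qed (use p in auto)
qed

lemma sob_scale:
 assumes "sob Om p u g" "0 < p" shows "sob Om p (%x. c * u x) (%x. c *R g x)"
 by (rule sob_chain[OF assms, of "%t. c * t" "%_. c" "<|c|>"]) (auto intro!: deriv_eqs)

lemma sob_diff:
 assumes "sob Om p u g" "sob Om p v k" "0 < p"
 shows "sob Om p (%x. u x - v x) (%x. g x - k x)"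
 using sob_add[OF assms(1) sob_scale[OF assms(2,3), of "-1"] assms(3)] by simp

text \<open>A C1 minorant of the positive part of t - m, with slope between 0 and 1, that converges
  to it as \<open>e\<close> tends to 0. The chain rule is available for C1 functions only.\<close>

definition softpos :: "real => real => real => real" where
 "softpos m e t = (if t > m then (t - m)\<^sup>2 / (t - m + e) else 0)"

definition softpos' :: "real => real => real => real" where
 "softpos' m e t = (if t > m then 1 - e\<^sup>2 / (t - m + e)^2 else 0)"

context
 fixes m e :: real
 assumes e: "e > 0"
begin

lemma softpos'_bounds: "0 <= softpos' m e t" "softpos' m e t <= 1"
proof -
 have "0 <= softpos' m e t & softpos' m e t <= 1"
 proof (cases "t > m")
  case True
  then have "e\<^sup>2 <= (t - m + e)^2" using e by (intro power_mono) auto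
  moreover have "0 < (t - m + e)^2" using True e by simp
  ultimately show ?thesis using True by (simp add: softpos'_def)
 qed (simp add: softpos'_def)
 then show "0 <= softpos' m e t" "softpos' m e t <= 1" by auto
qed

lemma softpos_bounds: "0 <= softpos m e t" "softpos m e t <= max (t - m) 0"
proof -
 have "0 <= softpos m e t & softpos m e t <= max (t - m) 0"
 proof (cases "t > m")
  case True
  have "(t - m)^2 <= (t - m) * (t - m + e)"
  using True e unfolding power2_eq_square by (intro mult_lm) auto
  then have "(t - m)^2 / (t - m + e) <= t - m"
  using True e by (simp add: divide_le_eq)
  moreover have "0 <= (t - m)^2 / (t - m + e)" using True e by simp
  ultimately show ?thesis using True by (simp add: softpos_def)
 qed (simp add: softpos_def)
 then show "0 <= softpos m e t" "softpos m e t <= max (t - m) 0" by auto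
qed

lemma softpos_has_derivative: "(softpos m e has_real_derivative softpos' m e t) (at t)"
proof (cases t m rule: linorder_cases)
 case less
 have "((%t. 0) has_real_derivative 0) (at t)" by simp
 then have "(softpos m e has_real_derivative 0) (at t)"
  by (rule deriv_transform[where d = "m - t"])
  (use less in "auto simp: softpos_def dist_real_def")
 then show ?thesis using less by (simp add: softpos'_def)
next
 case greater
 have "((%t. (t - m)\<^sup>2 / (t - m + e)) has_real_derivative
  (2 * (t - m) * (t - m + e) - (t - m)^2) / ((t - m + e) * (t - m + e))) (at t)"
  using greater e by (auto intro!: deriv_eqs)
 also have "(2 * (t - m) * (t - m + e) - (t - m)^2) / ((t - m + e) * (t - m + e)) = 1 - e\<^sup>2 / (t - m + e)^2"
 proof -
  have "t - m + e ~= 0" using greater e by simp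
  then have "1 - e\<^sup>2 / (t - m + e)^2 = ((t - m + e)^2 - e\<^sup>2) / (t - m + e)^2" by (simp add: diff_divide_distrib)
  moreover have "2 * (t - m) * (t - m + e) - (t - m)^2 = (t - m + e)^2 - e\<^sup>2"
  by (simp add: power2_eq_square algebra_simps)
  ultimately show ?thesis by (simp add: power2_eq_square)
 qed
 finally have "((%t. (t - m)\<^sup>2 / (t - m + e)) has_real_derivative softpos' m e t) (at t)"
  using greater by (simp add: softpos'_def)
 then show ?thesis
  by (rule deriv_transform[where d = "t - m"])
  (use greater in "auto simp: softpos_def dist_real_def abs_if split: if_splits")
next
 case equal
 have "((%h. (softpos m e (t + h) - softpos m e t) / h) \<longlongrightarrow> 0) (at 0)"
 proof (rule Lim_null_comparison[where g = "%h. (1 / e) * <|h|>"])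
  have "norm ((softpos m e (t + h) - softpos m e t) / h) <= (1 / e) * <|h|>" for h
  proof (cases "h > 0")
  case True
  then have "h\<^sup>2 / (h + e) / h <= h / e" using e by (simp add: power2_eq_square frac_le)
  then show ?thesis using True e equal by (simp add: softpos_def)
  qed (use e equal in "simp add: softpos_def divide_nonpos_pos")
  then show "\<forall>\<^sub>F h in at 0. norm ((softpos m e (t + h) - softpos m e t) / h) <= (1 / e) * <|h|>" by simp
  show "((%h::real. (1 / e) * <|h|>) \<longlongrightarrow> 0) (at 0)"
  by (rule tendsto_mult_right_zero, rule tendsto_rabs_zero, rule tendsto_ident_at)
 qed
 then show ?thesis unfolding DERIV_def using equal by (simp add: softpos'_def)
qed

lemma continuous_softpos': "contU (softpos' m e)"
proof -
 have "softpos' m e = (%t. 1 - e\<^sup>2 / (max (t - m) 0 + e)^2)"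
  using e by (auto simp: softpos'_def max_def)
 moreover have "contU (%t. 1 - e\<^sup>2 / (max (t - m) 0 + e)^2)"
  using e by (intro con_intros) (auto simp: add_nonneg_eq_0_iff)
 ultimately show ?thesis by simp
qed

end

text \<open>The threshold may move. A fixed one produces positive parts; a positive one that shrinks
  to 0 gives compact support when composed with a function vanishing on the boundary.\<close>

lemma softpos_tendsto:
 assumes "!!n. e n > 0" "e ----> 0" "c ----> m" "!!n. m <= c n"
 shows "(%n. softpos (c n) (e n) t) ----> max (t - m) 0"
  "(%n. softpos' (c n) (e n) t) ----> (if t > m then 1 else 0)"
proof -
 have ev: "\<forall>\<^sub>F n in sequentially. t > c n" if "t > m"
  using order_tendstoD(2)[OF assms(3) that] .
 have not: "\<not> t > c n" if "\<not> t > m" for n using assms(4)[of n] that by simp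
 show "(%n. softpos (c n) (e n) t) ----> max (t - m) 0"
 proof (cases "t > m")
  case True
  have "(%n. (t - c n)\<^sup>2 / (t - c n + e n)) ----> (t - m)^2 / (t - m + 0)"
  by (intro tendsto_intros assms) (use True in auto)
  moreover have "\<forall>\<^sub>F n in sequentially. (t - c n)\<^sup>2 / (t - c n + e n) = softpos (c n) (e n) t"
  using ev[OF True] by eventually_elim (simp add: softpos_def)
  ultimately show ?thesis using True by (auto simp: power2_eq_square max_def intro: Lim_transform_eventually)
 qed (use not in "auto simp: softpos_def max_def")
 show "(%n. softpos' (c n) (e n) t) ----> (if t > m then 1 else 0)"
 proof (cases "t > m")
  case True
  have "(%n. 1 - (e n)^2 / (t - c n + e n)^2) ----> 1 - 0\<^sup>2 / (t - m + 0)^2"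
  by (intro tendsto_intros assms) (use True in auto)
  moreover have "\<forall>\<^sub>F n in sequentially. 1 - (e n)^2 / (t - c n + e n)^2 = softpos' (c n) (e n) t"
  using ev[OF True] by eventually_elim (simp add: softpos'_def)
  ultimately show ?thesis using True by (auto intro: Lim_transform_eventually)
 qed (use not in "auto simp: softpos'_def")
qed

lemma inv_Suc: "0 < 1 / real (Suc n)" "(%n. 1 / real (Suc n)) ----> 0"
 using LIMSEQ_inverse_real_of_nat by (simp_all add: inverse_eq_divide)

lemma sob_pos_part:
 assumes s: "sob Om p u g" and p: "0 < p" and m: "0 <= m"
 shows "sob Om p (%x. max (u x - m) 0) (%x. if u x > m then g x else 0)"
proof -
 note [measurable] = sob_meas[OF s]
 define e where "e = (%n. 1 / real (Suc n))"
 have e: "e n > 0" for n unfolding e_def by (rule inv_Suc)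
 have elim0: "e ----> 0" unfolding e_def by (rule inv_Suc)
 note lims = softpos_tendsto[where c = "%_. m" and m = m, OF e elim0 tendsto_const order_refl]
 show ?thesis
 proof (rule sob_limit)
  show "sob Om p (%x. softpos m (e n) (u x)) (%x. softpos' m (e n) (u x) *R g x)" for n
  by (rule sob_chain[OF s p softpos_has_derivative[OF e] continuous_softpos'[OF e], where L = 1])
  (use softpos'_bounds[OF e] m in "auto simp: softpos_def")
  show "AL x. (%n. softpos m (e n) (u x)) ----> max (u x - m) 0" using lims(1) by simp
  have "(%n. softpos' m (e n) (u x) *R g x) ----> (if u x > m then g x else 0)" for x
  using tendsto_scaleR[OF lims(2)[of "u x"] tendsto_const[of "g x"]] by (simp split: if_splits)
  then show "AL x. (%n. softpos' m (e n) (u x) *R g x) ----> (if u x > m then g x else 0)" by simp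
  show "lint (pdens p u g)" using sob_pdens_intb[OF s p] .
  have "pdens p (%x. softpos m (e n) (u x)) (%x. softpos' m (e n) (u x) *R g x) x <= pdens p u g x" for n x
  unfolding pdens_def using softpos_bounds[OF e[of n], of m "u x"] softpos'_bounds[OF e[of n], of m "u x"] p m
  by (intro add_mono powr_mono2) (auto simp: mult_left_le_one_le max_def split: if_splits)
  then show "AL x. ALL n. pdens p (%x. softpos m (e n) (u x)) (%x. softpos' m (e n) (u x) *R g x) x <= pdens p u g x" by simp
 qed (use p in auto)
qed

lemma has_real_derivative_Un:
 assumes "(f has_real_derivative d) (at x within S)" "(f has_real_derivative d) (at x within T)"
 shows "(f has_real_derivative d) (at x within (S \<union> T))"
 using assms unfolding has_field_derivative_iff by (simp add: Lim_within_Un)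

lemma real_deriv_cong:
 fixes f :: "real => real"
 shows "(f has_real_derivative d) (at x within S) ==> x : S ==> (!!y. y : S ==> g y = f y) ==>
  (g has_real_derivative d) (at x within S)"
 unfolding has_field_derivative_def by (rule has_derivative_transform)

text \<open>Powers have bounded derivatives only on suitable compact intervals. A bounded C1
  extension to the whole line makes the chain and product rules applicable to them.\<close>

lemma C1_extension:
 fixes f f' :: "real => real"
 assumes ab: "a <= b"
  and f: "!!t. t : {a..b} ==> (f has_real_derivative f' t) (at t within {a..b})"
  and f': "continuous_on {a..b} f'"
 obtains F F' B where "!!t. (F has_real_derivative F' t) (at t)" "contU F'"
  "!!t. <|F t|> <= B" "!!t. <|F' t|> <= B"
  "!!t. t : {a..b} ==> F t = f t" "!!t. t : {a..b} ==> F' t = f' t"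
proof -
 define cl where "cl = (%t. max a (min b t))"
 have cl: "cl t : {a..b}" for t using ab by (auto simp: cl_def)
 have cla: "cl t = a" if "t <= a" for t using ab that by (simp add: cl_def)
 have clb: "cl t = b" if "b <= t" for t using ab that by (simp add: cl_def)
 have ccl: "contU cl" unfolding cl_def by (intro con_intros)
 \<comment> \<open>Beyond an end point the sine continues the function with matching value and slope
   while keeping both it and its derivative bounded.\<close>
 define F where "F = (%t. f (cl t) + f' (cl t) * sin (t - cl t))"
 define F' where "F' = (%t. f' (cl t) * cos (t - cl t))"
 have cf: "continuous_on {a..b} f" using f DERIV_continuous_on by blast
 obtain B1 where "ALL y:f ` {a..b}. norm y <= B1"
  using cpt_bounded[OF cpt_image[OF cf compact_Icc]] unfolding bounded_iff by blast
 then have B1: "<|f t|> <= B1" if "t : {a..b}" for t using that by simp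
 obtain B2 where "ALL y:f' ` {a..b}. norm y <= B2"
  using cpt_bounded[OF cpt_image[OF f' compact_Icc]] unfolding bounded_iff by blast
 then have B2: "<|f' t|> <= B2" if "t : {a..b}" for t using that by simp
 have B0: "0 <= B1" "0 <= B2" using B1[of a] B2[of a] ab by auto
 have bF': "<|f' (cl t) * cos s|> <= B2" "<|f' (cl t) * sin s|> <= B2" for t s
  using mult_mono[OF B2[OF cl[of t]] abs_cos_le_one[of s]] mult_mono[OF B2[OF cl[of t]] abs_sin_le_one[of s]] B0
  by (auto simp: abs_mult)
 have der: "(F has_real_derivative F' t) (at t)" for t
 proof -
  \<comment> \<open>At a point outside a closed set the filter within this set is trivial, so the
    claim holds vacuously; the three pieces can then be glued at every \<open>t\<close>
    alike.\<close>
  have triv: "(F has_real_derivative F' t) (at t within S)" if "closed S" "t ~: S" for S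
  proof -
  have "at t within S = bot"
  using that by (simp add: trivial_limit_within closed_limpt)
  (use closed_limpt in blast)
  then show ?thesis by (simp add: has_field_derivative_iff)
  qed
  have "(F has_real_derivative F' t) (at t within {..a})"
  proof (cases "t : {..a}")
  case True
  have "((%t. f a + f' a * sin (t - a)) has_real_derivative f' a * cos (t - a)) (at t within {..a})"
  by (auto intro!: deriv_eqs)
  then have "(F has_real_derivative f' a * cos (t - a)) (at t within {..a})"
  by (rule real_deriv_cong) (use True in "auto simp: F_def cla clb")
  moreover have "cl t = a" using True by (simp add: cla)
  ultimately show ?thesis by (simp add: F'_def)
  qed (use triv in auto)
  moreover have "(F has_real_derivative F' t) (at t within {a..b})"
  proof (cases "t : {a..b}")
  case True
  have "(F has_real_derivative f' t) (at t within {a..b})"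
  by (rule real_deriv_cong[OF f[OF True] True]) (auto simp: F_def cl_def)
  moreover have "cl t = t" using True by (auto simp: cl_def)
  ultimately show ?thesis by (simp add: F'_def)
  qed (use triv in auto)
  moreover have "(F has_real_derivative F' t) (at t within {b..})"
  proof (cases "t : {b..}")
  case True
  have "((%t. f b + f' b * sin (t - b)) has_real_derivative f' b * cos (t - b)) (at t within {b..})"
  by (auto intro!: deriv_eqs)
  then have "(F has_real_derivative f' b * cos (t - b)) (at t within {b..})"
  by (rule real_deriv_cong) (use True in "auto simp: F_def cla clb")
  moreover have "cl t = b" using True by (simp add: clb)
  ultimately show ?thesis by (simp add: F'_def)
  qed (use triv in auto)
  ultimately have "(F has_real_derivative F' t) (at t within ({..a} \<union> {a..b} \<union> {b..}))"
  by (intro has_real_derivative_Un)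
  moreover have "{..a} \<union> {a..b} \<union> {b..} = UNIV" by auto
  ultimately show ?thesis by simp
 qed
 show ?thesis
 proof (rule that[of F F' "B1 + B2"])
  show "contU F'" unfolding F'_def
  by (intro continuous_on_mult con_comp[OF f' ccl] continuous_on_cos continuous_on_diff
  ccl continuous_on_id) (use cl in auto)
  show "<|F t|> <= B1 + B2" for t
  using B1[OF cl[of t]] bF'(2)[of t "t - cl t"] by (simp add: F_def)
  show "<|F' t|> <= B1 + B2" for t
  using bF'(1)[of t "t - cl t"] B0 by (simp add: F'_def)
  show "F t = f t" "F' t = f' t" if "t : {a..b}" for t
  using that by (auto simp: F_def F'_def cl_def)
 qed (rule der)
qed

lemma sob_chain_interval:
 assumes s: "sob Om p u g" and p: "0 < p" and u: "!!x. u x : {a..b}" and 0: "0 : {a..b}"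
  and f: "!!t. t : {a..b} ==> (f has_real_derivative f' t) (at t within {a..b})"
  "continuous_on {a..b} f'" "f 0 = 0"
 shows "sob Om p (%x. f (u x)) (%x. f' (u x) *R g x)"
proof -
 have ab: "a <= b" using 0 by simp
 obtain F F' B where F: "!!t. (F has_real_derivative F' t) (at t)" "contU F'"
  "!!t. <|F t|> <= B" "!!t. <|F' t|> <= B"
  "!!t. t : {a..b} ==> F t = f t" "!!t. t : {a..b} ==> F' t = f' t"
  by (rule C1_extension[OF ab f(1,2)]) (assumption | rule that)+
 have "sob Om p (%x. F (u x)) (%x. F' (u x) *R g x)"
  by (rule sob_chain[OF s p F(1,2) _ F(4)]) (use F(5)[OF 0] f(3) in simp)
 then show ?thesis using F(5,6) u by simp
qed

text \<open>The support comes from \<open>w\<close> alone, so \<open>z\<close> may be a Sobolev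
  function on another domain, as happens for minima of translates. The approximants of
  \<open>w\<close> need not be bounded; they are composed with a bounded function that is the
  identity on [-M, M].\<close>

lemma sob_mult:
 assumes w: "sob Om p w h" "!!x. <|w x|> <= M" and z: "sob Om' p z k" and p: "0 < p"
  and G: "!!t. (G has_real_derivative G' t) (at t)" "contU G'" "!!t. <|G t|> <= B" "!!t. <|G' t|> <= B"
 shows "sob Om p (%x. w x * G (z x)) (%x. G (z x) *R h x + (w x * G' (z x)) *R k x)"
proof -
 note [measurable] = sob_meas[OF w(1)] sob_meas[OF z]
 have M: "0 <= M" "- M <= M" using w(2)[of undefined] by auto
 have Gc: "contU G" using G(1) DERIV_isCont con_at by blast
 have [measurable]: "G : borel_measurable borel" "G' : borel_measurable borel"
  using Gc G(2) meas_con by blast+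
 have "((%t. t) has_real_derivative 1) (at t within {-M..M})" for t by simp
 then obtain F F' C where F: "!!t. (F has_real_derivative F' t) (at t)" "contU F'"
  "!!t. <|F t|> <= C" "!!t. <|F' t|> <= C"
  "!!t. t : {-M..M} ==> F t = t" "!!t. t : {-M..M} ==> F' t = 1"
  using C1_extension[OF M(2), of "%t. t" "%t. 1"] continuous_on_const by metis
 have F0: "F 0 = 0" using F(5)[of 0] M by simp
 have C: "0 <= C" using F(3)[of 0] by simp
 have B: "0 <= B" using G(3)[of 0] by simp
 have tF: "isCont F t" "isCont F' t" "isCont G t" "isCont G' t" for t
  using F(2) G(2) DERIV_isCont[OF F(1)] DERIV_isCont[OF G(1)] by (auto simp: con_eq_at)
 obtain Ph H l where 1: "!!n. c1c Om (Ph n) (H n)" "AL x. (%n. Ph n x) ----> w x"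
  "AL x. (%n. H n x) ----> h x" "lint l" "!!x. 0 <= l x"
  "AL x. ALL n. pdens p (Ph n) (H n) x <= l x" "AL x. pdens p w h x <= l x"
  by (rule sob_dominated[OF w(1) p]) (assumption | rule that)+
 obtain Z K l' where 2: "!!n. c1c Om' (Z n) (K n)" "AL x. (%n. Z n x) ----> z x"
  "AL x. (%n. K n x) ----> k x" "lint l'" "!!x. 0 <= l' x"
  "AL x. ALL n. pdens p (Z n) (K n) x <= l' x" "AL x. pdens p z k x <= l' x"
  by (rule sob_dominated[OF z p]) (assumption | rule that)+
 have c: "c1c Om (%x. F (Ph n x) * G (Z n x))
  (%x. G (Z n x) *R (F' (Ph n x) *R H n x) + F (Ph n x) *R (G' (Z n x) *R K n x))" for n
 proof (rule c1c_mult)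
  show "c1c Om (%x. F (Ph n x)) (%x. F' (Ph n x) *R H n x)"
  by (rule c1c_compose[OF 1(1) F(1,2) F0])
  fix x
  have dZ: "(Z n has_derivative (%v. K n x *. v)) (at x)" and cK: "contU (K n)"
  using 2(1)[of n] by (auto simp: c1c_def)
  have "((%x. G (Z n x)) has_derivative (%v. G' (Z n x) * (K n x *. v))) (at x)"
  using has_derivative_compose[OF dZ G(1)[unfolded has_field_derivative_def]] .
  then show "((%x. G (Z n x)) has_derivative (*.) (G' (Z n x) *R K n x)) (at x)"
  by (rule has_derivative_eq_rhs) auto
  show "contU (%x. G' (Z n x) *R K n x)"
  by (intro continuous_on_scaleR cK con_comp[OF G(2) c1c_con[OF 2(1)]]) auto
 qed
 show ?thesis
 proof (rule sob_limit[OF c1c_sob[OF c] p])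
  have wM: "w x : {-M..M}" for x using w(2)[of x] by auto
  show "AL x. (%n. F (Ph n x) * G (Z n x)) ----> w x * G (z x)"
  using 1(2) 2(2)
  proof eventually_elim
  case (elim x)
  have "(%n. F (Ph n x) * G (Z n x)) ----> F (w x) * G (z x)"
  by (intro tendsto_mult isCont_lim[OF tF(1)] isCont_lim[OF tF(3)] elim)
  then show ?case by (simp add: F(5)[OF wM])
  qed
  show "AL x. (%n. G (Z n x) *R (F' (Ph n x) *R H n x) + F (Ph n x) *R (G' (Z n x) *R K n x))
  ----> G (z x) *R h x + (w x * G' (z x)) *R k x"
  using 1(2,3) 2(2,3)
  proof eventually_elim
  case (elim x)
  have "(%n. G (Z n x) *R (F' (Ph n x) *R H n x) + F (Ph n x) *R (G' (Z n x) *R K n x))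
  ----> G (z x) *R (F' (w x) *R h x) + F (w x) *R (G' (z x) *R k x)"
  by (intro tendsto_add tendsto_scaleR isCont_lim[OF tF(1)] isCont_lim[OF tF(2)]
  isCont_lim[OF tF(3)] isCont_lim[OF tF(4)] elim)
  then show ?case by (simp add: F(5)[OF wM] F(6)[OF wM])
  qed
  show "lint (%x. ((B * C) powr p + 2 powr p * (B * C) powr p) * l x + 2 powr p * (B * C) powr p * l' x)"
  using 1(4) 2(4) by (intro intb_add integrable_mult_right)
  show "AL x. ALL n. pdens p (%x. F (Ph n x) * G (Z n x))
  (%x. G (Z n x) *R (F' (Ph n x) *R H n x) + F (Ph n x) *R (G' (Z n x) *R K n x)) x
  <= ((B * C) powr p + 2 powr p * (B * C) powr p) * l x + 2 powr p * (B * C) powr p * l' x"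
  using 1(6) 2(6)
  proof eventually_elim
  case (elim x)
  show ?case
  proof
  fix n
  have lipF: "<|F t|> <= C * <|t|>" for t
  proof -
  have "norm (F t - F 0) <= C * norm (t - 0)"
  by (rule field_differentiable_bound[of UNIV F F']) (use F in "auto intro: has_field_derivative_at_within")
  then show ?thesis using F0 by simp
  qed
  have bnd: "norm a powr p <= (B * C) powr p * d" if "norm a <= (B * C) * s" "0 <= s" "s powr p <= d" for a :: "'b::real_normed_vector" and s d
  proof -
  have "norm a powr p <= ((B * C) * s) powr p" using that p by (intro powr_mono2) auto
  also have "... = (B * C) powr p * s powr p" using B C that by (simp add: powr_mult)
  also have "... <= (B * C) powr p * d" using that by (intro mult_lm) auto
  finally show ?thesis .
  qed
  let ?X = "G (Z n x) *R (F' (Ph n x) *R H n x)" and ?Y = "F (Ph n x) *R (G' (Z n x) *R K n x)"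
  have l: "<|Ph n x|> powr p + norm (H n x) powr p <= l x" "<|Z n x|> powr p + norm (K n x) powr p <= l' x"
  using spec[OF elim(1), of n] spec[OF elim(2), of n] by (auto simp: pdens_def)
  then have l: "<|Ph n x|> powr p <= l x" "norm (H n x) powr p <= l x" "norm (K n x) powr p <= l' x"
  using powr_ge_zero[of "norm (H n x)" p] powr_ge_zero[of "<|Ph n x|>" p] powr_ge_zero[of "<|Z n x|>" p] by linarith+
  have "<|F (Ph n x) * G (Z n x)|> <= (C * <|Ph n x|>) * B"
  unfolding abs_mult by (rule mult_mono) (use lipF G(3) C in auto)
  then have t1: "<|F (Ph n x) * G (Z n x)|> powr p <= (B * C) powr p * l x"
  using bnd[of "F (Ph n x) * G (Z n x)" "<|Ph n x|>"] l by (simp add: mult_ac)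
  have "norm ?X <= B * (C * norm (H n x))"
  unfolding norm_scaleR by (intro mult_mono) (use G(3) F(4) B C in auto)
  then have t2: "norm ?X powr p <= (B * C) powr p * l x" by (intro bnd[OF _ _ l(2)]) (simp_all add: mult_ac)
  have "norm ?Y <= C * (B * norm (K n x))"
  unfolding norm_scaleR by (intro mult_mono) (use G(4) F(3) B C in auto)
  then have t3: "norm ?Y powr p <= (B * C) powr p * l' x" by (intro bnd[OF _ _ l(3)]) (simp_all add: mult_ac)
  have "norm (?X + ?Y) powr p <= 2 powr p * (norm ?X powr p + norm ?Y powr p)"
  using p by (intro powr_norm_add_le) auto
  also have "... <= 2 powr p * ((B * C) powr p * l x + (B * C) powr p * l' x)"
  using t2 t3 by (intro mult_lm add_mono) auto
  finally show "pdens p (%x. F (Ph n x) * G (Z n x))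
  (%x. G (Z n x) *R (F' (Ph n x) *R H n x) + F (Ph n x) *R (G' (Z n x) *R K n x)) x
  <= ((B * C) powr p + 2 powr p * (B * C) powr p) * l x + 2 powr p * (B * C) powr p * l' x"
  using t1 by (simp add: pdens_def algebra_simps)
  qed
  qed
 qed (use p in auto)
qed

lemma sob_mult_interval:
 assumes w: "sob Om p w h" "!!x. w x : {0..M}" and z: "sob Om' p z k" "!!x. z x : {0..m}" and p: "0 < p"
  and f: "!!t. t : {0..M} ==> (f has_real_derivative f' t) (at t within {0..M})"
  "continuous_on {0..M} f'" "f 0 = 0"
  and g: "!!t. t : {0..m} ==> (g has_real_derivative g' t) (at t within {0..m})"
  "continuous_on {0..m} g'"
 shows "sob Om p (%x. f (w x) * g (z x)) (%x. (g (z x) * f' (w x)) *R h x + (f (w x) * g' (z x)) *R k x)"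
proof -
 have M: "0 <= M" "0 <= m" using w(2)[of undefined] z(2)[of undefined] by auto
 obtain F F' B where F: "!!t. (F has_real_derivative F' t) (at t)" "contU F'"
  "!!t. <|F t|> <= B" "!!t. <|F' t|> <= B"
  "!!t. t : {0..M} ==> F t = f t" "!!t. t : {0..M} ==> F' t = f' t"
  by (rule C1_extension[OF M(1) f(1,2)]) (assumption | rule that)+
 obtain G G' C where G: "!!t. (G has_real_derivative G' t) (at t)" "contU G'"
  "!!t. <|G t|> <= C" "!!t. <|G' t|> <= C"
  "!!t. t : {0..m} ==> G t = g t" "!!t. t : {0..m} ==> G' t = g' t"
  by (rule C1_extension[OF M(2) g(1,2)]) (assumption | rule that)+
 have s: "sob Om p (%x. F (w x)) (%x. F' (w x) *R h x)"
  by (rule sob_chain[OF w(1) p F(1,2) _ F(4)]) (use F(5)[of 0] f(3) M in simp)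
 have "sob Om p (%x. F (w x) * G (z x)) (%x. G (z x) *R (F' (w x) *R h x) + (F (w x) * G' (z x)) *R k x)"
  by (rule sob_mult[OF s F(3) z(1) p G(1-4)])
 then show ?thesis using F(5,6)[OF w(2)] G(5,6)[OF z(2)] by simp
qed

text \<open>Continuity and the zero values outside make {u >= e n} a compact subset of
  \<open>Om\<close>. Cutting \<open>u\<close> at the level \<open>e n\<close> therefore gives C1
  functions of compact support that converge to \<open>u\<close>.\<close>

lemma sob_C1_zero_boundary:
 assumes Om: "open Om" "bounded Om" and u: "contU u" "!!x. 0 <= u x" "!!x. x ~: Om ==> u x = 0"
  and g: "!!x. x : Om ==> (u has_derivative (%v. g x *. v)) (at x)" "continuous_on Om g"
  "!!x. x ~: Om ==> g x = 0" "!!x. norm (g x) <= B" and pos: "!!x. x : Om ==> 0 < u x" and p: "0 < p"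
 shows "sob Om p u g"
proof -
 define e where "e = (%n. 1 / real (Suc n))"
 have e: "e n > 0" for n unfolding e_def by (rule inv_Suc)
 have elim0: "e ----> 0" unfolding e_def by (rule inv_Suc)
 have lims: "(%n. softpos (e n) (e n) t) ----> max (t - 0) 0"
  "(%n. softpos' (e n) (e n) t) ----> (if t > 0 then 1 else 0)" for t
  using softpos_tendsto[OF e elim0 elim0] e by (simp_all add: less_imp_le)
 have um[measurable]: "u : lmeas" using u(1) by (rule con_meas)
 have gm[measurable]: "g : lmeas"
 proof -
  have "(%x. indicator Om x *R g x) : borel_measurable borel"
  using borel_measurable_continuous_on_indicator[of Om g] Om(1) g(2) by simp
  also have "(%x. indicator Om x *R g x) = g" using g(3) by (auto simp: indicator_def)
  finally show ?thesis by (simp add: measurable_completion)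
 qed
 have c: "c1c Om (%x. softpos (e n) (e n) (u x)) (%x. softpos' (e n) (e n) (u x) *R g x)" for n
 proof -
  let ?K = "{x. e n <= u x}"
  have K1: "?K <= Om" using u(3) e[of n] by force
  have K2: "closed ?K" using u(1) by (intro closed_Collect_le) auto
  have K3: "compact ?K" using K1 K2 Om(2) bounded_subset compact_eq_bounded_closed by blast
  have z: "softpos (e n) (e n) (u x) = 0 & softpos' (e n) (e n) (u x) = 0" if "x ~: ?K" for x
  using that by (auto simp: softpos_def softpos'_def)
  have oK: "open (- ?K)" using K2 by (simp add: open_Compl)
  show ?thesis unfolding c1c_def
  proof (intro conjI allI exI[of _ ?K] K1 K3 impI)
  fix x
  show "((%x. softpos (e n) (e n) (u x)) has_derivative (*.) (softpos' (e n) (e n) (u x) *R g x)) (at x)"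
  proof (cases "x : Om")
  case True
  show ?thesis
  by (rule has_derivative_eq_rhs[OF has_derivative_compose[OF g(1)[OF True]
  softpos_has_derivative[OF e, unfolded has_field_derivative_def]]]) auto
  next
  case False
  then have x: "x ~: ?K" using K1 by blast
  have "((%x. 0) has_derivative (%v. 0)) (at x)" by simp
  then have "((%x. softpos (e n) (e n) (u x)) has_derivative (%v. 0)) (at x)"
  by (rule has_derivative_transform_within_open[OF _ oK]) (use x z in auto)
  then show ?thesis by (rule has_derivative_eq_rhs) (use z[OF x] in "simp add: fun_eq_iff")
  qed
  have "continuous_on (Om \<union> - ?K) (%x. softpos' (e n) (e n) (u x) *R g x)"
  proof (rule continuous_on_open_Un[OF Om(1) oK])
  show "continuous_on Om (%x. softpos' (e n) (e n) (u x) *R g x)"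
  by (intro continuous_on_scaleR g con_comp[OF continuous_softpos'[OF e] con_sub[OF u(1)]]) auto
  have "continuous_on (- ?K) (%x. 0)" by simp
  then show "continuous_on (- ?K) (%x. softpos' (e n) (e n) (u x) *R g x)"
  by (rule continuous_on_cong[THEN iffD1, rotated 2]) (use z in auto)
  qed
  moreover have "Om \<union> - ?K = UNIV" using K1 by blast
  ultimately show "contU (%x. softpos' (e n) (e n) (u x) *R g x)" by simp
  next
  fix x assume "x ~: ?K"
  then show "softpos (e n) (e n) (u x) = 0" "softpos' (e n) (e n) (u x) *R g x = 0" using z by auto
  qed
 qed
 obtain A where A: "!!x. u x <= A"
 proof -
  have "compact (closure Om)" using Om(2) by simp
  then have "bounded (u ` closure Om)"
  by (intro cpt_bounded cpt_image con_sub[OF u(1)]) auto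
  then obtain A where A: "A > 0" "!!x. x : closure Om ==> norm (u x) <= A" unfolding bounded_pos by blast
  have "u x <= A" for x
  using A u(3)[of x] closure_subset[of Om] by (cases "x : Om") force+
  then show ?thesis by (rule that)
 qed
 show ?thesis
 proof (rule sob_limit[OF c1c_sob[OF c] p um gm])
  show "AL x. (%n. softpos (e n) (e n) (u x)) ----> u x"
  proof (rule AE_I2)
  show "(%n. softpos (e n) (e n) (u x)) ----> u x" for x
  using lims(1)[of "u x"] u(2)[of x] by (simp add: max_def)
  qed
  have "(%n. softpos' (e n) (e n) (u x) *R g x) ----> g x" for x
  using tendsto_scaleR[OF lims(2)[of "u x"] tendsto_const[of "g x"]] pos[of x] g(3)[of x] by (cases "x : Om") auto
  then show "AL x. (%n. softpos' (e n) (e n) (u x) *R g x) ----> g x" by simp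
  have "Om : lmeasurable" using Om by (simp add: lmeasurable_open)
  then show "lint (%x. indicator Om x * (A powr p + B powr p))"
  by (intro integrable_mult_left) (auto simp: fmeasurable_def)
  have "pdens p (%x. softpos (e n) (e n) (u x)) (%x. softpos' (e n) (e n) (u x) *R g x) x
  <= indicator Om x * (A powr p + B powr p)" for n x
  proof (cases "x : Om")
  case True
  have "softpos (e n) (e n) (u x) <= A"
  using softpos_bounds(2)[OF e[of n], of "e n" "u x"] A[of x] u(2)[of x] e[of n] by (auto simp: max_def split: if_splits)
  moreover have "norm (softpos' (e n) (e n) (u x) *R g x) <= 1 * B"
  unfolding norm_scaleR using softpos'_bounds[OF e[of n], of "e n" "u x"] g(4)[of x] by (intro mult_mono) auto
  ultimately show ?thesis using True p softpos_bounds(1)[OF e[of n], of "e n" "u x"]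
  by (auto simp: pdens_def intro!: add_mono powr_mono2)
  next
  case False
  then show ?thesis using u(3) g(3) e[of n] by (simp add: pdens_def softpos_def)
  qed
  then show "AL x. ALL n. pdens p (%x. softpos (e n) (e n) (u x)) (%x. softpos' (e n) (e n) (u x) *R g x) x
  <= indicator Om x * (A powr p + B powr p)" by simp
 qed
qed

lemma sob_outside:
 assumes "sob Om p u g" "0 < p" shows "AL x. x ~: Om --> u x = 0 & g x = 0"
proof -
 obtain Ph H l where 1: "!!n. c1c Om (Ph n) (H n)" "AL x. (%n. Ph n x) ----> u x"
  "AL x. (%n. H n x) ----> g x" "lint l" "!!x. 0 <= l x"
  "AL x. ALL n. pdens p (Ph n) (H n) x <= l x" "AL x. pdens p u g x <= l x"
  by (rule sob_dominated[OF assms]) (assumption | rule that)+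
 have z: "Ph n x = 0 & H n x = 0" if "x ~: Om" for n x using 1(1)[of n] that unfolding c1c_def by blast
 show ?thesis using 1(2,3)
 proof eventually_elim
  case (elim x)
  show ?case
  proof
  assume "x ~: Om"
  then have "(%n. 0) ----> u x" "(%n. 0) ----> g x" using elim z by simp_all
  then show "u x = 0 & g x = 0" by (simp add: LIMSEQ_const_iff)
  qed
 qed
qed

section \<open>Integration by parts for Sobolev pairs\<close>

lemma le_one_plus_powr: "0 <= t ==> 1 <= p ==> t <= 1 + t powr (p::real)"
proof (cases "t <= 1")
 case False
 assume "1 <= p"
 then have "t powr 1 <= t powr p" using False by (intro powr_mono) auto
 then show ?thesis using False by simp
qed (simp add: add_increasing2)

text \<open>On a bounded set, t <= 1 + t powr p turns a majorant of p-th powers into a majorant of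
  first powers.\<close>

lemma sob_L1_dominated:
 fixes u :: "'a::euclidean_space => real"
 assumes s: "sob Om p u g" and p: "1 <= p" and Om: "bounded Om"
 obtains Ph G h where "!!n. c1c Om (Ph n) (G n)" "AL x. (%n. Ph n x) ----> u x"
  "AL x. (%n. G n x) ----> g x" "lint h"
  "AL x. ALL n. <|Ph n x|> <= h x & norm (G n x) <= h x"
  "AL x. <|u x|> <= h x & norm (g x) <= h x"
proof -
 have p0: "0 < p" using p by simp
 obtain Ph G h where 1: "!!n. c1c Om (Ph n) (G n)" "AL x. (%n. Ph n x) ----> u x"
  "AL x. (%n. G n x) ----> g x" "lint h" "!!x. 0 <= h x"
  "AL x. ALL n. pdens p (Ph n) (G n) x <= h x" "AL x. pdens p u g x <= h x"
  by (rule sob_dominated[OF s p0]) (assumption | rule that)+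
 obtain R where R: "Om <= cball 0 R" using bounded_subset_ballD[OF Om, of 0] ball_subset_cball by fast
 define k where "k = (%x::'a. indicator (cball 0 R) x + h x)"
 have i: "lint k" unfolding k_def
  using lmeasurable_cball[of "0::'a" R] 1(4) by (auto simp: fmeasurable_def less_top)
 have z: "Ph n x = 0 & G n x = 0" if "x ~: Om" for n x using 1(1)[of n] that unfolding c1c_def by blast
 have b: "<|a|> <= k x & norm b <= k x" if "<|a|> powr p + norm b powr p <= h x" "x ~: Om --> a = 0 & b = 0"
  for a and b :: 'a and x
 proof (cases "x : Om")
  case True
  have "<|a|> powr p <= h x" "norm b powr p <= h x"
  using that(1) powr_ge_zero[of "norm b" p] powr_ge_zero[of "<|a|>" p] by linarith+
  then show ?thesis
  using le_one_plus_powr[of "<|a|>" p] le_one_plus_powr[of "norm b" p] p True R by (auto simp: k_def)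
 qed (use that 1(5)[of x] in "auto simp: k_def")
 show ?thesis
 proof (rule that[OF 1(1-3) i])
  show "AL x. ALL n. <|Ph n x|> <= k x & norm (G n x) <= k x"
  using 1(6)
  proof eventually_elim
  case (elim x)
  show ?case by (intro allI b) (use elim z[of x] in "auto simp: pdens_def")
  qed
  show "AL x. <|u x|> <= k x & norm (g x) <= k x"
  using 1(7) sob_outside[OF s p0] by eventually_elim (rule b, auto simp: pdens_def)
 qed
qed

lemma sob_integrable_L1:
 assumes "sob Om p u g" "1 <= p" "bounded Om"
 shows "lint u" "lint g"
proof -
 note [measurable] = sob_meas[OF assms(1)]
 obtain h where h: "lint h" "AL x. <|u x|> <= h x & norm (g x) <= h x"
  by (rule sob_L1_dominated[OF assms]) blast
 show "lint u"
  by (rule intb_bound[OF h(1)]) (measurable, use h(2) in eventually_elim, auto)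
 show "lint g"
  by (rule intb_bound[OF h(1)]) (measurable, use h(2) in eventually_elim, auto)
qed

lemma sob_ibp:
 assumes s: "sob Om p u g" and p: "1 <= p" and Om: "bounded Om"
  and ps: "!!x. (ps has_derivative (%v. H x *. v)) (at x)" "contU H"
 shows "lint (%x. u x * (H x *. v))" "lint (%x. (g x *. v) * ps x)"
  "(LI x. u x * (H x *. v)) = - (LI x. (g x *. v) * ps x)"
proof -
 have p0: "0 < p" using p by simp
 note [measurable] = sob_meas[OF s]
 obtain Ph G h where 1: "!!n. c1c Om (Ph n) (G n)" "AL x. (%n. Ph n x) ----> u x"
  "AL x. (%n. G n x) ----> g x" "lint h"
  "AL x. ALL n. <|Ph n x|> <= h x & norm (G n x) <= h x"
  "AL x. <|u x|> <= h x & norm (g x) <= h x"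
  by (rule sob_L1_dominated[OF s p Om]) (assumption | rule that)+
 have cps: "contU ps"
  using ps(1) by (meson con_at has_derivative_continuous)
 note [measurable] = con_meas[OF cps] con_meas[OF ps(2)] c1c_meas[OF 1(1)]
 have K: "compact (closure Om)" using Om by simp
 have "bounded (ps ` closure Om)" "bounded (H ` closure Om)"
  by (intro cpt_bounded cpt_image con_sub[OF cps] con_sub[OF ps(2)] K; simp)+
 then obtain A B where A: "!!x. x : closure Om ==> <|ps x|> <= A" and B: "!!x. x : closure Om ==> norm (H x) <= B"
  unfolding bounded_iff by auto
 define C where "C = (<|A|> + <|B|>) * norm v"
 have C: "0 <= C" by (simp add: C_def)
 have bH: "<|a * (H x *. v)|> <= C * h x" if "<|a|> <= h x" "x ~: Om --> a = 0" for a x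
 proof (cases "x : Om")
  case True
  then have "norm (H x) <= <|A|> + <|B|>" using B[of x] closure_subset[of Om] by force
  then have "<|H x *. v|> <= C"
  unfolding C_def by (intro order_trans[OF Cauchy_Schwarz_ineq2] mult_rm) auto
  then show ?thesis using that(1) unfolding abs_mult mult.commute[of C] by (intro mult_mono) auto
 qed (use that C in auto)
 have bps: "<|(b *. v) * ps x|> <= C * h x" if "norm b <= h x" "x ~: Om --> b = 0" for b x
 proof (cases "x : Om")
  case True
  then have "<|ps x|> <= <|A|> + <|B|>" using A[of x] closure_subset[of Om] by force
  moreover have "<|b *. v|> <= h x * norm v"
  using that(1) by (intro order_trans[OF Cauchy_Schwarz_ineq2] mult_rm) auto
  ultimately have "<|b *. v|> * <|ps x|> <= (h x * norm v) * (<|A|> + <|B|>)"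
  using order_trans[OF norm_ge_zero that(1)] by (intro mult_mono mult_nonneg_nonneg) auto
  then show ?thesis by (simp add: abs_mult C_def mult_ac)
 qed (use that C in auto)
 have z: "Ph n x = 0 & G n x = 0" if "x ~: Om" for n x using 1(1)[of n] that unfolding c1c_def by blast
 have hi: "lint (%x. C * h x)" using 1(4) by simp
 show i1: "lint (%x. u x * (H x *. v))"
  by (rule intb_bound[OF hi], measurable)
  (use 1(6) sob_outside[OF s p0] in eventually_elim, use bH in force)
 show i2: "lint (%x. (g x *. v) * ps x)"
  by (rule intb_bound[OF hi], measurable)
  (use 1(6) sob_outside[OF s p0] in eventually_elim, use bps in force)
 have l1: "(%n. LI x. Ph n x * (H x *. v)) ----> (LI x. u x * (H x *. v))"
 proof (rule int_dom[where w = "%x. C * h x"])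
  show "AL x. (%n. Ph n x * (H x *. v)) ----> u x * (H x *. v)"
  using 1(2) by eventually_elim (intro tendsto_intros)
  show "AL x. norm (Ph n x * (H x *. v)) <= C * h x" for n
  using 1(5) by eventually_elim (use bH z in auto)
 qed (use hi in "measurable")
 have l2: "(%n. LI x. (G n x *. v) * ps x) ----> (LI x. (g x *. v) * ps x)"
 proof (rule int_dom[where w = "%x. C * h x"])
  show "AL x. (%n. (G n x *. v) * ps x) ----> (g x *. v) * ps x"
  using 1(3) by eventually_elim (intro tendsto_intros)
  show "AL x. norm ((G n x *. v) * ps x) <= C * h x" for n
  using 1(5) by eventually_elim (use bps z in auto)
 qed (use hi in "measurable")
 have "(LI x. Ph n x * (H x *. v)) = - (LI x. (G n x *. v) * ps x)" for n
  by (rule c1c_ibp[OF 1(1) ps])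
 then have "(%n. - (LI x. (G n x *. v) * ps x)) ----> (LI x. u x * (H x *. v))"
  using l1 by simp
 then show "(LI x. u x * (H x *. v)) = - (LI x. (g x *. v) * ps x)"
  using tendsto_minus[OF l2] LIMSEQ_unique by blast
qed

text \<open>Integrate by parts against the coordinate x . i, whose derivative in direction
  \<open>i\<close> is 1: the integral of \<open>u\<close> is minus an integral of the vanishing
  gradient. No Poincare inequality is involved.\<close>

lemma sob_zero_gradient:
 fixes u :: "'a::euclidean_space => real"
 assumes s: "sob Om p u g" and p: "1 <= p" and Om: "bounded Om" and u: "!!x. 0 <= u x"
  and g: "AL x. g x = 0"
 shows "AL x. u x = 0"
proof -
 obtain i :: 'a where i: "i : Basis" using nonempty_Basis by blast
 have d: "((%x. x *. i) has_derivative (%v. i *. v)) (at x)" for x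
  by (auto intro!: deriv_eqs simp: inner_commute)
 note ibp = sob_ibp[OF s p Om d continuous_on_const, of i]
 have "(LI x. (g x *. i) * (x *. i)) = integral\<^sup>L lebesgue (%x::'a. 0::real)"
  by (rule integral_cong_AE) (use ibp(2) g in auto)
 then have "(LI x. u x) = 0" "lint u"
  using ibp i by auto
 then show ?thesis using integral_nonneg_eq_0_iff_AE[of lebesgue u] u by simp
qed

lemma c1c_translation:
 assumes "c1c Om ph G" shows "c1c ((%x. x - a) ` Om) (%x. ph (a + x)) (%x. G (a + x))"
proof -
 obtain K where K: "compact K" "K <= Om" "!!x. x ~: K ==> ph x = 0 & G x = 0"
  and der: "!!x. (ph has_derivative (%v. G x *. v)) (at x)" and cont: "contU G"
  using assms unfolding c1c_def by auto
 show ?thesis unfolding c1c_def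
 proof (intro conjI allI exI[of _ "(%x. x - a) ` K"] impI)
  show "((%x. ph (a + x)) has_derivative (*.) (G (a + x))) (at x)" for x
  proof -
  have "((%x. a + x) has_derivative (%v. v)) (at x)" by (auto intro!: deriv_eqs)
  from has_derivative_compose[OF this der] show ?thesis .
  qed
  show "contU (%x. G (a + x))"
  by (rule con_comp[OF cont]) (auto intro: continuous_on_add)
  show "compact ((%x. x - a) ` K)" using K(1) by (rule compact_translation_subtract)
  show "(%x. x - a) ` K <= (%x. x - a) ` Om" using K(2) by blast
  fix x assume "x ~: (%x. x - a) ` K"
  then have "a + x ~: K" by (metis add_diff_cancel_left' imageI)
  then show "ph (a + x) = 0" "G (a + x) = 0" using K(3) by auto
 qed
qed

lemma sob_translation:
 assumes s: "sob Om p u g" shows "sob ((%x. x - a) ` Om) p (%x. u (a + x)) (%x. g (a + x))"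
proof -
 note [measurable] = sob_meas[OF s] measurable_translation_lebesgue
 have m: "(%x. u (a + x)) : lmeas" "(%x. g (a + x)) : lmeas"
  by (rule measurable_compose[OF measurable_translation_lebesgue]; rule sob_meas[OF s])+
 show ?thesis unfolding sob_def
 proof (intro conjI m allI impI)
  fix e :: real assume "e > 0"
  then obtain ph G where c: "c1c Om ph G"
  "(NI x. ennreal (pdens p (%x. ph x - u x) (%x. G x - g x) x)) < ennreal e"
  using s unfolding sob_def by blast
  note [measurable] = c1c_meas[OF c(1)]
  have "(NI x. ennreal (pdens p (%x. ph (a + x) - u (a + x)) (%x. G (a + x) - g (a + x)) x)) < ennreal e"
  using c(2) nn_trans[of "%x. ennreal (pdens p (%x. ph x - u x) (%x. G x - g x) x)" a]
  by (simp add: pdens_def)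
  then show "EX ph G. c1c ((%x. x - a) ` Om) ph G &
  (NI x. ennreal (pdens p (%x. ph x - u (a + x)) (%x. G x - g (a + x)) x)) < ennreal e"
  using c1c_translation[OF c(1)] by blast
 qed
qed

subsection \<open>Weak gradients and \<open>W01p\<close>\<close>

lemma intb_on_iff:
 fixes f :: "'a::euclidean_space => 'b::euclidean_space"
 assumes "S : sets lebesgue"
 shows "integrable (lebesgue_on S) f \<longleftrightarrow> lint (%x. indicator S x *R f x)"
 using assms by (subst integrable_restrict_space) (auto simp: set_integrable_def)

lemma LINT_lebesgue_on:
 fixes f :: "'a::euclidean_space => 'b::euclidean_space"
 assumes "S : sets lebesgue"
 shows "(LINT x|lebesgue_on S. f x) = (LI x. indicator S x *R f x)"
 using assms by (subst integral_restrict_space) (auto simp: set_lebesgue_integral_def)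

lemma AE_lebesgue_on_iff:
 assumes "S : sets lebesgue"
 shows "(AE x in lebesgue_on S. P x) \<longleftrightarrow> (AL x. x : S --> P x)"
 using assms by (subst AE_restrict_space_iff) auto

lemma meas_AE:
 fixes f g :: "'a::euclidean_space => 'b::euclidean_space"
 assumes f: "f : lmeas" and ae: "AL x. f x = g x"
 shows "g : lmeas"
proof (rule measurableI)
 fix A :: "'b set" assume "A : sets borel"
 then have 1: "f -` A \<inter> space lebesgue : sets lebesgue" using f by (rule measurable_sets[rotated])
 have 2: "AL x. x : f -` A \<inter> space lebesgue \<longleftrightarrow> x : g -` A \<inter> space lebesgue"
  using ae by eventually_elim auto
 show "g -` A \<inter> space lebesgue : sets lebesgue"
  by (rule completion.in_sets_AE[OF 2 1]) simp
qed auto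

lemma LINT_cong_AE:
 fixes f g :: "'a::euclidean_space => 'b::euclidean_space"
 assumes "f : lmeas" "AL x. f x = g x"
 shows "(LI x. g x) = (LI x. f x)"
 by (rule integral_cong_AE[symmetric, OF assms(1) meas_AE[OF assms] assms(2)])

lemma intb_ind_con:
 fixes f :: "'a::euclidean_space => real" and ze :: "'a => real"
 assumes f: "integrable (lebesgue_on K) f" and K: "compact K"
  and ze: "contU ze" "!!x. x ~: K ==> ze x = 0"
 shows "lint (%x. f x * ze x)"
proof -
 have Km: "K : sets lebesgue" using K by (simp add: compact_imp_closed)
 obtain B where B: "!!x. norm (ze x) <= B" using bdd_compact[OF ze(1) K ze(2)] by blast
 have "lint (%x. indicator K x *R f x)" using f by (simp add: intb_on_iff[OF Km])
 then have "lint (%x. (indicator K x *R f x) * ze x)"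
  by (rule intb_mult_con[OF _ ze(1)]) (use B in simp)
 also have "(%x. (indicator K x *R f x) * ze x) = (%x. f x * ze x)"
  using ze(2) by (auto simp: indicator_def fun_eq_iff)
 finally show ?thesis .
qed

lemma test_zero_con:
 assumes f: "locally_integrable Om f" and Om: "open Om"
  and z: "!!et. et : test_functions Om ==> (LINT x|lebesgue_on Om. f x * et x) = 0"
  and ze: "contU ze" "compact K" "K <= Om" "!!x. x ~: K ==> ze x = 0"
 shows "(LI x. f x * ze x) = 0"
proof -
 have Omm: "Om : sets lebesgue" using Om by simp
 obtain K' where K': "compact K'" "K <= K'" "K' <= Om"
  "!!e. e > 0 ==> EX et:test_functions Om. (ALL x. x ~: K' --> et x = 0 & grad et x = 0) & (ALL x. <|et x - ze x|> <= e) &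
  (ALL G. c1c Om ze G --> (ALL x v. <|grad et x *. v - G x *. v|> <= e * norm v))"
  by (rule mollify[OF ze(1,2,4) Om ze(3)]) (assumption | rule that)+
 have K'm: "K' : sets lebesgue" using K'(1) by (simp add: compact_imp_closed)
 have fK: "integrable (lebesgue_on K') f" using f K' by (simp add: locally_integrable_def)
 then have fK2: "lint (%x. indicator K' x *R f x)" by (simp add: intb_on_iff[OF K'm])
 define A where "A = (LI x. <|indicator K' x *R f x|>)"
 have A: "0 <= A" by (simp add: A_def)
 have i1: "lint (%x. f x * ze x)"
  by (rule intb_ind_con[OF fK K'(1) ze(1)]) (use ze(4) K'(2) in blast)
 have "<|LI x. f x * ze x|> <= 0 + e" if e: "e > 0" for e
 proof -
  have "e / (A + 1) > 0" using e A by simp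
  then obtain et where et0: "et : test_functions Om" "ALL x. x ~: K' --> et x = 0 & grad et x = 0"
  "ALL x. <|et x - ze x|> <= e / (A + 1)"
  by (elim bexE[OF K'(4)] conjE) (rule that)
  have et: "et : test_functions Om" "!!x. x ~: K' ==> et x = 0" "!!x. <|et x - ze x|> <= e / (A + 1)"
  using et0 by auto
  have cet: "contU et" using c1c_con[OF test_c1c[OF et(1)]] .
  have i2: "lint (%x. f x * et x)"
  by (rule intb_ind_con[OF fK K'(1) cet et(2)])
  have "(LINT x|lebesgue_on Om. f x * et x) = (LI x. f x * et x)"
  unfolding LINT_lebesgue_on[OF Omm] using et(2) K'(3)
  by (intro lint_cong) (auto simp: indicator_def)
  then have "(LI x. f x * ze x) = (LI x. f x * ze x - f x * et x)"
  using i1 i2 z[OF et(1)] by simp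
  also have "<|...|> <= (LI x. (e / (A + 1)) * <|indicator K' x *R f x|>)"
  proof (rule LINT_abs_bound)
  have "<|f x * ze x - f x * et x|> <= (e / (A + 1)) * <|indicator K' x *R f x|>" for x
  proof (cases "x : K'")
  case True
  have "<|f x * ze x - f x * et x|> = <|et x - ze x|> * <|f x|>"
  by (simp add: abs_mult[symmetric] algebra_simps abs_minus_commute)
  then show ?thesis using mult_rm[OF et(3), of "<|f x|>" x] True by simp
  next
  case False
  then have "ze x = 0" "et x = 0" using ze(4) et(2) K'(2) by blast+
  then show ?thesis using False by simp
  qed
  then show "AL x. <|f x * ze x - f x * et x|> <= (e / (A + 1)) * <|indicator K' x *R f x|>" by simp
  qed (use fK2 in auto)
  also have "... = (e / (A + 1)) * A" by (simp add: A_def)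
  also have "... <= e" using e A by (simp add: divide_le_eq mult_lm)
  finally show ?thesis by simp
 qed
 then have "<|LI x. f x * ze x|> <= 0" by (rule field_le_epsilon)
 then show ?thesis by simp
qed

text \<open>Continuous functions vanishing outside a compact set are uniform limits of test functions, and
 every measurable function is an almost everywhere limit of continuous ones; so the truncated \<open>f\<close>
 itself, localised by a cut-off, may be used as a test function.\<close>

lemma fundamental_lemma_variations:
 assumes f: "locally_integrable Om f" and Om: "open Om"
  and z: "!!et. et : test_functions Om ==> (LINT x|lebesgue_on Om. f x * et x) = 0"
 shows "AL x. x : Om --> f x = 0"
proof -
 have "negligible {x:Om. f x ~= 0}"
 proof (rule iffD2[OF locally_negligible_alt], intro ballI)
  fix a assume a: "a : {x:Om. f x ~= 0}"
  then obtain r where r: "0 < r" "cball a r <= Om" using Om open_contains_cball by blast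
  define K where "K = cball a r"
  have Km: "K : sets lebesgue" by (simp add: K_def)
  have "integrable (lebesgue_on K) f" using f r by (simp add: locally_integrable_def K_def)
  then have iF: "lint (%x. indicator K x *R f x)" by (simp add: intb_on_iff[OF Km])
  define F where "F x = indicator K x *R f x" for x
  note iF = iF[folded F_def]
  obtain N g where N: "negligible N" "!!n. contU (g n)" "!!x. x ~: N ==> (%n. g n x) ----> F x"
  using lebesgue_measurable_imp_measurable_on_real[of F UNIV] iF unfolding measurable_on_def by auto
  \<comment> \<open>A bounded continuous function with the sign of its argument: boundedness gives
    the majorant, the sign makes the product with \<open>F\<close> nonnegative.\<close>
  define k where "k t = max (-1) (min 1 (t::real))" for t
  define cu where "cu x = max 0 (r - dist a x)" for x
  have kc: "isCont k t" for t unfolding k_def by (intro con_intros)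
  have c: "contU (%x. cu x * k (h x))" if "contU h" for h
  unfolding cu_def k_def by (intro con_intros that)
  have b: "<|F x * (cu x * k t)|> <= r * <|F x|>" for x t
  proof -
  have "cu x * <|k t|> <= r * 1" using r by (intro mult_mono) (auto simp: cu_def k_def)
  from mult_lm[OF this, of "<|F x|>"] show ?thesis by (simp add: abs_mult cu_def mult_ac)
  qed
  have [measurable]: "F : lmeas" "k : borel_measurable borel"
  using iF unfolding k_def[abs_def] by (auto intro!: con_intros meas_con)
  have [measurable]: "cu : lmeas"
  by (rule con_meas) (simp add: cu_def[abs_def] con_intros)
  have [measurable]: "g n : lmeas" for n by (rule con_meas[OF N(2)])
  \<comment> \<open>This is nonnegative, and in the open ball, where the cut-off is positive, it
    vanishes only where \<open>f\<close> does.\<close>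
  let ?h = "%x. F x * (cu x * k (F x))"
  have hm: "?h : lmeas" "(%x. F x * (cu x * k (g n x))) : lmeas" for n by measurable
  have iw: "lint (%x. r * <|F x|>)" using iF by auto
  have "AL x. x ~: N" using N(1) by (intro AE_not_in) (simp add: negligible_iff_null_sets)
  then have lim: "AL x. (%n. F x * (cu x * k (g n x))) ----> ?h x"
  by eventually_elim (intro tendsto_mult_left isCont_lim[OF kc] N(3))
  have "AL x. norm (F x * (cu x * k (g n x))) <= r * <|F x|>" for n using b by simp
  note dc = hm iw lim this
  have "(LI x. F x * (cu x * k (g n x))) = 0" for n
  proof -
  have "(LI x. f x * (cu x * k (g n x))) = 0"
  by (rule test_zero_con[OF f Om z c[OF N(2)], of K]) (use r in "auto simp: K_def cu_def")
  also have "(%x. f x * (cu x * k (g n x))) = (%x. F x * (cu x * k (g n x)))"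
  by (auto simp: F_def K_def cu_def indicator_def fun_eq_iff)
  finally show ?thesis .
  qed
  then have "integral\<^sup>L lebesgue ?h = 0" using int_dom[OF dc] by (simp add: LIMSEQ_const_iff)
  moreover have "0 <= ?h x" for x
  by (cases "0 <= F x") (auto simp: k_def cu_def max_def min_def mult_nonneg_nonneg mult_nonpos_nonpos mult_nonneg_nonpos)
  ultimately have "AL x. ?h x = 0"
  using integral_nonneg_eq_0_iff_AE[OF integrable_dominated_convergence[OF dc]] by simp
  then have "AL x. x ~: {x:Om. f x ~= 0} \<inter> ball a r"
  by eventually_elim (auto simp: F_def K_def cu_def k_def max_def min_def split: if_splits)
  then obtain M where "M : null_sets lebesgue" "{x:Om. f x ~= 0} \<inter> ball a r <= M" unfolding eventually_ae_filter by (auto simp: Int_def)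
  then have "negligible ({x:Om. f x ~= 0} \<inter> ball a r)" by (metis negligible_iff_null_sets negligible_subset)
  then show "EX U. openin (top_of_set {x:Om. f x ~= 0}) U & a : U & negligible U"
  using a r by (intro exI[of _ "{x:Om. f x ~= 0} \<inter> ball a r"]) auto
 qed
 then have "AL x. x ~: {x:Om. f x ~= 0}" by (intro AE_not_in) (simp add: negligible_iff_null_sets)
 then show ?thesis by eventually_elim auto
qed

lemma intb_test_deriv:
 fixes g :: "'a::euclidean_space => 'a"
 assumes "locally_integrable Om g" "ph : test_functions Om" "open Om"
 shows "integrable (lebesgue_on Om) (%x. (g x *. v) * ph x)"
proof -
 obtain K where K: "compact K" "K <= Om" "!!x. x ~: K ==> ph x = 0 & grad ph x = 0"
  using test_c1c[OF assms(2)] unfolding c1c_def by blast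
 have "integrable (lebesgue_on K) (%x. g x *. v)"
  using assms(1) K by (simp add: locally_integrable_def)
 then have "lint (%x. (g x *. v) * ph x)"
  by (rule intb_ind_con[OF _ K(1) c1c_con[OF test_c1c[OF assms(2)]]])
  (use K(3) in blast)
 also have "(%x. (g x *. v) * ph x) = (%x. indicator Om x *R ((g x *. v) * ph x))"
  using K by (auto simp: indicator_def fun_eq_iff)
 finally show ?thesis using assms(3) by (subst intb_on_iff) auto
qed

lemma weak_gradient_unique:
 fixes u :: "'a::euclidean_space => real"
 assumes "has_weak_gradient Om u g" "has_weak_gradient Om u g'" "open Om"
 shows "AL x. x : Om --> g x = g' x"
proof -
 have l: "locally_integrable Om g" "locally_integrable Om g'" using assms by (auto simp: has_weak_gradient_def)
 have "AL x. x : Om --> (g x - g' x) *. i = 0" for i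
 proof (rule fundamental_lemma_variations[OF _ assms(3)])
  show "locally_integrable Om (%x. (g x - g' x) *. i)"
  using l by (auto simp: locally_integrable_def inner_diff_left)
  fix et assume et: "et : test_functions Om"
  have "(LINT x|lebesgue_on Om. u x * frechet_derivative et (at x) i) = - (LINT x|lebesgue_on Om. (g x *. i) * et x)"
  "(LINT x|lebesgue_on Om. u x * frechet_derivative et (at x) i) = - (LINT x|lebesgue_on Om. (g' x *. i) * et x)"
  using assms(1,2) et by (simp_all add: has_weak_gradient_def)
  then have "(LINT x|lebesgue_on Om. (g x *. i) * et x) = (LINT x|lebesgue_on Om. (g' x *. i) * et x)"
  by linarith
  then show "(LINT x|lebesgue_on Om. ((g x - g' x) *. i) * et x) = 0"
  using intb_test_deriv[OF l(1) et assms(3)] intb_test_deriv[OF l(2) et assms(3)]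
  by (simp add: inner_diff_left left_diff_distrib)
 qed
 then have "AL x. ALL i:Basis. x : Om --> (g x - g' x) *. i = 0"
  by (intro AE_finite_allI) auto
 then show ?thesis
  by eventually_elim (auto simp: euclidean_eq_iff[of "g _"] inner_diff_left)
qed

lemma weak_grad_unique:
 assumes "has_weak_gradient Om u g" "open Om"
 shows "AL x. x : Om --> weak_grad Om u x = g x"
proof -
 have "has_weak_gradient Om u (weak_grad Om u)"
  unfolding weak_grad_def by (rule someI[of _ g]) (rule assms(1))
 then show ?thesis by (rule weak_gradient_unique[OF _ assms])
qed

lemma test_frechet_grad: "ph : test_functions Om ==> frechet_derivative ph (at x) v = grad ph x *. v"
 by (rule grad_inner[symmetric]) (auto simp: test_functions_def smooth_fun_def dest: spec[of _ "Suc 0"])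

lemma sob_has_weak_gradient:
 fixes u :: "'a::euclidean_space => real"
 assumes s: "sob Om' p u g" and p: "1 <= p" and Om: "open Om" "bounded Om'"
 shows "has_weak_gradient Om u g"
 unfolding has_weak_gradient_def
proof (intro conjI ballI allI)
 have i: "lint u" "lint g" using sob_integrable_L1[OF s p Om(2)] by auto
 have li: "integrable (lebesgue_on K) f" if "compact K" "lint f" for K and f :: "'a => 'b::euclidean_space"
 proof -
  have "K : sets lebesgue" using that by (simp add: compact_imp_closed)
  then show ?thesis using that(2) by (simp add: intb_on_iff integrable_mult_indicator)
 qed
 show "locally_integrable Om u" "locally_integrable Om g"
  using i li by (auto simp: locally_integrable_def)
 fix ph :: "'a => real" and v assume ph: "ph : test_functions Om"
 have c: "c1c Om ph (grad ph)" using test_c1c[OF ph] .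
 then obtain K where K: "compact K" "K <= Om" "!!x. x ~: K ==> ph x = 0 & grad ph x = 0"
  unfolding c1c_def by blast
 have z: "ph x = 0" "grad ph x = 0" if "x ~: Om" for x using K that by blast+
 have d: "!!x. (ph has_derivative (%v. grad ph x *. v)) (at x)" "contU (grad ph)"
  using c by (auto simp: c1c_def)
 have Omm: "Om : sets lebesgue" using Om by simp
 have "(LINT x|lebesgue_on Om. u x * frechet_derivative ph (at x) v) = (LI x. u x * (grad ph x *. v))"
  unfolding LINT_lebesgue_on[OF Omm] test_frechet_grad[OF ph]
  by (intro lint_cong) (use z in "auto simp: indicator_def")
 also have "... = - (LI x. (g x *. v) * ph x)" by (rule sob_ibp(3)[OF s p Om(2) d])
 also have "(LI x. (g x *. v) * ph x) = (LINT x|lebesgue_on Om. (g x *. v) * ph x)"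
  unfolding LINT_lebesgue_on[OF Omm]
  by (intro lint_cong) (use K in "auto simp: indicator_def")
 finally show "(LINT x|lebesgue_on Om. u x * frechet_derivative ph (at x) v) = - (LINT x|lebesgue_on Om. (g x *. v) * ph x)" .
qed

lemma norm_le_of_inner_le:
 fixes x :: "'a::real_inner"
 assumes "!!v. <|x *. v|> <= e * norm v" "0 <= e"
 shows "norm x <= e"
 using assms(1)[of x] assms(2) by (cases "x = 0") (auto simp: dot_square_norm power2_eq_square)

lemma sob_test_dense:
 assumes s: "sob Om p u g" and p: "0 < p" and Om: "open Om" and e: "e > 0"
 obtains et where "et : test_functions Om"
  "(NI x. ennreal (pdens p (%x. u x - et x) (%x. g x - grad et x) x)) < ennreal e"
proof -
 note [measurable] = sob_meas[OF s]
 define C where "C = (2::real) powr p"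
 have C: "C >= 1" using p by (simp add: C_def ge_one_powr_ge_zero)
 have "e / (2 * C) > 0" using e C by simp
 then obtain ph G where ph: "c1c Om ph G"
  "(NI x. ennreal (pdens p (%x. ph x - u x) (%x. G x - g x) x)) < ennreal (e / (2 * C))"
  using s unfolding sob_def by blast
 note [measurable] = c1c_meas[OF ph(1)]
 obtain K where K: "compact K" "K <= Om" "!!x. x ~: K ==> ph x = 0 & G x = 0"
  using ph(1) unfolding c1c_def by blast
 have Kz: "!!x. x ~: K ==> ph x = 0" using K(3) by blast
 obtain K' where K': "compact K'" "K <= K'" "K' <= Om"
  "!!e. e > 0 ==> EX et:test_functions Om. (ALL x. x ~: K' --> et x = 0 & grad et x = 0) & (ALL x. <|et x - ph x|> <= e) &
  (ALL G. c1c Om ph G --> (ALL x v. <|grad et x *. v - G x *. v|> <= e * norm v))"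
  by (rule mollify[OF c1c_con[OF ph(1)] K(1) Kz Om K(2)]) (assumption | rule that)+
 define m where "m = measure lebesgue K'"
 have m: "0 <= m" by (simp add: m_def)
 have K'l: "K' : lmeasurable" using K'(1) by (rule lmeasurable_compact)
 \<comment> \<open>The value and gradient errors together contribute at most
   \<open>2 * t powr p * m\<close>, which this choice keeps below \<open>e / (2 * C)\<close>;
   \<open>m + 1\<close> avoids division by 0.\<close>
 define t where "t = (e / (4 * C * (m + 1))) powr (1 / p)"
 have t: "t > 0" using e C m by (simp add: t_def)
 have tp: "t powr p = e / (4 * C * (m + 1))" using e C m p by (simp add: t_def powr_powr)
 obtain et where et0: "et : test_functions Om" "ALL x. x ~: K' --> et x = 0 & grad et x = 0"
  "ALL x. <|et x - ph x|> <= t" "ALL G. c1c Om ph G --> (ALL x v. <|grad et x *. v - G x *. v|> <= t * norm v)"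
  by (rule bexE[OF K'(4)[OF t]]) (elim conjE, rule that)
 have et: "et : test_functions Om" "!!x. x ~: K' ==> et x = 0 & grad et x = 0" "!!x. <|et x - ph x|> <= t"
  "!!x v. <|grad et x *. v - G x *. v|> <= t * norm v"
  using et0(1) et0(2) et0(3) spec[OF et0(4), of G] ph(1) by simp_all
 note [measurable] = c1c_meas[OF test_c1c[OF et(1)]]
 have gb: "norm (grad et x - G x) <= t" for x
  using et(4)[of x] t by (intro norm_le_of_inner_le) (auto simp: inner_diff_left)
 have pb: "pdens p (%x. ph x - et x) (%x. G x - grad et x) x <= indicator K' x * (2 * t powr p)" for x
 proof (cases "x : K'")
  case True
  have "<|ph x - et x|> powr p <= t powr p" "norm (G x - grad et x) powr p <= t powr p"
  using et(3)[of x] gb[of x] p by (auto intro!: powr_mono2 simp: abs_minus_commute norm_minus_commute)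
  then show ?thesis using True by (simp add: pdens_def)
 next
  case False
  then have "x ~: K" using K'(2) by blast
  then show ?thesis using False K(3) et(2) by (simp add: pdens_def)
 qed
 have "(NI x. ennreal (pdens p (%x. ph x - et x) (%x. G x - grad et x) x))
  <= (NI x. ennreal (2 * t powr p) * indicator K' x)"
  by (intro nn_integral_mono order_trans[OF ennreal_leI[OF pb]]) (auto simp: indicator_def)
 also have "... = ennreal (2 * t powr p) * emeasure lebesgue K'"
  using K'l by (intro nn_integral_cmult_indicator) auto
 also have "... = ennreal (2 * t powr p * m)"
  using K'l m by (simp add: m_def emeasure_eq_measure2 ennreal_mult)
 also have "... < ennreal (e / (2 * C))"
 proof -
  have "2 * (e / (4 * C * K)) * m = (e / (2 * C)) * (m / K)" if "K > 0" for K
  using C that by (simp add: field_simps)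
  from this[of "m + 1"] have "2 * t powr p * m = (e / (2 * C)) * (m / (m + 1))" using m by (simp add: tp)
  also have "... < (e / (2 * C)) * 1" using e C m by (intro mult_strict_left_mono) auto
  finally show ?thesis using e C by (intro ennreal_lessI) auto
 qed
 finally have small: "(NI x. ennreal (pdens p (%x. ph x - et x) (%x. G x - grad et x) x)) < ennreal (e / (2 * C))" .
 have "(NI x. ennreal (pdens p (%x. u x - et x) (%x. g x - grad et x) x)) <=
  (NI x. ennreal C * (ennreal (pdens p (%x. ph x - u x) (%x. G x - g x) x)
  + ennreal (pdens p (%x. ph x - et x) (%x. G x - grad et x) x)))"
 proof (rule nn_integral_mono)
  fix x
  have "pdens p (%x. u x - et x) (%x. g x - grad et x) x
  <= C * (pdens p (%x. u x - ph x) (%x. g x - G x) x + pdens p (%x. ph x - et x) (%x. G x - grad et x) x)"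
  unfolding C_def using p by (intro pdens_triangle) auto
  also have "ennreal ... = ennreal C * (ennreal (pdens p (%x. ph x - u x) (%x. G x - g x) x)
  + ennreal (pdens p (%x. ph x - et x) (%x. G x - grad et x) x))"
  using C by (simp add: ennreal_mult' ennreal_plus pdens_diff_commute[of p u])
  finally show "ennreal (pdens p (%x. u x - et x) (%x. g x - grad et x) x) <=
  ennreal C * (ennreal (pdens p (%x. ph x - u x) (%x. G x - g x) x)
  + ennreal (pdens p (%x. ph x - et x) (%x. G x - grad et x) x))"
  using ennreal_leI by blast
 qed
 also have "... = ennreal C * ((NI x. ennreal (pdens p (%x. ph x - u x) (%x. G x - g x) x))
  + (NI x. ennreal (pdens p (%x. ph x - et x) (%x. G x - grad et x) x)))"
  by (subst nn_integral_cmult, measurable, subst nn_integral_add, measurable)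
 also have "... < ennreal C * (ennreal (e / (2 * C)) + ennreal (e / (2 * C)))"
  using ph(2) small C by (intro ennreal_mult_strict_left_mono add_strict_mono) auto
 also have "... = ennreal e"
  using e C by (simp add: ennreal_plus[symmetric] ennreal_mult'[symmetric] field_simps del: ennreal_plus)
 finally show ?thesis using that et(1) by blast
qed

lemma W1p_norm_powr:
 assumes "0 < p"
 shows "W1p_norm Om p u powr p =
  (LINT x|lebesgue_on Om. <|u x|> powr p) + (LINT x|lebesgue_on Om. norm (weak_grad Om u x) powr p)"
proof -
 have "0 <= (LINT x|lebesgue_on Om. <|u x|> powr p)" "0 <= (LINT x|lebesgue_on Om. norm (weak_grad Om u x) powr p)"
  by simp_all
 then show ?thesis using assms by (simp add: W1p_norm_def Lp_norm_def powr_powr)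
qed

text \<open>The norm in \<open>W01p\<close> involves the chosen gradient of the difference
  \<open>u - ph\<close>. By uniqueness of weak gradients this is almost everywhere the difference of
  the gradients, so the p-th power of the norm is the integral of \<open>pdens\<close>.\<close>

lemma W01p_sob:
 fixes u :: "'a::euclidean_space => real"
 assumes u: "u : W01p Om p" and Om: "open Om" and p: "1 < p"
 shows "sob Om p (%x. if x : Om then u x else 0) (%x. if x : Om then weak_grad Om u x else 0)"
  (is "sob Om p ?u ?g")
proof -
 have Omm: "Om : sets lebesgue" using Om by simp
 have p0: "0 < p" using p by simp
 obtain g where uL: "u : Lp_space Om p" and gL: "g : Lp_space Om p" and wg: "has_weak_gradient Om u g"
  using u by (auto simp: W01p_def W1p_def)
 have ae: "AL x. x : Om --> weak_grad Om u x = g x" using weak_grad_unique[OF wg Om] .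
 have um: "?u : lmeas" and gm: "(%x. if x : Om then g x else 0) : lmeas"
  using uL gL Omm by (auto simp: Lp_space_def borel_measurable_if)
 have gm': "?g : lmeas"
 proof -
  have "AL x. (if x : Om then g x else 0) = ?g x" using ae by eventually_elim auto
  then show ?thesis using gm by (rule meas_AE[rotated])
 qed
 have approx: "EX ph:test_functions Om. (NI x. ennreal (pdens p (%x. ph x - ?u x) (%x. grad ph x - ?g x) x)) < ennreal e"
  if e: "e > 0" for e
 proof -
  have "e powr (1/p) > 0" using e by simp
  then obtain ph where ph: "ph : test_functions Om" "W1p_norm Om p (%x. u x - ph x) < e powr (1/p)"
  using u unfolding W01p_def by blast
  have c: "c1c Om ph (grad ph)" using test_c1c[OF ph(1)] .
  then obtain K where K: "compact K" "K <= Om" "!!x. x ~: K ==> ph x = 0 & grad ph x = 0"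
  unfolding c1c_def by blast
  note [measurable] = c1c_meas[OF c] um gm gm'
  \<comment> \<open>\<open>Om\<close> is not assumed bounded here, so \<open>ph\<close> is regarded
    as a Sobolev function on its compact support.\<close>
  have wphi: "has_weak_gradient Om ph (grad ph)"
  proof -
  have "bounded K" using K(1) cpt_bounded by blast
  moreover have "c1c K ph (grad ph)" using c K unfolding c1c_def by blast
  ultimately show ?thesis using sob_has_weak_gradient[OF c1c_sob _ Om, of K ph "grad ph" p] p by simp
  qed
  have "has_weak_gradient Om (%x. u x - ph x) (%x. g x - grad ph x)"
  unfolding has_weak_gradient_def
  proof (intro conjI ballI allI)
  have l: "locally_integrable Om u" "locally_integrable Om g" "locally_integrable Om ph" "locally_integrable Om (grad ph)"
  using wg wphi by (auto simp: has_weak_gradient_def)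
  then show "locally_integrable Om (%x. u x - ph x)" "locally_integrable Om (%x. g x - grad ph x)"
  by (auto simp: locally_integrable_def)
  fix et :: "'a => real" and v assume et: "et : test_functions Om"
  have D: "(%x. grad et x *. v) : test_functions Om" using test_function_derivative[OF et] .
  have ii: "integrable (lebesgue_on Om) (%x. f x * (grad et x *. v))" if "locally_integrable Om f" for f
  proof -
  obtain i :: 'a where i: "i : Basis" using nonempty_Basis by blast
  have "locally_integrable Om (%x. f x *R i)" using that by (simp add: locally_integrable_def)
  from intb_test_deriv[OF this D Om, of i] show ?thesis using i by simp
  qed
  have eqs: "(LINT x|lebesgue_on Om. u x * (grad et x *. v)) = - (LINT x|lebesgue_on Om. (g x *. v) * et x)"
  "(LINT x|lebesgue_on Om. ph x * (grad et x *. v)) = - (LINT x|lebesgue_on Om. (grad ph x *. v) * et x)"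
  using wg wphi et by (simp_all add: has_weak_gradient_def test_frechet_grad[OF et, symmetric])
  show "(LINT x|lebesgue_on Om. (u x - ph x) * frechet_derivative et (at x) v) =
  - (LINT x|lebesgue_on Om. ((g x - grad ph x) *. v) * et x)"
  using eqs ii[OF l(1)] ii[OF l(3)] intb_test_deriv[OF l(2) et Om, of v]
  intb_test_deriv[OF l(4) et Om, of v]
  by (simp add: test_frechet_grad[OF et] left_diff_distrib inner_diff_left)
  qed
  then have ae2: "AL x. x : Om --> weak_grad Om (%x. u x - ph x) x = g x - grad ph x"
  by (rule weak_grad_unique[OF _ Om])
  have i1: "lint (%x. <|?u x - ph x|> powr p)" and i2: "lint (%x. norm (?g x - grad ph x) powr p)"
  proof -
  have iu: "lint (pdens p ?u ?g)"
  proof -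
  have "lint (%x. indicator Om x *R (<|u x|> powr p))" "lint (%x. indicator Om x *R (norm (g x) powr p))"
  using uL gL by (auto simp: Lp_space_def intb_on_iff[OF Omm])
  then have a1: "lint (%x. indicator Om x *R (<|u x|> powr p) + indicator Om x *R (norm (g x) powr p))"
  by (rule intb_add)
  have a2: "AL x. indicator Om x *R (<|u x|> powr p) + indicator Om x *R (norm (g x) powr p) = pdens p ?u ?g x"
  using ae by eventually_elim (use p0 in "auto simp: pdens_def")
  show ?thesis by (rule integrable_cong_AE_imp[OF a1 pdens_measurable[OF um gm'] a2])
  qed
  have le: "pdens p (%x. ?u x - ph x) (%x. ?g x - grad ph x) x <= 2 powr p * (pdens p ?u ?g x + pdens p ph (grad ph) x)" for x
  using powr_norm_add_le[of p "?u x" "- ph x"] powr_norm_add_le[of p "?g x" "- grad ph x"] p0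
  by (simp add: pdens_def distrib_left)
  have bd: "lint (%x. 2 powr p * (pdens p ?u ?g x + pdens p ph (grad ph) x))"
  using iu c1c_pdens_integrable[OF c p0] by auto
  have "lint (pdens p (%x. ?u x - ph x) (%x. ?g x - grad ph x))"
  proof (rule intb_bound[OF bd])
  show "AL x. norm (pdens p (%x. ?u x - ph x) (%x. ?g x - grad ph x) x)
  <= norm (2 powr p * (pdens p ?u ?g x + pdens p ph (grad ph) x))"
  unfolding real_norm_def abs_of_nonneg[OF pdens_nonneg] by (intro AE_I2 order_trans[OF le abs_ge_self])
  qed measurable
  then show "lint (%x. <|?u x - ph x|> powr p)" "lint (%x. norm (?g x - grad ph x) powr p)"
  by (rule intb_bound, measurable, simp add: pdens_def)+
  qed
  have e1: "(LINT x|lebesgue_on Om. <|u x - ph x|> powr p) = (LI x. <|?u x - ph x|> powr p)"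
  unfolding LINT_lebesgue_on[OF Omm]
  by (intro lint_cong) (use K p0 in "auto simp: indicator_def")
  have e2: "(LINT x|lebesgue_on Om. norm (weak_grad Om (%x. u x - ph x) x) powr p) = (LI x. norm (?g x - grad ph x) powr p)"
  unfolding LINT_lebesgue_on[OF Omm]
  proof (rule LINT_cong_AE)
  show "AL x. norm (?g x - grad ph x) powr p = indicator Om x *R (norm (weak_grad Om (%x. u x - ph x) x) powr p)"
  using ae ae2 by eventually_elim (use K p0 in "auto simp: indicator_def")
  qed measurable
  have "(NI x. ennreal (pdens p (%x. ph x - ?u x) (%x. grad ph x - ?g x) x)) =
  (NI x. ennreal (<|?u x - ph x|> powr p + norm (?g x - grad ph x) powr p))"
  unfolding pdens_diff_commute[of p ph ?u "grad ph" ?g] by (simp only: pdens_def)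
  also have "... = ennreal (LI x. <|?u x - ph x|> powr p + norm (?g x - grad ph x) powr p)"
  by (rule nn_eq_lint) (use i1 i2 in auto)
  also have "(LI x. <|?u x - ph x|> powr p + norm (?g x - grad ph x) powr p) = W1p_norm Om p (%x. u x - ph x) powr p"
  using i1 i2 by (simp add: W1p_norm_powr[OF p0] e1 e2)
  finally have eq: "(NI x. ennreal (pdens p (%x. ph x - ?u x) (%x. grad ph x - ?g x) x)) =
  ennreal (W1p_norm Om p (%x. u x - ph x) powr p)" .
  have "W1p_norm Om p (%x. u x - ph x) powr p < (e powr (1/p)) powr p"
  using ph(2) p0 by (intro powr_less_mono2) (auto simp: W1p_norm_def)
  also have "... = e" using e p0 by (simp add: powr_powr)
  finally show ?thesis using ph(1) by (intro bexI[OF _ ph(1)]) (simp add: eq ennreal_less_iff)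
 qed
 show ?thesis unfolding sob_def
 proof (intro conjI um gm' allI impI)
  fix e :: real assume "e > 0"
  from approx[OF this] show "EX ph G. c1c Om ph G &
  (NI x. ennreal (pdens p (%x. ph x - ?u x) (%x. G x - ?g x) x)) < ennreal e"
  by (elim bexE) (intro exI conjI, rule test_c1c)
 qed
qed

lemma sob_W01p:
 fixes u :: "'a::euclidean_space => real"
 assumes s: "sob Om p u g" and Om: "open Om" "bounded Om" and p: "1 < p"
 shows "u : W01p Om p" "AL x. x : Om --> weak_grad Om u x = g x"
proof -
 have Omm: "Om : sets lebesgue" using Om by simp
 have p0: "0 < p" and p1: "1 <= p" using p by auto
 note [measurable] = sob_meas[OF s]
 have wg: "has_weak_gradient Om u g" by (rule sob_has_weak_gradient[OF s p1 Om])
 then show ae: "AL x. x : Om --> weak_grad Om u x = g x" by (rule weak_grad_unique[OF _ Om(1)])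
 have Lp: "f : Lp_space Om p" if "f : lmeas" "lint (%x. norm (f x) powr p)"
  for f :: "'a => 'b::euclidean_space"
  using that integrable_mult_indicator[OF Omm that(2)]
  by (auto simp: Lp_space_def intb_on_iff[OF Omm] intro: measurable_restrict_space1)
 have W1: "u : W1p Om p" unfolding W1p_def
  using wg Lp[of u] Lp[of g] sob_intb[OF s p0] sob_meas[OF s] by auto
 have "EX ph:test_functions Om. W1p_norm Om p (%x. u x - ph x) < e" if e: "e > 0" for e
 proof -
  have "e powr p > 0" using e by simp
  then obtain et where et: "et : test_functions Om"
  "(NI x. ennreal (pdens p (%x. u x - et x) (%x. g x - grad et x) x)) < ennreal (e powr p)"
  by (rule sob_test_dense[OF s p0 Om(1)]) (assumption | rule that)+
  have s2: "sob Om p (%x. u x - et x) (%x. g x - grad et x)"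
  by (rule sob_diff[OF s c1c_sob[OF test_c1c[OF et(1)]] p0])
  note [measurable] = sob_meas[OF s2]
  have ae2: "AL x. x : Om --> weak_grad Om (%x. u x - et x) x = g x - grad et x"
  by (rule weak_grad_unique[OF sob_has_weak_gradient[OF s2 p1 Om] Om(1)])
  note i = sob_intb[OF s2 p0]
  have e1: "(LINT x|lebesgue_on Om. <|u x - et x|> powr p) <= (LI x. <|u x - et x|> powr p)"
  unfolding LINT_lebesgue_on[OF Omm] using i(1) Omm
  by (intro integral_mono integrable_mult_indicator) (auto simp: indicator_def)
  have e2: "(LINT x|lebesgue_on Om. norm (weak_grad Om (%x. u x - et x) x) powr p) <= (LI x. norm (g x - grad et x) powr p)"
  proof -
  have "AL x. indicator Om x *R (norm (weak_grad Om (%x. u x - et x) x) powr p)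
  = indicator Om x *R (norm (g x - grad et x) powr p)"
  using ae2 by eventually_elim (auto simp: indicator_def)
  moreover have "(%x. indicator Om x *R (norm (g x - grad et x) powr p)) : lmeas"
  using Omm by measurable
  moreover have "(%x. indicator Om x *R (norm (weak_grad Om (%x. u x - et x) x) powr p)) : lmeas"
  by (rule meas_AE[OF calculation(2)]) (use calculation(1) in eventually_elim, rule sym)
  ultimately have "(LINT x|lebesgue_on Om. norm (weak_grad Om (%x. u x - et x) x) powr p)
  = (LI x. indicator Om x *R (norm (g x - grad et x) powr p))"
  unfolding LINT_lebesgue_on[OF Omm] by (intro integral_cong_AE)
  also have "... <= (LI x. norm (g x - grad et x) powr p)"
  using i(2) Omm by (intro integral_mono integrable_mult_indicator) (auto simp: indicator_def)
  finally show ?thesis .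
  qed
  have "W1p_norm Om p (%x. u x - et x) powr p <= (LI x. pdens p (%x. u x - et x) (%x. g x - grad et x) x)"
  using e1 e2 i by (simp add: W1p_norm_powr[OF p0] pdens_def)
  also have "... < e powr p"
  proof -
  have "(NI x. ennreal (pdens p (%x. u x - et x) (%x. g x - grad et x) x)) =
  ennreal (LI x. pdens p (%x. u x - et x) (%x. g x - grad et x) x)"
  by (rule nn_eq_lint[OF sob_pdens_intb[OF s2 p0]]) simp
  then show ?thesis using et(2) by (simp add: ennreal_less_iff)
  qed
  finally have lt: "W1p_norm Om p (%x. u x - et x) powr p < e powr p" .
  have "W1p_norm Om p (%x. u x - et x) < e"
  proof (rule ccontr)
  assume "\<not> W1p_norm Om p (%x. u x - et x) < e"
  then have "e powr p <= W1p_norm Om p (%x. u x - et x) powr p"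
  using p0 e by (intro powr_mono2) auto
  then show False using lt by simp
  qed
  then show ?thesis using et(1) by blast
 qed
 then show "u : W01p Om p" using W1 by (auto simp: W01p_def)
qed

subsection \<open>Young's inequality and Picone's expression\<close>

text \<open>The expression is \<open>t powr r\<close> minus its tangent line at 1. Convexity gives
  the sign, strict convexity the case of equality.\<close>

lemma powr_tangent:
 fixes t r :: real
 assumes t: "0 <= t" and r: "1 < r"
 shows "0 <= t powr r - r * t + (r - 1)" "t powr r - r * t + (r - 1) = 0 ==> t = 1"
proof -
 define g where "g = (%t. t powr r - r * t + (r - 1))"
 have der: "(g has_real_derivative (r * (x powr (r - 1) - 1))) (at x)" if "x > 0" for x
  unfolding g_def using that by (auto intro!: deriv_eqs simp: algebra_simps)
 have g1: "g 1 = 0" by (simp add: g_def)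
 have pos: "g t > 0" if "t ~= 1" "t > 0" for t
 proof (cases "t < 1")
  case True
  have "EX y. (g has_real_derivative y) (at x) & y < 0" if "t <= x" "x < 1" for x
  proof -
  have "x powr (r - 1) < 1 powr (r - 1)" using that \<open>t > 0\<close> r by (intro powr_less_mono2) auto
  then have "r * (x powr (r - 1) - 1) < 0" using r by (intro mult_pos_neg) auto
  then show ?thesis using der[of x] that \<open>t > 0\<close> by auto
  qed
  moreover have "continuous_on {t..1} g"
  using der \<open>t > 0\<close> by (intro con_at ballI DERIV_isCont[OF der]) auto
  ultimately have "g 1 < g t" using DERIV_neg_imp_decreasing_open[of t 1 g] True by auto
  then show ?thesis using g1 by simp
 next
  case False
  then have "t > 1" using that by simp
  have "EX y. (g has_real_derivative y) (at x) & y > 0" if "1 < x" "x <= t" for x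
  proof -
  have "1 powr (r - 1) < x powr (r - 1)" using that r by (intro powr_less_mono2) auto
  then have "r * (x powr (r - 1) - 1) > 0" using r by (intro mult_pos_pos) auto
  then show ?thesis using der[of x] that by auto
  qed
  moreover have "continuous_on {1..t} g"
  by (intro con_at ballI DERIV_isCont[OF der]) auto
  ultimately have "g 1 < g t" using DERIV_pos_imp_increasing_open[of 1 t g] \<open>t > 1\<close> by auto
  then show ?thesis using g1 by simp
 qed
 have g0: "g 0 > 0" using r by (simp add: g_def)
 have "0 <= g t" using pos[of t] g1 g0 t by (cases "t = 0"; cases "t = 1") auto
 then show "0 <= t powr r - r * t + (r - 1)" by (simp add: g_def)
 show "t powr r - r * t + (r - 1) = 0 ==> t = 1"
  using pos[of t] g0 t by (cases "t = 0") (auto simp: g_def)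
qed

text \<open>By homogeneity only the ratio t = x / y matters, for which this is the tangent
  inequality at 1.\<close>

lemma young_powr:
 fixes x y r :: real
 assumes "0 <= x" "0 <= y" and r: "1 < r"
 shows "0 <= x powr r - r * (y powr (r - 1) * x) + (r - 1) * y powr r"
  "x powr r - r * (y powr (r - 1) * x) + (r - 1) * y powr r = 0 ==> x = y"
proof -
 have *: "x powr r - r * (y powr (r - 1) * x) + (r - 1) * y powr r =
  y powr r * ((x / y) powr r - r * (x / y) + (r - 1))" if "y > 0"
 proof -
  have "y powr r * (x / y) powr r = x powr r" using that assms(1) by (simp add: powr_divide)
  moreover have "y powr r * (x / y) = y powr (r - 1) * x" using that by (simp add: powr_diff)
  moreover have "y powr r * ((x / y) powr r - r * (x / y) + (r - 1)) =
  y powr r * (x / y) powr r - r * (y powr r * (x / y)) + (r - 1) * y powr r"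
  by (simp only: ring_distribs mult_ac)
  ultimately show ?thesis by (simp only:)
 qed
 show "0 <= x powr r - r * (y powr (r - 1) * x) + (r - 1) * y powr r"
 proof (cases "y = 0")
  case False
  then show ?thesis using * assms powr_tangent(1)[of "x / y" r] by simp
 qed (use r in simp)
 show "x = y" if "x powr r - r * (y powr (r - 1) * x) + (r - 1) * y powr r = 0"
 proof (cases "y = 0")
  case True
  then show ?thesis using that r assms by simp
 next
  case False
  then have "(x / y) powr r - r * (x / y) + (r - 1) = 0" using * assms that by simp
  then have "x / y = 1" using powr_tangent(2)[of "x / y" r] assms r False by simp
  then show ?thesis using False by simp
 qed
qed

text \<open>The tangent inequality for the convex inverse power \<open>1 / th\<close>, evaluated at
  \<open>s powr th\<close>.\<close>

lemma powr_concave_tangent: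
 fixes s th :: real
 assumes "0 <= s" "0 < th" "th <= 1"
 shows "s powr th <= (1 - th) + th * s"
proof (cases "th = 1")
 case False
 have "0 <= (s powr th) powr (1 / th) - (1 / th) * s powr th + (1 / th - 1)"
  using assms False by (intro powr_tangent(1)) auto
 also have "(s powr th) powr (1 / th) = s" using assms by (simp add: powr_powr)
 finally have "th * 0 <= th * (s - (1 / th) * s powr th + (1 / th - 1))"
  using assms by (intro mult_lm) auto
 also have "... = th * s - s powr th + (1 - th)" using assms by (simp add: algebra_simps)
 finally show ?thesis by simp
qed (use assms in simp)

definition fl :: "real => 'a::euclidean_space => 'a" where
 "fl r xi = norm xi powr (r - 2) *R xi"

lemma fl_zero [simp]: "fl r 0 = 0" by (simp add: fl_def)

lemma powr_mult_self: "0 <= x ==> x powr s * x = x powr (s + 1 :: real)"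
 by (cases "x = 0") (auto simp: powr_add)

lemma norm_fl: "norm (fl r xi) = norm xi powr (r - 1)"
 using powr_mult_self[of "norm xi" "r - 2"] by (simp add: fl_def)

lemma fl_inner_self: "fl r xi *. xi = norm xi powr r"
proof -
 have "fl r xi *. xi = norm xi powr (r - 2) * norm xi * norm xi"
  by (simp add: fl_def dot_square_norm power2_eq_square)
 then show ?thesis by (simp add: powr_mult_self)
qed

lemma fl_inner_le: "<|fl r xi *. et|> <= norm xi powr (r - 1) * norm et"
 using Cauchy_Schwarz_ineq2[of "fl r xi" et] by (simp add: norm_fl)

lemma fl_scaleR: "0 <= c ==> fl r (c *R xi) = c powr (r - 1) *R fl r xi"
proof -
 assume c: "0 <= c"
 have "fl r (c *R xi) = (c powr (r - 2) * c) *R (norm xi powr (r - 2) *R xi)"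
  using c by (simp add: fl_def powr_mult mult_ac)
 then show ?thesis using c by (simp add: powr_mult_self fl_def)
qed

lemma fl_measurable [measurable]:
 fixes g :: "'b => 'a::euclidean_space"
 assumes [measurable]: "g : borel_measurable M" shows "(%x. fl r (g x)) : borel_measurable M"
 unfolding fl_def by measurable

text \<open>Picone's remainder: for a = (ph / v) grad v and b = grad ph it equals |grad ph|^r minus
  |grad v|^(r-2) grad v . grad(ph^r v^(1-r)).\<close>

definition picD :: "real => 'a::euclidean_space => 'a => real" where
 "picD r a b = norm b powr r - r * (fl r a *. b) + (r - 1) * norm a powr r"

lemma picD_nonneg:
 assumes "1 < r" shows "0 <= picD r a b"
proof -
 have "r * (fl r a *. b) <= r * (norm a powr (r - 1) * norm b)"
  using assms fl_inner_le[of r a b] by (intro mult_lm) auto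
 then show ?thesis unfolding picD_def
  using young_powr(1)[OF norm_ge_zero norm_ge_zero assms, of b a] by linarith
qed

lemma picD_eq_zero:
 assumes r: "1 < r" and 0: "picD r a b = 0" shows "a = b"
proof -
 have le: "fl r a *. b <= norm a powr (r - 1) * norm b" using fl_inner_le[of r a b] by simp
 then have "r * (fl r a *. b) <= r * (norm a powr (r - 1) * norm b)" using r by (intro mult_lm) auto
 moreover note young_powr(1)[OF norm_ge_zero norm_ge_zero r, of b a]
 ultimately have e: "norm b powr r - r * (norm a powr (r - 1) * norm b) + (r - 1) * norm a powr r = 0"
  "r * (fl r a *. b) = r * (norm a powr (r - 1) * norm b)"
  using 0 unfolding picD_def by linarith+
 have n: "norm b = norm a" using young_powr(2)[OF _ _ r e(1)] by simp
 show ?thesis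
 proof (cases "a = 0")
  case False
  have "norm a powr (r - 2) * (a *. b) = norm a powr (r - 2) * (norm a * norm a)"
  using e(2) r n powr_mult_self[of "norm a" "r - 2"] by (simp add: fl_def mult.assoc[symmetric])
  then have "a *. b = norm a * norm b" using False n by simp
  then have "norm a *R b = norm b *R a" using norm_cauchy_schwarz_eq by metis
  then show ?thesis using n False by simp
 qed (use n in simp)
qed

text \<open>Symmetrising Picone's expression, \<open>picD r a b + picD r b a\<close>, gives r times
  the monotonicity product, so the sign and the case of equality are inherited.\<close>

lemma fl_monotone:
 fixes a b :: "'a::euclidean_space"
 assumes r: "1 < r" shows "0 <= (fl r a - fl r b) *. (a - b)" "(fl r a - fl r b) *. (a - b) = 0 ==> a = b"
proof -
 let ?A = "norm a" and ?B = "norm b"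
 have eq: "r * ((fl r a - fl r b) *. (a - b)) = picD r a b + picD r b a"
  by (simp add: picD_def inner_diff fl_inner_self algebra_simps)
 then have "0 <= r * ((fl r a - fl r b) *. (a - b))" using picD_nonneg[OF r, of a b] picD_nonneg[OF r, of b a] by simp
 then show "0 <= (fl r a - fl r b) *. (a - b)" using r by (simp add: zero_le_mult_iff)
 show "a = b" if "(fl r a - fl r b) *. (a - b) = 0"
  using eq that picD_nonneg[OF r, of a b] picD_nonneg[OF r, of b a] picD_eq_zero[OF r, of a b] by simp
qed

text \<open>For a = (ph / u) grad u and b = grad ph, this times u^(p-q) ph^(q-p) is the p-flux of ph
  tested with ph^(q-p+1) u^(p-q), minus the p-flux of u tested with ph^q u^(1-q).\<close>

definition core :: "real => real => 'a::euclidean_space => 'a => real" where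
 "core p q a b = (q - p + 1) * norm b powr p + (p - q) * (fl p b *. a) - q * (fl p a *. b) + (q - 1) * norm a powr p"

lemma core_eq_linear:
 "core p q a b = (q - p + 1) * norm b powr p + (q - 1) * norm a powr p
  + (a *. b) * ((p - q) * norm b powr (p - 2) - q * norm a powr (p - 2))"
 by (simp add: core_def fl_def inner_commute algebra_simps)

text \<open>With s = A / B the claim is q s^(p-1) <= (q-p+1) + (p-q) s + (q-1) s^p. Concavity bounds
  the first two terms on the right from below by s^(p-q), and what remains is s^(p-q) times Young's
  inequality with exponent q.\<close>

lemma core_aligned_nonneg:
 fixes A B :: real
 assumes q: "1 < q" "q < p" "p <= q + 1" and AB: "0 < A" "0 < B"
 shows "0 <= (q - p + 1) * B powr p + (q - 1) * A powr p
  + (A * B) * ((p - q) * B powr (p - 2) - q * A powr (p - 2))"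
proof -
 define s where "s = A / B"
 have s: "s > 0" using AB by (simp add: s_def)
 have A: "A = s * B" using AB by (simp add: s_def)
 have e: "A powr p = s powr p * B powr p" "B * B powr (p - 2) * B = B powr p"
  "A * A powr (p - 2) = s powr (p - 1) * B powr (p - 1)" "B powr (p - 1) * B = B powr p"
  using s AB powr_mult_self[of B "p - 2"] powr_mult_self[of B "p - 1"] powr_mult_self[of A "p - 2"]
  by (simp_all add: A powr_mult mult_ac)
 have "(q - p + 1) * B powr p + (q - 1) * A powr p
  + (A * B) * ((p - q) * B powr (p - 2) - q * A powr (p - 2)) =
  (q - p + 1) * B powr p + (q - 1) * A powr p + (p - q) * s * (B * B powr (p - 2) * B) - q * (A * A powr (p - 2)) * B"
  by (simp add: A algebra_simps)
 also have "... = B powr p * ((q - p + 1) + (q - 1) * s powr p + (p - q) * s) - q * (s powr (p - 1) * (B powr (p - 1) * B))"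
  unfolding e(1,2,3) by (simp add: algebra_simps)
 also have "... = B powr p * ((q - p + 1) + (p - q) * s - q * s powr (p - 1) + (q - 1) * s powr p)"
  unfolding e(4) by (simp add: algebra_simps)
 also have "... >= 0"
 proof (intro mult_nonneg_nonneg)
  have "s powr (p - q) <= (q - p + 1) + (p - q) * s"
  using powr_concave_tangent[of s "p - q"] s q by (simp add: algebra_simps)
  moreover have "0 <= s powr (p - q) * (1 powr q - q * (s powr (q - 1) * 1) + (q - 1) * s powr q)"
  using young_powr(1)[of 1 s q] s q by (intro mult_nonneg_nonneg) auto
  moreover have "s powr (p - q) * s powr (q - 1) = s powr (p - 1)" "s powr (p - q) * s powr q = s powr p"
  by (simp_all add: powr_add[symmetric])
  ultimately show "0 <= (q - p + 1) + (p - q) * s - q * s powr (p - 1) + (q - 1) * s powr p"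
  by (simp add: algebra_simps)
 qed simp
 finally show ?thesis .
qed

lemma linear_between_nonneg:
 fixes x y :: real
 assumes "0 <= e + l * x" "0 <= e + l * y" "x <= c" "c <= y"
 shows "0 <= e + l * c"
proof (cases "0 <= l")
 case True
 then have "l * x <= l * c" using assms by (intro mult_lm) auto
 then show ?thesis using assms(1) by linarith
next
 case False
 then have "l * y <= l * c" using assms by (intro mult_left_mono_neg) auto
 then show ?thesis using assms(2) by linarith
qed

text \<open>For fixed norms \<open>core\<close> is affine in the inner product. At orthogonal
  vectors all terms are nonnegative because p <= q + 1, and parallel vectors are covered by
  \<open>core_aligned_nonneg\<close>.\<close>

lemma core_nonneg_acute:
 assumes q: "1 < q" "q < p" "p <= q + 1" and ab: "0 <= a *. b"
 shows "0 <= core p q a b"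
proof (cases "a = 0 \<or> b = 0")
 case True
 then show ?thesis using q by (auto simp: core_def)
next
 case False
 have "0 <= ((q - p + 1) * norm b powr p + (q - 1) * norm a powr p)
  + ((p - q) * norm b powr (p - 2) - q * norm a powr (p - 2)) * (a *. b)"
 proof (rule linear_between_nonneg[where x = 0 and y = "norm a * norm b"])
  show "a *. b <= norm a * norm b" by (rule norm_cauchy_schwarz)
  show "0 <= (q - p + 1) * norm b powr p + (q - 1) * norm a powr p
  + ((p - q) * norm b powr (p - 2) - q * norm a powr (p - 2)) * (norm a * norm b)"
  using core_aligned_nonneg[OF q, of "norm a" "norm b"] False by (simp add: algebra_simps)
 qed (use q ab in auto)
 then show ?thesis by (simp add: core_eq_linear algebra_simps)
qed

lemma Iset_le:
 assumes "p : Iset q" shows "p <= q + 1"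
proof -
 have "ALL s>=0. 0 <= (q - 1) * s powr p + q * s powr (p - 1) - (p - q) * s + (q - p + 1)"
  using assms by (simp add: Iset_def)
 from this[rule_format, of 0] show ?thesis by simp
qed

text \<open>Again affine in the inner product; at the end point of opposite vectors the inequality
  is the defining one of \<open>Iset\<close> at s = |a| / |b|.\<close>

lemma core_nonneg_Iset:
 assumes q: "1 < q" "q < p" and I: "p : Iset q"
 shows "0 <= core p q a b"
proof (cases "a = 0 \<or> b = 0")
 case True
 then show ?thesis using q Iset_le[OF I] by (auto simp: core_def)
next
 case False
 note q' = q Iset_le[OF I]
 let ?A = "norm a" and ?B = "norm b"
 have AB: "?A > 0" "?B > 0" using False by auto
 have "0 <= ((q - p + 1) * ?B powr p + (q - 1) * ?A powr p)
  + ((p - q) * ?B powr (p - 2) - q * ?A powr (p - 2)) * (a *. b)"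
 proof (rule linear_between_nonneg[where x = "- (?A * ?B)" and y = "?A * ?B"])
  show "a *. b <= ?A * ?B" by (rule norm_cauchy_schwarz)
  show "- (?A * ?B) <= a *. b" using Cauchy_Schwarz_ineq2[of a b] by linarith
  show "0 <= (q - p + 1) * ?B powr p + (q - 1) * ?A powr p
  + ((p - q) * ?B powr (p - 2) - q * ?A powr (p - 2)) * (?A * ?B)"
  using core_aligned_nonneg[OF q' AB] by (simp add: algebra_simps)
  define s where "s = ?A / ?B"
  have s: "s > 0" using AB by (simp add: s_def)
  have A: "?A = s * ?B" using AB by (simp add: s_def)
  have e: "?A powr p = s powr p * ?B powr p" "?B * ?B powr (p - 2) * ?B = ?B powr p"
  "?A * ?A powr (p - 2) = s powr (p - 1) * ?B powr (p - 1)" "?B powr (p - 1) * ?B = ?B powr p"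
  using s AB powr_mult_self[of ?B "p - 2"] powr_mult_self[of ?B "p - 1"] powr_mult_self[of ?A "p - 2"]
  by (simp_all add: A powr_mult mult_ac)
  have "0 <= (q - 1) * s powr p + q * s powr (p - 1) - (p - q) * s + (q - p + 1)"
  using I s by (auto simp: Iset_def)
  then have "0 <= ?B powr p * ((q - 1) * s powr p + q * s powr (p - 1) - (p - q) * s + (q - p + 1))"
  by (intro mult_nonneg_nonneg) auto
  also have "... = (q - p + 1) * ?B powr p + (q - 1) * (s powr p * ?B powr p) - (p - q) * s * ?B powr p + q * (s powr (p - 1) * ?B powr p)"
  by (simp add: algebra_simps)
  also have "... = (q - p + 1) * ?B powr p + (q - 1) * ?A powr p - (p - q) * s * (?B * ?B powr (p - 2) * ?B) + q * (?A * ?A powr (p - 2)) * ?B"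
  unfolding e(1,2,3) using e(4) by (simp add: mult.assoc)
  also have "... = (q - p + 1) * ?B powr p + (q - 1) * ?A powr p
  + ((p - q) * ?B powr (p - 2) - q * ?A powr (p - 2)) * (- (?A * ?B))"
  by (simp add: A algebra_simps)
  finally show "0 <= (q - p + 1) * ?B powr p + (q - 1) * ?A powr p
  + ((p - q) * ?B powr (p - 2) - q * ?A powr (p - 2)) * (- (?A * ?B))" .
 qed
 then show ?thesis by (simp add: core_eq_linear algebra_simps)
qed

subsection \<open>Weak supersolutions\<close>

definition flux :: "real => real => real => 'a::euclidean_space => 'a" where
 "flux al p q xi = al *R fl p xi + fl q xi"

lemma flux_measurable [measurable]:
 fixes g :: "'b => 'a::euclidean_space"
 assumes [measurable]: "g : borel_measurable M" shows "(%x. flux al p q (g x)) : borel_measurable M"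
 unfolding flux_def by measurable

lemma flux_zero [simp]: "flux al p q 0 = 0" by (simp add: flux_def)

lemma flux_monotone:
 fixes a b :: "'a::euclidean_space"
 assumes "0 <= al" "1 < p" "1 < q"
 shows "0 <= (flux al p q a - flux al p q b) *. (a - b)" "(flux al p q a - flux al p q b) *. (a - b) = 0 ==> a = b"
proof -
 have eq: "(flux al p q a - flux al p q b) *. (a - b) = al * ((fl p a - fl p b) *. (a - b)) + (fl q a - fl q b) *. (a - b)"
  by (simp add: flux_def inner_diff_left inner_add_left algebra_simps)
 have 1: "0 <= al * ((fl p a - fl p b) *. (a - b))" using assms fl_monotone(1)[OF assms(2), of a b] by simp
 have 2: "0 <= (fl q a - fl q b) *. (a - b)" using fl_monotone(1)[OF assms(3)] .
 show "0 <= (flux al p q a - flux al p q b) *. (a - b)" using eq 1 2 by simp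
 show "(flux al p q a - flux al p q b) *. (a - b) = 0 ==> a = b"
  using eq 1 2 fl_monotone(2)[OF assms(3), of a b] by simp
qed

lemma powr_le_one_plus:
 fixes t r p :: real assumes "0 <= t" "0 <= r" "r <= p" shows "t powr r <= 1 + t powr p"
proof (cases "t <= 1")
 case True
 then have "t powr r <= 1" using assms powr_le1[of r t] by simp
 then show ?thesis by (simp add: add_increasing2)
next
 case False
 then have "t powr r <= t powr p" using assms by (intro powr_mono) auto
 then show ?thesis by simp
qed

lemma powr_mult_le_add:
 fixes a b :: real assumes "0 <= a" "0 <= b" "1 < r" shows "a powr (r - 1) * b <= a powr r + b powr r"
proof (cases "a <= b")
 case True
 then have "a powr (r - 1) * b <= b powr (r - 1) * b" using assms by (intro mult_rm powr_mono2) auto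
 then show ?thesis using assms powr_mult_self[of b "r - 1"] by (simp add: add_increasing)
next
 case False
 then have "a powr (r - 1) * b <= a powr (r - 1) * a" by (intro mult_lm) auto
 then show ?thesis using assms powr_mult_self[of a "r - 1"] by (simp add: add_increasing2)
qed

lemma fl_inner_bound:
 assumes "1 < r" "r <= p" shows "<|fl r xi *. et|> <= 2 + norm xi powr p + norm et powr p"
proof -
 have "<|fl r xi *. et|> <= norm xi powr r + norm et powr r"
  using fl_inner_le[of r xi et] powr_mult_le_add[of "norm xi" "norm et" r] assms by simp
 moreover have "norm xi powr r <= 1 + norm xi powr p" "norm et powr r <= 1 + norm et powr p"
  using assms by (auto intro!: powr_le_one_plus)
 ultimately show ?thesis by simp
qed

lemma flux_inner_bound:
 assumes "1 < q" "q <= p" "0 <= al"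
 shows "<|flux al p q xi *. et|> <= (al + 1) * (2 + norm xi powr p + norm et powr p)"
proof -
 let ?M = "2 + norm xi powr p + norm et powr p"
 have "<|flux al p q xi *. et|> <= al * <|fl p xi *. et|> + <|fl q xi *. et|>"
  using assms abs_triangle_ineq[of "al * (fl p xi *. et)" "fl q xi *. et"] by (simp add: flux_def inner_add_left abs_mult)
 also have "... <= al * ?M + ?M"
  using assms fl_inner_bound[of p p xi et] fl_inner_bound[of q p xi et] by (intro add_mono mult_lm) auto
 finally show ?thesis by (simp add: algebra_simps)
qed

text \<open>The data of a function \<open>v\<close> enter only through a representative \<open>g\<close> of its gradient, which may be given
 on a neighbourhood of \<open>Om\<close> only; \<open>al = 0\<close> is the \<open>q\<close>-Laplacian alone.\<close>

definition supersol ::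
  "'a::euclidean_space set => real => real => real => ('a => 'a) => ('a => real) => bool" where
 "supersol Om al p q g F \<longleftrightarrow> (ALL w h B. sob Om p w h --> (ALL x. 0 <= w x & w x <= B) -->
  0 <= (LI x. flux al p q (g x) *. h x) &
  (NI x. ennreal (F x * w x)) <= ennreal (LI x. flux al p q (g x) *. h x))"

definition grad_int :: "'a::euclidean_space set => real => ('a => 'a) => bool" where
 "grad_int Om p g \<longleftrightarrow> g : lmeas & lint (%x. indicator Om x * norm (g x) powr p)"

lemma sob_grad_int:
 assumes "sob Om' p v g" "0 < p" "Om : sets lebesgue" shows "grad_int Om p g"
 unfolding grad_int_def using sob_meas[OF assms(1)] sob_intb(2)[OF assms(1,2)]
  integrable_mult_indicator[OF assms(3), of "%x. norm (g x) powr p"] by auto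

lemma intb_indicator:
 fixes Om :: "'a::euclidean_space set"
 assumes "open Om" "bounded Om" shows "lint (indicator Om :: 'a => real)"
 using assms lmeasurable_open[of Om] by (auto simp: fmeasurable_def)

lemma flux_dominated:
 fixes g :: "'a::euclidean_space => 'a"
 assumes Om: "open Om" "bounded Om" and pq: "1 < q" "q <= p" "0 <= al" and g: "grad_int Om p g" and s: "sob Om p w h"
 obtains D where "lint D" "AL x. <|flux al p q (g x) *. h x|> <= D x"
  "lint (%x. flux al p q (g x) *. h x)"
proof -
 have p0: "0 < p" using pq by simp
 define D where "D = (%x. (al + 1) * (2 * indicator Om x + indicator Om x * norm (g x) powr p + norm (h x) powr p))"
 have i: "lint D" unfolding D_def
  using intb_indicator[OF Om] g sob_intb(2)[OF s p0] by (auto simp: grad_int_def)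
 have b: "AL x. <|flux al p q (g x) *. h x|> <= D x"
  using sob_outside[OF s p0]
 proof eventually_elim
  case (elim x)
  show ?case
  proof (cases "x : Om")
  case True
  then show ?thesis using flux_inner_bound[OF pq, of "g x" "h x"] by (simp add: D_def)
  qed (use elim pq in "simp add: D_def")
 qed
 have [measurable]: "g : lmeas" "h : lmeas"
  using g sob_meas[OF s] by (auto simp: grad_int_def)
 have "lint (%x. flux al p q (g x) *. h x)"
  by (rule intb_bound[OF i]) (measurable, use b in eventually_elim, simp)
 then show ?thesis using that i b by blast
qed

lemma fatou_bound:
 assumes [measurable]: "!!n. f n : borel_measurable M" and lim: "AE x in M. (%n. f n x) ----> f' x"
  and le: "!!n. (\<integral>\<^sup>+x. f n x \<partial>M) <= c n" and c: "c ----> (C::ennreal)"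
 shows "(\<integral>\<^sup>+x. f' x \<partial>M) <= C"
proof -
 have "(\<integral>\<^sup>+x. f' x \<partial>M) = (\<integral>\<^sup>+x. liminf (%n. f n x) \<partial>M)"
  by (rule nn_integral_cong_AE) (use lim in eventually_elim, simp add: lim_imp_Liminf)
 also have "... <= liminf (%n. \<integral>\<^sup>+x. f n x \<partial>M)" by (rule nn_integral_liminf) measurable
 also have "... <= liminf c" by (rule Liminf_mono) (simp add: le)
 also have "... = C" using c by (simp add: lim_imp_Liminf)
 finally show ?thesis .
qed

text \<open>An approximate Heaviside function; the square of the positive part makes it C1 across
  0.\<close>

definition cut :: "real => real => real" where
 "cut e t = (max t 0)^2 / ((max t 0)^2 + e\<^sup>2)"

lemma max_square_has_derivative: "((%t::real. (max t 0)\<^sup>2) has_real_derivative 2 * max t 0) (at t)"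
proof (cases t "0::real" rule: linorder_cases)
 case less
 have "((%t::real. 0) has_real_derivative 0) (at t)" by simp
 then have "((%t::real. (max t 0)\<^sup>2) has_real_derivative 0) (at t)"
  by (rule deriv_transform[where d = "- t"]) (use less in "auto simp: dist_real_def")
 then show ?thesis using less by simp
next
 case greater
 have "((%t::real. t\<^sup>2) has_real_derivative 2 * t) (at t)" by (auto intro!: deriv_eqs)
 then have "((%t::real. (max t 0)\<^sup>2) has_real_derivative 2 * t) (at t)"
  by (rule deriv_transform[where d = t])
  (use greater in "auto simp: dist_real_def max_def abs_if split: if_splits")
 then show ?thesis using greater by simp
next
 case equal
 have "((%h. ((max (t + h) 0)^2 - (max t 0)^2) / h) \<longlongrightarrow> 0) (at 0)"
 proof (rule Lim_null_comparison[where g = "%h. <|h|>"])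
  have "norm (((max (t + h) 0)^2 - (max t 0)^2) / h) <= <|h|>" for h
  using equal by (auto simp: max_def power2_eq_square)
  then show "\<forall>\<^sub>F h in at 0. norm (((max (t + h) 0)^2 - (max t 0)^2) / h) <= <|h|>" by simp
  show "((%h::real. <|h|>) \<longlongrightarrow> 0) (at 0)" by (rule tendsto_rabs_zero, rule tendsto_ident_at)
 qed
 then show ?thesis unfolding DERIV_def using equal by simp
qed

definition cut' :: "real => real => real" where
 "cut' e t = 2 * max t 0 * e\<^sup>2 / ((max t 0)^2 + e\<^sup>2)^2"

lemma cut_pos: "e > 0 ==> 0 < (max t 0)^2 + e\<^sup>2" for e t :: real
 by (intro add_nonneg_pos) auto

lemma cut_has_derivative:
 assumes e: "e > 0" shows "(cut e has_real_derivative cut' e t) (at t)"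
proof -
 let ?m = "(max t 0)^2" and ?d = "2 * max t 0"
 have ne: "?m + e\<^sup>2 ~= 0" using cut_pos[OF e, of t] by linarith
 have "((%t. (max t 0)\<^sup>2 + e\<^sup>2) has_real_derivative ?d + 0) (at t)"
  by (intro DERIV_add max_square_has_derivative DERIV_const)
 from DERIV_divide[OF max_square_has_derivative this ne]
 have "(cut e has_real_derivative (?d * (?m + e\<^sup>2) - ?m * (?d + 0)) / ((?m + e\<^sup>2) * (?m + e\<^sup>2))) (at t)"
  by (simp add: cut_def[abs_def])
 moreover have "(?d * (?m + e\<^sup>2) - ?m * (?d + 0)) / ((?m + e\<^sup>2) * (?m + e\<^sup>2)) = cut' e t"
 proof -
  have "?d * (?m + e\<^sup>2) - ?m * (?d + 0) = 2 * max t 0 * e\<^sup>2" by (simp add: algebra_simps)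
  then show ?thesis by (simp only: cut'_def power2_eq_square[of "(max t 0)^2 + e\<^sup>2"])
 qed
 ultimately show ?thesis by simp
qed

lemma cut_continuous:
 assumes "e > 0" shows "contU (cut' e)"
 unfolding cut'_def[abs_def] by (intro con_intros) (use assms in auto)

lemma cut_bounds: "e > 0 ==> 0 <= cut e t" "e > 0 ==> cut e t <= 1"
 using cut_pos[of e t] by (auto simp: cut_def)

lemma cut'_bounds: assumes "e > 0" shows "0 <= cut' e t" "cut' e t <= 1 / e"
proof -
 let ?s = "max t 0"
 show "0 <= cut' e t" by (simp add: cut'_def)
 have pos: "0 < ?s\<^sup>2 + e\<^sup>2" using cut_pos[OF assms] .
 have 1: "2 * ?s * e <= ?s\<^sup>2 + e\<^sup>2" using sum_squares_ge_zero[of "?s - e" 0] by (simp add: power2_eq_square algebra_simps)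
 have "cut' e t = (2 * ?s * e / (?s\<^sup>2 + e\<^sup>2)) * (e / (?s\<^sup>2 + e\<^sup>2))"
  by (simp add: cut'_def power2_eq_square)
 also have "... <= 1 * (1 / e)"
 proof (intro mult_mono)
  show "2 * ?s * e / (?s\<^sup>2 + e\<^sup>2) <= 1" using 1 pos by simp
  show "e / (?s\<^sup>2 + e\<^sup>2) <= 1 / e" using assms pos by (simp add: field_simps power2_eq_square)
 qed (use assms pos in auto)
 finally show "cut' e t <= 1 / e" by simp
qed

lemma cut_tendsto:
 assumes "!!n. e n > 0" "e ----> 0" shows "(%n. cut (e n) t) ----> (if t > 0 then 1 else 0)"
proof (cases "t > 0")
 case True
 have "(%n. t\<^sup>2 / (t\<^sup>2 + (e n)^2)) ----> t\<^sup>2 / (t\<^sup>2 + 0\<^sup>2)"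
  by (intro tendsto_intros assms) (use True in auto)
 then show ?thesis using True by (simp add: cut_def)
qed (simp add: cut_def)

text \<open>The minimum of two supersolutions is a supersolution: test the first inequality with \<open>w th(v\<^sub>2 - v\<^sub>1)\<close> and the
 second with \<open>w (1 - th(v\<^sub>2 - v\<^sub>1))\<close>, where the increasing \<open>th\<close> approximates the Heaviside function;
 the terms with \<open>th'\<close> have a sign by monotonicity.\<close>

lemma supersol_min:
 assumes Om: "open Om" "bounded Om" and pq: "1 < q" "q <= p" "0 <= al"
  and s1: "supersol Om al p q g1 F1" and s2: "supersol Om al p q g2 F2"
  and g: "grad_int Om p g1" "grad_int Om p g2"
  and F: "!!x. 0 <= F1 x" "!!x. 0 <= F2 x" "F1 : lmeas" "F2 : lmeas"
  and z: "sob Om' p (%x. v2 x - v1 x - c) (%x. g2 x - g1 x)"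
 shows "supersol Om al p q (%x. if v1 x < v2 x then g1 x else g2 x) (%x. if v1 x < v2 x then F1 x else F2 x)"
 unfolding supersol_def
proof (intro allI impI)
 fix w h B assume w: "sob Om p w h" and wB: "ALL x. 0 <= w x & w x <= B"
 have p0: "0 < p" and p1: "1 < p" using pq by auto
 note [measurable] = F(3,4) sob_meas[OF w] sob_meas[OF z]
 have [measurable]: "g1 : lmeas" "g2 : lmeas" using g by (auto simp: grad_int_def)
 define e where "e = (%n. 1 / real (Suc n))"
 have e: "e n > 0" for n unfolding e_def by (rule inv_Suc)
 have e0: "e ----> 0" unfolding e_def by (rule inv_Suc)
 \<comment> \<open>The cut-off is applied to the Sobolev function d - c and shifted back. This
   admits differences that equal a nonzero constant outside the domain, as in the comparison with a
   constant.\<close>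
 define d where "d = (%x. v2 x - v1 x)"
 have [measurable]: "d : lmeas"
 proof -
  have "(%x. (v2 x - v1 x - c) + c) : lmeas" by measurable
  then show ?thesis by (simp add: d_def)
 qed
 have cutm [measurable]: "cut (e n) : borel_measurable borel" "cut' (e n) : borel_measurable borel" for n
  by (intro meas_con con_at ballI DERIV_isCont[OF cut_has_derivative[OF e]])
  (rule meas_con[OF cut_continuous[OF e]])
 define T where "T = (%n x. cut (e n) (d x))"
 define T' where "T' = (%n x. cut' (e n) (d x))"
 have Tb: "0 <= T n x" "T n x <= 1" for n x using cut_bounds[OF e] by (auto simp: T_def)
 have Tm[measurable]: "T n : lmeas" "T' n : lmeas" for n
  unfolding T_def T'_def by measurable
 define A1 where "A1 = (%x. flux al p q (g1 x))"
 define A2 where "A2 = (%x. flux al p q (g2 x))"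
 have [measurable]: "A1 : lmeas" "A2 : lmeas"
  unfolding A1_def A2_def by measurable
 define h1 where "h1 = (%n x. T n x *R h x + (w x * T' n x) *R (g2 x - g1 x))"
 have w1: "sob Om p (%x. w x * T n x) (h1 n)" for n
 proof -
  have *: "<|w x|> <= B" for x using wB by simp
  have c1: "<|cut (e n) (t + c)|> <= max 1 (1 / e n)" for t
  using cut_bounds[OF e[of n], of "t + c"] by (simp add: max_def)
  have c2: "<|cut' (e n) (t + c)|> <= max 1 (1 / e n)" for t
  using cut'_bounds[OF e[of n], of "t + c"] by simp
  have der: "((%t. cut (e n) (t + c)) has_real_derivative cut' (e n) (t + c)) (at t)" for t
  using cut_has_derivative[OF e[of n], of "t + c"] by (simp add: DERIV_shift)
  have cont: "contU (%t. cut' (e n) (t + c))"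
  by (rule con_comp[OF cut_continuous[OF e]]) (auto intro: continuous_on_add)
  have "sob Om p (%x. w x * cut (e n) ((v2 x - v1 x - c) + c))
  (%x. cut (e n) ((v2 x - v1 x - c) + c) *R h x + (w x * cut' (e n) ((v2 x - v1 x - c) + c)) *R (g2 x - g1 x))"
  by (rule sob_mult[OF w * z p0 der cont c1 c2])
  then show ?thesis by (simp add: T_def T'_def d_def h1_def)
 qed
 have w2: "sob Om p (%x. w x - w x * T n x) (%x. h x - h1 n x)" for n
  by (rule sob_diff[OF w w1 p0])
 have b1: "ALL x. 0 <= w x * T n x & w x * T n x <= B" for n
  using wB Tb by (auto intro: order_trans[OF mult_left_le])
 have b2: "ALL x. 0 <= w x - w x * T n x & w x - w x * T n x <= B" for n
 proof
  fix x
  have "w x * T n x <= w x" using wB Tb by (auto intro: mult_left_le)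
  moreover have "0 <= w x * T n x" using wB Tb by simp
  ultimately show "0 <= w x - w x * T n x & w x - w x * T n x <= B" using wB[rule_format, of x] by linarith
 qed
 obtain D1 where D1: "lint D1" "AL x. <|flux al p q (g1 x) *. h x|> <= D1 x"
  "lint (%x. flux al p q (g1 x) *. h x)" by (rule flux_dominated[OF Om pq g(1) w]) (assumption | rule that)+
 obtain D2 where D2: "lint D2" "AL x. <|flux al p q (g2 x) *. h x|> <= D2 x"
  "lint (%x. flux al p q (g2 x) *. h x)" by (rule flux_dominated[OF Om pq g(2) w]) (assumption | rule that)+
 have i1: "lint (%x. A1 x *. h1 n x)" for n
  unfolding A1_def using flux_dominated[OF Om pq g(1) w1] by blast
 have i2: "lint (%x. A2 x *. (h x - h1 n x))" for n
  unfolding A2_def using flux_dominated[OF Om pq g(2) w2] by blast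
 define J where "J = (%n x. T n x * (A1 x *. h x) + (1 - T n x) * (A2 x *. h x))"
 define Jl where "Jl = (%x. (if v1 x < v2 x then A1 x else A2 x) *. h x)"
 have Jb: "AL x. <|J n x|> <= D1 x + D2 x" for n
  using D1(2) D2(2)
 proof eventually_elim
  case (elim x)
  have "<|J n x|> <= T n x * <|A1 x *. h x|> + (1 - T n x) * <|A2 x *. h x|>"
  unfolding J_def using Tb[of n x] by (intro order_trans[OF abs_triangle_ineq]) (simp add: abs_mult)
  also have "... <= 1 * <|A1 x *. h x|> + 1 * <|A2 x *. h x|>"
  using Tb[of n x] by (intro add_mono mult_rm) auto
  finally show ?case using elim by (simp add: A1_def A2_def)
 qed
 have Ji: "lint (J n)" for n
  by (rule intb_bound[of _ "%x. D1 x + D2 x"])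
  (use D1 D2 in simp, (simp add: J_def), use Jb[of n] in eventually_elim, simp)
 have Jlim: "(%n. LI x. J n x) ----> (LI x. Jl x)"
 proof (rule int_dom[where w = "%x. D1 x + D2 x"])
  have "Jl = (%x. if 0 < d x then A1 x *. h x else A2 x *. h x)" by (auto simp: Jl_def d_def)
  then show "Jl : lmeas" by simp
  show "J n : lmeas" for n using Ji by auto
  have "(%n. J n x) ----> Jl x" for x
  proof -
  have "(%n. T n x) ----> (if d x > 0 then 1 else 0)" unfolding T_def by (rule cut_tendsto[OF e e0])
  then have "(%n. J n x) ----> (if d x > 0 then 1 else 0) * (A1 x *. h x) + (1 - (if d x > 0 then 1 else 0)) * (A2 x *. h x)"
  unfolding J_def by (intro tendsto_intros)
  then show ?thesis by (simp add: Jl_def d_def split: if_splits)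
  qed
  then show "AL x. (%n. J n x) ----> Jl x" by simp
  show "AL x. norm (J n x) <= D1 x + D2 x" for n using Jb[of n] by simp
 qed (use D1 D2 in simp)
 have step: "0 <= (LI x. J n x) &
  (NI x. ennreal (F1 x * (w x * T n x)) + ennreal (F2 x * (w x - w x * T n x))) <= ennreal (LI x. J n x)" for n
 proof -
  define I1 where "I1 = (LI x. A1 x *. h1 n x)"
  define I2 where "I2 = (LI x. A2 x *. (h x - h1 n x))"
  have 1: "0 <= I1" "(NI x. ennreal (F1 x * (w x * T n x))) <= ennreal I1"
  using s1 w1[of n] b1[of n] unfolding supersol_def I1_def A1_def by blast+
  have 2: "0 <= I2" "(NI x. ennreal (F2 x * (w x - w x * T n x))) <= ennreal I2"
  using s2 w2[of n] b2[of n] unfolding supersol_def I2_def A2_def by blast+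
  have "I1 + I2 = (LI x. A1 x *. h1 n x + A2 x *. (h x - h1 n x))"
  using i1 i2 by (simp add: I1_def I2_def)
  also have "... <= (LI x. J n x)"
  proof (rule integral_mono)
  fix x
  have "A1 x *. h1 n x + A2 x *. (h x - h1 n x) = J n x - (w x * T' n x) * ((A2 x - A1 x) *. (g2 x - g1 x))"
  by (simp add: h1_def J_def inner_add_right inner_diff_right inner_diff_left algebra_simps)
  moreover have "0 <= (w x * T' n x) * ((A2 x - A1 x) *. (g2 x - g1 x))"
  using wB cut'_bounds(1)[OF e] flux_monotone(1)[OF pq(3) p1 pq(1)]
  by (intro mult_nonneg_nonneg) (auto simp: T'_def A1_def A2_def)
  ultimately show "A1 x *. h1 n x + A2 x *. (h x - h1 n x) <= J n x" by linarith
  qed (use i1 i2 Ji in auto)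
  finally have le: "I1 + I2 <= (LI x. J n x)" .
  have "(NI x. ennreal (F1 x * (w x * T n x)) + ennreal (F2 x * (w x - w x * T n x))) <= ennreal I1 + ennreal I2"
  by (subst nn_integral_add) (measurable, use 1 2 in "simp add: add_mono")
  also have "... <= ennreal (LI x. J n x)"
  using 1(1) 2(1) le by (simp add: ennreal_plus[symmetric] ennreal_leI del: ennreal_plus)
  finally show ?thesis using le 1(1) 2(1) by simp
 qed
 have eq: "flux al p q (if v1 x < v2 x then g1 x else g2 x) *. h x = Jl x" for x by (simp add: Jl_def A1_def A2_def)
 have "0 <= (LI x. Jl x)"
  by (rule LIMSEQ_le_const[OF Jlim]) (use step in auto)
 moreover have "(NI x. ennreal ((if v1 x < v2 x then F1 x else F2 x) * w x)) <= ennreal (LI x. Jl x)"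
 proof (rule fatou_bound)
  show "(NI x. ennreal (F1 x * (w x * T n x)) + ennreal (F2 x * (w x - w x * T n x))) <= ennreal (LI x. J n x)" for n
  using step by blast
  show "(%n. ennreal (LI x. J n x)) ----> ennreal (LI x. Jl x)"
  by (rule tendsto_ennrealI[OF Jlim])
  have "(%n. ennreal (F1 x * (w x * T n x)) + ennreal (F2 x * (w x - w x * T n x)))
  ----> ennreal ((if v1 x < v2 x then F1 x else F2 x) * w x)" for x
  proof -
  have "(%n. T n x) ----> (if d x > 0 then 1 else 0)" unfolding T_def by (rule cut_tendsto[OF e e0])
  then have "(%n. ennreal (F1 x * (w x * T n x)) + ennreal (F2 x * (w x - w x * T n x)))
  ----> ennreal (F1 x * (w x * (if d x > 0 then 1 else 0))) + ennreal (F2 x * (w x - w x * (if d x > 0 then 1 else 0)))"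
  by (intro tendsto_add tendsto_ennrealI tendsto_intros)
  then show ?thesis by (simp add: d_def split: if_splits)
  qed
  then show "AL x. (%n. ennreal (F1 x * (w x * T n x)) + ennreal (F2 x * (w x - w x * T n x)))
  ----> ennreal ((if v1 x < v2 x then F1 x else F2 x) * w x)" by simp
 qed measurable
 ultimately show "0 <= (LI x. flux al p q (if v1 x < v2 x then g1 x else g2 x) *. h x) &
  (NI x. ennreal ((if v1 x < v2 x then F1 x else F2 x) * w x))
  <= ennreal (LI x. flux al p q (if v1 x < v2 x then g1 x else g2 x) *. h x)"
  by (simp only: eq)
qed

subsection \<open>The integrated Picone inequality\<close>

lemma isCont_fl: "1 < r ==> isCont (fl r) xi"
proof (cases "xi = 0")
 case False
 have "continuous (at xi) (%xi. norm xi powr (r - 2) *R xi)"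
  by (intro continuous_scaleR continuous_at_within_powr continuous_norm continuous_ident continuous_const) (use False in auto)
 then show ?thesis by (simp add: fl_def[abs_def])
next
 case True
 assume r: "1 < r"
 have "norm \<midarrow>(0::'a)\<rightarrow> 0" using tendsto_norm_zero[OF tendsto_ident_at] .
 then have "(%xi. norm (xi::'a) powr (r - 1)) \<midarrow>0\<rightarrow> 0"
  by (rule tendsto_zero_powrI[OF _ tendsto_const]) (use r in auto)
 then have "(%xi. norm (fl r (xi::'a))) \<midarrow>0\<rightarrow> 0" by (simp only: norm_fl)
 then have "fl r \<midarrow>(0::'a)\<rightarrow> 0" by (rule tendsto_norm_zero_cancel)
 then show ?thesis using True by (simp add: isCont_def)
qed

lemma tendsto_picD:
 assumes "1 < r" "(a \<longlongrightarrow> A) Fi" shows "((%n. picD r (a n) b) \<longlongrightarrow> picD r A b) Fi"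
 unfolding picD_def
 by (intro tendsto_add tendsto_diff tendsto_mult tendsto_const tendsto_inner isCont_lim[OF isCont_fl]
  tendsto_powr' tendsto_norm assms) (use assms(1) in auto)

text \<open>Needed where ph exceeds its truncation level. There the truncated ph has gradient 0, the
  positivity of \<open>core\<close> is of no help, and the mixed term must be absorbed.\<close>

lemma trunc_young:
 fixes p q :: real
 assumes "1 < q" "q < p"
 obtains C where "0 <= C" "!!A B. 0 <= A ==> 0 <= B ==> (p - q) * (B powr (p - 1) * A) <= (q - 1) * A powr p + C * B powr p"
proof -
 \<comment> \<open>The ratio A / B at which the mixed term equals (q - 1) A^p; beyond it the first
   term on the right suffices, below it the second.\<close>
 define M where "M = ((p - q) / (q - 1)) powr (1 / (p - 1))"
 have M: "M > 0" using assms by (simp add: M_def)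
 have Mp: "M powr (p - 1) = (p - q) / (q - 1)" using assms by (simp add: M_def powr_powr)
 show ?thesis
 proof (rule that[of "(p - q) * M"])
  show "0 <= (p - q) * M" using M assms by simp
  fix A B :: real assume AB: "0 <= A" "0 <= B"
  show "(p - q) * (B powr (p - 1) * A) <= (q - 1) * A powr p + (p - q) * M * B powr p"
  proof (cases "A <= M * B")
  case True
  have "B powr (p - 1) * A <= B powr (p - 1) * (M * B)" using True by (intro mult_lm) auto
  also have "... = M * B powr p" using powr_mult_self[OF AB(2), of "p - 1"] by simp
  finally have "(p - q) * (B powr (p - 1) * A) <= (p - q) * (M * B powr p)" using assms by (intro mult_lm) auto
  moreover have "0 <= (q - 1) * A powr p" using assms by simp
  ultimately show ?thesis by simp
  next
  case False
  then have "(M * B) powr (p - 1) <= A powr (p - 1)" using assms AB M by (intro powr_mono2) auto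
  then have "(p - q) / (q - 1) * B powr (p - 1) <= A powr (p - 1)" using M AB by (simp add: powr_mult Mp)
  then have "(p - q) * B powr (p - 1) <= (q - 1) * A powr (p - 1)" using assms by (simp add: field_simps)
  then have "(p - q) * B powr (p - 1) * A <= (q - 1) * A powr (p - 1) * A" using AB by (intro mult_rm) auto
  also have "... = (q - 1) * A powr p" using powr_mult_self[OF AB(1), of "p - 1"] by (simp add: mult.assoc)
  finally have "(p - q) * (B powr (p - 1) * A) <= (q - 1) * A powr p" by (simp add: mult.assoc)
  moreover have "0 <= (p - q) * M * B powr p" using assms M by simp
  ultimately show ?thesis by linarith
  qed
 qed
qed

lemma norm_scaleR_powr: "0 <= c ==> norm (c *R g) powr r = c powr r * norm g powr r"
 by (simp add: powr_mult)

text \<open>Picone's identity for the shifted functions U and Ph. Subtracting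
  \<open>d powr q\<close> makes the test function vanish where ph does; its cost is the last
  term.\<close>

lemma picone_q_pointwise:
 fixes g B :: "'a::euclidean_space"
 assumes q: "1 < q" and U: "0 < e" "e <= U" and Ph: "0 < d" "d <= Ph"
 shows "fl q g *. ((U powr (1 - q) * (q * Ph powr (q - 1))) *R B + ((Ph powr q - d powr q) * ((1 - q) * U powr (- q))) *R g)
  + picD q ((Ph / U) *R g) B <= norm B powr q + (q - 1) * (d powr q * e powr (- q)) * norm g powr q"
proof -
 have pos: "0 < U" "0 < Ph" using assms by auto
 have s0: "0 <= Ph / U" using pos by simp
 have s: "(Ph / U) powr (q - 1) = Ph powr (q - 1) * U powr (1 - q)" "(Ph / U) powr q = Ph powr q * U powr (- q)"
  using pos by (simp_all add: powr_divide powr_minus_divide powr_diff field_simps)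
 have "picD q ((Ph / U) *R g) B = norm B powr q - q * (Ph powr (q - 1) * U powr (1 - q)) * (fl q g *. B)
  + (q - 1) * (Ph powr q * U powr (- q)) * norm g powr q"
  unfolding picD_def fl_scaleR[OF s0] norm_scaleR_powr[OF s0] inner_scaleR_left s by (simp only: mult.assoc)
 moreover have "fl q g *. ((U powr (1 - q) * (q * Ph powr (q - 1))) *R B + ((Ph powr q - d powr q) * ((1 - q) * U powr (- q))) *R g)
  = q * (Ph powr (q - 1) * U powr (1 - q)) * (fl q g *. B)
  - (q - 1) * (Ph powr q * U powr (- q)) * norm g powr q + (q - 1) * (d powr q * U powr (- q)) * norm g powr q"
  by (simp add: inner_add_right fl_inner_self algebra_simps)
 moreover have "(q - 1) * (d powr q * U powr (- q)) * norm g powr q <= (q - 1) * (d powr q * e powr (- q)) * norm g powr q"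
  using q U by (intro mult_rm mult_lm powr_mono2') auto
 ultimately show ?thesis by linarith
qed

text \<open>Multiplying \<open>core\<close> at (Ph / U) g by the factor \<open>S\<close> below
  yields the difference of the two tested p-fluxes; the last term is again the cost of
  \<open>d powr q\<close>.\<close>

lemma picone_p_pointwise:
 fixes g B :: "'a::euclidean_space"
 assumes q: "1 < q" "q < p" and U: "0 < e" "e <= U" and Ph: "0 < d" "d <= Ph"
  and core: "0 <= core p q ((Ph / U) *R g) B"
 shows "fl p g *. ((U powr (1 - q) * (q * Ph powr (q - 1))) *R B + ((Ph powr q - d powr q) * ((1 - q) * U powr (- q))) *R g)
  <= fl p B *. ((U powr (p - q) * ((q - p + 1) * Ph powr (q - p))) *R B + (Ph powr (q - p + 1) * ((p - q) * U powr (p - q - 1))) *R g)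
  + (q - 1) * (d powr q * e powr (- q)) * norm g powr p"
proof -
 have pos: "0 < U" "0 < Ph" using assms by auto
 have s0: "0 <= Ph / U" using pos by simp
 define S where "S = U powr (p - q) * Ph powr (q - p)"
 have S: "0 <= S" by (simp add: S_def)
 have s: "S * (Ph / U) powr (p - 1) = Ph powr (q - 1) * U powr (1 - q)"
  "S * (Ph / U) powr p = Ph powr q * U powr (- q)"
  "S * (Ph / U) = Ph powr (q - p + 1) * U powr (p - q - 1)"
 proof -
  have *: "S * (Ph powr a * U powr b) = Ph powr (q - p + a) * U powr (p - q + b)" for a b
  by (simp add: S_def powr_add mult_ac)
  have "(Ph / U) powr c = Ph powr c * U powr (- c)" for c using pos by (simp add: powr_divide powr_minus_divide)
  moreover from this[of 1] have "Ph / U = Ph powr 1 * U powr (- 1)" using pos by simp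
  ultimately show "S * (Ph / U) powr (p - 1) = Ph powr (q - 1) * U powr (1 - q)"
  "S * (Ph / U) powr p = Ph powr q * U powr (- q)"
  "S * (Ph / U) = Ph powr (q - p + 1) * U powr (p - q - 1)"
  using *[of "p - 1" "1 - p"] *[of p "- p"] *[of 1 "- 1"] by (simp_all only:) (simp_all add: algebra_simps)
 qed
 have "0 <= S * core p q ((Ph / U) *R g) B" using S core by simp
 also have "... = (q - p + 1) * S * norm B powr p + (p - q) * (S * (Ph / U)) * (fl p B *. g)
  - q * (S * (Ph / U) powr (p - 1)) * (fl p g *. B) + (q - 1) * (S * (Ph / U) powr p) * norm g powr p"
  unfolding core_def fl_scaleR[OF s0] norm_scaleR_powr[OF s0] inner_scaleR_left inner_scaleR_right
  by (simp only: ring_distribs mult_ac)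
 finally have 1: "0 <= (q - p + 1) * S * norm B powr p + (p - q) * (Ph powr (q - p + 1) * U powr (p - q - 1)) * (fl p B *. g)
  - q * (Ph powr (q - 1) * U powr (1 - q)) * (fl p g *. B) + (q - 1) * (Ph powr q * U powr (- q)) * norm g powr p"
  unfolding s .
 have 2: "fl p g *. ((U powr (1 - q) * (q * Ph powr (q - 1))) *R B + ((Ph powr q - d powr q) * ((1 - q) * U powr (- q))) *R g)
  = q * (Ph powr (q - 1) * U powr (1 - q)) * (fl p g *. B)
  - (q - 1) * (Ph powr q * U powr (- q)) * norm g powr p + (q - 1) * (d powr q * U powr (- q)) * norm g powr p"
  by (simp add: inner_add_right fl_inner_self algebra_simps)
 have 3: "fl p B *. ((U powr (p - q) * ((q - p + 1) * Ph powr (q - p))) *R B + (Ph powr (q - p + 1) * ((p - q) * U powr (p - q - 1))) *R g)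
  = (q - p + 1) * S * norm B powr p + (p - q) * (Ph powr (q - p + 1) * U powr (p - q - 1)) * (fl p B *. g)"
  by (simp add: inner_add_right fl_inner_self S_def algebra_simps)
 have "(q - 1) * (d powr q * U powr (- q)) * norm g powr p <= (q - 1) * (d powr q * e powr (- q)) * norm g powr p"
  using q U by (intro mult_rm mult_lm powr_mono2') auto
 then show ?thesis using 1 2 3 by linarith
qed

text \<open>The version above the truncation level. The weight of the error is at most M^(p-q)
  k^(q-p), which tends to 0 as the level k grows because q < p.\<close>

lemma picone_truncated_pointwise:
 fixes g B :: "'a::euclidean_space"
 assumes q: "1 < q" "q < p" and U: "0 < e" "e <= U" "U <= M" and Ph: "0 < d" "d <= Ph" "0 < k" "k <= Ph"
  and C: "0 <= C" "!!A B. 0 <= A ==> 0 <= B ==> (p - q) * (B powr (p - 1) * A) <= (q - 1) * A powr p + C * B powr p"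
 shows "fl p g *. (((Ph powr q - d powr q) * ((1 - q) * U powr (- q))) *R g)
  <= fl p B *. ((Ph powr (q - p + 1) * ((p - q) * U powr (p - q - 1))) *R g)
  + (q - 1) * (d powr q * e powr (- q)) * norm g powr p + C * (M powr (p - q) * k powr (q - p)) * norm B powr p"
proof -
 have pos: "0 < U" "0 < Ph" using assms by auto
 have s0: "0 <= Ph / U" using pos by simp
 define S where "S = U powr (p - q) * Ph powr (q - p)"
 have S: "0 <= S" by (simp add: S_def)
 have s: "S * (Ph / U) powr p = Ph powr q * U powr (- q)"
  "S * (Ph / U) = Ph powr (q - p + 1) * U powr (p - q - 1)"
 proof -
  have *: "S * (Ph powr a * U powr b) = Ph powr (q - p + a) * U powr (p - q + b)" for a b
  by (simp add: S_def powr_add mult_ac)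
  have "(Ph / U) powr c = Ph powr c * U powr (- c)" for c using pos by (simp add: powr_divide powr_minus_divide)
  moreover from this[of 1] have "Ph / U = Ph powr 1 * U powr (- 1)" using pos by simp
  ultimately show "S * (Ph / U) powr p = Ph powr q * U powr (- q)"
  "S * (Ph / U) = Ph powr (q - p + 1) * U powr (p - q - 1)"
  using *[of p "- p"] *[of 1 "- 1"] by (simp_all only:) (simp_all add: algebra_simps)
 qed
 have "(p - q) * (norm B powr (p - 1) * (Ph / U * norm g)) <= (q - 1) * (Ph / U * norm g) powr p + C * norm B powr p"
  using pos by (intro C(2)) auto
 then have "S * ((p - q) * (norm B powr (p - 1) * (Ph / U * norm g))) <= S * ((q - 1) * (Ph / U * norm g) powr p + C * norm B powr p)"
  using S by (rule mult_lm)
 also have "(Ph / U * norm g) powr p = (Ph / U) powr p * norm g powr p"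
  using s0 by (intro powr_mult)
 finally have "(p - q) * (S * (Ph / U)) * (norm B powr (p - 1) * norm g)
  <= (q - 1) * (S * (Ph / U) powr p) * norm g powr p + C * S * norm B powr p"
  by (simp only: ring_distribs mult_ac)
 then have 1: "(p - q) * (Ph powr (q - p + 1) * U powr (p - q - 1)) * (norm B powr (p - 1) * norm g)
  <= (q - 1) * (Ph powr q * U powr (- q)) * norm g powr p + C * S * norm B powr p" unfolding s .
 have 2: "- ((p - q) * (Ph powr (q - p + 1) * U powr (p - q - 1)) * (norm B powr (p - 1) * norm g))
  <= (p - q) * (Ph powr (q - p + 1) * U powr (p - q - 1)) * (fl p B *. g)"
 proof -
  have "- (norm B powr (p - 1) * norm g) <= fl p B *. g" using fl_inner_le[of p B g] by linarith
  then have "((p - q) * (Ph powr (q - p + 1) * U powr (p - q - 1))) * - (norm B powr (p - 1) * norm g)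
  <= ((p - q) * (Ph powr (q - p + 1) * U powr (p - q - 1))) * (fl p B *. g)"
  using q by (intro mult_lm) auto
  then show ?thesis by simp
 qed
 have 3: "fl p g *. (((Ph powr q - d powr q) * ((1 - q) * U powr (- q))) *R g)
  = - (q - 1) * (Ph powr q * U powr (- q)) * norm g powr p + (q - 1) * (d powr q * U powr (- q)) * norm g powr p"
  by (simp add: fl_inner_self algebra_simps)
 have 4: "fl p B *. ((Ph powr (q - p + 1) * ((p - q) * U powr (p - q - 1))) *R g)
  = (p - q) * (Ph powr (q - p + 1) * U powr (p - q - 1)) * (fl p B *. g)" by (simp add: algebra_simps)
 have 5: "(q - 1) * (d powr q * U powr (- q)) * norm g powr p <= (q - 1) * (d powr q * e powr (- q)) * norm g powr p"
  using q U by (intro mult_rm mult_lm powr_mono2') auto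
 have "S <= M powr (p - q) * k powr (q - p)"
  unfolding S_def using q U Ph by (intro mult_mono powr_mono2 powr_mono2') auto
 then have 6: "C * S * norm B powr p <= C * (M powr (p - q) * k powr (q - p)) * norm B powr p"
  using C(1) by (intro mult_rm mult_lm) auto
 show ?thesis using 1 2 3 4 5 6 by linarith
qed

lemma powr_shift_deriv:
 "0 <= t ==> 0 < d ==> ((%t. (t + d) powr r) has_real_derivative r * (t + d) powr (r - 1)) (at t within S)"
 by (rule has_field_derivative_at_within) (auto intro!: deriv_eqs)

lemma powr_shift_continuous:
 "0 < d ==> continuous_on {0..b} (%t. c * (t + d) powr r)" for d :: real
 by (intro con_intros) auto

lemma sob_min_const:
 assumes s: "sob Om p u g" and p: "0 < p" and k: "0 <= k"
 shows "sob Om p (%x. min (u x) k) (%x. if u x > k then 0 else g x)"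
proof -
 have "sob Om p (%x. u x - max (u x - k) 0) (%x. g x - (if u x > k then g x else 0))"
  by (rule sob_diff[OF s sob_pos_part[OF s p k] p])
 moreover have "(%x. u x - max (u x - k) 0) = (%x. min (u x) k)" by (auto simp: fun_eq_iff)
 moreover have "(%x. g x - (if u x > k then g x else 0)) = (%x. if u x > k then 0 else g x)" by auto
 ultimately show ?thesis by simp
qed

lemma fl_dominated:
 fixes g :: "'a::euclidean_space => 'a"
 assumes Om: "open Om" "bounded Om" and p: "1 < p" and g: "grad_int Om p g" and s: "sob Om p w h"
 shows "lint (%x. fl p (g x) *. h x)"
proof -
 obtain D where "lint (%x. flux 0 p p (g x) *. h x)"
  using flux_dominated[OF Om p order_refl order_refl g s] by blast
 then show ?thesis by (simp add: flux_def)
qed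

lemma sob_powr_intb:
 assumes Om: "open Om" "bounded Om" and s: "sob Om p u g" and r: "0 < r" "r <= p"
 shows "lint (%x. <|u x|> powr r)" "lint (%x. norm (g x) powr r)"
proof -
 have p0: "0 < p" using r by simp
 note [measurable] = sob_meas[OF s]
 have i: "lint (%x. indicator Om x + <|u x|> powr p)" "lint (%x. indicator Om x + norm (g x) powr p)"
  using intb_indicator[OF Om] sob_intb[OF s p0] by auto
 show "lint (%x. <|u x|> powr r)"
 proof (rule intb_bound[OF i(1)])
  show "AL x. norm (<|u x|> powr r) <= norm (indicator Om x + <|u x|> powr p)"
  using sob_outside[OF s p0] by eventually_elim (use r powr_le_one_plus in "auto simp: indicator_def")
 qed measurable
 show "lint (%x. norm (g x) powr r)"
 proof (rule intb_bound[OF i(2)])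
  show "AL x. norm (norm (g x) powr r) <= norm (indicator Om x + norm (g x) powr p)"
  using sob_outside[OF s p0] by eventually_elim (use r powr_le_one_plus in "auto simp: indicator_def")
 qed measurable
qed

text \<open>\<open>v\<close> is bounded but has no positive lower bound, and \<open>ph\<close> need
  not be bounded: hence the shifts \<open>e\<close> and \<open>d\<close> and the truncation level
  \<open>k\<close> defined below.\<close>

locale picone_data =
 fixes Om :: "'a::euclidean_space set" and al p q m :: real and v ph F :: "'a => real" and g B :: "'a => 'a"
 assumes Om: "open Om" "bounded Om" and pq: "1 < q" "q <= p" "0 <= al"
  and v: "sob Om p v g" "!!x. 0 <= v x" "!!x. v x <= m" and vpos: "AL x. x : Om --> 0 < v x"
  and sup: "supersol Om al p q g F" and F: "!!x. 0 <= F x" "F : lmeas"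
  and ph: "sob Om p ph B" "!!x. 0 <= ph x"
begin

lemma p0: "0 < p" and p1: "1 < p" and q0: "0 < q" using pq by auto

definition "e n = 1 / real (Suc n)"
text \<open>The error caused by \<open>d n\<close> is proportional to (d n / e n)^q, which tends to
  0 thanks to the square.\<close>

definition "d n = (e n)^2"
definition "k n = real (Suc n)"
definition "phk n x = min (ph x) (k n)"
definition "Bk n x = (if ph x > k n then 0 else B x)"
definition "Ph n x = phk n x + d n"
definition "U n x = v x + e n"
text \<open>The regularised, truncated form of the test function ph^q v^(1-q).\<close>

definition "w1 n x = (Ph n x powr q - d n powr q) * U n x powr (1 - q)"
definition "h1 n x = (U n x powr (1 - q) * (q * Ph n x powr (q - 1))) *R Bk n x
  + ((Ph n x powr q - d n powr q) * ((1 - q) * U n x powr (- q))) *R g x"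
definition "Dn n x = (if ph x > k n then 0 else picD q ((Ph n x / U n x) *R g x) (B x))"
definition "D x = picD q ((ph x / v x) *R g x) (B x)"

lemma e_pos: "0 < e n" and e_le: "e n <= 1" and d_pos: "0 < d n" and k_pos: "0 < k n" and d_le: "d n <= 1"
 by (auto simp: e_def d_def k_def power_le_one)

lemma e_lim: "e ----> 0" unfolding e_def by (rule inv_Suc)

lemma d_lim: "d ----> 0" unfolding d_def using tendsto_power[OF e_lim, of 2] by simp

lemma phk_range: "phk n x : {0..k n}" using ph(2)[of x] k_pos[of n] by (auto simp: phk_def)

lemma v_range: "v x : {0..m}" using v by auto

lemma m0: "0 <= m" using v(2,3)[of undefined] by linarith

lemma U_ge: "e n <= U n x" and U_le: "U n x <= m + 1" and U_pos: "0 < U n x"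
 using v(2,3)[of x] e_pos[of n] e_le[of n] by (auto simp: U_def)

lemma Ph_ge: "d n <= Ph n x" and Ph_pos: "0 < Ph n x" and Ph_le: "Ph n x <= ph x + 1"
 using phk_range[of n x] d_pos[of n] d_le[of n] by (auto simp: Ph_def phk_def)

lemma sob_phk: "sob Om p (phk n) (Bk n)"
 unfolding phk_def[abs_def] Bk_def[abs_def] using sob_min_const[OF ph(1) p0, of "k n"] k_pos[of n] by simp

lemma sob_w1: "sob Om p (w1 n) (h1 n)"
proof -
 have "sob Om p (%x. ((phk n x + d n) powr q - d n powr q) * (v x + e n) powr (1 - q))
  (%x. ((v x + e n) powr (1 - q) * (q * (phk n x + d n) powr (q - 1))) *R Bk n x
  + (((phk n x + d n) powr q - d n powr q) * ((1 - q) * (v x + e n) powr (- q))) *R g x)"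
 proof (rule sob_mult_interval[OF sob_phk phk_range v(1) v_range p0])
  show "((%t. (t + d n) powr q - d n powr q) has_real_derivative q * (t + d n) powr (q - 1)) (at t within {0..k n})"
  if "t : {0..k n}" for t
  using DERIV_diff[OF powr_shift_deriv[of t "d n" q "{0..k n}"] DERIV_const] that d_pos by simp
  show "((%t. (t + e n) powr (1 - q)) has_real_derivative (1 - q) * (t + e n) powr (- q)) (at t within {0..m})"
  if "t : {0..m}" for t
  using powr_shift_deriv[of t "e n" "1 - q" "{0..m}"] that e_pos by simp
 qed (use powr_shift_continuous d_pos e_pos in auto)
 then show ?thesis by (simp add: w1_def[abs_def] h1_def[abs_def] Ph_def U_def)
qed

lemma w1_bounds: "0 <= w1 n x" "w1 n x <= (k n + d n) powr q * e n powr (1 - q)"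
proof -
 have "d n powr q <= Ph n x powr q" using Ph_ge d_pos[of n] q0 by (intro powr_mono2) auto
 then show "0 <= w1 n x" by (simp add: w1_def)
 have "Ph n x powr q - d n powr q <= Ph n x powr q" by simp
 also have "... <= (k n + d n) powr q"
  using phk_range[of n x] d_pos[of n] q0 by (intro powr_mono2) (auto simp: Ph_def)
 finally have 1: "Ph n x powr q - d n powr q <= (k n + d n) powr q" .
 have 2: "U n x powr (1 - q) <= e n powr (1 - q)" using U_ge e_pos pq by (intro powr_mono2') auto
 show "w1 n x <= (k n + d n) powr q * e n powr (1 - q)" unfolding w1_def by (intro mult_mono 1 2) auto
qed

lemma g_int: "grad_int Om p g" using sob_grad_int[OF v(1) p0] Om by simp

lemma B_int: "grad_int Om p B" using sob_grad_int[OF ph(1) p0] Om by simp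

lemma measurable_basic [measurable]:
 "v : lmeas" "g : lmeas" "ph : lmeas" "B : lmeas"
 "F : lmeas"
 using sob_meas[OF v(1)] sob_meas[OF ph(1)] F by auto

lemma picD_measurable [measurable]:
 assumes [measurable]: "a : lmeas" "b : lmeas"
 shows "(%x. picD q (a x) (b x)) : lmeas"
 unfolding picD_def by measurable

lemma Dn_measurable [measurable]: "Dn n : lmeas"
 unfolding Dn_def Ph_def phk_def U_def by measurable

lemma w1_measurable [measurable]: "w1 n : lmeas"
 using sob_meas[OF sob_w1] by auto

lemma Dn_nonneg: "0 <= Dn n x" by (auto simp: Dn_def intro: picD_nonneg[OF pq(1)])

text \<open>The limit passage common to the two versions below: \<open>En\<close> is an integrable
  bound for the tested flux plus remainder, and Fatou's lemma treats the left-hand side. The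
  remainder \<open>D\<close> is retained for the case of equality.\<close>

lemma limit_step:
 assumes R: "!!n. EX En. lint En & (AL x. flux al p q (g x) *. h1 n x + Dn n x <= En x) &
  (LI x. En x) <= R n" "R ----> Rl"
 shows "(NI x. ennreal (F x * (ph x powr q * v x powr (1 - q)) + D x)) <= ennreal Rl"
proof (rule fatou_bound)
 have step: "(NI x. ennreal (F x * w1 n x + Dn n x)) <= ennreal (R n)" for n
 proof -
  obtain En where En: "lint En" "AL x. flux al p q (g x) *. h1 n x + Dn n x <= En x"
  "(LI x. En x) <= R n" using R(1) by blast
  have i1: "lint (%x. flux al p q (g x) *. h1 n x)"
  using flux_dominated[OF Om pq g_int sob_w1] by blast
  define I1 where "I1 = (LI x. flux al p q (g x) *. h1 n x)"
  have s: "0 <= I1" "(NI x. ennreal (F x * w1 n x)) <= ennreal I1"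
  using sup[unfolded supersol_def] sob_w1[of n] w1_bounds[of n] unfolding I1_def by blast+
  have iD: "lint (Dn n)"
  proof (rule intb_bound[of _ "%x. En x - flux al p q (g x) *. h1 n x"])
  show "AL x. norm (Dn n x) <= norm (En x - flux al p q (g x) *. h1 n x)"
  using En(2) by eventually_elim (use Dn_nonneg in auto)
  qed (use En i1 in auto)
  have "(NI x. ennreal (F x * w1 n x + Dn n x)) = (NI x. ennreal (F x * w1 n x)) + (NI x. ennreal (Dn n x))"
  by (subst nn_integral_add[symmetric]) (measurable, use F w1_bounds Dn_nonneg in "simp add: ennreal_plus")
  also have "(NI x. ennreal (Dn n x)) = ennreal (LI x. Dn n x)"
  by (rule nn_eq_lint[OF iD]) (simp add: Dn_nonneg)
  also have "(NI x. ennreal (F x * w1 n x)) + ennreal (LI x. Dn n x)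
  <= ennreal I1 + ennreal (LI x. Dn n x)" using s(2) by (rule add_right_mono)
  also have "... = ennreal (I1 + (LI x. Dn n x))"
  using s(1) by (intro ennreal_plus[symmetric]) (auto simp: Dn_nonneg)
  also have "I1 + (LI x. Dn n x) = (LI x. flux al p q (g x) *. h1 n x + Dn n x)"
  unfolding I1_def using i1 iD by simp
  also have "ennreal ... <= ennreal (LI x. En x)"
  using i1 iD En(1,2) by (intro ennreal_leI integral_mono_AE) auto
  also have "... <= ennreal (R n)" using En(3) by (rule ennreal_leI)
  finally show ?thesis .
 qed
 show "(NI x. ennreal (F x * w1 n x + Dn n x)) <= ennreal (R n)" for n by (rule step)
 show "(%n. ennreal (R n)) ----> ennreal Rl" using R(2) by (rule tendsto_ennrealI)
 show "AL x. (%n. ennreal (F x * w1 n x + Dn n x)) ----> ennreal (F x * (ph x powr q * v x powr (1 - q)) + D x)"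
  using vpos sob_outside[OF v(1) p0] sob_outside[OF ph(1) p0]
 proof eventually_elim
  case (elim x)
  have ev: "\<forall>\<^sub>F n in sequentially. \<not> ph x > k n"
  proof -
  obtain N :: nat where "ph x < real N" using reals_Archimedean2 by blast
  then show ?thesis by (intro eventually_sequentiallyI[of N]) (auto simp: k_def)
  qed
  show ?case
  proof (cases "x : Om")
  case True
  have vx: "v x > 0" using elim True by simp
  have lPh: "(%n. Ph n x) ----> ph x"
  proof -
  have "(%n. ph x + d n) ----> ph x + 0" by (intro tendsto_add tendsto_const d_lim)
  moreover have "\<forall>\<^sub>F n in sequentially. ph x + d n = Ph n x"
  using ev by eventually_elim (simp add: Ph_def phk_def)
  ultimately show ?thesis by (auto intro: Lim_transform_eventually)
  qed
  have lU: "(%n. U n x) ----> v x" unfolding U_def using tendsto_add[OF tendsto_const e_lim, of "v x"] by simp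
  have "(%n. w1 n x) ----> (ph x powr q - 0 powr q) * v x powr (1 - q)"
  unfolding w1_def
  by (intro tendsto_mult tendsto_diff tendsto_powr' tendsto_const lPh lU d_lim)
  (use q0 vx Ph_pos d_pos in "auto simp: less_imp_le")
  then have l1: "(%n. w1 n x) ----> ph x powr q * v x powr (1 - q)" by simp
  have "(%n. picD q ((Ph n x / U n x) *R g x) (B x)) ----> D x"
  unfolding D_def by (intro tendsto_picD pq tendsto_scaleR tendsto_divide tendsto_const lPh lU) (use vx in auto)
  moreover have "\<forall>\<^sub>F n in sequentially. picD q ((Ph n x / U n x) *R g x) (B x) = Dn n x"
  using ev by eventually_elim (simp add: Dn_def)
  ultimately have l2: "(%n. Dn n x) ----> D x" by (rule Lim_transform_eventually)
  show ?thesis by (intro tendsto_ennrealI tendsto_add tendsto_mult tendsto_const l1 l2)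
  next
  case False
  then have z: "ph x = 0" "v x = 0" "g x = 0" "B x = 0" using elim by auto
  have "w1 n x = 0" for n using z k_pos[of n] by (simp add: w1_def Ph_def phk_def)
  moreover have "Dn n x = 0" "D x = 0" for n using z q0 by (auto simp: Dn_def D_def picD_def)
  ultimately show ?thesis using z q0 by simp
  qed
 qed
qed measurable

definition "Eq n x = (q - 1) * (d n powr q * e n powr (- q)) * norm (g x) powr q"

lemma Eq_lim: "(%n. (q - 1) * (d n powr q * e n powr (- q))) ----> 0"
proof -
 have eq: "d n powr q * e n powr (- q) = e n powr q" for n
 proof -
  have "d n = e n powr 2" using e_pos[of n] by (simp add: d_def)
  then have "d n powr q = e n powr (2 * q)" by (simp only: powr_powr)
  then show ?thesis by (simp add: powr_add[symmetric])
 qed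
 have "(%n. e n powr q) ----> 0"
  by (rule tendsto_zero_powrI[OF e_lim tendsto_const]) (use q0 e_pos in "auto simp: less_imp_le")
 then show ?thesis unfolding eq by (rule tendsto_mult_right_zero)
qed

lemma q_part:
 "fl q (g x) *. h1 n x + Dn n x <= norm (B x) powr q + Eq n x"
proof (cases "ph x > k n")
 case True
 have "fl q (g x) *. h1 n x + picD q ((Ph n x / U n x) *R g x) 0 <= norm (0::'a) powr q + Eq n x"
  using picone_q_pointwise[OF pq(1) e_pos[of n] U_ge[of n x] d_pos[of n] Ph_ge[of n x], where g = "g x" and B = "0::'a"] True
  unfolding Eq_def by (simp add: h1_def Bk_def)
 moreover have "0 <= picD q ((Ph n x / U n x) *R g x) 0" by (rule picD_nonneg[OF pq(1)])
 ultimately have "fl q (g x) *. h1 n x <= Eq n x" by simp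
 moreover have "Dn n x = 0" using True by (simp add: Dn_def)
 ultimately show ?thesis using powr_ge_zero[of "norm (B x)" q] by linarith
next
 case False
 then show ?thesis
  using picone_q_pointwise[OF pq(1) e_pos[of n] U_ge[of n x] d_pos[of n] Ph_ge[of n x], where g = "g x" and B = "B x"]
  unfolding Eq_def by (simp add: h1_def Bk_def Dn_def)
qed

lemma Eq_integrable: "lint (Eq n)"
 unfolding Eq_def using sob_powr_intb(2)[OF Om v(1) q0 pq(2)] by simp

lemma Bq_integrable: "lint (%x. norm (B x) powr q)"
 using sob_powr_intb(2)[OF Om ph(1) q0 pq(2)] .

text \<open>For a source La v^(q-1) this bounds La times the integral of ph^q, plus the remainder,
  by the integral of |grad ph|^q: a lower bound for Rayleigh quotients that knows its case of
  equality.\<close>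

theorem picone_homogeneous:
 assumes "al = 0"
 shows "(NI x. ennreal (F x * (ph x powr q * v x powr (1 - q)) + D x)) <= ennreal (LI x. norm (B x) powr q)"
proof (rule limit_step)
 let ?R = "%n. (LI x. norm (B x) powr q) + (q - 1) * (d n powr q * e n powr (- q)) * (LI x. norm (g x) powr q)"
 show "EX En. lint En & (AL x. flux al p q (g x) *. h1 n x + Dn n x <= En x) &
  (LI x. En x) <= ?R n" for n
  by (intro exI[of _ "%x. norm (B x) powr q + Eq n x"] conjI)
  (use q_part Bq_integrable Eq_integrable assms sob_powr_intb(2)[OF Om v(1) q0 pq(2)] in "auto simp: flux_def Eq_def")
 have "?R ----> (LI x. norm (B x) powr q) + 0 * (LI x. norm (g x) powr q)"
  by (intro tendsto_add tendsto_const tendsto_mult Eq_lim)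
 then show "?R ----> (LI x. norm (B x) powr q)" by simp
qed

end

text \<open>Positivity of \<open>core\<close> is required for all positive multiples of
  \<open>g x\<close>, because the regularised quotient \<open>Ph n x / U n x\<close> changes with
  \<open>n\<close>.\<close>

locale picone_eigen = picone_data +
 fixes La :: real
 assumes a1: "al = 1" and qp: "q < p" "p <= q + 1" and La: "0 <= La"
  and core: "AL x. ALL s>0. 0 <= core p q (s *R g x) (B x)"
  and eig: "!!w h M. sob Om p w h ==> (!!x. 0 <= w x & w x <= M) ==>
  (LI x. fl p (B x) *. h x) <= (LI x. La * (ph x powr (p - 1) * w x))"
begin

definition "ka = q - p + 1"

lemma ka0: "0 <= ka" using qp by (simp add: ka_def)

text \<open>The regularised test function ph^(q-p+1) v^(p-q) for the eigenvalue equation; the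
  constant makes it vanish where both functions do.\<close>

definition "w2 n x = Ph n x powr ka * U n x powr (p - q) - d n powr ka * e n powr (p - q)"
definition "h2 n x = (U n x powr (p - q) * (ka * Ph n x powr (ka - 1))) *R Bk n x
  + (Ph n x powr ka * ((p - q) * U n x powr (p - q - 1))) *R g x"

text \<open>The product rule wants a first factor vanishing at ph = 0. So the function is split into
  (Ph^ka - d^ka) U^(p-q) and d^ka (U^(p-q) - e^(p-q)), and the second summand is handled by the
  chain rule in \<open>v\<close>.\<close>

lemma sob_w2: "sob Om p (w2 n) (h2 n)"
proof -
 let ?G = "%t. (t + e n) powr (p - q)" and ?G' = "%t. (p - q) * (t + e n) powr (p - q - 1)"
 have dG: "(?G has_real_derivative ?G' t) (at t within {0..m})" if "t : {0..m}" for t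
  using powr_shift_deriv[of t "e n" "p - q" "{0..m}"] that e_pos by simp
 have cG: "continuous_on {0..m} ?G'" by (rule powr_shift_continuous[OF e_pos])
 have "sob Om p (%x. ((phk n x + d n) powr ka - d n powr ka) * ?G (v x))
  (%x. (?G (v x) * (ka * (phk n x + d n) powr (ka - 1))) *R Bk n x
  + (((phk n x + d n) powr ka - d n powr ka) * ?G' (v x)) *R g x)"
 proof (rule sob_mult_interval[OF sob_phk phk_range v(1) v_range p0 _ _ _ dG cG])
  show "((%t. (t + d n) powr ka - d n powr ka) has_real_derivative ka * (t + d n) powr (ka - 1)) (at t within {0..k n})"
  if "t : {0..k n}" for t
  using DERIV_diff[OF powr_shift_deriv[of t "d n" ka "{0..k n}"] DERIV_const] that d_pos by simp
 qed (use powr_shift_continuous d_pos in auto)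
 moreover have "sob Om p (%x. ?G (v x) - ?G 0) (%x. ?G' (v x) *R g x)"
 proof (rule sob_chain_interval[OF v(1) p0 v_range, where f = "%t. ?G t - ?G 0" and f' = ?G'])
  show "((%t. ?G t - ?G 0) has_real_derivative ?G' t) (at t within {0..m})" if "t : {0..m}" for t
  using DERIV_diff[OF dG[OF that] DERIV_const] by simp
 qed (use cG m0 in auto)
 from sob_scale[OF this p0, of "d n powr ka"]
 have "sob Om p (%x. d n powr ka * (?G (v x) - ?G 0)) (%x. d n powr ka *R (?G' (v x) *R g x))" .
 ultimately have "sob Om p (%x. ((phk n x + d n) powr ka - d n powr ka) * ?G (v x) + d n powr ka * (?G (v x) - ?G 0))
  (%x. ((?G (v x) * (ka * (phk n x + d n) powr (ka - 1))) *R Bk n x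
  + (((phk n x + d n) powr ka - d n powr ka) * ?G' (v x)) *R g x) + d n powr ka *R (?G' (v x) *R g x))"
  by (rule sob_add[OF _ _ p0])
 moreover have "(%x. ((phk n x + d n) powr ka - d n powr ka) * ?G (v x) + d n powr ka * (?G (v x) - ?G 0)) = w2 n"
  by (auto simp: w2_def Ph_def U_def algebra_simps)
 moreover have "(%x. ((?G (v x) * (ka * (phk n x + d n) powr (ka - 1))) *R Bk n x
  + (((phk n x + d n) powr ka - d n powr ka) * ?G' (v x)) *R g x) + d n powr ka *R (?G' (v x) *R g x)) = h2 n"
 proof
  have aux: "(H + ((X - c) * y) *R b) + c *R (y *R b) = H + (X * y) *R b" for H b :: 'a and X c y :: real
  by (simp add: algebra_simps)
  show "((?G (v x) * (ka * (phk n x + d n) powr (ka - 1))) *R Bk n x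
  + (((phk n x + d n) powr ka - d n powr ka) * ?G' (v x)) *R g x) + d n powr ka *R (?G' (v x) *R g x) = h2 n x" for x
  unfolding aux by (simp only: h2_def Ph_def U_def)
 qed
 ultimately show ?thesis by simp
qed

lemma w2_bounds: "0 <= w2 n x" "w2 n x <= (ph x + 1) powr ka * (m + 1) powr (p - q)"
 "w2 n x <= (k n + d n) powr ka * (m + 1) powr (p - q)"
proof -
 have "d n powr ka * e n powr (p - q) <= Ph n x powr ka * U n x powr (p - q)"
  using Ph_ge[of n x] U_ge[of n x] ka0 qp d_pos[of n] e_pos[of n] by (intro mult_mono powr_mono2) auto
 then show "0 <= w2 n x" by (simp add: w2_def)
 have "w2 n x <= Ph n x powr ka * U n x powr (p - q)" by (simp add: w2_def)
 moreover have "... <= (ph x + 1) powr ka * (m + 1) powr (p - q)"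
  using Ph_le[of n x] Ph_pos[of n x] U_le[of n x] U_pos[of n x] ka0 qp by (intro mult_mono powr_mono2) auto
 moreover have "Ph n x powr ka * U n x powr (p - q) <= (k n + d n) powr ka * (m + 1) powr (p - q)"
  using phk_range[of n x] Ph_pos[of n x] U_le[of n x] U_pos[of n x] ka0 qp by (intro mult_mono powr_mono2) (auto simp: Ph_def)
 ultimately show "w2 n x <= (ph x + 1) powr ka * (m + 1) powr (p - q)"
  "w2 n x <= (k n + d n) powr ka * (m + 1) powr (p - q)" by linarith+
qed

lemma ph_powr_product: "ph x powr (p - 1) * ph x powr ka = ph x powr q"
 by (simp add: powr_add[symmetric] ka_def)

lemma eig_limit:
 "(%n. LI x. La * (ph x powr (p - 1) * w2 n x)) ----> (LI x. La * (ph x powr q * v x powr (p - q)))"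
proof (rule int_dom[where w = "%x. La * (m + 1) powr (p - q) * (indicator Om x + 2 powr p * (ph x powr p + indicator Om x))"])
 have "lint (%x. ph x powr p)" using sob_intb(1)[OF ph(1) p0] ph(2) by simp
 then show "lint (%x. La * (m + 1) powr (p - q) * (indicator Om x + 2 powr p * (ph x powr p + indicator Om x)))"
  using intb_indicator[OF Om] by (intro integrable_mult_right intb_add)
 have [measurable]: "w2 n : lmeas" for n using sob_meas[OF sob_w2] by auto
 show "(%x. La * (ph x powr (p - 1) * w2 n x)) : lmeas" for n by measurable
 show "AL x. (%n. La * (ph x powr (p - 1) * w2 n x)) ----> La * (ph x powr q * v x powr (p - q))"
 proof (rule AE_I2)
  fix x
  show "(%n. La * (ph x powr (p - 1) * w2 n x)) ----> La * (ph x powr q * v x powr (p - q))"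
  \<comment> \<open>Where ph vanishes the factor \<open>ph x powr (p - 1)\<close> settles the limit.
    This includes ka = 0, for which \<open>0 powr 0 = 0\<close> would not be the limit of
    \<open>Ph n x powr ka\<close>.\<close>
  proof (cases "ph x = 0")
  case True
  then show ?thesis by simp
  next
  case False
  then have pos: "ph x > 0" using ph(2)[of x] by simp
  obtain N :: nat where "ph x < real N" using reals_Archimedean2 by blast
  then have ev: "\<forall>\<^sub>F n in sequentially. ph x + d n = Ph n x"
  by (intro eventually_sequentiallyI[of N]) (auto simp: k_def Ph_def phk_def)
  have "(%n. ph x + d n) ----> ph x + 0" by (intro tendsto_add tendsto_const d_lim)
  then have lPh: "(%n. Ph n x) ----> ph x" using ev by (auto intro: Lim_transform_eventually)
  have lU: "(%n. U n x) ----> v x" unfolding U_def using tendsto_add[OF tendsto_const e_lim, of "v x"] by simp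
  have "(%n. d n powr ka * e n powr (p - q)) ----> 0"
  proof (rule Lim_null_comparison[OF always_eventually])
  show "(%n. e n powr (p - q)) ----> 0"
  by (rule tendsto_zero_powrI[OF e_lim tendsto_const]) (use qp e_pos in "auto simp: less_imp_le")
  have "d n powr ka <= 1" for n using d_le[of n] d_pos[of n] ka0 powr_le1[of ka "d n"] by simp
  then show "ALL n. norm (d n powr ka * e n powr (p - q)) <= e n powr (p - q)"
  by (simp add: abs_mult mult_left_le_one_le)
  qed
  then have "(%n. w2 n x) ----> ph x powr ka * v x powr (p - q) - 0"
  unfolding w2_def
  by (intro tendsto_mult tendsto_diff tendsto_powr' tendsto_const lPh lU)
  (use pos qp U_pos in "auto simp: less_imp_le")
  then have "(%n. La * (ph x powr (p - 1) * w2 n x)) ----> La * (ph x powr (p - 1) * (ph x powr ka * v x powr (p - q) - 0))"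
  by (intro tendsto_mult tendsto_const)
  then show ?thesis using ph_powr_product[of x] by (simp add: mult.assoc[symmetric])
  qed
 qed
 show "AL x. norm (La * (ph x powr (p - 1) * w2 n x))
  <= La * (m + 1) powr (p - q) * (indicator Om x + 2 powr p * (ph x powr p + indicator Om x))" for n
  using sob_outside[OF ph(1) p0]
 proof eventually_elim
  case (elim x)
  show ?case
  proof (cases "x : Om")
  case True
  have "ph x powr (p - 1) * w2 n x <= (ph x + 1) powr (p - 1) * ((ph x + 1) powr ka * (m + 1) powr (p - q))"
  using w2_bounds[of n x] ph(2)[of x] p1 by (intro mult_mono powr_mono2) auto
  also have "... = (ph x + 1) powr q * (m + 1) powr (p - q)"
  by (simp add: powr_add[symmetric] ka_def mult.assoc[symmetric])
  also have "(ph x + 1) powr q <= 1 + (ph x + 1) powr p"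
  using ph(2)[of x] pq by (intro powr_le_one_plus) auto
  also have "(ph x + 1) powr p <= 2 powr p * (ph x powr p + 1)"
  using powr_norm_add_le[of p "ph x" 1] p0 ph(2)[of x] by simp
  finally have "ph x powr (p - 1) * w2 n x <= (1 + 2 powr p * (ph x powr p + 1)) * (m + 1) powr (p - q)"
  by (auto simp: mult_rm)
  then have "La * (ph x powr (p - 1) * w2 n x) <= La * ((1 + 2 powr p * (ph x powr p + 1)) * (m + 1) powr (p - q))"
  using La by (rule mult_lm)
  moreover have "0 <= La * (ph x powr (p - 1) * w2 n x)" using La w2_bounds by simp
  ultimately show ?thesis using True by (simp add: mult_ac)
  next
  case False
  then show ?thesis using elim La p0 by simp
  qed
 qed
qed measurable

text \<open>For the source La v^(p-1) + mu v^(q-1) the two integrals with La coincide, and what is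
  left bounds mu times the integral of ph^q, plus the remainder, by the integral of |grad
  ph|^q.\<close>

theorem picone_integral:
 "(NI x. ennreal (F x * (ph x powr q * v x powr (1 - q)) + D x))
  <= ennreal ((LI x. norm (B x) powr q) + (LI x. La * (ph x powr q * v x powr (p - q))))"
proof -
 obtain C where C: "0 <= C" "!!A B. 0 <= A ==> 0 <= B ==> (p - q) * (B powr (p - 1) * A) <= (q - 1) * A powr p + C * B powr p"
  by (rule trunc_young[OF pq(1) qp(1)]) (assumption | rule that)+
 define c where "c = (%n. (q - 1) * (d n powr q * e n powr (- q)))"
 define c' where "c' = (%n. C * ((m + 1) powr (p - q) * k n powr (q - p)))"
 define En where "En = (%n x. norm (B x) powr q + Eq n x + fl p (B x) *. h2 n x + c n * norm (g x) powr p + c' n * norm (B x) powr p)"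
 define R where "R = (%n. (LI x. norm (B x) powr q) + c n * (LI x. norm (g x) powr q)
  + (LI x. La * (ph x powr (p - 1) * w2 n x)) + c n * (LI x. norm (g x) powr p)
  + c' n * (LI x. norm (B x) powr p))"
 show ?thesis
 proof (rule limit_step[where R = R])
  fix n
  have i2: "lint (%x. fl p (B x) *. h2 n x)"
  by (rule fl_dominated[OF Om p1 B_int sob_w2])
  have igp: "lint (%x. norm (g x) powr p)" "lint (%x. norm (B x) powr p)"
  using sob_intb(2)[OF v(1) p0] sob_intb(2)[OF ph(1) p0] by auto
  have igq: "lint (%x. norm (g x) powr q)" using sob_powr_intb(2)[OF Om v(1) q0 pq(2)] .
  have "lint (En n)" unfolding En_def
  using Bq_integrable Eq_integrable i2 igp by (intro intb_add integrable_mult_right)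
  moreover have "AL x. flux al p q (g x) *. h1 n x + Dn n x <= En n x"
  using core
  proof eventually_elim
  case (elim x)
  have "flux al p q (g x) *. h1 n x + Dn n x = fl p (g x) *. h1 n x + (fl q (g x) *. h1 n x + Dn n x)"
  by (simp add: flux_def a1 inner_add_left)
  also have "... <= fl p (g x) *. h1 n x + (norm (B x) powr q + Eq n x)" using q_part[of x n] by simp
  also have "fl p (g x) *. h1 n x <= fl p (B x) *. h2 n x + c n * norm (g x) powr p + c' n * norm (B x) powr p"
  proof (cases "ph x > k n")
  case True
  have "k n <= Ph n x" using True d_pos[of n] by (simp add: Ph_def phk_def)
  from picone_truncated_pointwise[OF pq(1) qp(1) e_pos[of n] U_ge[of n x] U_le d_pos[of n] Ph_ge k_pos this C, where g = "g x" and B = "B x"]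
  show ?thesis using True by (simp add: h1_def h2_def Bk_def c_def c'_def ka_def)
  next
  case False
  have "0 <= core p q ((Ph n x / U n x) *R g x) (B x)" using elim Ph_pos[of n x] U_pos[of n x] by simp
  from picone_p_pointwise[OF pq(1) qp(1) e_pos[of n] U_ge[of n x] d_pos[of n] Ph_ge[of n x] this]
  have "fl p (g x) *. h1 n x <= fl p (B x) *. h2 n x + c n * norm (g x) powr p"
  using False by (simp add: h1_def h2_def Bk_def c_def ka_def)
  moreover have "0 <= c' n * norm (B x) powr p" using C by (simp add: c'_def)
  ultimately show ?thesis by linarith
  qed
  finally show ?case by (simp add: En_def)
  qed
  moreover have "(LI x. En n x) <= R n"
  proof -
  have "(LI x. En n x) = (LI x. norm (B x) powr q) + (LI x. Eq n x)
  + (LI x. fl p (B x) *. h2 n x) + c n * (LI x. norm (g x) powr p)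
  + c' n * (LI x. norm (B x) powr p)"
  unfolding En_def using Bq_integrable Eq_integrable i2 igp by simp
  moreover have "(LI x. Eq n x) = c n * (LI x. norm (g x) powr q)"
  unfolding Eq_def c_def by simp
  moreover have "(LI x. fl p (B x) *. h2 n x) <= (LI x. La * (ph x powr (p - 1) * w2 n x))"
  by (rule eig[OF sob_w2]) (use w2_bounds in blast)
  ultimately show ?thesis by (simp add: R_def)
  qed
  ultimately show "EX En. lint En & (AL x. flux al p q (g x) *. h1 n x + Dn n x <= En x) &
  (LI x. En x) <= R n" by blast
 next
  have lc: "c ----> 0" unfolding c_def by (rule Eq_lim)
  have lc': "c' ----> 0"
  proof -
  have "k n powr (q - p) = e n powr (p - q)" for n
  proof -
  have "k n powr (q - p) = inverse (k n) powr (p - q)"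
  using powr_minus[of "k n" "p - q"] k_pos[of n] by (simp add: inverse_powr)
  then show ?thesis by (simp add: k_def e_def inverse_eq_divide)
  qed
  moreover have "(%n. e n powr (p - q)) ----> 0"
  by (rule tendsto_zero_powrI[OF e_lim tendsto_const]) (use qp e_pos in "auto simp: less_imp_le")
  ultimately show ?thesis unfolding c'_def by (simp add: tendsto_mult_right_zero)
  qed
  have "R ----> (LI x. norm (B x) powr q) + 0 * (LI x. norm (g x) powr q)
  + (LI x. La * (ph x powr q * v x powr (p - q))) + 0 * (LI x. norm (g x) powr p)
  + 0 * (LI x. norm (B x) powr p)"
  unfolding R_def by (intro tendsto_add tendsto_const tendsto_mult lc lc' eig_limit)
  then show "R ----> (LI x. norm (B x) powr q) + (LI x. La * (ph x powr q * v x powr (p - q)))"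
  by simp
 qed
qed

end

subsection \<open>Reformulation of the problem on the whole space\<close>

lemma measurable_AE_limit:
 fixes f :: "nat => 'a::euclidean_space => real"
 assumes [measurable]: "!!k. f k : lmeas" and lim: "AL x. (%k. f k x) ----> g x"
 shows "g : lmeas"
proof (rule meas_AE)
 show "(%x. lim (%k. f k x)) : lmeas" by measurable
 show "AL x. lim (%k. f k x) = g x" using lim by eventually_elim (rule limI)
qed

locale eigen_pair =
 fixes Om :: "'a::euclidean_space set" and p q lam :: real and ph :: "'a => real" and B :: "'a => 'a"
 assumes Om: "open Om" "bounded Om" "Om ~= {}" and q: "1 < q" "q < p"
  and ph: "sob Om p ph B" "!!x. 0 <= ph x" "AL x. x : Om --> 0 < ph x"
  and eig: "!!w h. sob Om p w h ==> (LI x. fl p (B x) *. h x) = lam * (LI x. ph x powr (p - 1) * w x)"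
begin

lemma pp: "0 < p" "1 < p" "0 < q" "q <= p" using q by auto

lemma sob_outside_zero: "sob Om p w h ==> AL x. x ~: Om --> w x = 0 & h x = 0"
 using sob_outside pp(1) by blast

lemma integral_powr_pos:
 assumes s: "sob Om p v g" and v: "!!x. 0 <= v x" "AL x. x : Om --> 0 < v x" and r: "0 < r" "r <= p"
 shows "lint (%x. v x powr r)" "0 < (LI x. v x powr r)"
proof -
 show i: "lint (%x. v x powr r)" using sob_powr_intb(1)[OF Om(1,2) s r] v(1) by simp
 have "(LI x. v x powr r) ~= 0"
 proof
  assume "(LI x. v x powr r) = 0"
  then have "AL x. v x powr r = 0" using integral_nonneg_eq_0_iff_AE[OF i] by simp
  then have "AL x. x ~: Om" using v(2) by eventually_elim auto
  then have "Om : null_sets lebesgue" using AE_iff_null_sets[of Om lebesgue] Om by simp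
  then show False using open_not_negligible[OF Om(1,3)] negligible_iff_null_sets by blast
 qed
 moreover have "0 <= (LI x. v x powr r)" by simp
 ultimately show "0 < (LI x. v x powr r)" by linarith
qed

lemma ph_powr: "0 < r ==> r <= p ==> lint (%x. ph x powr r)"
 "0 < r ==> r <= p ==> 0 < (LI x. ph x powr r)"
 using integral_powr_pos[OF ph] by auto

lemma rayleigh_p: "(LI x. norm (B x) powr p) = lam * (LI x. ph x powr p)"
proof -
 have "ph x powr (p - 1) * ph x = ph x powr p" for x using powr_mult_self[OF ph(2), of x "p - 1"] by simp
 then show ?thesis using eig[OF ph(1)] by (simp add: fl_inner_self)
qed

lemma lam_nonneg: "0 <= lam"
proof -
 have "0 <= lam * (LI x. ph x powr p)" unfolding rayleigh_p[symmetric] by simp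
 then show ?thesis using ph_powr(2)[of p] pp by (simp add: zero_le_mult_iff)
qed

lemma ph_zero_outside: "AL x. x ~: Om --> ph x = 0 & B x = 0"
 using sob_outside_zero[OF ph(1)] .

lemma measurable_ph [measurable]: "ph : lmeas" "B : lmeas"
 using sob_meas[OF ph(1)] by auto

lemma mixed_powr_le:
 fixes a b :: real assumes "0 <= a" "0 <= b"
 shows "a powr q * b powr (p - q) <= a powr p + b powr p"
proof -
 have "a powr q * b powr (p - q) <= max a b powr q * max a b powr (p - q)"
  using assms q by (intro mult_mono powr_mono2) auto
 also have "... = max a b powr p" by (simp add: powr_add[symmetric])
 also have "... <= a powr p + b powr p" by (auto simp: max_def)
 finally show ?thesis .
qed

lemma mixed_integrable:
 assumes "sob Om p v g" "!!x. 0 <= v x"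
 shows "lint (%x. ph x powr q * v x powr (p - q))"
proof (rule intb_bound[of _ "%x. ph x powr p + v x powr p"])
 have [measurable]: "v : lmeas" using sob_meas[OF assms(1)] by auto
 show "(%x. ph x powr q * v x powr (p - q)) : lmeas" by measurable
 show "lint (%x. ph x powr p + v x powr p)"
  using ph_powr(1)[of p] pp sob_intb(1)[OF assms(1) pp(1)] assms(2) by auto
 show "AL x. norm (ph x powr q * v x powr (p - q)) <= norm (ph x powr p + v x powr p)"
  using mixed_powr_le ph(2) assms(2) by simp
qed

lemma eig_supersol_form:
 assumes "sob Om p w h"
 shows "(LI x. fl p (B x) *. h x) <= (LI x. lam * (ph x powr (p - 1) * w x))"
 using eig[OF assms] by simp

end

locale solution_pair = eigen_pair Om p q lam ph B
 for Om :: "'a::euclidean_space set" and p q lam :: real and ph :: "'a => real" and B :: "'a => 'a" +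
 fixes mu :: real and u :: "'a => real" and G :: "'a => 'a"
 assumes mu: "0 <= mu"
  and u: "sob Om p u G" "!!x. 0 <= u x" "AL x. x : Om --> 0 < u x"
  and sol: "!!w h. sob Om p w h ==> (LI x. flux 1 p q (G x) *. h x)
  = lam * (LI x. u x powr (p - 1) * w x) + mu * (LI x. u x powr (q - 1) * w x)"
begin

definition "f t = lam * t powr (p - 1) + mu * t powr (q - 1)"

lemma f_nonneg: "0 <= f t" using lam_nonneg mu by (simp add: f_def)

lemma f_mono: "0 <= s ==> s <= t ==> f s <= f t"
 unfolding f_def using lam_nonneg mu q by (intro add_mono mult_lm powr_mono2) auto

lemma f_measurable [measurable]: "f : borel_measurable borel"
 unfolding f_def by measurable

lemma measurable_u [measurable]: "u : lmeas" "G : lmeas"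
 using sob_meas[OF u(1)] by auto

lemma power_test_integrable:
 assumes w: "sob Om p w h" and v: "sob Om p v g" "!!x. 0 <= v x" and r: "1 < r" "r <= p"
 shows "lint (%x. v x powr (r - 1) * w x)"
proof (rule intb_bound[of _ "%x. <|v x|> powr r + <|w x|> powr r"])
 have [measurable]: "v : lmeas" "w : lmeas"
  using sob_meas[OF v(1)] sob_meas[OF w] by auto
 show "(%x. v x powr (r - 1) * w x) : lmeas" by measurable
 show "lint (%x. <|v x|> powr r + <|w x|> powr r)"
  using sob_powr_intb(1)[OF Om(1,2) v(1), of r] sob_powr_intb(1)[OF Om(1,2) w, of r] r by auto
 have "v x powr (r - 1) * <|w x|> <= <|v x|> powr r + <|w x|> powr r" for x
  using powr_mult_le_add[of "v x" "<|w x|>" r] v(2)[of x] r by simp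
 then show "AL x. norm (v x powr (r - 1) * w x) <= norm (<|v x|> powr r + <|w x|> powr r)"
  by (simp add: abs_mult)
qed

lemma sol_f:
 assumes w: "sob Om p w h"
 shows "lint (%x. f (u x) * w x)"
  "(LI x. flux 1 p q (G x) *. h x) = (LI x. f (u x) * w x)"
proof -
 note i = power_test_integrable[OF w u(1,2), of p] power_test_integrable[OF w u(1,2), of q]
 have eq: "(%x. f (u x) * w x) = (%x. lam * (u x powr (p - 1) * w x) + mu * (u x powr (q - 1) * w x))"
  by (simp add: f_def algebra_simps)
 show "lint (%x. f (u x) * w x)" unfolding eq using i pp q by auto
 show "(LI x. flux 1 p q (G x) *. h x) = (LI x. f (u x) * w x)"
  unfolding eq using i pp q sol[OF w] by simp
qed

lemma supersol_u: "supersol Om 1 p q G (%x. f (u x))"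
 unfolding supersol_def
proof (intro allI impI)
 fix w h M assume w: "sob Om p w h" "ALL x. 0 <= w x & w x <= M"
 have nn: "0 <= f (u x) * w x" for x using f_nonneg w(2) by simp
 have "(NI x. ennreal (f (u x) * w x)) = ennreal (LI x. f (u x) * w x)"
  by (rule nn_eq_lint[OF sol_f(1)[OF w(1)]]) (simp add: nn)
 moreover have "0 <= (LI x. f (u x) * w x)" by (simp add: nn)
 ultimately show "0 <= (LI x. flux 1 p q (G x) *. h x) &
  (NI x. ennreal (f (u x) * w x)) <= ennreal (LI x. flux 1 p q (G x) *. h x)"
  unfolding sol_f(2)[OF w(1)] by simp
qed

text \<open>min(u, m) is the minimum of the solution and the constant m, a supersolution with source
  0. Outside the domain u - m equals -m, which is the constant passed to
  \<open>supersol_min\<close>.\<close>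

lemma supersol_truncated:
 assumes m: "0 < m"
 shows "supersol Om 1 p q (%x. if m < u x then 0 else G x) (%x. if m < u x then 0 else f (u x))"
proof (rule supersol_min[OF Om(1,2) q(1) pp(4) zero_le_one _ supersol_u, where c = "-m" and Om' = Om])
 show "supersol Om 1 p q (%x. 0) (%x. 0)" by (simp add: supersol_def)
 show "grad_int Om p (%x. 0)" using pp by (simp add: grad_int_def)
 show "grad_int Om p G" using sob_grad_int[OF u(1) pp(1)] Om by simp
 show "sob Om p (%x. u x - m - - m) (%x. G x - 0)" using u(1) by simp
qed (auto simp: f_nonneg)

text \<open>Serves both truncations of u, with b = u, and radial iterates below u. Fatou's lemma
  acts on the left, and domination by ph^q u^(p-q) on the right. The excess \<open>E\<close>
  consists of the surplus L - f(b) of the source, suitably weighted, and Picone's remainder; both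
  are nonnegative, so equality makes both vanish.\<close>

lemma picone_sequence:
 assumes P: "!!k. picone_eigen Om 1 p q (m k) (v k) ph (F k) (g k) B lam"
  and vu: "AL x. ALL k. v k x <= u x"
  and lim: "AL x. x : Om --> 0 < b x & (%k. v k x) ----> b x & (%k. g k x) ----> H x
  & (%k. F k x) ----> L x & f (b x) <= L x"
 shows "mu * (LI x. ph x powr q) <= (LI x. norm (B x) powr q)"
  and "(LI x. norm (B x) powr q) <= mu * (LI x. ph x powr q) ==>
  AL x. x : Om --> L x = f (b x) & (ph x / b x) *R H x = B x"
proof -
 interpret P: picone_eigen Om 1 p q "m k" "v k" ph "F k" "g k" B lam for k by (rule P)
 let ?R = "LI x. norm (B x) powr q" and ?w = "%x. ph x powr q * b x powr (p - q)"
 let ?X = "%k x. F k x * (ph x powr q * v k x powr (1 - q)) + P.D k x"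
 define Y where "Y x = lam * ?w x + mu * ph x powr q" for x
 define E where "E x = (if x : Om then (L x - f (b x)) * (ph x powr q * b x powr (1 - q)) + picD q ((ph x / b x) *R H x) (B x) else 0)" for x
 have [measurable]: "v k : lmeas" "g k : lmeas" "F k : lmeas" for k
  using sob_meas[OF P.v(1)] P.F(2) by auto
 have dom: "ph x powr q * v k x powr (p - q) <= ph x powr q * u x powr (p - q)" if "ALL k. v k x <= u x" for k x
  using that P.v(2) q by (intro mult_lm powr_mono2) auto
 have lw: "AL x. (%k. ph x powr q * v k x powr (p - q)) ----> ?w x"
  using lim ph_zero_outside
 proof eventually_elim
  case (elim x)
  show ?case
  by (cases "x : Om") (use elim q in "auto intro!: tendsto_mult_left tendsto_powr")
 qed
 have wm[measurable]: "?w : lmeas" by (rule measurable_AE_limit[OF _ lw]) measurable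
 note iu = mixed_integrable[OF u(1,2)]
 have dom': "AL x. norm (ph x powr q * v k x powr (p - q)) <= ph x powr q * u x powr (p - q)" for k
  using vu by eventually_elim (use dom in simp)
 note iw = integrable_dominated_convergence[OF wm _ iu lw dom'] and limR = int_dom[OF wm _ iu lw dom']
 have iY: "lint Y" unfolding Y_def using iw ph_powr(1)[of q] pp by simp
 have Y0: "0 <= Y x" for x using lam_nonneg mu by (simp add: Y_def)
 have limX: "AL x. (%k. ?X k x) ----> Y x + E x & 0 <= E x"
  using lim ph_zero_outside
 proof eventually_elim
  case (elim x)
  show ?case
  proof (cases "x : Om")
  case True
  then have l: "0 < b x" "(%k. v k x) ----> b x" "(%k. g k x) ----> H x" "(%k. F k x) ----> L x" "f (b x) <= L x"
  using elim by auto
  then have "(%k. ?X k x) ----> L x * (ph x powr q * b x powr (1 - q)) + picD q ((ph x / b x) *R H x) (B x)"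
  unfolding P.D_def by (intro tendsto_intros tendsto_picD) (use q in auto)
  moreover have e: "b x powr (p - 1) * b x powr (1 - q) = b x powr (p - q)" "b x powr (q - 1) * b x powr (1 - q) = 1"
  using l by (simp_all add: powr_add[symmetric])
  have "f (b x) * (ph x powr q * b x powr (1 - q))
  = ph x powr q * (lam * (b x powr (p - 1) * b x powr (1 - q)) + mu * (b x powr (q - 1) * b x powr (1 - q)))"
  by (simp add: f_def algebra_simps)
  then have "f (b x) * (ph x powr q * b x powr (1 - q)) = Y x" unfolding e Y_def by (simp add: algebra_simps)
  moreover have "0 <= (L x - f (b x)) * (ph x powr q * b x powr (1 - q))" using l by simp
  ultimately show ?thesis using True picD_nonneg[OF q(1), of "(ph x / b x) *R H x" "B x"]
  by (simp add: E_def left_diff_distrib add.commute)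
  qed (use elim q in "simp add: E_def Y_def P.D_def picD_def")
 qed
 have Em: "E : lmeas"
 proof (rule measurable_AE_limit)
  show "AL x. (%k. ?X k x - Y x) ----> E x"
  using limX
  proof eventually_elim
  case (elim x)
  from tendsto_diff[OF conjunct1[OF elim] tendsto_const[of "Y x"]] show ?case by simp
  qed
  show "(%x. ?X k x - Y x) : lmeas" for k unfolding P.D_def using borel_measurable_integrable[OF iY] by measurable
 qed
 let ?C = "?R + lam * (LI x. ?w x)"
 have "(NI x. ennreal (Y x)) + (NI x. ennreal (E x)) = (NI x. ennreal (Y x) + ennreal (E x))"
  using iY Em by (intro nn_integral_add[symmetric]) auto
 also have "... <= ennreal ?C"
 proof (rule fatou_bound)
  show "AL x. (%k. ennreal (?X k x)) ----> ennreal (Y x) + ennreal (E x)"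
  using limX
  proof eventually_elim
  case (elim x)
  from tendsto_ennrealI[OF conjunct1[OF elim]] elim show ?case by (simp only: ennreal_plus[OF Y0])
  qed
  show "(NI x. ennreal (?X k x)) <= ennreal (?R + lam * (LI x. ph x powr q * v k x powr (p - q)))" for k
  using P.picone_integral[of k] by simp
  show "(%k. ennreal (?R + lam * (LI x. ph x powr q * v k x powr (p - q)))) ----> ennreal ?C"
  by (intro tendsto_ennrealI tendsto_intros limR) measurable
  show "(%x. ennreal (?X k x)) : lmeas" for k unfolding P.D_def by measurable
 qed
 also have "(NI x. ennreal (Y x)) = ennreal (LI x. Y x)"
  by (rule nn_eq_lint[OF iY]) (use Y0 in simp)
 finally have le: "ennreal (LI x. Y x) + (NI x. ennreal (E x)) <= ennreal ?C" .
 have iYe: "(LI x. Y x) = lam * (LI x. ?w x) + mu * (LI x. ph x powr q)"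
  unfolding Y_def using iw ph_powr(1)[of q] pp by simp
 have C0: "0 <= ?C" using lam_nonneg by simp
 have "ennreal (LI x. Y x) <= ennreal ?C" by (rule order_trans[OF add_increasing2[OF zero_le order_refl] le])
 then have "(LI x. Y x) <= ?C" using C0 by simp
 then show "mu * (LI x. ph x powr q) <= ?R" using iYe by simp
 assume "?R <= mu * (LI x. ph x powr q)"
 then have "ennreal ?C <= ennreal (LI x. Y x) + 0" using iYe by (simp add: ennreal_leI)
 from order_trans[OF le this] have "(NI x. ennreal (E x)) = 0"
  by (subst (asm) ennreal_add_left_cancel_le) auto
 then have "AL x. ennreal (E x) = 0" by (subst (asm) nn_integral_0_iff_AE) (use Em in auto)
 then show "AL x. x : Om --> L x = f (b x) & (ph x / b x) *R H x = B x"
  using limX lim ph(3)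
 proof eventually_elim
  case (elim x)
  show ?case
  proof
  assume x: "x : Om"
  let ?P = "(L x - f (b x)) * (ph x powr q * b x powr (1 - q))"
  have l: "0 < b x" "f (b x) <= L x" "0 < ph x" using elim x by auto
  have "?P + picD q ((ph x / b x) *R H x) (B x) = 0" using elim x by (simp add: E_def ennreal_eq_0_iff)
  moreover have "0 <= ?P" using l by simp
  ultimately have 0: "?P = 0" "picD q ((ph x / b x) *R H x) (B x) = 0"
  using picD_nonneg[OF q(1), of "(ph x / b x) *R H x" "B x"] by linarith+
  show "L x = f (b x) & (ph x / b x) *R H x = B x" using picD_eq_zero[OF q(1) 0(2)] 0(1) l by simp
  qed
 qed
qed

text \<open>Picone's inequality was proved for bounded supersolutions; the truncations of u at the
  levels k + 1 exhaust u.\<close>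

theorem mu_le_of_core:
 assumes pq: "p <= q + 1" and core: "!!a b :: 'a. 0 <= core p q a b"
 shows "mu * (LI x. ph x powr q) <= (LI x. norm (B x) powr q)"
proof -
 let ?m = "%k. real (Suc k)"
 let ?v = "%k x. min (u x) (?m k)" and ?g = "%k x. if ?m k < u x then 0 else G x" and ?F = "%k x. if ?m k < u x then 0 else f (u x)"
 have P: "picone_eigen Om 1 p q (?m k) (?v k) ph (?F k) (?g k) B lam" for k
 proof
  show "sob Om p (?v k) (?g k)" using sob_min_const[OF u(1) pp(1), of "?m k"] by simp
  show "AL x. x : Om --> 0 < ?v k x" using u(3) by eventually_elim auto
  show "supersol Om 1 p q (?g k) (?F k)" by (rule supersol_truncated) simp
  show "AL x. ALL s>0. 0 <= core p q (s *R ?g k x) (B x)" using core by simp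
  show "(LI x. fl p (B x) *. h x) <= (LI x. lam * (ph x powr (p - 1) * w x))"
  if "sob Om p w h" for w h using eig_supersol_form[OF that] .
 qed (use Om q pp pq u lam_nonneg f_nonneg ph in auto)
 have l: "(%k. ?v k x) ----> u x" "(%k. ?g k x) ----> G x" "(%k. ?F k x) ----> f (u x)" for x
 proof -
  obtain N :: nat where "u x < real N" using reals_Archimedean2 by blast
  then have "\<forall>\<^sub>F k in sequentially. u x <= ?m k" by (intro eventually_sequentiallyI[of N]) auto
  then show "(%k. ?v k x) ----> u x" "(%k. ?g k x) ----> G x" "(%k. ?F k x) ----> f (u x)"
  by (auto intro!: tendsto_eventually elim!: eventually_mono)
 qed
 show ?thesis
 proof (rule picone_sequence(1)[where m = ?m and b = u and H = G and L = "%x. f (u x)", OF P])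
  show "AL x. x : Om --> 0 < u x & (%k. ?v k x) ----> u x & (%k. ?g k x) ----> G x
  & (%k. ?F k x) ----> f (u x) & f (u x) <= f (u x)"
  using u(3) by eventually_elim (simp only: l, simp)
 qed simp
qed

end

section \<open>Translation of the weak formulation into Sobolev pairs\<close>

lemma r_laplacian_form_eq:
 assumes w: "sob Om p w h" and Om: "open Om" "bounded Om" and p: "1 < p"
  and g: "g : lmeas" "AL x. x : Om --> weak_grad Om u x = g x"
 shows "r_laplacian_form Om r u w = (LI x. fl r (g x) *. h x)"
proof -
 have Omm: "Om : sets lebesgue" using Om by simp
 have p0: "0 < p" using p by simp
 have [measurable]: "g : lmeas" "h : lmeas" using g sob_meas[OF w] by auto
 have ae: "AL x. fl r (g x) *. h x = indicator Om x *R (norm (weak_grad Om u x) powr (r - 2) * (weak_grad Om u x *. weak_grad Om w x))"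
  using g(2) sob_W01p(2)[OF w Om p] sob_outside[OF w p0]
  by eventually_elim (auto simp: indicator_def fl_def)
 show ?thesis unfolding r_laplacian_form_def LINT_lebesgue_on[OF Omm] by (rule LINT_cong_AE[OF _ ae]) measurable
qed

lemma r_power_form_eq:
 assumes w: "sob Om p w h" and Om: "open Om" and p: "1 < p"
  and v: "v : lmeas" "AL x. x : Om --> u x = v x" "!!x. 0 <= v x"
 shows "r_power_form Om r u w = (LI x. v x powr (r - 1) * w x)"
proof -
 have Omm: "Om : sets lebesgue" using Om by simp
 have p0: "0 < p" using p by simp
 have [measurable]: "v : lmeas" "w : lmeas" using v sob_meas[OF w] by auto
 have pv: "<|v x|> powr (r - 2) * v x = v x powr (r - 1)" for x using powr_mult_self[OF v(3), of x "r - 2"] v(3)[of x] by simp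
 have ae: "AL x. v x powr (r - 1) * w x = indicator Om x *R (<|u x|> powr (r - 2) * u x * w x)"
  using v(2) sob_outside[OF w p0]
  by eventually_elim (use pv in "auto simp: indicator_def")
 show ?thesis unfolding r_power_form_def LINT_lebesgue_on[OF Omm] by (rule LINT_cong_AE[OF _ ae]) measurable
qed

text \<open>Taking the positive part of the zero extension makes the sign hold at every point
  without changing the class of the function.\<close>

lemma positive_W01p_pair:
 assumes u: "u : W01p Om p" "positive_in Om u" and Om: "open Om" and p: "1 < p"
 obtains v g where "sob Om p v g" "!!x. 0 <= v x" "AL x. x : Om --> 0 < v x"
  "AL x. x : Om --> u x = v x" "AL x. x : Om --> weak_grad Om u x = g x"
proof -
 have Omm: "Om : sets lebesgue" using Om by simp
 have p0: "0 < p" using p by simp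
 let ?u = "%x. if x : Om then u x else 0" and ?g = "%x. if x : Om then weak_grad Om u x else 0"
 have s: "sob Om p ?u ?g" by (rule W01p_sob[OF u(1) Om p])
 have pos: "AL x. x : Om --> 0 < u x"
  using u(2) unfolding positive_in_def AE_lebesgue_on_iff[OF Omm] .
 note s2 = sob_pos_part[OF s p0 order_refl]
 show ?thesis
 proof (rule that[OF s2])
  show "AL x. x : Om --> 0 < max (?u x - 0) 0" "AL x. x : Om --> u x = max (?u x - 0) 0"
  "AL x. x : Om --> weak_grad Om u x = (if 0 < ?u x then ?g x else 0)"
  using pos by (eventually_elim, simp)+
 qed simp
qed

subsection \<open>Radial vector fields with prescribed divergence\<close>

text \<open>For r > 0 this is r^(-N) times the integral of s^(N-1) F(s) over [0, r]; the integral
  over [0, 1] is the form that remains continuous at r = 0. In dimension N the field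
  \<open>radk N F |x|\<close> times x has divergence F(|x|).\<close>

definition radk :: "nat => (real => real) => real => real" where
 "radk N F r = integral {0..1} (%ta. ta ^ (N - 1) * F (ta * r))"

lemma radk_intb:
 fixes F :: "real => real"
 assumes "contU F" shows "(%ta. ta ^ (N - 1) * F (ta * r)) integrable_on {0..1}"
 by (intro intb_cont con_intros con_comp[OF assms]) auto

lemma continuous_radk:
 assumes "contU F" shows "contU (radk N F)"
proof -
 have "contU (%r. integral (cbox 0 1) (%ta. ta ^ (N - 1) * F (ta * r)))"
  by (rule integral_continuous_on_param)
  (auto simp: split_beta intro!: con_intros con_comp[OF assms])
 then show ?thesis by (simp add: radk_def[abs_def])
qed

lemma radk_abs_le:
 assumes F: "contU F" and b: "!!s. 0 <= s ==> s <= r ==> <|F s|> <= M" and r: "0 <= r"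
 shows "<|radk N F r|> <= M"
proof -
 have "norm (integral {0..1} (%ta. ta ^ (N - 1) * F (ta * r))) <= integral {0..1} (%ta::real. M)"
 proof (rule Henstock_Kurzweil_Integration.integral_norm_bound_integral)
  show "(%ta. ta ^ (N - 1) * F (ta * r)) integrable_on {0..1}" by (rule radk_intb[OF F])
  fix ta :: real assume t: "ta : {0..1}"
  have "<|ta ^ (N - 1)|> <= 1" using t by (simp add: power_le_one)
  moreover have "ta * r <= r" using t r mult_rm[of ta 1 r] by simp
  then have "<|F (ta * r)|> <= M" using t r by (intro b) auto
  ultimately have "<|ta ^ (N - 1)|> * <|F (ta * r)|> <= 1 * M" by (intro mult_mono) auto
  then show "norm (ta ^ (N - 1) * F (ta * r)) <= M" by (simp add: abs_mult)
 qed (rule integrable_const_ivl)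
 then show ?thesis by (simp add: radk_def)
qed

lemma radk_diff:
 assumes "contU F" "contU G"
 shows "radk N (%s. F s - G s) r = radk N F r - radk N G r"
 unfolding radk_def by (subst integral_diff[OF radk_intb[OF assms(1)] radk_intb[OF assms(2)], symmetric])
  (simp add: algebra_simps)

lemma radk_monomial: "N >= 1 ==> radk N (%s. s ^ k) r = r ^ k / (N + k)"
proof -
 assume N: "N >= 1"
 have "((%ta. ta ^ (N - 1) * (ta * r) ^ k) has_integral (1 ^ (N + k) * r ^ k / (N + k) - 0 ^ (N + k) * r ^ k / (N + k))) {0..1}"
 proof (rule fundamental_theorem_of_calculus)
  fix x :: real assume "x : {0..1}"
  have "x ^ (N + k - 1) = x ^ (N - 1) * x ^ k" using N by (simp add: power_add[symmetric])
  then have x: "real (N + k) * x ^ (N + k - 1) * (r ^ k / (N + k)) = x ^ (N - 1) * (x * r) ^ k"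
  using N by (simp add: power_mult_distrib)
  have "((%ta. ta ^ (N + k) * (r ^ k / (N + k))) has_real_derivative real (N + k) * x ^ (N + k - 1) * (r ^ k / (N + k))) (at x within {0..1})"
  by (intro DERIV_cmult_right) (use DERIV_pow[of "N + k"] in simp)
  then show "((%ta. ta ^ (N + k) * r ^ k / (N + k)) has_vector_derivative x ^ (N - 1) * (x * r) ^ k) (at x within {0..1})"
  unfolding real_vec_deriv[symmetric] x by simp
 qed simp
 then show ?thesis unfolding radk_def using N by (simp add: integral_unique)
qed

lemma radk_sum:
 assumes "finite I" "!!i. i : I ==> contU (F i)"
 shows "radk N (%s. \<Sum>i\<in>I. a i * F i s) r = (\<Sum>i\<in>I. a i * radk N (F i) r)"
proof -
 have "radk N (%s. \<Sum>i\<in>I. a i * F i s) r = integral {0..1} (%ta. \<Sum>i\<in>I. a i * (ta ^ (N - 1) * F i (ta * r)))"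
  by (simp add: radk_def sum_distrib_left mult_ac)
 also have "... = (\<Sum>i\<in>I. integral {0..1} (%ta. a i * (ta ^ (N - 1) * F i (ta * r))))"
  by (rule integral_sum) (use assms in "auto intro!: integrable_on_mult_right radk_intb[simplified]")
 finally show ?thesis by (simp add: radk_def)
qed

lemma radk_times_power:
 assumes F: "contU F" and N: "1 <= N" and r: "0 <= r"
 shows "r ^ N * radk N F r = integral {0..r} (%s. s ^ (N - 1) * F s)"
proof (cases "r = 0")
 case False
 with r have r: "0 < r" by simp
 have "(%s. s ^ (N - 1) * F s) integrable_on {0..r}"
  by (intro intb_cont con_intros con_sub[OF F]) auto
 then have "((%s. s ^ (N - 1) * F s) has_integral integral {0..r} (%s. s ^ (N - 1) * F s)) {0..r}" by auto
 from has_integral_stretch_real[OF this, of r] r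
 have "((%ta. (r * ta) ^ (N - 1) * F (r * ta)) has_integral 1 / r * integral {0..r} (%s. s ^ (N - 1) * F s)) ((%x. x / r) ` {0..r})"
  by simp
 moreover have "(%x. x / r) ` {0..r} = {0..1}" using r by (auto simp: image_def field_simps zero_le_mult_iff intro!: bexI[of _ "_ * r"])
 ultimately have "integral {0..1} (%ta. (r * ta) ^ (N - 1) * F (r * ta)) = 1 / r * integral {0..r} (%s. s ^ (N - 1) * F s)"
  by (simp add: integral_unique)
 moreover have "integral {0..1} (%ta. (r * ta) ^ (N - 1) * F (r * ta)) = r ^ (N - 1) * radk N F r"
  unfolding radk_def integral_mult_right[symmetric] by (simp add: power_mult_distrib mult_ac)
 moreover have "r ^ N = r * r ^ (N - 1)" using N by (simp flip: power_Suc)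
 ultimately show ?thesis using r by (simp add: field_simps)
qed (use N in auto)

text \<open>Even powers of the norm are polynomials, so the components of |x - c|^(2i) (x - c) are
  smooth. The divergence of this field is (N + 2i) |x - c|^(2i).\<close>

lemma radial_field_monomial:
 fixes c :: "'a::euclidean_space"
 assumes s: "sob Om p w h" and p: "1 <= p" and Om: "bounded Om"
 shows "(LI x. norm (x - c) ^ (2 * i) * ((x - c) *. h x)) = - ((real DIM('a) + 2 * i) * (LI x. norm (x - c) ^ (2 * i) * w x))"
  "lint (%x. norm (x - c) ^ (2 * i) * ((x - c) *. h x))"
  "lint (%x. norm (x - c) ^ (2 * i) * w x)"
proof -
 let ?n = "%x. (x - c) *. (x - c)"
 define H where "H = (%b x. (2 * i * ?n x ^ (i - 1) * ((x - c) *. b)) *R (x - c) + (?n x ^ i) *R b)"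
 have d: "((%x. ?n x ^ i * ((x - c) *. b)) has_derivative (%v. H b x *. v)) (at x)" for b x
  unfolding H_def by (rule deriv_eqs refl)+ (auto simp: inner_add_left inner_commute algebra_simps)
 have cH: "contU (H b)" for b unfolding H_def by (intro con_intros)
 note ibp = sob_ibp[OF s p Om d cH]
 have n: "norm (x - c) ^ (2 * i) = ?n x ^ i" for x by (simp add: power_mult power2_norm_eq_inner)
 have e1: "norm (x - c) ^ (2 * i) * ((x - c) *. h x) = (\<Sum>b\<in>Basis. (h x *. b) * (?n x ^ i * ((x - c) *. b)))" for x
  unfolding n euclidean_inner[of "x - c" "h x"] sum_distrib_left by (simp add: mult_ac)
 have HB: "(\<Sum>b\<in>Basis. H b x *. b) = (real DIM('a) + 2 * i) * ?n x ^ i" for x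
 proof -
  have "(\<Sum>b\<in>Basis. H b x *. b) = (\<Sum>b\<in>Basis. (2 * i * ?n x ^ (i - 1)) * (((x - c) *. b) * ((x - c) *. b)) + ?n x ^ i)"
  by (rule sum.cong) (auto simp: H_def inner_add_left)
  also have "... = 2 * i * ?n x ^ (i - 1) * ?n x + real DIM('a) * ?n x ^ i"
  unfolding euclidean_inner[of "x - c" "x - c"] sum.distrib by (simp add: sum_distrib_left)
  also have "2 * i * ?n x ^ (i - 1) * ?n x = 2 * i * ?n x ^ i" by (cases i) auto
  finally show ?thesis by (simp add: algebra_simps)
 qed
 have e2: "(\<Sum>b\<in>Basis. w x * (H b x *. b)) = (real DIM('a) + 2 * i) * (norm (x - c) ^ (2 * i) * w x)" for x
  unfolding sum_distrib_left[symmetric] HB n by simp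
 show i1: "lint (%x. norm (x - c) ^ (2 * i) * ((x - c) *. h x))"
  unfolding e1 by (intro Bochner_Integration.integrable_sum ibp)
 have "lint (%x. (real DIM('a) + 2 * i) * (norm (x - c) ^ (2 * i) * w x))"
  unfolding e2[symmetric] by (intro Bochner_Integration.integrable_sum ibp)
 moreover have "real DIM('a) + 2 * i ~= 0" by (simp add: add_nonneg_eq_0_iff)
 ultimately show i2: "lint (%x. norm (x - c) ^ (2 * i) * w x)" by simp
 have "(LI x. norm (x - c) ^ (2 * i) * ((x - c) *. h x)) = (\<Sum>b\<in>Basis. LI x. (h x *. b) * (?n x ^ i * ((x - c) *. b)))"
  unfolding e1 by (rule Bochner_Integration.integral_sum) (rule ibp)
 also have "... = - (\<Sum>b\<in>Basis. LI x. w x * (H b x *. b))" by (simp add: ibp(3) sum_negf)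
 also have "(\<Sum>b\<in>Basis. LI x. w x * (H b x *. b)) = (LI x. (\<Sum>b\<in>Basis. w x * (H b x *. b)))"
  by (rule Bochner_Integration.integral_sum[symmetric]) (rule ibp)
 finally show "(LI x. norm (x - c) ^ (2 * i) * ((x - c) *. h x)) = - ((real DIM('a) + 2 * i) * (LI x. norm (x - c) ^ (2 * i) * w x))"
  unfolding e2 by simp
qed

lemma bounded_norm_minus:
 assumes "bounded (Om :: 'a::real_normed_vector set)"
 obtains L where "!!x. x : Om ==> norm (x - c) <= L" "0 <= L"
proof -
 obtain e where e: "ALL x:Om. dist c x <= e" using assms bounded_any_center by blast
 show ?thesis by (rule that[of "max e 0"]) (use e in "auto simp: dist_norm norm_minus_commute")
qed

lemma radial_field_intb:
 fixes c :: "'a::euclidean_space"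
 assumes s: "sob Om p w h" and p: "1 <= p" and Om: "bounded Om" and F: "contU F"
 shows "lint (%x. F (norm (x - c)) * ((x - c) *. h x))" (is ?A)
  "lint (%x. F (norm (x - c)) * w x)" (is ?B)
proof -
 obtain L where L: "!!x. x : Om ==> norm (x - c) <= L" and L0: "0 <= L"
  by (rule bounded_norm_minus[OF Om, of c]) blast
 have "compact (F ` {0..L})" by (intro cpt_image con_sub[OF F]) auto
 then obtain M where M: "!!t. t : {0..L} ==> <|F t|> <= M" using cpt_bounded bounded_iff by (metis imageI real_norm_def)
 have M0: "0 <= M" using M[of 0] L0 by simp
 have p0: "0 < p" using p by simp
 note i = sob_integrable_L1[OF s p Om]
 have [measurable]: "w : lmeas" "h : lmeas" using sob_meas[OF s] by auto
 have [measurable]: "(%x::'a. F (norm (x - c))) : lmeas"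
  by (rule con_meas) (intro con_comp[OF F] con_intros, auto)
 have [measurable]: "(%x::'a. x - c) : lmeas"
  by (rule con_meas) (intro con_intros)
 note out = sob_outside[OF s p0]
 show ?A
 proof (rule intb_bound[of _ "%x. (M * L) *R norm (h x)"])
  show "AL x. norm (F (norm (x - c)) * ((x - c) *. h x)) <= norm ((M * L) *R norm (h x))"
  using out
  proof eventually_elim
  case (elim x)
  show ?case
  proof (cases "x : Om")
  case True
  have "<|F (norm (x - c))|> * <|(x - c) *. h x|> <= M * (L * norm (h x))"
  by (intro mult_mono M order_trans[OF Cauchy_Schwarz_ineq2] mult_rm L[OF True] mult_nonneg_nonneg M0 L0)
  (use L[OF True] norm_ge_zero[of "x - c"] in auto)
  then show ?thesis using M0 L0 by (simp add: abs_mult mult.assoc)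
  qed (use elim in simp)
  qed
 qed (use i in "auto intro: measurable")
 show ?B
 proof (rule intb_bound[of _ "%x. M * <|w x|>"])
  show "AL x. norm (F (norm (x - c)) * w x) <= norm (M * <|w x|>)"
  using out
  proof eventually_elim
  case (elim x)
  show ?case
  proof (cases "x : Om")
  case True
  have "<|F (norm (x - c))|> * <|w x|> <= M * <|w x|>" by (intro mult_rm M) (use L[OF True] in auto)
  then show ?thesis using M0 by (simp add: abs_mult)
  qed (use elim in simp)
  qed
 qed (use i in auto)
qed

text \<open>Both sides depend linearly on \<open>F\<close> and are bounded by its supremum on
  [0, L], so even polynomials suffice. Weierstrass approximation of F(sqrt s) provides them, and
  \<open>radk\<close> never has to be differentiated.\<close>

lemma radial_field_ibp:
 fixes c :: "'a::euclidean_space"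
 assumes s: "sob Om p w h" and p: "1 <= p" and Om: "bounded Om" and F: "contU F"
 shows "(LI x. radk DIM('a) F (norm (x - c)) * ((x - c) *. h x)) = - (LI x. F (norm (x - c)) * w x)"
proof -
 let ?N = "DIM('a)"
 let ?J = "%F. (LI x. radk ?N F (norm (x - c)) * ((x - c) *. h x)) + (LI x. F (norm (x - c)) * w x)"
 note int = radial_field_intb[OF s p Om, where c = c]
 obtain L where L: "!!x. x : Om ==> norm (x - c) <= L" and L0: "0 <= L"
  by (rule bounded_norm_minus[OF Om, of c]) blast
 have p0: "0 < p" using p by simp
 note i = sob_integrable_L1[OF s p Om]
 have poly: "?J (%t. \<Sum>i\<le>n. a i * t ^ (2 * i)) = 0" for n and a :: "nat => real"
 proof -
  note m = radial_field_monomial[OF s p Om, of c]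
  have e: "radk ?N (%t. \<Sum>i\<le>n. a i * t ^ (2 * i)) r = (\<Sum>i\<le>n. a i * (r ^ (2 * i) / (?N + 2 * i)))" for r
  by (subst radk_sum) (auto intro!: con_intros simp: radk_monomial)
  have "(LI x. radk ?N (%t. \<Sum>i\<le>n. a i * t ^ (2 * i)) (norm (x - c)) * ((x - c) *. h x))
  = (LI x. (\<Sum>i\<le>n. a i / (?N + 2 * i) * (norm (x - c) ^ (2 * i) * ((x - c) *. h x))))"
  unfolding e by (simp add: sum_distrib_left sum_distrib_right mult_ac)
  also have "... = (\<Sum>i\<le>n. LI x. a i / (?N + 2 * i) * (norm (x - c) ^ (2 * i) * ((x - c) *. h x)))"
  by (rule Bochner_Integration.integral_sum) (intro integrable_mult_right m)
  also have "... = (\<Sum>i\<le>n. - (LI x. a i * (norm (x - c) ^ (2 * i) * w x)))"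
  proof (rule sum.cong[OF refl])
  fix i
  have ne: "real ?N + 2 * real i ~= 0" by (simp add: add_nonneg_eq_0_iff)
  have "(LI x. a i / (?N + 2 * i) * (norm (x - c) ^ (2 * i) * ((x - c) *. h x)))
  = a i / (real ?N + 2 * i) * - ((real ?N + 2 * i) * (LI x. norm (x - c) ^ (2 * i) * w x))"
  unfolding m(1)[symmetric] by simp
  also have "... = - (a i * (LI x. norm (x - c) ^ (2 * i) * w x))" using ne by simp
  finally show "(LI x. a i / (?N + 2 * i) * (norm (x - c) ^ (2 * i) * ((x - c) *. h x)))
  = - (LI x. a i * (norm (x - c) ^ (2 * i) * w x))" by simp
  qed
  also have "... = - (\<Sum>i\<le>n. LI x. a i * (norm (x - c) ^ (2 * i) * w x))" by (simp add: sum_negf)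
  also have "(\<Sum>i\<le>n. LI x. a i * (norm (x - c) ^ (2 * i) * w x)) = (LI x. (\<Sum>i\<le>n. a i * (norm (x - c) ^ (2 * i) * w x)))"
  by (rule Bochner_Integration.integral_sum[symmetric]) (intro integrable_mult_right m)
  also have "... = (LI x. (\<Sum>i\<le>n. a i * norm (x - c) ^ (2 * i)) * w x)" by (simp add: sum_distrib_left sum_distrib_right mult_ac)
  finally show ?thesis by linarith
 qed
 define C where "C = L * (LI x. norm (h x)) + (LI x. <|w x|>)"
 have C: "0 <= C" unfolding C_def using L0 by (intro add_nonneg_nonneg mult_nonneg_nonneg) auto
 have bound: "<|?J F|> <= e * C" if e: "0 < e" for e
 proof -
  have "continuous_on {0..L\<^sup>2} (%s. F (sqrt s))"
  by (rule con_comp[OF F]) (auto intro!: con_intros)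
  from Stone_Weierstrass_real_polynomial_function[OF _ this e]
  obtain g where g: "real_polynomial_function g" "!!s. s : {0..L\<^sup>2} ==> <|F (sqrt s) - g s|> < e" by auto
  obtain a n where a: "g = (%x. \<Sum>i\<le>n. a i * x ^ i)" using g(1) real_polynomial_function_iff_sum by blast
  define P where "P = (%t::real. \<Sum>i\<le>n. a i * t ^ (2 * i))"
  have Pc: "contU P" unfolding P_def by (intro con_intros)
  have Dc: "contU (%t. F t - P t)" by (intro con_intros F Pc)
  have D: "<|F t - P t|> <= e" if "0 <= t" "t <= L" for t
  using g(2)[of "t\<^sup>2"] that by (simp add: a P_def power_mult[symmetric] power_mono less_imp_le flip: power_mult)
  have "?J F - ?J P = (LI x. radk ?N (%t. F t - P t) (norm (x - c)) * ((x - c) *. h x)) + (LI x. (F (norm (x - c)) - P (norm (x - c))) * w x)"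
  using int[OF continuous_radk[OF F]] int[OF continuous_radk[OF Pc]] int[OF F] int[OF Pc]
  by (simp add: radk_diff[OF F Pc] left_diff_distrib)
  moreover have "?J P = 0" unfolding P_def by (rule poly)
  moreover have "<|LI x. radk ?N (%t. F t - P t) (norm (x - c)) * ((x - c) *. h x)|> <= (LI x. e * L * norm (h x))"
  proof (rule order_trans[OF integral_abs_bound integral_mono_AE])
  show "lint (%x. <|radk ?N (%t. F t - P t) (norm (x - c)) * ((x - c) *. h x)|>)"
  using int[OF continuous_radk[OF Dc]] by auto
  show "AL x. <|radk ?N (%t. F t - P t) (norm (x - c)) * ((x - c) *. h x)|> <= e * L * norm (h x)"
  using sob_outside[OF s p0]
  proof eventually_elim
  case (elim x)
  show ?case
  proof (cases "x : Om")
  case True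
  have "<|radk ?N (%t. F t - P t) (norm (x - c))|> <= e"
  by (rule radk_abs_le[OF Dc]) (use D L[OF True] in auto)
  then have "<|radk ?N (%t. F t - P t) (norm (x - c))|> * <|(x - c) *. h x|> <= e * (L * norm (h x))"
  using e L0 by (intro mult_mono order_trans[OF Cauchy_Schwarz_ineq2] mult_rm L[OF True]) auto
  then show ?thesis by (simp add: abs_mult)
  qed (use elim in simp)
  qed
  qed (use i in auto)
  moreover have "<|LI x. (F (norm (x - c)) - P (norm (x - c))) * w x|> <= (LI x. e * <|w x|>)"
  proof (rule order_trans[OF integral_abs_bound integral_mono_AE])
  show "lint (%x. <|(F (norm (x - c)) - P (norm (x - c))) * w x|>)" using int[OF Dc] by auto
  show "AL x. <|(F (norm (x - c)) - P (norm (x - c))) * w x|> <= e * <|w x|>"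
  using sob_outside[OF s p0]
  proof eventually_elim
  case (elim x)
  show ?case
  proof (cases "x : Om")
  case True
  show ?thesis unfolding abs_mult by (intro mult_rm D) (use L[OF True] in auto)
  qed (use elim in simp)
  qed
  qed (use i in auto)
  ultimately show ?thesis unfolding C_def by (simp add: algebra_simps)
 qed
 have "?J F = 0"
 proof (rule ccontr)
  assume n: "?J F ~= 0"
  define e where "e = <|?J F|> / (2 * (C + 1))"
  have "0 < e" unfolding e_def using n C by (intro divide_pos_pos) auto
  have "e * (2 * (C + 1)) = <|?J F|>" unfolding e_def using C by simp
  then show False using bound[OF \<open>0 < e\<close>] \<open>0 < e\<close> C mult_nonneg_nonneg[of e C] by (simp add: algebra_simps)
 qed
 then show ?thesis by linarith
qed

subsection \<open>Radial barriers\<close>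

text \<open>The extension by the identity to negative arguments makes this a bijection of the real line.\<close>

definition flow :: "real => real => real => real => real" where
 "flow al p q s = (if s < 0 then s else al * s powr (p - 1) + s powr (q - 1))"

context
 fixes al p q :: real
 assumes pq: "1 < q" "q <= p" "0 <= al"
begin

lemma flow_strict_mono: "strict_mono (flow al p q)"
proof (rule strict_monoI)
 fix x y :: real assume xy: "x < y"
 show "flow al p q x < flow al p q y"
 proof (cases "x < 0")
  case True
  have "0 <= flow al p q y" if "y >= 0" using that pq by (simp add: flow_def)
  then show ?thesis using True xy by (cases "y < 0") (auto simp: flow_def)
 next
  case False
  have "x powr (q - 1) < y powr (q - 1)" "x powr (p - 1) <= y powr (p - 1)"
  using False xy pq by (auto intro!: powr_less_mono2 powr_mono2)
  then show ?thesis using False xy pq by (auto simp: flow_def intro!: add_le_less_mono mult_lm)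
 qed
qed

lemma flow_continuous: "continuous_on {0..} (flow al p q)"
proof -
 have "continuous_on {0..} (%s::real. al * s powr (p - 1) + s powr (q - 1))"
  using pq by (intro continuous_on_add continuous_on_mult continuous_on_powr' continuous_on_const continuous_on_id) auto
 then show ?thesis by (rule continuous_on_eq) (simp add: flow_def)
qed

lemma flow_surj: "EX x. flow al p q x = y"
proof (cases "y < 0")
 case False
 define b where "b = y powr (1 / (q - 1))"
 have b: "b powr (q - 1) = y" "0 <= b" using False pq by (auto simp: b_def powr_powr)
 have "EX x>=0. x <= b & flow al p q x = y"
  by (rule IVT'[OF _ _ _ con_sub[OF flow_continuous]]) (use b False pq in "auto simp: flow_def")
 then show ?thesis by blast
qed (auto simp: flow_def)

definition "flow_inv = inv (flow al p q)"

lemma flow_flow_inv [simp]: "flow al p q (flow_inv y) = y"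
 unfolding flow_inv_def by (rule f_inv_into_f) (use flow_surj[of y] in auto)

lemma flow_inv_flow [simp]: "flow_inv (flow al p q y) = y"
 unfolding flow_inv_def using strict_mono_imp_inj_on[OF flow_strict_mono] by simp

lemma flow_inv_le_iff [simp]: "flow_inv x <= flow_inv y \<longleftrightarrow> x <= y"
 using strict_mono_less_eq[OF flow_strict_mono, of "flow_inv x" "flow_inv y"] by simp

lemma flow_inv_less_iff [simp]: "flow_inv x < flow_inv y \<longleftrightarrow> x < y"
 using strict_mono_less[OF flow_strict_mono, of "flow_inv x" "flow_inv y"] by simp

lemma flow_inv_zero [simp]: "flow_inv 0 = 0"
 using flow_inv_flow[of 0] by (simp add: flow_def)

lemma flow_inv_continuous: "contU flow_inv"
proof (rule continuous_onI_mono)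
 have "flow_inv ` UNIV = UNIV" using flow_inv_flow by (metis surjI)
 then show "open (flow_inv ` UNIV)" by simp
qed simp

lemma flux_radial:
 fixes x :: "'a::euclidean_space"
 assumes "0 <= y" "x ~= 0"
 shows "flux al p q (- (y / norm x) *R x) = - (flow al p q y / norm x) *R x"
proof -
 have fl: "fl r (- (y / norm x) *R x) = - (y powr (r - 1) / norm x) *R x" for r
 proof -
  have "norm (- (y / norm x) *R x) = y" using assms by simp
  then have "fl r (- (y / norm x) *R x) = - (y powr (r - 2) * y / norm x) *R x" by (simp add: fl_def)
  then show ?thesis using powr_mult_self[OF assms(1), of "r - 2"] by simp
 qed
 show ?thesis unfolding flux_def fl using assms by (simp add: flow_def scaleR_add_left[symmetric] field_simps)
qed

end

locale barrier =
 fixes c :: "'a::euclidean_space" and R al p q :: real and F :: "real => real"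
 assumes R: "0 < R" and pq: "1 < q" "q <= p" "0 <= al"
  and F: "contU F" "!!t. 0 <= F t" "0 < F 0"
begin

text \<open>Minus the derivative of the radial solution: by the divergence theorem the flux through
  the sphere of radius r equals the mass of the source inside, that is, \<open>flow\<close> of the
  slope is \<open>r * radk DIM('a) F r\<close>.\<close>

definition "slope r = flow_inv al p q (r * radk DIM('a) F r)"
definition "prof r = integral {r..R} slope"
definition "bar x = (if norm (x - c) < R then prof (norm (x - c)) else 0)"
definition "bar_grad x = (if norm (x - c) < R then - (slope (norm (x - c)) / norm (x - c)) *R (x - c) else 0)"

lemma slope_con: "contU slope"
 unfolding slope_def by (intro con_comp[OF flow_inv_continuous[OF pq]] con_intros continuous_radk F) auto

lemma mass_pos:
 assumes r: "0 < r" shows "0 < integral {0..r} (%s. s ^ (DIM('a) - 1) * F s)"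
proof -
 have c: "continuous_on {0..r} (%s. s ^ (DIM('a) - 1) * F s)"
  by (intro con_intros con_sub[OF F(1)]) auto
 have "integral {0..r} (%s. s ^ (DIM('a) - 1) * F s) ~= 0"
 proof
  assume z: "integral {0..r} (%s. s ^ (DIM('a) - 1) * F s) = 0"
  have z2: "s ^ (DIM('a) - 1) * F s = 0" if "s : {0..r}" for s
  using integral_eq_0_iff[OF c r] z F(2) that by simp
  have "isCont F 0" using F(1) con_eq_at open_UNIV by blast
  then have "\<forall>\<^sub>F s in at 0. 0 < F s" unfolding isCont_def using order_tendstoD(1) F(3) by blast
  then obtain d where d: "0 < d" "!!s. s ~= 0 ==> <|s|> < d ==> 0 < F s" by (auto simp: eventually_at dist_real_def)
  have "0 < F (min r (d / 2))" using r d by (intro d(2)) auto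
  moreover have "min r (d / 2) ^ (DIM('a) - 1) * F (min r (d / 2)) = 0" by (rule z2) (use r d in auto)
  moreover have "0 < min r (d / 2)" using r d by simp
  ultimately show False by simp
 qed
 moreover have "0 <= integral {0..r} (%s. s ^ (DIM('a) - 1) * F s)"
  by (rule integral_nonneg) (use c F(2) in "auto intro!: intb_cont")
 ultimately show ?thesis by linarith
qed

lemma radk_pos:
 assumes r: "0 < r" shows "0 < radk DIM('a) F r"
 using mass_pos[OF r] radk_times_power[OF F(1), of "DIM('a)" r] r
 by (metis DIM_ge_Suc0 One_nat_def less_eq_real_def zero_less_mult_pos zero_less_power)

lemma slope_pos: "0 < r ==> 0 < slope r"
 unfolding slope_def using flow_inv_less_iff[OF pq, of 0] flow_inv_zero[OF pq] radk_pos[of r] by simp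

lemma slope_zero [simp]: "slope 0 = 0"
 unfolding slope_def using flow_inv_zero[OF pq] by simp

lemma slope_nonneg: "0 <= r ==> 0 <= slope r"
 using slope_pos[of r] by (cases "r = 0") auto

lemma flow_slope: "flow al p q (slope r) = r * radk DIM('a) F r"
 unfolding slope_def by (rule flow_flow_inv[OF pq])

lemma slope_integrable: "slope integrable_on {a..b}"
 by (intro intb_cont con_sub[OF slope_con]) auto

lemma prof_derivative:
 assumes "a <= r" "r <= R" shows "(prof has_real_derivative - slope r) (at r within {a..R})"
 unfolding prof_def[abs_def]
 using integral_has_vector_derivative'[OF con_sub[OF slope_con], of a R r] assms
 by (simp add: real_vec_deriv)

lemma prof_DERIV:
 assumes "r < R" shows "(prof has_real_derivative - slope r) (at r)"
proof -
 have "(prof has_real_derivative - slope r) (at r within {r - 1..R})" using assms by (intro prof_derivative) auto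
 then show ?thesis using assms by (simp add: at_within_interior[of r "{r - 1..R}"])
qed

lemma prof_R [simp]: "prof R = 0" by (simp add: prof_def)

lemma prof_diff: "0 <= r ==> r <= s ==> s <= R ==> prof r - prof s = integral {r..s} slope"
 unfolding prof_def using hk_combine[OF _ _ slope_integrable, of r s R] by simp

lemma prof_strict_decreasing:
 assumes "0 <= r" "r < s" "s <= R" shows "prof s < prof r"
proof (rule DERIV_neg_imp_decreasing_open[OF assms(2)])
 show "EX y. DERIV prof x :> y & y < 0" if "r < x" "x < s" for x
  using prof_DERIV[of x] slope_pos[of x] that assms by (intro exI[of _ "- slope x"]) auto
 have "continuous_on {r..R} prof"
  by (rule DERIV_continuous_on[OF prof_derivative]) auto
 then show "continuous_on {r..s} prof" by (rule con_sub) (use assms in auto)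
qed

lemma prof_pos: "0 <= r ==> r < R ==> 0 < prof r"
 using prof_strict_decreasing[of r R] by simp

lemma bar_nonneg: "0 <= bar x" using prof_pos[of "norm (x - c)"] by (auto simp: bar_def)

lemma bar_pos: "x : ball c R ==> 0 < bar x"
 using prof_pos[of "norm (x - c)"] by (auto simp: bar_def dist_norm norm_minus_commute)

lemma bar_le: "bar x <= prof 0"
 using prof_pos[of 0] prof_strict_decreasing[of 0 "norm (x - c)"] R
 by (cases "x = c") (auto simp: bar_def less_imp_le)

lemma bar_continuous: "contU bar"
proof -
 have p: "continuous_on {0..R} prof" by (rule DERIV_continuous_on[OF prof_derivative]) auto
 have "bar = (%x. prof (min (norm (x - c)) R))" using R by (auto simp: bar_def min_def)
 moreover have "contU (%x. prof (min (norm (x - c)) R))"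
  by (rule con_comp[OF p]) (use R in "auto intro!: con_intros")
 ultimately show ?thesis by simp
qed

lemma bar_grad_bounded: obtains M where "!!x. norm (bar_grad x) <= M"
proof -
 have "compact (slope ` {0..R})" by (intro cpt_image con_sub[OF slope_con]) auto
 then obtain M where M: "!!t. t : {0..R} ==> <|slope t|> <= M" using cpt_bounded bounded_iff by (metis imageI real_norm_def)
 have "norm (bar_grad x) <= M" for x
 proof -
  have "norm (bar_grad x) <= <|slope (norm (x - c))|>" by (auto simp: bar_grad_def)
  then show ?thesis using M[of "norm (x - c)"] M[of 0] R by (cases "norm (x - c) < R") (auto simp: bar_grad_def)
 qed
 then show ?thesis using that by blast
qed

lemma bar_derivative:
 assumes x: "x : ball c R" shows "(bar has_derivative (%v. bar_grad x *. v)) (at x)"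
proof -
 have xR: "norm (x - c) < R" using x by (simp add: dist_norm norm_minus_commute)
 have "((%x. prof (norm (x - c))) has_derivative (%v. bar_grad x *. v)) (at x)"
 proof (cases "x = c")
  case False
  have "((%x. norm (x - c)) has_derivative (%v. v *. sgn (x - c))) (at x)"
  proof -
  have "(norm has_derivative (%v. v *. sgn (x - c))) (at (x - c))" using False by (intro has_derivative_norm) auto
  moreover have "((%x. x - c) has_derivative (%v. v)) (at x)" by (auto intro!: deriv_eqs)
  ultimately show ?thesis using has_derivative_compose[of "%x. x - c" "%v. v" x UNIV norm] by simp
  qed
  from DERIV_compose_FDERIV[OF prof_DERIV[OF xR] this]
  show ?thesis by (rule has_derivative_eq_rhs) (use xR False in "auto simp: fun_eq_iff bar_grad_def sgn_div_norm inner_commute divide_simps")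
 next
  case True
  have d: "(prof has_real_derivative 0) (at 0)" using prof_DERIV[of 0] R by simp
  have l: "((%t. (prof t - prof 0) / t) \<longlongrightarrow> 0) (at 0)" using d unfolding has_field_derivative_iff by simp
  \<comment> \<open>The norm is not differentiable at the centre, but the slope vanishes there, so
    the difference quotient tends to 0.\<close>
  have "((%y. (prof (norm (y - c)) - prof 0) / norm (y - c)) \<longlongrightarrow> 0) (at c)"
  by (rule filterlim_compose[OF l]) (auto simp: filterlim_at eventually_at_filter intro!: tendsto_eq_intros)
  then show ?thesis using True
  by (simp add: has_derivative_within bar_grad_def bounded_linear_inner_right divide_inverse_commute)
 qed
 then show ?thesis
  by (rule has_derivative_transform_within_open[OF _ open_ball x]) (auto simp: bar_def dist_norm norm_minus_commute)
qed

lemma bar_grad_continuous: "continuous_on (ball c R) bar_grad"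
 unfolding con_eq_at[OF open_ball]
proof
 fix x assume x: "x : ball c R"
 then have xR: "norm (x - c) < R" by (simp add: dist_norm norm_minus_commute)
 have "contU (%y. slope (norm (y - c)))"
  by (rule con_comp[OF slope_con]) (auto intro!: con_intros)
 then have sc: "isCont (%y. slope (norm (y - c))) x" for x using con_eq_at[OF open_UNIV] by blast
 have ev: "\<forall>\<^sub>F y in nhds x. - (slope (norm (y - c)) / norm (y - c)) *R (y - c) = bar_grad y"
  using x open_ball[of c R] unfolding eventually_nhds by (intro exI[of _ "ball c R"]) (auto simp: bar_grad_def dist_norm norm_minus_commute)
 have "isCont (%y. - (slope (norm (y - c)) / norm (y - c)) *R (y - c)) x"
 proof (cases "x = c")
  case False
  then show ?thesis by (intro con_intros sc) auto
 next
  case True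
  have "((%y. slope (norm (y - c))) \<longlongrightarrow> slope (norm (c - c))) (at c)"
  using sc[of c] by (simp add: isCont_def)
  then have "((%y. norm (slope (norm (y - c)))) \<longlongrightarrow> 0) (at c)" by (simp add: tendsto_rabs_zero)
  then have "((%y. norm (- (slope (norm (y - c)) / norm (y - c)) *R (y - c))) \<longlongrightarrow> 0) (at c)"
  by (rule Lim_transform_eventually) (auto simp: eventually_at_filter)
  then show ?thesis using True unfolding isCont_def by (simp only: tendsto_norm_zero_iff) simp
 qed
 then show "isCont bar_grad x" using isCont_cong[OF ev] by blast
qed

lemma bar_sob: "0 < s ==> sob (ball c R) s bar bar_grad"
proof -
 assume s: "0 < s"
 obtain M where M: "!!x. norm (bar_grad x) <= M" by (rule bar_grad_bounded) (rule that)
 show ?thesis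
  by (rule sob_C1_zero_boundary[OF open_ball bounded_ball bar_continuous bar_nonneg _ bar_derivative bar_grad_continuous _ M bar_pos s])
  (auto simp: bar_def bar_grad_def dist_norm norm_minus_commute)
qed

lemma flux_bar_grad:
 "flux al p q (bar_grad x) = (if norm (x - c) < R then - radk DIM('a) F (norm (x - c)) *R (x - c) else 0)"
proof (cases "x ~= c & norm (x - c) < R")
 case True
 then show ?thesis using flux_radial[OF pq slope_nonneg[of "norm (x - c)"], of "x - c"]
  by (simp add: bar_grad_def flow_slope)
qed (auto simp: bar_grad_def)

lemma bar_weak:
 assumes s: "sob Om p w h" and Om: "bounded Om" and out: "AL x. x ~: ball c R --> h x = 0"
 shows "(LI x. flux al p q (bar_grad x) *. h x) = (LI x. F (norm (x - c)) * w x)"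
  "lint (%x. flux al p q (bar_grad x) *. h x)"
proof -
 have p: "1 <= p" using pq by simp
 let ?k = "%x. - (radk DIM('a) F (norm (x - c)) * ((x - c) *. h x))"
 have [measurable]: "h : lmeas" using sob_meas[OF s] by auto
 have [measurable]: "bar_grad : lmeas" using sob_meas[OF bar_sob[of 1]] by auto
 have i: "lint ?k" using radial_field_intb(1)[OF s p Om continuous_radk[OF F(1)]] by auto
 have m: "(%x. flux al p q (bar_grad x) *. h x) : lmeas" by measurable
 have ae: "AL x. flux al p q (bar_grad x) *. h x = ?k x"
  using out by eventually_elim (auto simp: flux_bar_grad dist_norm norm_minus_commute)
 show "(LI x. flux al p q (bar_grad x) *. h x) = (LI x. F (norm (x - c)) * w x)"
  using integral_cong_AE[OF m borel_measurable_integrable[OF i] ae] radial_field_ibp[OF s p Om F(1), of c] by simp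
 show "lint (%x. flux al p q (bar_grad x) *. h x)"
  by (rule integrable_cong_AE_imp[OF i m]) (use ae in eventually_elim, simp)
qed

lemma bar_supersol:
 assumes Om: "Om <= ball c R"
 shows "supersol Om al p q bar_grad (%x. F (norm (x - c)))"
 unfolding supersol_def
proof (intro allI impI)
 fix w h B assume s: "sob Om p w h" and w: "ALL x. 0 <= w x & w x <= B"
 have p: "0 < p" "1 <= p" using pq by auto
 have b: "bounded Om" using Om bounded_ball bounded_subset by blast
 have "AL x. x ~: ball c R --> h x = 0"
  using sob_outside[OF s p(1)] by eventually_elim (use Om in auto)
 note bw = bar_weak[OF s b this]
 have nn: "0 <= F (norm (x - c)) * w x" for x using F(2) w by simp
 have "(NI x. ennreal (F (norm (x - c)) * w x)) = ennreal (LI x. F (norm (x - c)) * w x)"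
  by (rule nn_eq_lint[OF radial_field_intb(2)[OF s p(2) b F(1)]]) (simp add: nn)
 moreover have "0 <= (LI x. F (norm (x - c)) * w x)" by (simp add: nn)
 ultimately show "0 <= (LI x. flux al p q (bar_grad x) *. h x) &
  (NI x. ennreal (F (norm (x - c)) * w x)) <= ennreal (LI x. flux al p q (bar_grad x) *. h x)"
  unfolding bw(1) by simp
qed

text \<open>Comparison: test both equations with the positive part of \<open>bar - u\<close>.\<close>

lemma bar_le_supersol:
 assumes Om: "open Om" "bounded Om" "ball c R <= Om" and u: "sob Om p u g" "!!x. 0 <= u x"
  and s: "supersol Om al p q g f" and f: "f : lmeas"
  and le: "AL x. x : ball c R --> F (norm (x - c)) <= f x"
 shows "AL x. bar x <= u x"
proof -
 have p: "0 < p" "1 < p" "1 <= p" using pq by auto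
 let ?w = "%x. max (bar x - u x - 0) 0" and ?h = "%x. if bar x - u x > 0 then bar_grad x - g x else 0"
 have sb: "sob Om p bar bar_grad" by (rule sob_mono[OF bar_sob[OF p(1)] Om(3)])
 have sw: "sob Om p ?w ?h" by (rule sob_pos_part[OF sob_diff[OF sb u(1) p(1)] p(1) order_refl])
 have wB: "ALL x. 0 <= ?w x & ?w x <= prof 0"
 proof
  show "0 <= ?w x & ?w x <= prof 0" for x using bar_le[of x] u(2)[of x] prof_pos[of 0] R by auto
 qed
 have outb: "x ~: ball c R ==> bar x = 0" for x by (simp add: bar_def dist_norm norm_minus_commute)
 have out: "AL x. x ~: ball c R --> ?h x = 0"
 proof (intro AE_I2 impI)
  fix x assume "x ~: ball c R"
  then have "bar x - u x <= 0" using outb[of x] u(2)[of x] by simp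
  then show "?h x = 0" by simp
 qed
 note bw = bar_weak[OF sw Om(2) out]
 have gi: "grad_int Om p g" using sob_grad_int[OF u(1) p(1)] Om(1) by simp
 have ig: "lint (%x. flux al p q (g x) *. ?h x)"
  by (rule flux_dominated[OF Om(1,2) pq gi sw])
 have iF: "lint (%x. F (norm (x - c)) * ?w x)" by (rule radial_field_intb(2)[OF sw p(3) Om(2) F(1)])
 have "ennreal (LI x. F (norm (x - c)) * ?w x) = (NI x. ennreal (F (norm (x - c)) * ?w x))"
  by (rule nn_eq_lint[symmetric, OF iF]) (use F(2) in auto)
 also have "... <= (NI x. ennreal (f x * ?w x))"
 proof (rule nn_integral_mono_AE, use le in eventually_elim)
  fix x assume x: "x : ball c R --> F (norm (x - c)) <= f x"
  show "ennreal (F (norm (x - c)) * ?w x) <= ennreal (f x * ?w x)"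
  proof (cases "x : ball c R")
  case True
  then show ?thesis using x by (intro ennreal_leI mult_rm) auto
  next
  case False
  then have "?w x = 0" using outb[of x] u(2)[of x] by simp
  then show ?thesis by simp
  qed
 qed
 also have "... <= ennreal (LI x. flux al p q (g x) *. ?h x)" using s sw wB unfolding supersol_def by blast
 finally have "(LI x. F (norm (x - c)) * ?w x) <= (LI x. flux al p q (g x) *. ?h x)"
  using s sw wB unfolding supersol_def by (subst (asm) ennreal_le_iff) blast+
 then have le0: "(LI x. flux al p q (bar_grad x) *. ?h x - flux al p q (g x) *. ?h x) <= 0"
  using bw ig by simp
 have nn: "0 <= flux al p q (bar_grad x) *. ?h x - flux al p q (g x) *. ?h x" for x
  using flux_monotone(1)[OF pq(3) p(2) pq(1), of "bar_grad x" "g x"] by (auto simp: inner_diff_left)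
 have "AL x. flux al p q (bar_grad x) *. ?h x - flux al p q (g x) *. ?h x = 0"
 proof (subst integral_nonneg_eq_0_iff_AE[symmetric])
  show "(LI x. flux al p q (bar_grad x) *. ?h x - flux al p q (g x) *. ?h x) = 0"
  by (rule order_antisym[OF le0 Bochner_Integration.integral_nonneg]) (rule nn)
 qed (use nn bw(2) ig in auto)
 then have "AL x. ?h x = 0"
  by eventually_elim (use flux_monotone(2)[OF pq(3) p(2) pq(1)] in "auto simp: inner_diff_left split: if_splits")
 have "AL x. ?w x = 0" by (rule sob_zero_gradient[OF sw p(3) Om(2) _ \<open>AL x. ?h x = 0\<close>]) simp
 then show ?thesis by eventually_elim (simp add: max_def split: if_splits)
qed

end

subsection \<open>The radial first eigenfunction of a ball\<close>

context
 fixes N :: nat and m :: real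
 assumes N: "1 <= N" and m: "0 < m"
begin

text \<open>The exponent m stands for r - 1. The positive part lets the radial equation be continued
  past the first zero of the profile.\<close>

definition "ptrunc G t = max (G t) 0 powr m" for G :: "real => real"
text \<open>The slope of a radial solution for the r-Laplacian alone with source G^m.\<close>

definition "decay G s = (s * radk N (ptrunc G) s) powr (1 / m)" for G :: "real => real"

lemma ptrunc_con: "continuous_on A G ==> continuous_on A (ptrunc G)"
 unfolding ptrunc_def using m by (intro continuous_on_powr' con_intros) auto

lemma ptrunc_nonneg [simp]: "0 <= ptrunc G t" by (simp add: ptrunc_def)

lemma ptrunc_le_one: "G t <= 1 ==> ptrunc G t <= 1"
 unfolding ptrunc_def using powr_mono2[of m "max (G t) 0" 1] m by simp

lemma radk_nonneg:
 assumes "contU F" "!!s. 0 <= F s" shows "0 <= radk N F r"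
 unfolding radk_def by (rule integral_nonneg[OF radk_intb[OF assms(1)]]) (use assms(2) in auto)

lemma decay_continuous:
 assumes "contU G" shows "continuous_on {0..} (decay G)"
 unfolding decay_def using m radk_nonneg[OF ptrunc_con[OF assms]]
 by (intro continuous_on_powr' con_intros con_sub[OF continuous_radk[OF ptrunc_con[OF assms]]]) auto

lemma decay_nonneg [simp]: "0 <= decay G s" by (simp add: decay_def)

lemma decay_intb:
 assumes "contU G" "0 <= a" shows "decay G integrable_on {a..b}"
 by (rule intb_cont, rule con_sub[OF decay_continuous[OF assms(1)]]) (use assms in auto)

lemma decay_le:
 assumes G: "contU G" "!!t. t <= s ==> G t <= 1" and s: "0 <= s"
 shows "decay G s <= s powr (1 / m)"
proof -
 have "<|radk N (ptrunc G) s|> <= 1"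
  by (rule radk_abs_le[OF ptrunc_con[OF G(1)] _ s]) (use G(2) ptrunc_le_one in auto)
 then have "s * radk N (ptrunc G) s <= s * 1" by (intro mult_lm) (use s in auto)
 then show ?thesis unfolding decay_def using m s radk_nonneg[OF ptrunc_con[OF G(1)]] by (intro powr_mono2) auto
qed

text \<open>Fixed points solve the initial value problem from the centre, with value 1 and slope 0
  there.\<close>

definition "volterra G t = 1 - integral {0..t} (decay G)" for G :: "real => real"

lemma volterra_nonpos [simp]: "t <= 0 ==> volterra G t = 1"
 by (cases "t = 0") (auto simp: volterra_def)

lemma volterra_le_one:
 assumes "contU G" shows "volterra G t <= 1"
 unfolding volterra_def using integral_nonneg[OF decay_intb[OF assms order_refl], of t] by simp

lemma volterra_diff:
 assumes G: "contU G" and "0 <= s" "s <= t"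
 shows "volterra G s - volterra G t = integral {s..t} (decay G)"
 unfolding volterra_def
 using hk_combine[OF assms(2,3) decay_intb[OF G order_refl]] by simp

lemma volterra_lipschitz:
 assumes G: "contU G" "!!t. t <= L ==> G t <= 1" and t: "s <= t" "t <= L"
 shows "<|volterra G s - volterra G t|> <= L powr (1 / m) * (t - s)"
proof (cases "0 <= t")
 case True
 have "<|volterra G (max s 0) - volterra G t|> <= L powr (1 / m) * (t - max s 0)"
 proof -
  have "norm (integral {max s 0..t} (decay G)) <= L powr (1 / m) * (t - max s 0)"
  proof (rule integral_bound)
  show "continuous_on {max s 0..t} (decay G)" by (rule con_sub[OF decay_continuous[OF G(1)]]) auto
  fix x assume "x : {max s 0..t}"
  then have "decay G x <= x powr (1 / m)" "x powr (1 / m) <= L powr (1 / m)"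
  using t m by (auto intro!: decay_le G powr_mono2)
  then show "norm (decay G x) <= L powr (1 / m)" by simp
  qed (use t True in auto)
  then show ?thesis using volterra_diff[OF G(1), of "max s 0" t] t True by simp
 qed
 also have "volterra G (max s 0) = volterra G s" by (cases "0 <= s") auto
 also have "L powr (1 / m) * (t - max s 0) <= L powr (1 / m) * (t - s)" by (intro mult_lm) auto
 finally show ?thesis .
qed (use t in auto)

lemma volterra_continuous:
 assumes G: "contU G" shows "contU (volterra G)"
proof -
 have "continuous_on {0..max b 1} (volterra G)" for b
  unfolding volterra_def by (intro con_intros indefinite_integral_continuous_1 decay_intb[OF G]) simp
 then have c: "continuous_on {0..b} (volterra G)" for b by (rule con_sub[of "{0..max b 1}" "volterra G" "{0..b}"]) auto
 have "isCont (volterra G) x" for x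
 proof -
  have "continuous_on {x - 1..x + 1} (%t. volterra G (max t 0))"
  by (rule con_comp[OF c[of "max (x + 1) 0"]]) (auto intro!: con_intros)
  moreover have "volterra G (max t 0) = volterra G t" for t by (cases "t <= 0") auto
  ultimately have "continuous_on {x - 1..x + 1} (volterra G)" by (simp only:)
  then show ?thesis by (rule continuous_on_interior) auto
 qed
 then show ?thesis by (simp add: con_at)
qed

text \<open>Delaying the argument by \<open>e\<close> makes the Volterra equation explicit; a subsequence of the solutions converges as \<open>e\<close> tends to 0.\<close>

primrec delay :: "real => nat => real => real" where
 "delay e 0 = (%t. 1)"
| "delay e (Suc j) = volterra (%s. delay e j (s - e))"

lemma delay_continuous: "contU (delay e j)"
 by (induction j) (auto intro!: volterra_continuous con_comp[where f = "%s. s - e"] con_intros)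

lemma delay_shift_continuous: "contU (%s. delay e j (s - e))"
 by (rule con_comp[OF delay_continuous]) (auto intro!: con_intros)

lemma delay_le_one: "delay e j t <= 1"
 by (cases j) (auto intro: volterra_le_one delay_shift_continuous)

text \<open>The right-hand side at t uses values only up to t - e, so each iteration settles the
  solution on one more interval of length e.\<close>

lemma delay_stable:
 assumes e: "0 < e" shows "t <= real j * e ==> delay e (Suc j) t = delay e j t"
proof (induction j arbitrary: t)
 case (Suc j)
 have "decay (%s. delay e (Suc j) (s - e)) s = decay (%s. delay e j (s - e)) s" if s: "s : {0..t}" for s
 proof -
  have "delay e (Suc j) (ta * s - e) = delay e j (ta * s - e)" if "ta : {0..1}" for ta
  proof (rule Suc.IH)
  have "ta * s <= 1 * t" using that s by (intro mult_mono) auto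
  then show "ta * s - e <= real j * e" using Suc.prems by (simp add: algebra_simps)
  qed
  then have "radk N (ptrunc (%s. delay e (Suc j) (s - e))) s = radk N (ptrunc (%s. delay e j (s - e))) s"
  unfolding radk_def by (intro integral_cong) (simp add: ptrunc_def del: delay.simps)
  then show ?thesis unfolding decay_def by simp
 qed
 then have "integral {0..t} (decay (%s. delay e (Suc j) (s - e))) = integral {0..t} (decay (%s. delay e j (s - e)))"
  by (rule integral_cong)
 then show ?case unfolding delay.simps(2)[of e "Suc j"] delay.simps(2)[of e j] volterra_def by simp
qed simp

text \<open>The powers m and 1 / m need not be Lipschitz at 0, so a contraction argument is not at
  hand. Solutions bounded above by 1 have slopes at most L^(1/m) on [0, L], and Arzela-Ascoli
  applies to the delayed solutions.\<close>

lemma volterra_fixpoint: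
 assumes L: "0 < L"
 obtains X where "contU X" "!!t. t : {0..L} ==> X t = volterra X t" "!!t. X t <= 1"
proof -
 \<comment> \<open>With this delay \<open>Suc n\<close> steps reach exactly \<open>L\<close>, so on
   [0, L] the iterate \<open>Suc n\<close> already solves the delayed equation.\<close>
 define e where "e n = L / real (Suc n)" for n
 define Z where "Z n = delay (e n) (Suc n)" for n
 have e: "0 < e n" for n using L by (simp add: e_def)
 have e0: "e ----> 0" using tendsto_mult_right_zero[OF inv_Suc(2), of L] by (simp add: e_def[abs_def])
 let ?sh = "%n s. Z n (s - e n)"
 have Zc: "contU (Z n)" "contU (?sh n)" for n unfolding Z_def by (rule delay_continuous delay_shift_continuous)+
 have Z1: "Z n t <= 1" for n t unfolding Z_def by (rule delay_le_one)
 have Zeq: "Z n t = volterra (?sh n) t" if "t <= L" for n t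
 proof -
  have "delay (e n) (Suc (Suc n)) t = delay (e n) (Suc n) t" by (rule delay_stable[OF e]) (use that L in "simp add: e_def")
  then show ?thesis unfolding Z_def delay.simps(2)[of _ "Suc n"] by simp
 qed
 define M where "M = L powr (1 / m)"
 have M: "0 <= M" by (simp add: M_def)
 have lip: "<|Z n s - Z n t|> <= M * <|s - t|>" if "s <= L" "t <= L" for n s t
 proof -
  have "<|Z n s - Z n t|> <= M * (t - s)" if "s <= t" "t <= L" for s t
  using volterra_lipschitz[OF Zc(2), of L n s t] Z1 that Zeq[of s n] Zeq[of t n] unfolding M_def by auto
  from this[of s t] this[of t s] that show ?thesis by (cases "s <= t") (auto simp: abs_minus_commute)
 qed
 have Z0: "Z n t = 1" if "t <= 0" for n t using Zeq[of t n] that L by simp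
 obtain g k where gc: "continuous_on {0..L} g" and k: "strict_mono (k :: nat => nat)"
  and gl: "!!e. 0 < e ==> EX N. ALL n x. n >= N & x : {0..L} --> norm (Z (k n) x - g x) < e"
 proof (rule Arzela_Ascoli[of "{0..L}" Z "1 + M * L"])
  fix n x assume x: "x : {0..L}"
  have "M * x <= M * L" using x M by (intro mult_lm) auto
  then show "norm (Z n x) <= 1 + M * L" using lip[of x 0 n] x L Z0[of 0 n] by auto
 next
  fix x e :: real assume x: "x : {0..L}" and e: "0 < e"
  show "EX d>0. ALL n y. y : {0..L} & norm (x - y) < d --> norm (Z n x - Z n y) < e"
  proof (intro exI[of _ "e / (M + 1)"] conjI allI impI)
  show "0 < e / (M + 1)" using e M by simp
  fix n y assume y: "y : {0..L} & norm (x - y) < e / (M + 1)"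
  then have "(M + 1) * <|x - y|> < e" using M by (simp add: field_simps)
  moreover have "M * <|x - y|> <= (M + 1) * <|x - y|>" by (intro mult_rm) auto
  ultimately show "norm (Z n x - Z n y) < e" using lip[of x y n] x y by simp
  qed
 qed auto
 define X where "X t = g (min (max t 0) L)" for t
 have Xc: "contU X" unfolding X_def
  by (rule con_comp[OF gc]) (use L in "auto intro!: con_intros")
 have lim: "(%n. Z (k n) t) ----> X t" if "t : {0..L}" for t
 proof (rule LIMSEQ_I)
  fix r :: real assume "0 < r"
  moreover have "X t = g t" using that by (simp add: X_def)
  ultimately show "EX no. ALL n>=no. norm (Z (k n) t - X t) < r" using gl[of r] that by metis
 qed
 have X1: "X t <= 1" for t
  using LIMSEQ_le_const2[OF lim[of "min (max t 0) L"], of 1] Z1 L by (auto simp: X_def)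
 have lim': "(%n. ?sh (k n) t) ----> X t" if "t : {0..L}" for t
 proof -
  have "(%n. M * e (k n)) ----> 0" using tendsto_mult_right_zero[OF LIMSEQ_subseq_LIMSEQ[OF e0 k], of M] by (simp add: o_def)
  then have "(%n. ?sh (k n) t - Z (k n) t) ----> 0"
  proof (rule Lim_null_comparison[rotated], intro always_eventually allI)
  fix n show "norm (?sh (k n) t - Z (k n) t) <= M * e (k n)"
  using lip[of "t - e (k n)" t "k n"] that e[of "k n"] by simp
  qed
  from tendsto_add[OF this lim[OF that]] show ?thesis by simp
 qed
 have rad: "(%n. radk N (ptrunc (?sh (k n))) s) ----> radk N (ptrunc X) s" if s: "s : {0..L}" for s
  unfolding radk_def
 proof (rule dominated_convergence(2)[where h = "%_. 1"])
  show "(%ta. ta ^ (N - 1) * ptrunc (?sh (k n)) (ta * s)) integrable_on {0..1}" for n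
  by (rule radk_intb[OF ptrunc_con[OF Zc(2)]])
  show "(%_. 1) integrable_on {0..1::real}" by (rule integrable_const_ivl)
  fix ta :: real assume t: "ta : {0..1}"
  show "norm (ta ^ (N - 1) * ptrunc (?sh (k n)) (ta * s)) <= 1" for n
  using mult_mono[of "ta ^ (N - 1)" 1 "ptrunc (?sh (k n)) (ta * s)" 1] t ptrunc_le_one[of "?sh (k n)" "ta * s"] Z1
  by (auto simp: abs_mult power_le_one)
  have ts: "ta * s : {0..L}" using t s mult_mono[of ta 1 s L] by auto
  show "(%n. ta ^ (N - 1) * ptrunc (?sh (k n)) (ta * s)) ----> ta ^ (N - 1) * ptrunc X (ta * s)"
  unfolding ptrunc_def using m
  by (intro tendsto_mult tendsto_const tendsto_powr2 tendsto_max lim'[OF ts]) auto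
 qed
 have dec: "(%n. decay (?sh (k n)) s) ----> decay X s" if s: "s : {0..L}" for s
  unfolding decay_def using m s radk_nonneg[OF ptrunc_con[OF Zc(2)]]
  by (intro tendsto_powr2 tendsto_mult tendsto_const rad[OF s] always_eventually allI) auto
 have "X t = volterra X t" if t: "t : {0..L}" for t
 proof -
  have "(%n. integral {0..t} (decay (?sh (k n)))) ----> integral {0..t} (decay X)"
  proof (rule dominated_convergence(2)[where h = "%_. M"])
  show "decay (?sh (k n)) integrable_on {0..t}" for n by (rule decay_intb[OF Zc(2)]) simp
  show "(%_. M) integrable_on {0..t}" by (rule integrable_const_ivl)
  fix s assume s: "s : {0..t}"
  have "decay (?sh (k n)) s <= s powr (1 / m)" for n by (rule decay_le[OF Zc(2)]) (use Z1 s in auto)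
  moreover have "s powr (1 / m) <= M" unfolding M_def using s t m by (intro powr_mono2) auto
  ultimately have "decay (?sh (k n)) s <= M" for n using order_trans by blast
  then show "norm (decay (?sh (k n)) s) <= M" for n by simp
  show "(%n. decay (?sh (k n)) s) ----> decay X s" by (rule dec) (use s t in auto)
  qed
  from tendsto_diff[OF tendsto_const[of 1] this] have "(%n. volterra (?sh (k n)) t) ----> volterra X t" by (simp add: volterra_def)
  moreover have "(%n. volterra (?sh (k n)) t) ----> X t" using lim[OF t] Zeq[of t] t by simp
  ultimately show ?thesis using LIMSEQ_unique by blast
 qed
 with Xc X1 show ?thesis using that by blast
qed

lemma volterra_DERIV:
 assumes X: "contU X" "!!t. t : {0..L} ==> X t = volterra X t" and t: "0 < t" "t < L"
 shows "(X has_real_derivative - decay X t) (at t)"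
proof -
 have "((%t. integral {0..t} (decay X)) has_vector_derivative decay X t) (at t within {0..L})"
  by (rule integral_has_vector_derivative[OF con_sub[OF decay_continuous[OF X(1)]]]) (use t in auto)
 then have "((%t. integral {0..t} (decay X)) has_real_derivative decay X t) (at t)"
  using t by (simp add: real_vec_deriv at_within_interior[of t "{0..L}"])
 then have "(volterra X has_real_derivative - decay X t) (at t)"
  unfolding volterra_def by (auto intro!: deriv_eqs)
 then show ?thesis
  by (rule has_field_derivative_transform_within_open[of _ _ _ "{0<..<L}"]) (use t X(2) in auto)
qed

lemma decay_lower:
 assumes X: "contU X" and s: "0 <= s" and b: "0 <= b" "b powr m <= s * radk N (ptrunc X) s"
 shows "b <= decay X s"
proof -
 have "(b powr m) powr (1 / m) <= decay X s" unfolding decay_def using m b by (intro powr_mono2) auto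
 then show ?thesis using m b by (simp add: powr_powr)
qed

text \<open>Suppose the profile is positive up to L = 2 T. Past s = N its slope is at least its
  value, so X(T) <= exp(N - T). But the mass near the centre forces a slope of at least a constant
  times T^((1-N)/m) on [T, 2 T], and a total decrease there that exceeds X(T) once T is
  large.\<close>

lemma volterra_fixpoint_vanishes:
 obtains X L where "0 < L" "contU X" "!!t. t : {0..L} ==> X t = volterra X t"
  "X L = 0" "!!t. 0 <= t ==> t < L ==> 0 < X t"
proof -
 \<comment> \<open>A lower bound for the mass inside radius 1/2: slopes are at most 1 on [0, 1], so
   X >= 1/2 there.\<close>
 define C where "C = (1/2) powr m * ((1/2) ^ N / N)"
 have C: "0 < C" using N by (simp add: C_def)
 \<comment> \<open>The constant for which \<open>K * T powr ((1 - real N) / m)\<close> bounds the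
   slope on [T, 2 T] from below.\<close>
 define K where "K = (C powr (1 / m) * 2 powr ((1 - real N) / m))"
 have K: "0 < K" using C by (simp add: K_def)
 have "((%T. exp (real N - T) * T powr ((real N - 1) / m)) \<longlongrightarrow> 0) at_top" by real_asymp
 then have "\<forall>\<^sub>F T in at_top::real filter. exp (real N - T) * T powr ((real N - 1) / m) < K" using K order_tendstoD(2) by blast
 then have "\<forall>\<^sub>F T in at_top::real filter. exp (real N - T) * T powr ((real N - 1) / m) < K & T >= real N + 1"
  using eventually_ge_at_top by (rule eventually_conj)
 then obtain T where T: "exp (real N - T) * T powr ((real N - 1) / m) < K" "T >= real N + 1"
  unfolding eventually_at_top_linorder by blast
 define L where "L = 2 * T"
 have T0: "1 <= T" "0 < L" using T N by (auto simp: L_def)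
 obtain X where X: "contU X" "!!t. t : {0..L} ==> X t = volterra X t" "!!t. X t <= 1"
  using volterra_fixpoint[OF T0(2)] by metis
 note der = volterra_DERIV[OF X(1,2)]
 have anti: "X t <= X s" if "0 <= s" "s <= t" "t <= L" for s t
  using volterra_diff[OF X(1), of s t] that X(2)[of s] X(2)[of t] integral_nonneg[OF decay_intb[OF X(1), of s], of t] by simp
 have X0: "X 0 = 1" using X(2)[of 0] T0 by simp
 have half: "1/2 <= X s" if s: "0 <= s" "s <= 1/2" for s
  using volterra_lipschitz[OF X(1), of 1 0 s] X(3) s X(2)[of s] T0 by (simp add: L_def)
 have "EX t:{0..L}. X t <= 0"
 proof (rule ccontr)
  assume "\<not> ?thesis"
  then have pos: "0 < X t" if "t : {0..L}" for t using that by (metis not_le)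
  have rad: "l powr m / N <= radk N (ptrunc X) s" if l: "!!ta. ta : {0..1} ==> l <= X (ta * s)" "0 <= l" for l s
  proof -
  have e: "((%ta. l powr m * ta ^ (N - 1)) has_integral l powr m * (1 ^ N / N - 0 ^ N / N)) {0..1}"
  using N by (intro has_integral_mult_right fundamental_theorem_of_calculus)
  (auto intro!: deriv_eqs simp: real_vec_deriv[symmetric])
  have "l powr m / N = integral {0..1} (%ta. l powr m * ta ^ (N - 1))" using integral_unique[OF e] N by (simp add: power_0_left)
  also have "... <= radk N (ptrunc X) s" unfolding radk_def
  proof (rule integral_le[OF _ radk_intb[OF ptrunc_con[OF X(1)]]])
  show "(%ta. l powr m * ta ^ (N - 1)) integrable_on {0..1}" using e by blast
  fix ta :: real assume "ta : {0..1}"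
  then show "l powr m * ta ^ (N - 1) <= ta ^ (N - 1) * ptrunc X (ta * s)"
  using l(1)[of ta] l(2) m by (auto simp: mult.commute[of "ta ^ _"] ptrunc_def intro!: mult_rm powr_mono2)
  qed
  finally show ?thesis .
  qed
  have mass: "C <= s ^ N * radk N (ptrunc X) s" if s: "1/2 <= s" "s <= L" for s
  proof -
  have c: "continuous_on A (%si. si ^ (N - 1) * ptrunc X si)" for A
  by (intro con_intros con_sub[OF ptrunc_con[OF X(1)]]) auto
  note r = radk_times_power[OF ptrunc_con[OF X(1)] N]
  have h: "(1/2) powr m / N <= radk N (ptrunc X) (1/2)" by (intro rad half) auto
  have "C <= (1/2) ^ N * radk N (ptrunc X) (1/2)"
  using mult_lm[OF h, of "(1/2) ^ N"] by (simp add: C_def mult_ac)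
  also have "... = integral {0..1/2} (%si. si ^ (N - 1) * ptrunc X si)" by (rule r) simp
  also have "... <= integral {0..s} (%si. si ^ (N - 1) * ptrunc X si)"
  by (rule integral_subset_le[OF _ intb_cont[OF c] intb_cont[OF c]]) (use s in auto)
  also have "... = s ^ N * radk N (ptrunc X) s" by (rule r[symmetric]) (use s in simp)
  finally show ?thesis .
  qed
  define b where "b = (C * L powr (1 - real N)) powr (1 / m)"
  have low: "b <= decay X s" if s: "T <= s" "s <= L" for s
  proof (rule decay_lower[OF X(1)])
  have "b powr m = C * L powr (1 - real N)" using m C by (simp add: b_def powr_powr)
  also have "... <= C * s powr (1 - real N)" using s C T0 N by (intro mult_lm powr_mono2') auto
  also have "... <= (s ^ N * radk N (ptrunc X) s) * s powr (1 - real N)" using mass[of s] s T0 by (intro mult_rm) auto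
  also have "... = (s ^ N * s powr (1 - real N)) * radk N (ptrunc X) s" by (simp add: mult_ac)
  also have "s ^ N * s powr (1 - real N) = s" using s T0 powr_add[of s "real N" "1 - real N"] by (simp add: powr_realpow)
  finally show "b powr m <= s * radk N (ptrunc X) s" .
  qed (use s T0 in "auto simp: b_def")
  have "T * b = integral {T..L} (%s. b)" using T0 by (simp add: L_def)
  also have "... <= integral {T..L} (decay X)"
  by (rule integral_le[OF integrable_const_ivl decay_intb[OF X(1)]]) (use low T0 in auto)
  also have "... = X T - X L" using volterra_diff[OF X(1), of T L] X(2)[of T] X(2)[of L] T0 by (simp add: L_def)
  also have "... < X T" using pos[of L] T0 by simp
  also have "X T <= exp (real N - T)"
  proof -
  have dX: "X s <= decay X s" if s: "real N < s" "s < T" for s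
  proof (rule decay_lower[OF X(1)])
  have "X s powr m / N <= radk N (ptrunc X) s"
  proof (rule rad)
  fix ta :: real assume t: "ta : {0..1}"
  have "ta * s <= s" using t s mult_rm[of ta 1 s] by simp
  then show "X s <= X (ta * s)" using t s by (intro anti) (auto simp: L_def)
  qed (use pos[of s] s in "auto simp: L_def less_imp_le")
  then have "s * (X s powr m * (1 / N)) <= s * radk N (ptrunc X) s" using s by (intro mult_lm) auto
  moreover have "X s powr m * 1 <= X s powr m * (s / N)" using s N by (intro mult_lm) auto
  ultimately show "X s powr m <= s * radk N (ptrunc X) s" by (simp add: mult_ac)
  qed (use s pos[of s] T0 in "auto simp: L_def less_imp_le")
  \<comment> \<open>Since the slope dominates the value beyond N, the product with the exponential
    decreases.\<close>
  have "(%s. X s * exp s) T <= (%s. X s * exp s) (real N)"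
  proof (rule DERIV_nonpos_imp_decreasing_open[where a = "real N" and b = T])
  show "real N <= T" using T by simp
  fix s assume s: "real N < s" "s < T"
  have "((%s. X s * exp s) has_real_derivative (- decay X s * exp s + exp s * X s)) (at s)"
  using s T0 by (auto intro!: deriv_eqs der simp: L_def)
  moreover have "- decay X s * exp s + exp s * X s <= 0" using dX[OF s] by (simp add: algebra_simps)
  ultimately show "EX y. ((%s. X s * exp s) has_real_derivative y) (at s) & y <= 0" by blast
  qed (intro con_intros con_sub[OF X(1)], auto)
  moreover have "X (real N) * exp (real N) <= 1 * exp (real N)" by (intro mult_rm X) auto
  ultimately have "X T * exp T <= exp (real N)" by linarith
  then show ?thesis by (simp add: exp_diff field_simps)
  qed
  finally have "T * b < exp (real N - T)" .
  moreover have "b = K * T powr ((1 - real N) / m)"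
  using C T0 by (simp add: b_def K_def L_def powr_mult powr_powr)
  moreover have "1 * (K * T powr ((1 - real N) / m)) <= T * (K * T powr ((1 - real N) / m))" using T0 K by (intro mult_rm) auto
  ultimately have "K * T powr ((1 - real N) / m) < exp (real N - T)" by simp
  then have "K * T powr ((1 - real N) / m) * T powr ((real N - 1) / m) < exp (real N - T) * T powr ((real N - 1) / m)"
  using T0 by (intro mult_strict_right_mono) auto
  moreover have "T powr ((1 - real N) / m) * T powr ((real N - 1) / m) = 1" using T0 by (simp add: powr_add[symmetric] add_divide_distrib[symmetric])
  ultimately show False using T(1) by (simp add: mult.assoc)
 qed
 then obtain t1 where t1: "t1 : {0..L}" "X t1 <= 0" by blast
 have "EX t>=0. t <= t1 & X t = 0" by (rule IVT2'[OF t1(2) _ _ con_sub[OF X(1)]]) (use t1 X0 in auto)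
 then obtain t2 where t2: "0 <= t2" "t2 <= t1" "X t2 = 0" by blast
 define Z where "Z = {0..L} \<inter> X -` {0}"
 have "closed Z" unfolding Z_def by (intro continuous_closed_preimage con_sub[OF X(1)]) auto
 moreover have "bounded Z" unfolding Z_def by (intro bounded_Int) simp
 ultimately have Zc: "compact Z" using compact_eq_bounded_closed by blast
 have "t2 : Z" using t1 t2 by (simp add: Z_def)
 then have "Z ~= {}" by blast
 note Zc = Zc this
 obtain t0 where t0: "t0 : Z" "!!t. t : Z ==> t0 <= t" using compact_attains_inf[OF Zc] by blast
 show ?thesis
 proof (rule that[of t0 X])
  show "0 < t0" using t0(1) X0 by (cases "t0 = 0") (auto simp: Z_def)
  show "X t = volterra X t" if "t : {0..t0}" for t using X(2) that t0(1) by (auto simp: Z_def)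
  show "X t0 = 0" using t0(1) by (simp add: Z_def)
  show "0 < X t" if t: "0 <= t" "t < t0" for t
  proof (rule ccontr)
  assume "\<not> 0 < X t"
  then have "EX s>=0. s <= t & X s = 0" by (intro IVT2'[OF _ _ _ con_sub[OF X(1)]]) (use t X0 in auto)
  then obtain s where "0 <= s" "s <= t" "X s = 0" by blast
  then show False using t0(2)[of s] t t0(1) by (auto simp: Z_def)
  qed
 qed (rule X(1))
qed

text \<open>The first zero L of the fixed point is moved to R by the scaling t -> l t with l = L /
  R; the eigenvalue comes out of this scaling, and no variational argument is needed.\<close>

lemma radial_eigenprofile:
 assumes R: "0 < R"
 obtains V lam where "0 < lam" "contU V" "!!t. 0 <= V t" "V 0 = 1"
  "!!t. 0 <= t ==> t <= R ==> V t = integral {t..R} (%s. (s * radk N (%t. lam * V t powr m) s) powr (1 / m))"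
proof -
 obtain X L where L: "0 < L" and X: "contU X" "!!t. t : {0..L} ==> X t = volterra X t"
  "X L = 0" "!!t. 0 <= t ==> t < L ==> 0 < X t"
  by (rule volterra_fixpoint_vanishes) blast
 define l where "l = L / R"
 have l: "0 < l" "l * R = L" using L R by (auto simp: l_def)
 define V where "V t = X (l * min (max t 0) R)" for t
 \<comment> \<open>The slope gains a factor l, hence its m-th power gains l^m; one more l comes from
   the radius in front of \<open>radk\<close>.\<close>
 define lam where "lam = l powr (m + 1)"
 have Vc: "contU V" unfolding V_def
  by (rule con_comp[OF X(1)]) (auto intro!: con_intros)
 have in_L: "l * min (max t 0) R <= L" for t using l(2) mult_lm[of "min (max t 0) R" R l] l(1) by simp
 have V0: "0 <= V t" for t
 proof (cases "l * min (max t 0) R = L")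
  case False
  then show ?thesis using X(4)[of "l * min (max t 0) R"] in_L[of t] l R by (simp add: V_def less_imp_le)
 qed (use X(3) in "simp add: V_def")
 have rad: "radk N (%t. lam * V t powr m) s = lam * radk N (ptrunc X) (l * s)" if s: "0 <= s" "s <= R" for s
 proof -
  have "lam * V (ta * s) powr m = lam * ptrunc X (ta * (l * s))" if t: "ta : {0..1}" for ta
  proof -
  have "ta * s <= s" using t s mult_rm[of ta 1 s] by simp
  then have "V (ta * s) = X (ta * (l * s))" using t s by (simp add: V_def mult_ac)
  then show ?thesis using V0[of "ta * s"] by (simp add: ptrunc_def)
  qed
  then have "radk N (%t. lam * V t powr m) s = integral {0..1} (%ta. lam * (ta ^ (N - 1) * ptrunc X (ta * (l * s))))"
  unfolding radk_def by (intro integral_cong) simp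
  then show ?thesis by (simp add: radk_def)
 qed
 have eq: "V t = integral {t..R} (%s. (s * radk N (%t. lam * V t powr m) s) powr (1 / m))" if t: "0 <= t" "t <= R" for t
 proof -
  have lt: "l * t <= L" "0 <= l * t" using l t mult_lm[of t R l] by auto
  have "(decay X has_integral integral {l * t..L} (decay X)) {l * t..L}" using decay_intb[OF X(1) lt(2)] by blast
  from has_integral_stretch_real[OF this, of l] l
  have "((%s. decay X (l * s)) has_integral 1 / l * integral {l * t..L} (decay X)) ((%x. x / l) ` {l * t..L})" by simp
  moreover have "(%x. x / l) ` {l * t..L} = {t..R}"
  using l image_affinity_atLeastAtMost_div[of l 0 "l * t" L] lt by (simp add: field_simps)
  ultimately have "((%s. l * decay X (l * s)) has_integral integral {l * t..L} (decay X)) {t..R}"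
  using has_integral_mult_right[of "%s. decay X (l * s)" "1 / l * integral {l * t..L} (decay X)" "{t..R}" l] l by simp
  then have "integral {l * t..L} (decay X) = integral {t..R} (%s. l * decay X (l * s))" by (rule integral_unique[symmetric])
  also have "... = integral {t..R} (%s. (s * radk N (%t. lam * V t powr m) s) powr (1 / m))"
  proof (rule integral_cong)
  fix s assume s: "s : {t..R}"
  have "0 <= radk N (ptrunc X) (l * s)" by (rule radk_nonneg[OF ptrunc_con[OF X(1)]]) simp
  moreover have "l = (l powr m) powr (1 / m)" using l m by (simp add: powr_powr)
  ultimately have "l * decay X (l * s) = (l powr m * (l * s * radk N (ptrunc X) (l * s))) powr (1 / m)"
  unfolding decay_def using l s t by (subst powr_mult) auto
  also have "l powr m * (l * s * radk N (ptrunc X) (l * s)) = s * radk N (%t. lam * V t powr m) s"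
  using rad[of s] s t l by (simp add: lam_def powr_add mult_ac)
  finally show "l * decay X (l * s) = (s * radk N (%t. lam * V t powr m) s) powr (1 / m)" .
  qed
  finally show ?thesis
  using volterra_diff[OF X(1) lt(2,1)] X(2)[of "l * t"] X(2)[of L] X(3) lt L t by (simp add: V_def)
 qed
 show ?thesis
 proof (rule that[of lam V])
  show "0 < lam" using l by (simp add: lam_def)
  show "V 0 = 1" using X(2)[of 0] L R by (simp add: V_def)
 qed (fact Vc V0 eq)+
qed

end

lemma AE_eq_continuous:
 fixes f g :: "'a::euclidean_space => 'b::t2_space"
 assumes S: "open S" and f: "continuous_on S f" and g: "continuous_on S g"
  and ae: "AL x. x : S --> f x = g x" and x: "x : S"
 shows "f x = g x"
proof (rule ccontr)
 assume n: "f x ~= g x"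
 then obtain U W where U: "open U" "f x : U" and W: "open W" "g x : W" "U \<inter> W = {}" using hausdorff[OF n] by auto
 define O' where "O' = (S \<inter> f -` U) \<inter> (S \<inter> g -` W)"
 have o: "open O'" unfolding O'_def using continuous_open_preimage[OF f S U(1)] continuous_open_preimage[OF g S W(1)] by (rule open_Int)
 have "AL x. x ~: O'" using ae by eventually_elim (use W(3) in "auto simp: O'_def")
 moreover have "O' : sets lebesgue" using lmeasurable_open o by (simp add: borel_open)
 ultimately have "O' : null_sets lebesgue" using AE_iff_null_sets[of O' lebesgue] by blast
 moreover have "O' ~= {}" using x U W by (auto simp: O'_def)
 ultimately show False using open_not_negligible[OF o] by (simp add: negligible_iff_null_sets)
qed

text \<open>\<open>Vint\<close> says that V is reproduced by the barrier construction whose source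
  is computed from V itself. The barrier is then a positive radial eigenfunction of the r-Laplacian
  with eigenvalue La.\<close>

locale radial_eigen =
 fixes c :: "'a::euclidean_space" and R p r La :: real and V :: "real => real"
 assumes R: "0 < R" and r: "1 < r" "r <= p" and La: "0 < La"
  and V: "contU V" "!!t. 0 <= V t" "V 0 = 1"
  and Vint: "!!t. 0 <= t ==> t <= R ==>
  V t = integral {t..R} (%s. (s * radk DIM('a) (%t. La * V t powr (r - 1)) s) powr (1 / (r - 1)))"

sublocale radial_eigen \<subseteq> barrier c R 0 p r "%t. La * V t powr (r - 1)"
proof
 have "contU (%t. V t powr (r - 1))"
  by (rule continuous_on_powr'[OF V(1) continuous_on_const]) (use r V(2) in simp)
 then show "contU (%t. La * V t powr (r - 1))" by (rule continuous_on_mult[OF continuous_on_const])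
 show "0 <= La * V t powr (r - 1)" for t using La by simp
 show "0 < La * V 0 powr (r - 1)" using La V(3) by simp
qed (fact R r order_refl)+

context radial_eigen
begin

lemma slope_eq: "0 <= s ==> slope s = (s * radk DIM('a) (%t. La * V t powr (r - 1)) s) powr (1 / (r - 1))"
proof -
 assume s: "0 <= s"
 let ?z = "s * radk DIM('a) (%t. La * V t powr (r - 1)) s"
 have z: "0 <= ?z" using s radk_pos[of s] by (cases "s = 0") auto
 have "flow 0 p r (?z powr (1 / (r - 1))) = ?z" using z r by (simp add: flow_def powr_powr)
 then show "slope s = ?z powr (1 / (r - 1))" unfolding slope_def using flow_inv_flow[OF pq, of "?z powr (1 / (r - 1))"] by simp
qed

lemma prof_eq: "0 <= t ==> t <= R ==> prof t = V t"
 unfolding prof_def by (subst Vint) (auto intro!: integral_cong simp: slope_eq)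

lemma bar_eq: "x : ball c R ==> bar x = V (norm (x - c))"
 by (auto simp: bar_def prof_eq dist_norm norm_minus_commute)

lemma slope_mass:
 assumes "0 < t" shows "slope t powr (r - 1) * t ^ (DIM('a) - 1) = La * integral {0..t} (%s. s ^ (DIM('a) - 1) * V s powr (r - 1))"
proof -
 have N: "DIM('a) >= 1" using DIM_ge_Suc0[where 'a = 'a] by simp
 have "slope t powr (r - 1) = t * radk DIM('a) (%t. La * V t powr (r - 1)) t"
  using flow_slope[of t] slope_nonneg[of t] assms by (simp add: flow_def)
 then have "slope t powr (r - 1) * t ^ (DIM('a) - 1) = (t * t ^ (DIM('a) - 1)) * radk DIM('a) (%t. La * V t powr (r - 1)) t"
  by simp
 also have "t * t ^ (DIM('a) - 1) = t ^ DIM('a)" using power_minus_mult[OF DIM_positive[where 'a = 'a], of t] by (simp only: mult.commute)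
 also have "t ^ DIM('a) * radk DIM('a) (%t. La * V t powr (r - 1)) t = integral {0..t} (%s. s ^ (DIM('a) - 1) * (La * V s powr (r - 1)))"
  by (rule radk_times_power[OF F(1) N]) (use assms in simp)
 also have "... = integral {0..t} (%s. La * (s ^ (DIM('a) - 1) * V s powr (r - 1)))"
  by (simp only: mult.left_commute)
 finally show ?thesis by simp
qed

text \<open>In the ball the source divided by bar^(r-1) is the constant La, so Picone's inequality
  becomes a lower bound for the Rayleigh quotient of ph. Equality kills the remainder and makes the
  logarithmic gradients of ph and \<open>bar\<close> agree.\<close>

lemma picone_terms:
 assumes ph: "sob (ball c R) p ph B" "!!x. 0 <= ph x"
 shows "La * (LI x. ph x powr r) <= (LI x. norm (B x) powr r)" (is ?A)
  and "(LI x. norm (B x) powr r) <= La * (LI x. ph x powr r) ==>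
  AL x. x : ball c R --> (ph x / bar x) *R bar_grad x = B x" (is "?H ==> ?B")
proof -
 have p0: "0 < p" "0 < r" using r by auto
 interpret P: picone_data "ball c R" 0 p r "prof 0" bar ph "%x. La * V (norm (x - c)) powr (r - 1)" bar_grad B
 proof
  show "supersol (ball c R) 0 p r bar_grad (%x. La * V (norm (x - c)) powr (r - 1))" by (rule bar_supersol) simp
  show "(%x. La * V (norm (x - c)) powr (r - 1)) : lmeas"
  by (rule con_meas, rule con_comp[OF F(1), of _ "%x. norm (x - c)"]) (auto intro!: con_intros)
 qed (use r bar_sob[OF p0(1)] bar_nonneg bar_le bar_pos La ph in auto)
 have i: "lint (%x. ph x powr r)"
  using sob_powr_intb(1)[OF open_ball bounded_ball ph(1) p0(2) r(2)] ph(2) by simp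
 have D: "0 <= P.D x" for x unfolding P.D_def by (rule picD_nonneg[OF r(1)])
 have D_meas: "P.D : lmeas" unfolding P.D_def[abs_def]
  using sob_meas[OF ph(1)] sob_meas[OF bar_sob[OF p0(1)]] by (intro P.picD_measurable) auto
 have ae: "AL x. ennreal (La * V (norm (x - c)) powr (r - 1) * (ph x powr r * bar x powr (1 - r)) + P.D x)
  = ennreal (La * ph x powr r) + ennreal (P.D x)"
  using sob_outside[OF ph(1) p0(1)]
 proof eventually_elim
  case (elim x)
  have "La * V (norm (x - c)) powr (r - 1) * (ph x powr r * bar x powr (1 - r)) = La * ph x powr r"
  proof (cases "x : ball c R")
  case True
  then have "V (norm (x - c)) powr (r - 1) * bar x powr (1 - r) = 1"
  using bar_eq[OF True] bar_pos[OF True] by (simp add: powr_add[symmetric])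
  then show ?thesis by (simp add: mult_ac)
  qed (use elim in simp)
  then show ?case using La D by (simp add: ennreal_plus)
 qed
 have "ennreal (La * (LI x. ph x powr r)) + (NI x. ennreal (P.D x))
  = (NI x. ennreal (La * ph x powr r)) + (NI x. ennreal (P.D x))"
  by (subst nn_eq_lint) (use i La in auto)
 also have "... = (NI x. ennreal (La * ph x powr r) + ennreal (P.D x))"
  by (rule nn_integral_add[symmetric]) (use i D_meas in auto)
 also have "... = (NI x. ennreal (La * V (norm (x - c)) powr (r - 1) * (ph x powr r * bar x powr (1 - r)) + P.D x))"
  by (rule nn_integral_cong_AE) (use ae in eventually_elim, simp)
 also have "... <= ennreal (LI x. norm (B x) powr r)" by (rule P.picone_homogeneous) simp
 finally have le: "ennreal (La * (LI x. ph x powr r)) + (NI x. ennreal (P.D x)) <= ennreal (LI x. norm (B x) powr r)" .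
 have "ennreal (La * (LI x. ph x powr r)) <= ennreal (LI x. norm (B x) powr r)"
  by (rule order_trans[OF _ le]) simp
 then show ?A by (subst (asm) ennreal_le_iff) auto
 assume ?H
 then have "ennreal (La * (LI x. ph x powr r)) + (NI x. ennreal (P.D x)) <= ennreal (La * (LI x. ph x powr r)) + 0"
  unfolding add_0_right by (intro order_trans[OF le] ennreal_leI)
 then have "(NI x. ennreal (P.D x)) = 0" by (subst (asm) ennreal_add_left_cancel_le) auto
 then have "AL x. ennreal (P.D x) = 0" by (subst (asm) nn_integral_0_iff_AE) (use D_meas in auto)
 then show ?B
 proof eventually_elim
  case (elim x)
  then have "P.D x = 0" using D[of x] by (simp add: ennreal_eq_0_iff)
  then show ?case unfolding P.D_def using picD_eq_zero[OF r(1)] by blast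
 qed
qed

lemma rayleigh_bar: "(LI x. norm (bar_grad x) powr r) = La * (LI x. bar x powr r)"
proof -
 have p0: "0 < p" using r by simp
 have out: "AL x. x ~: ball c R --> bar_grad x = 0" by (simp add: bar_grad_def dist_norm norm_minus_commute)
 have "(LI x. norm (bar_grad x) powr r) = (LI x. flux 0 p r (bar_grad x) *. bar_grad x)"
  by (simp add: flux_def fl_inner_self)
 also have "... = (LI x. La * V (norm (x - c)) powr (r - 1) * bar x)"
  by (rule bar_weak(1)[OF bar_sob[OF p0] bounded_ball out])
 also have "... = (LI x. La * bar x powr r)"
 proof (rule lint_cong[OF refl])
  fix x
  show "La * V (norm (x - c)) powr (r - 1) * bar x = La * bar x powr r"
  proof (cases "x : ball c R")
  case True
  then show ?thesis using powr_mult_self[OF bar_nonneg, of x "r - 1"] by (simp add: bar_eq mult.assoc)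
  qed (simp add: bar_def dist_norm norm_minus_commute)
 qed
 finally show ?thesis by simp
qed

lemma V_R: "V R = 0" using prof_eq[of R] R by simp

lemma V_pos: "0 <= t ==> t < R ==> 0 < V t" using prof_eq[of t] prof_pos[of t] by simp

lemma ln_V_derivative:
 assumes t: "0 < t" "t < R" shows "((%t. ln (V t)) has_real_derivative - (slope t / V t)) (at t)"
proof -
 have "(V has_real_derivative - slope t) (at t)"
  by (rule has_field_derivative_transform_within_open[OF prof_DERIV[OF t(2)], of "{0<..<R}"]) (use t prof_eq in auto)
 then show ?thesis using V_pos[of t] t by (auto intro!: deriv_eqs)
qed

end

lemma radial_exists:
 assumes "0 < R" "1 < r" "r <= p"
 obtains V La where "radial_eigen TYPE('a::euclidean_space) R p r La V"
proof -
 have 1: "1 <= DIM('a)" "0 < r - 1" using assms DIM_ge_Suc0[where 'a = 'a] by auto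
 show ?thesis
 proof (rule radial_eigenprofile[OF 1 assms(1)])
  fix V lam
  assume 2: "0 < lam" "contU V" "!!t. 0 <= V t" "V 0 = 1"
  "!!t. 0 <= t ==> t <= R ==> V t = integral {t..R} (%s. (s * radk DIM('a) (%t. lam * V t powr (r - 1)) s) powr (1 / (r - 1)))"
  have "radial_eigen TYPE('a) R p r lam V" by (rule radial_eigen.intro) (fact assms 2)+
  then show ?thesis by (rule that)
 qed
qed

text \<open>Eliminating \<open>y\<close> shows that a combination of logarithms is constant; its derivative at \<open>R\<close> is
 \<open>(N - 1) (p - q) / R\<close>, because \<open>V\<close> vanishes there.\<close>

lemma radial_two_exponents:
 fixes V y :: "real => real"
 assumes N: "2 <= N" and q: "1 < q" "q < p" and R: "0 < R" and V: "contU V" "!!t. 0 <= V t" "V R = 0"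
  and V0: "0 < V 0" and ab: "0 < a" "0 < b" and y: "!!t. 0 < t ==> t < R ==> 0 < y t"
  and P: "!!t. 0 < t ==> t < R ==> y t powr (p - 1) * t ^ (N - 1) = a * integral {0..t} (%s. s ^ (N - 1) * V s powr (p - 1))"
  and Q: "!!t. 0 < t ==> t < R ==> y t powr (q - 1) * t ^ (N - 1) = b * integral {0..t} (%s. s ^ (N - 1) * V s powr (q - 1))"
 shows False
proof -
 define f where "f r s = s ^ (N - 1) * V s powr (r - 1)" for r s
 define M where "M r t = integral {0..t} (f r)" for r t
 have fc: "continuous_on A (f r)" if "1 < r" for r A unfolding f_def
  using that V(2) by (intro continuous_on_mult continuous_on_powr' con_intros con_sub[OF V(1)]) auto
 have dM: "(M r has_real_derivative f r t) (at t)" if "1 < r" "0 < t" for r t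
 proof -
  have "(M r has_vector_derivative f r t) (at t within {0..t + 1})" unfolding M_def
  by (rule integral_has_vector_derivative[OF fc[OF that(1)]]) (use that in auto)
  then show ?thesis
  using that by (simp add: real_vec_deriv at_within_interior[of t "{0..t + 1}"])
 qed
 have pos: "0 < M p t" "0 < M q t" if "0 < t" "t < R" for t
 proof -
  have "0 < a * M p t" "0 < b * M q t"
  unfolding M_def f_def P[OF that, symmetric] Q[OF that, symmetric] using y[OF that] that by auto
  then show "0 < M p t" "0 < M q t" using ab by (auto simp: zero_less_mult_iff)
 qed
 let ?h = "%t. (q - 1) * ln (M p t) - (p - 1) * ln (M q t) + (real N - 1) * (p - q) * ln t"
 let ?h' = "%t. (q - 1) * (f p t / M p t) - (p - 1) * (f q t / M q t) + (real N - 1) * (p - q) / t"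
 have const: "?h t = (p - 1) * ln b - (q - 1) * ln a" if t: "0 < t" "t < R" for t
 proof -
  have ln: "ln (t ^ (N - 1)) = (real N - 1) * ln t" using t N by (simp add: ln_realpow of_nat_diff)
  have "ln (y t powr (p - 1) * t ^ (N - 1)) = ln (a * M p t)" "ln (y t powr (q - 1) * t ^ (N - 1)) = ln (b * M q t)"
  unfolding P[OF t] Q[OF t] M_def f_def by simp_all
  then have e: "(p - 1) * ln (y t) + (real N - 1) * ln t = ln a + ln (M p t)"
  "(q - 1) * ln (y t) + (real N - 1) * ln t = ln b + ln (M q t)"
  using y[OF t] t ab pos[OF t] by (simp_all add: ln_mult ln[simplified] ln_powr)
  have "(q - 1) * (ln a + ln (M p t)) - (p - 1) * (ln b + ln (M q t)) = (q - p) * ((real N - 1) * ln t)"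
  unfolding e[symmetric] by (simp add: algebra_simps)
  then show ?thesis by (simp add: algebra_simps)
 qed
 have h0: "?h' t = 0" if t: "0 < t" "t < R" for t
 proof -
  have 1: "(?h has_real_derivative ?h' t) (at t)"
  using pos[OF t] t q by (auto intro!: deriv_eqs dM simp: divide_simps)
  have "(?h has_real_derivative 0) (at t)"
  by (rule has_field_derivative_transform_within_open[of "%t. (p - 1) * ln b - (q - 1) * ln a" 0 t "{0<..<R}"])
  (use t const in auto)
  from DERIV_unique[OF 1 this] show ?thesis .
 qed
 have lim: "((%t. f r t / M r t) \<longlongrightarrow> 0) (at_left R)" if r: "1 < r" and m: "0 < M r (R / 2)" for r
 proof -
  have "0 <= f r s" if "0 <= s" for s using that by (simp add: f_def)
  then have "M r (R / 2) <= M r R" unfolding M_def using R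
  by (intro integral_subset_le intb_cont fc r) auto
  then have "M r R ~= 0" using m by simp
  moreover have "(M r \<longlongrightarrow> M r R) (at_left R)" "(f r \<longlongrightarrow> f r R) (at_left R)"
  proof -
  have "isCont (M r) R" by (rule DERIV_isCont[OF dM[OF r R]])
  moreover have "isCont (f r) R" using fc[OF r, of UNIV] con_eq_at[OF open_UNIV] by blast
  ultimately show "(M r \<longlongrightarrow> M r R) (at_left R)" "(f r \<longlongrightarrow> f r R) (at_left R)"
  unfolding isCont_def by - (rule tendsto_within_subset[OF _ subset_UNIV], assumption)+
  qed
  ultimately have "((%t. f r t / M r t) \<longlongrightarrow> f r R / M r R) (at_left R)" by (intro tendsto_divide)
  then show ?thesis using V(3) r by (simp add: f_def)
 qed
 have "(?h' \<longlongrightarrow> (q - 1) * 0 - (p - 1) * 0 + (real N - 1) * (p - q) / R) (at_left R)"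
  using pos[of "R/2"] R q by (intro tendsto_add tendsto_diff tendsto_mult tendsto_const lim tendsto_divide tendsto_ident_at) auto
 moreover have "(?h' \<longlongrightarrow> 0) (at_left R)"
 proof (rule tendsto_eventually)
  show "\<forall>\<^sub>F t in at_left R. ?h' t = 0"
  using eventually_at_left_real[OF R] by eventually_elim (use h0 in auto)
 qed
 ultimately have "(q - 1) * 0 - (p - 1) * 0 + (real N - 1) * (p - q) / R = 0"
  by (rule tendsto_unique[OF trivial_limit_at_left_real])
 then show False using N q R by simp
qed

text \<open>Excludes that the eigenfunctions for p and for q are proportional. Equal logarithmic
  gradients together with V 0 = W 0 = 1 identify the profiles and their slopes, and
  \<open>radial_two_exponents\<close> applies.\<close>

lemma radial_eigen_distinct:
 fixes c :: "'a::euclidean_space"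
 assumes P: "radial_eigen TYPE('a) R p p a V" and Q: "radial_eigen TYPE('a) R p q b W" and N: "2 <= DIM('a)" and q: "q < p"
  and ae: "AL x. x : ball c R -->
  (1 / barrier.bar c R 0 p p (%t. a * V t powr (p - 1)) x) *R barrier.bar_grad c R 0 p p (%t. a * V t powr (p - 1)) x
  = (1 / barrier.bar c R 0 p q (%t. b * W t powr (q - 1)) x) *R barrier.bar_grad c R 0 p q (%t. b * W t powr (q - 1)) x"
 shows False
proof -
 interpret P: radial_eigen c R p p a V by (rule P)
 interpret Q: radial_eigen c R p q b W by (rule Q)
 have nz: "P.bar x ~= 0" "Q.bar x ~= 0" if "x : ball c R" for x
  using P.bar_pos[OF that] Q.bar_pos[OF that] by auto
 have eq: "(1 / P.bar x) *R P.bar_grad x = (1 / Q.bar x) *R Q.bar_grad x" if "x : ball c R" for x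
 proof (rule AE_eq_continuous[OF open_ball _ _ ae that])
  show "continuous_on (ball c R) (%x. (1 / P.bar x) *R P.bar_grad x)"
  by (intro continuous_on_scaleR continuous_on_divide continuous_on_const P.bar_grad_continuous con_sub[OF P.bar_continuous] ballI nz) auto
  show "continuous_on (ball c R) (%x. (1 / Q.bar x) *R Q.bar_grad x)"
  by (intro continuous_on_scaleR continuous_on_divide continuous_on_const Q.bar_grad_continuous con_sub[OF Q.bar_continuous] ballI nz) auto
 qed
 have rat: "P.slope t / V t = Q.slope t / W t" if t: "0 < t" "t < R" for t
 proof -
  obtain i :: 'a where i: "i : Basis" using nonempty_Basis by blast
  let ?x = "c + t *R i"
  have n: "norm (?x - c) = t" using i t by simp
  have x: "?x : ball c R" using n t by (simp add: dist_norm)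
  have "((1 / P.bar ?x) *R P.bar_grad ?x) *. i = ((1 / Q.bar ?x) *R Q.bar_grad ?x) *. i" using eq[OF x] by simp
  then show ?thesis using n x t i by (simp add: P.bar_grad_def Q.bar_grad_def P.bar_eq Q.bar_eq inner_same_Basis)
 qed
 have VW: "V t = W t" if t: "0 <= t" "t < R" for t
 proof (cases "t = 0")
  case False
  then have t0: "0 < t" using t by simp
  have "(%s. ln (V s) - ln (W s)) t = (%s. ln (V s) - ln (W s)) 0"
  proof (rule DERIV_isconst_end[OF t0, symmetric, THEN sym])
  show "continuous_on {0..t} (%s. ln (V s) - ln (W s))"
  proof (intro continuous_on_diff continuous_on_ln con_sub[OF P.V(1)] con_sub[OF Q.V(1)] ballI)
  fix s assume "s : {0..t}"
  then show "V s ~= 0" "W s ~= 0" using P.V_pos[of s] Q.V_pos[of s] t by auto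
  qed auto
  fix s assume s: "0 < s" "s < t"
  show "((%s. ln (V s) - ln (W s)) has_real_derivative 0) (at s)"
  using DERIV_diff[OF P.ln_V_derivative Q.ln_V_derivative, of s] rat[of s] s t by simp
  qed
  then show ?thesis using P.V_pos[OF t] Q.V_pos[OF t] P.V(3) Q.V(3) by simp
 qed (use P.V Q.V in simp)
 have yy: "P.slope t = Q.slope t" if t: "0 < t" "t < R" for t using rat[OF t] VW[of t] P.V_pos[of t] t by simp
 show False
 proof (rule radial_two_exponents[OF N Q.r(1) q P.R P.V(1,2) P.V_R _ P.La Q.La P.slope_pos])
  show "0 < V 0" using P.V(3) by simp
  fix t assume t: "0 < t" "t < R"
  show "P.slope t powr (p - 1) * t ^ (DIM('a) - 1) = a * integral {0..t} (%s. s ^ (DIM('a) - 1) * V s powr (p - 1))"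
  by (rule P.slope_mass[OF t(1)])
  have "integral {0..t} (%s. s ^ (DIM('a) - 1) * V s powr (q - 1)) = integral {0..t} (%s. s ^ (DIM('a) - 1) * W s powr (q - 1))"
  by (rule integral_cong) (use VW t in auto)
  then show "P.slope t powr (q - 1) * t ^ (DIM('a) - 1) = b * integral {0..t} (%s. s ^ (DIM('a) - 1) * V s powr (q - 1))"
  using Q.slope_mass[OF t(1)] yy[OF t] by simp
 qed
qed

subsection \<open>Local lower bounds for supersolutions\<close>

lemma supersol_translation:
 assumes s: "supersol Om al p q g F" and sub: "!!x. x : Om' ==> a + x : Om"
  and g: "g : lmeas" and F: "F : lmeas"
 shows "supersol Om' al p q (%x. g (a + x)) (%x. F (a + x))"
 unfolding supersol_def
proof (intro allI impI)
 fix w h B assume w: "sob Om' p w h" and wB: "ALL x. 0 <= w x & w x <= B"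
 let ?w = "%x. w (- a + x)" and ?h = "%x. h (- a + x)"
 have sw: "sob Om p ?w ?h"
  by (rule sob_mono[OF sob_translation[OF w, of "- a"]]) (use sub in "auto simp: add.commute")
 have wm: "?w : lmeas" "?h : lmeas" using sob_meas[OF sw] by auto
 have 1: "(%x. flux al p q (g x) *. ?h x) : lmeas"
  by (intro borel_measurable_inner flux_measurable g wm)
 have 2: "(%x. ennreal (F x * ?w x)) : lmeas"
  by (intro measurable_compose[OF _ measurable_ennreal] borel_measurable_times F wm)
 show "0 <= (LI x. flux al p q (g (a + x)) *. h x) &
  (NI x. ennreal (F (a + x) * w x)) <= ennreal (LI x. flux al p q (g (a + x)) *. h x)"
  using s sw wB lint_trans[OF 1, of a] nn_trans[OF 2, of a]
  unfolding supersol_def by (simp del: minus_add_distrib) blast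
qed

lemma supersol_source_mono:
 assumes "supersol Om al p q g F" and le: "!!x. F' x <= F x"
 shows "supersol Om al p q g F'"
 unfolding supersol_def
proof (intro allI impI conjI)
 fix w h B assume w: "sob Om p w h" "ALL x. 0 <= w x & w x <= B"
 note s = assms(1)[unfolded supersol_def, rule_format, OF w(1), of B]
 show "0 <= (LI x. flux al p q (g x) *. h x)" using s w(2) by blast
 have "(NI x. ennreal (F' x * w x)) <= (NI x. ennreal (F x * w x))"
  by (intro nn_integral_mono ennreal_leI mult_rm le) (use w(2) in auto)
 then show "(NI x. ennreal (F' x * w x)) <= ennreal (LI x. flux al p q (g x) *. h x)"
  using s w(2) order_trans by blast
qed

lemma young_absorb:
 fixes s b q p :: real
 assumes q: "1 < q" "1 < p" and "0 <= s" "0 <= b"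
 shows "q * (s powr (p - 1) * b) - (q - 1) * s powr p <= q * (q / (q - 1)) powr (p - 1) * b powr p"
proof (cases "(q - 1) * s <= q * b")
 case True
 then have "s <= q / (q - 1) * b" using q by (simp add: field_simps)
 then have "s powr (p - 1) <= (q / (q - 1) * b) powr (p - 1)" using assms by (intro powr_mono2) auto
 also have "... = (q / (q - 1)) powr (p - 1) * b powr (p - 1)" by (rule powr_mult)
 finally have "q * (s powr (p - 1) * b) <= q * ((q / (q - 1)) powr (p - 1) * b powr (p - 1) * b)"
  using assms by (intro mult_lm mult_rm) auto
 also have "... = q * (q / (q - 1)) powr (p - 1) * b powr p"
  using powr_mult_self[OF assms(4), of "p - 1"] by (simp add: mult.assoc)
 finally have "q * (s powr (p - 1) * b) <= q * (q / (q - 1)) powr (p - 1) * b powr p" .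
 moreover have "0 <= (q - 1) * s powr p" using q by simp
 ultimately show ?thesis by linarith
next
 case False
 then have "s powr (p - 1) * (q * b) <= s powr (p - 1) * ((q - 1) * s)" by (intro mult_lm) auto
 also have "... = (q - 1) * s powr p" using powr_mult_self[OF assms(3), of "p - 1"] by (simp add: mult_ac)
 finally have "q * (s powr (p - 1) * b) - (q - 1) * s powr p <= 0" by (simp add: mult_ac)
 also have "0 <= q * (q / (q - 1)) powr (p - 1) * b powr p" using q by simp
 finally show ?thesis .
qed

text \<open>Picone's inequality with the test function ps^q v^(1-q), without any equation for
  \<open>ps\<close>. The p-part carries the weight (v / ps)^(p-q); the growth condition on
  \<open>D\<close> cancels the singular power of \<open>ps\<close> and leaves an error that is small
  when \<open>v\<close> is small.\<close>

lemma picone_local: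
 assumes Om: "open Om" "bounded Om" and q: "1 < q" "q < p" and v: "sob Om' p v g" "!!x. v x : {0..1}"
  and pos: "AL x. x : Om --> 0 < v x"
  and s: "supersol Om 1 p q g F" and F: "F : lmeas" "!!x. 0 <= F x"
  and ps: "c1c Om ps D" "!!x. ps x : {0..M}" and K: "!!x. 0 < ps x ==> norm (D x) powr p <= K * ps x powr (p - q)"
 shows "(NI x. ennreal (F x * (ps x powr q * v x powr (1 - q))))
  <= ennreal ((LI x. norm (D x) powr q)
  + q * (q / (q - 1)) powr (p - 1) * K * (LI x. indicator Om x * v x powr (p - q)))"
proof -
 define C where "C = q * (q / (q - 1)) powr (p - 1)"
 have C: "0 <= C" using q by (simp add: C_def)
 have p: "0 < p" "1 < p" using q by auto
 have M: "0 <= M" using ps(2)[of undefined] by auto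
 have Dm[measurable]: "D : lmeas" "ps : lmeas" using c1c_meas[OF ps(1)] by auto
 have vm[measurable]: "v : lmeas" "g : lmeas" using sob_meas[OF v(1)] by auto
 have out: "ps x = 0 & D x = 0" if "x ~: Om" for x using ps(1) that unfolding c1c_def by blast
 have D0: "0 <= K" if "0 < ps x" for x
 proof -
  have "0 <= K * ps x powr (p - q)" using K[OF that] powr_ge_zero order_trans by blast
  then show ?thesis using that by (simp add: zero_le_mult_iff)
 qed
 define K' where "K' = max K 0"
 have K': "0 <= K'" "!!x. 0 < ps x ==> norm (D x) powr p <= K' * ps x powr (p - q)"
  using K D0 by (auto simp: K'_def max_def)
 define e where "e n = 1 / real (Suc n)" for n
 have e: "0 < e n" "e n <= 1" for n by (auto simp: e_def)
 have e0: "e ----> 0" unfolding e_def[abs_def] by (rule inv_Suc)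
 define E where "E n x = v x + e n" for n x
 have E: "0 < E n x" "e n <= E n x" "E n x <= 2" for n x using v(2)[of x] e[of n] by (auto simp: E_def)
 have E2: "E n x powr (p - q) <= 2 powr (p - q)" for n x by (rule powr_mono2) (use E q in "auto intro: less_imp_le")
 have Em[measurable]: "E n : lmeas" for n unfolding E_def[abs_def] by measurable
 have [measurable]: "Om : sets lebesgue" using Om by simp
 define w where "w n x = ps x powr q * E n x powr (1 - q)" for n x
 define h where "h n x = (E n x powr (1 - q) * (q * ps x powr (q - 1))) *R D x
  + (ps x powr q * ((1 - q) * E n x powr (- q))) *R g x" for n x
 have sw: "sob Om p (w n) (h n)" for n
 proof -
  have 1: "((%t. t powr q) has_real_derivative q * t powr (q - 1)) (at t within {0..M})" if "t : {0..M}" for t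
  proof (cases "t = 0")
  case True
  have "((%t. t powr q / t) \<longlongrightarrow> 0) (at 0 within {0..M})"
  proof (rule Lim_transform_eventually)
  show "((%t::real. t powr (q - 1)) \<longlongrightarrow> 0) (at 0 within {0..M})"
  using tendsto_powr'[of "%t::real. t" 0 "at 0 within {0..M}" "%_. q - 1" "q - 1"] q
  by (auto simp: eventually_at_filter intro!: tendsto_eq_intros)
  show "\<forall>\<^sub>F t in at 0 within {0..M}. t powr (q - 1) = t powr q / t"
  by (auto simp: eventually_at_filter powr_diff)
  qed
  then show ?thesis using True q by (simp add: has_field_derivative_iff)
  next
  case False
  then show ?thesis using that by (auto intro!: deriv_eqs simp: powr_diff)
  qed
  have 2: "((%t. (t + e n) powr (1 - q)) has_real_derivative (1 - q) * (t + e n) powr (- q)) (at t within {0..1})"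
  if "t : {0..1}" for t
  using powr_shift_deriv[of t "e n" "1 - q" "{0..1}"] that e[of n] by simp
  have "sob Om p (%x. ps x powr q * (v x + e n) powr (1 - q))
  (%x. ((v x + e n) powr (1 - q) * (q * ps x powr (q - 1))) *R D x + (ps x powr q * ((1 - q) * (v x + e n) powr (- q))) *R g x)"
  proof (rule sob_mult_interval[OF c1c_sob[OF ps(1)] ps(2) v p(1) 1 _ _ 2])
  show "continuous_on {0..M} (%t. q * t powr (q - 1))"
  by (intro continuous_on_mult continuous_on_powr' continuous_on_const continuous_on_id) (use q in auto)
  show "continuous_on {0..1} (%t. (1 - q) * (t + e n) powr (- q))"
  by (rule powr_shift_continuous[OF e(1)])
  qed (use q in auto)
  then show ?thesis by (simp add: w_def[abs_def] h_def[abs_def] E_def)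
 qed
 have wB: "0 <= w n x & w n x <= M powr q * e n powr (1 - q)" for n x
 proof -
  have "ps x powr q <= M powr q" using ps(2)[of x] q by (intro powr_mono2) auto
  moreover have "E n x powr (1 - q) <= e n powr (1 - q)" by (rule powr_mono2') (use q e[of n] E[of n x] in auto)
  ultimately show ?thesis unfolding w_def by (intro conjI mult_mono mult_nonneg_nonneg powr_ge_zero)
 qed
 let ?R = "%n x. norm (D x) powr q + C * K' * (indicator Om x * E n x powr (p - q))"
 have pt: "flux 1 p q (g x) *. h n x <= ?R n x" for n x
 proof (cases "0 < ps x")
  case False
  then have "ps x = 0" using ps(2)[of x] by auto
  then have "h n x = 0" using q by (simp add: h_def)
  then show ?thesis using C K' by simp
 next
  case True
  define a where "a = (ps x / E n x) *R g x"
  have psE: "0 < ps x / E n x" using True E by simp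
  have ga: "g x = (E n x / ps x) *R a" using True E[where n = n and x = x] by (simp add: a_def)
  \<comment> \<open>In terms of \<open>a\<close> the tested r-flux is homogeneous: for r = q the
    weight is 1 and Picone's remainder appears, for r = p the weight is (E / ps)^(p-q).\<close>
  have flr: "fl r (g x) *. h n x = (ps x powr (q - r) * E n x powr (r - q)) * (q * (fl r a *. D x) - (q - 1) * norm a powr r)" for r
  proof -
  let ?c = "E n x / ps x"
  have c: "0 < ?c" using True E[of n x] by simp
  have flg: "fl r (g x) = ?c powr (r - 1) *R fl r a" unfolding ga using c by (intro fl_scaleR) simp
  have T: "?c powr (r - 1) * (E n x powr (1 - q) * ps x powr (q - 1)) = ps x powr (q - r) * E n x powr (r - q)"
  proof -
  have "?c powr (r - 1) = E n x powr (r - 1) * ps x powr (1 - r)"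
  using powr_divide[of "E n x" "ps x" "r - 1"] powr_minus_divide[of "ps x" "r - 1"] True E[of n x] by simp
  then have "?c powr (r - 1) * (E n x powr (1 - q) * ps x powr (q - 1)) = (ps x powr (1 - r) * ps x powr (q - 1)) * (E n x powr (r - 1) * E n x powr (1 - q))"
  by (simp only: mult_ac)
  then show ?thesis by (simp add: powr_add[symmetric])
  qed
  have hn: "h n x = (q * (E n x powr (1 - q) * ps x powr (q - 1))) *R D x + ((1 - q) * (E n x powr (1 - q) * ps x powr (q - 1))) *R a"
  proof -
  have "ps x powr q * E n x powr (- q) * ?c = E n x powr (1 - q) * ps x powr (q - 1)"
  using True E[of n x] by (simp add: powr_diff powr_minus divide_simps)
  then have "(ps x powr q * ((1 - q) * E n x powr (- q))) *R g x = ((1 - q) * (E n x powr (1 - q) * ps x powr (q - 1))) *R a"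
  unfolding ga scaleR_scaleR by (metis (no_types) mult.assoc mult.left_commute)
  then show ?thesis unfolding h_def by (simp add: mult_ac)
  qed
  have "fl r (g x) *. h n x = (?c powr (r - 1) * (E n x powr (1 - q) * ps x powr (q - 1)))
  * (q * (fl r a *. D x) - (q - 1) * norm a powr r)"
  unfolding flg hn by (simp add: inner_add_right fl_inner_self algebra_simps)
  then show ?thesis unfolding T .
  qed
  have "fl q (g x) *. h n x <= norm (D x) powr q"
  using picD_nonneg[OF q(1), of a "D x"] True E[of n x] flr[of q] by (simp add: picD_def)
  moreover have "fl p (g x) *. h n x <= C * K' * E n x powr (p - q)"
  proof -
  have "q * (fl p a *. D x) <= q * (norm a powr (p - 1) * norm (D x))" using q fl_inner_le[of p a "D x"] by (intro mult_lm) auto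
  then have "q * (fl p a *. D x) - (q - 1) * norm a powr p <= C * norm (D x) powr p"
  using young_absorb[OF q(1) p(2) norm_ge_zero norm_ge_zero, of a "D x"] unfolding C_def by linarith
  also have "... <= C * (K' * ps x powr (p - q))" by (intro mult_lm K' True C)
  finally have "fl p (g x) *. h n x <= (ps x powr (q - p) * E n x powr (p - q)) * (C * (K' * ps x powr (p - q)))"
  unfolding flr by (intro mult_lm) auto
  also have "... = (ps x powr (q - p) * ps x powr (p - q)) * (C * K' * E n x powr (p - q))" by (simp add: mult_ac)
  also have "ps x powr (q - p) * ps x powr (p - q) = 1" using True by (simp add: powr_add[symmetric])
  finally show ?thesis by simp
  qed
  moreover have "x : Om" using out[of x] True by (cases "x : Om") auto
  ultimately show ?thesis by (simp add: flux_def inner_add_left)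
 qed
 have iD: "lint (%x. norm (D x) powr q)" using sob_intb(2)[OF c1c_sob[OF ps(1)], of q] q by simp
 have iO: "lint (%x. 2 powr (p - q) * indicator Om x)" using intb_indicator[OF Om] by simp
 have iE: "lint (%x. indicator Om x * E n x powr (p - q))" for n
 proof (rule intb_bound[OF iO])
  show "AL x. norm (indicator Om x * E n x powr (p - q)) <= norm (2 powr (p - q) * indicator Om x :: real)"
  using E2 by (simp add: indicator_def)
 qed measurable
 have step: "(NI x. ennreal (F x * w n x))
  <= ennreal ((LI x. norm (D x) powr q) + C * K' * (LI x. indicator Om x * E n x powr (p - q)))" for n
 proof -
  have gi: "grad_int Om p g" using sob_grad_int[OF v(1) p(1)] Om(1) by simp
  have i: "lint (%x. flux 1 p q (g x) *. h n x)"
  by (rule flux_dominated[OF Om q(1) less_imp_le[OF q(2)] zero_le_one gi sw])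
  have "(NI x. ennreal (F x * w n x)) <= ennreal (LI x. flux 1 p q (g x) *. h n x)"
  using s sw wB unfolding supersol_def by blast
  also have "... <= ennreal (LI x. ?R n x)"
  by (intro ennreal_leI integral_mono i pt) (use iD iE in auto)
  finally show ?thesis using iD iE by simp
 qed
 have lim: "(%n. (LI x. norm (D x) powr q) + C * K' * (LI x. indicator Om x * E n x powr (p - q)))
  ----> (LI x. norm (D x) powr q) + C * K' * (LI x. indicator Om x * v x powr (p - q))"
 proof (intro tendsto_add tendsto_mult tendsto_const)
  show "(%n. LI x. indicator Om x * E n x powr (p - q)) ----> (LI x. indicator Om x * v x powr (p - q))"
  proof (rule int_dom[OF _ _ iO])
  show "AL x. (%n. indicator Om x * E n x powr (p - q)) ----> indicator Om x * v x powr (p - q)"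
  proof (intro AE_I2 tendsto_mult tendsto_const)
  fix x
  have "(%n. E n x) ----> v x + 0" unfolding E_def by (intro tendsto_add tendsto_const e0)
  then have "(%n. E n x) ----> v x" by simp
  then show "(%n. E n x powr (p - q)) ----> v x powr (p - q)"
  proof (rule tendsto_powr2[OF _ tendsto_const])
  show "\<forall>\<^sub>F n in sequentially. 0 <= E n x" using E(1) by (intro always_eventually allI less_imp_le)
  qed (use q in simp)
  qed
  show "AL x. norm (indicator Om x * E n x powr (p - q)) <= 2 powr (p - q) * indicator Om x" for n
  using E2 by (simp add: indicator_def)
  qed measurable
 qed
 have fin: "(NI x. ennreal (F x * (ps x powr q * v x powr (1 - q))))
  <= ennreal ((LI x. norm (D x) powr q) + C * K' * (LI x. indicator Om x * v x powr (p - q)))"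
 proof (rule fatou_bound[OF _ _ step tendsto_ennrealI[OF lim]])
  show "(%x. ennreal (F x * w n x)) : lmeas" for n
  using F(1) sob_meas(1)[OF sw[of n]] by measurable
  show "AL x. (%n. ennreal (F x * w n x)) ----> ennreal (F x * (ps x powr q * v x powr (1 - q)))"
  using pos
  proof eventually_elim
  case (elim x)
  show ?case
  proof (cases "x : Om")
  case True
  have "(%n. E n x) ----> v x + 0" unfolding E_def by (intro tendsto_add tendsto_const e0)
  then have "(%n. E n x powr (1 - q)) ----> v x powr (1 - q)" using elim True by (auto intro!: tendsto_powr)
  then show ?thesis unfolding w_def by (intro tendsto_ennrealI tendsto_mult tendsto_const)
  qed (use out q in "simp add: w_def")
  qed
 qed
 show ?thesis
 proof (cases "EX x. 0 < ps x")
  case True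
  then have "K' = K" using D0 by (auto simp: K'_def max_def)
  then show ?thesis using fin by (simp add: C_def)
 next
  case False
  then have "ps x = 0" for x using ps(2)[of x] by (force intro: antisym simp: not_less)
  then show ?thesis using q by simp
 qed
qed

text \<open>By Fubini, integrating the measure of the overlap over all shifts shorter than
  \<open>de\<close> gives the integral over \<open>E\<close> of the measure of \<open>S\<close> in a
  ball, which is positive. So some shift has a non-null overlap.\<close>

lemma positive_overlap:
 fixes E S :: "'a::euclidean_space set"
 assumes E: "E : sets lborel" "emeasure lborel E ~= 0" and S: "S : sets lborel"
  and pos: "!!x. x : E ==> emeasure lborel (S \<inter> ball x de) ~= 0"
 obtains ta where "norm ta < de" "emeasure lborel {x:E. ta + x : S} ~= 0"
proof -
 have [measurable]: "E : sets borel" "S : sets borel" using E S by auto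
 define f :: "'a \<times> 'a => ennreal" where "f = (%(x, t). indicator E x * indicator S (t + x) * (if norm t < de then 1 else 0))"
 have fm: "f : borel_measurable (lborel \<Otimes>\<^sub>M lborel)" unfolding f_def by measurable
 have inner: "(\<integral>\<^sup>+t. f (x, t) \<partial>lborel) = indicator E x * emeasure lborel (S \<inter> ball x de)" for x
 proof -
  have B: "S \<inter> ball x de : sets borel" by (rule sets.Int[OF _ borel_open[OF open_ball]]) simp
  have "emeasure lborel (S \<inter> ball x de) = (\<integral>\<^sup>+y. indicator (S \<inter> ball x de) y \<partial>lborel)"
  by (rule nn_integral_indicator[symmetric]) (use B in simp)
  also have "... = (\<integral>\<^sup>+y. indicator (S \<inter> ball x de) y \<partial>distr lborel borel (%t. x + t))"
  by (simp add: lborel_distr_plus)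
  also have "... = (\<integral>\<^sup>+t. indicator (S \<inter> ball x de) (x + t) \<partial>lborel)" by (rule nn_integral_distr) (use B borel_measurable_indicator[OF B] in simp_all)
  also have "... = (\<integral>\<^sup>+t. indicator S (t + x) * (if norm t < de then 1 else 0) \<partial>lborel)"
  by (intro nn_integral_cong) (auto simp: indicator_def dist_norm add.commute)
  finally show ?thesis unfolding f_def by (simp add: nn_integral_cmult mult.assoc)
 qed
 have "EX ta. norm ta < de & emeasure lborel {x:E. ta + x : S} ~= 0"
 proof (rule ccontr)
  assume n: "\<not> ?thesis"
  have "(\<integral>\<^sup>+x. f (x, t) \<partial>lborel) = 0" for t
  proof (cases "norm t < de")
  case True
  have "(\<integral>\<^sup>+x. f (x, t) \<partial>lborel) = (\<integral>\<^sup>+x. indicator {x:E. t + x : S} x \<partial>lborel)"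
  unfolding f_def by (intro nn_integral_cong) (use True in "auto simp: indicator_def")
  also have "... = emeasure lborel {x:E. t + x : S}" by (rule nn_integral_indicator) measurable
  also have "... = 0" using n True by auto
  finally show ?thesis .
  next
  case False
  then show ?thesis unfolding f_def by simp
  qed
  then have "(\<integral>\<^sup>+t. \<integral>\<^sup>+x. f (x, t) \<partial>lborel \<partial>lborel) = 0" by simp
  then have "(\<integral>\<^sup>+x. \<integral>\<^sup>+t. f (x, t) \<partial>lborel \<partial>lborel) = 0" using lborel_pair.Fubini[OF fm] by simp
  moreover have "(%x. \<integral>\<^sup>+t. f (x, t) \<partial>lborel) : borel_measurable lborel"
  by (rule lborel.borel_measurable_nn_integral_fst[OF fm])
  ultimately have "AE x in lborel. (\<integral>\<^sup>+t. f (x, t) \<partial>lborel) = 0" by (subst (asm) nn_integral_0_iff_AE) auto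
  then have "AE x in lborel. x ~: E" by eventually_elim (use pos inner in "auto simp: indicator_def split: if_splits")
  then have "E : null_sets lborel" using AE_iff_null_sets[OF E(1)] by simp
  then show False using E(2) by auto
 qed
 then show ?thesis using that by blast
qed

text \<open>Among countable sets of translations choose one for which the part of \<open>E\<close> never sent into \<open>S\<close>
 is smallest; it must then be a null set.\<close>

lemma exhausting_translations:
 fixes E S :: "'a::euclidean_space set"
 assumes E: "E : sets lborel" "emeasure lborel E < \<infinity>" and S: "S : sets lborel"
  and pos: "!!x. x : E ==> emeasure lborel (S \<inter> ball x de) ~= 0"
 obtains T where "countable T" "T <= ball 0 de" "AE x in lborel. x : E --> (EX ta:T. ta + x : S)"
proof -
 define miss where "miss T = {x:E. ALL ta:T. ta + x ~: S}" for T
 let ?I = "{T. countable T & T <= ball 0 de}"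
 let ?m = "%T. measure lborel (miss T)"
 have [measurable]: "E : sets borel" "S : sets borel" using E S by auto
 have sets: "miss T : sets lborel" if "T : ?I" for T
 proof -
  have "miss T = E - (\<Union>ta\<in>T. {x. ta + x : S})" by (auto simp: miss_def)
  moreover have "{x. ta + x : S} : sets borel" for ta by measurable
  ultimately show ?thesis using that by (auto intro!: sets.Diff sets.countable_UN')
 qed
 have fin: "emeasure lborel (miss T) < \<infinity>" for T
  using E emeasure_mono[of "miss T" E lborel] by (auto simp: miss_def intro: le_less_trans)
 have mono: "?m T' <= ?m T" if "T <= T'" "T : ?I" "T' : ?I" for T T'
  by (rule measure_mono_fmeasurable) (use that sets fin in "auto simp: miss_def fmeasurable_def")
 define m where "m = (INF T\<in>?I. ?m T)"
 have bdd: "bdd_below (?m ` ?I)" by (rule bdd_belowI[of _ 0]) auto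
 have ne: "?I ~= {}" by (auto intro!: exI[of _ "{}"])
 have "EX T:?I. ?m T < m + 1 / real (Suc n)" for n
  using cInf_lessD[of "?m ` ?I" "m + 1 / real (Suc n)"] ne unfolding m_def by auto
 then obtain T where T: "!!n. T n : ?I" "!!n. ?m (T n) < m + 1 / real (Suc n)" by metis
 define U where "U = (\<Union>n. T n)"
 have U: "U : ?I" using T(1) by (auto simp: U_def)
 have "?m U <= m + 1 / real (Suc n)" for n
 proof -
  have "T n <= U" unfolding U_def by blast
  then have "?m U <= ?m (T n)" by (rule mono[OF _ T(1) U])
  then show ?thesis using T(2)[of n] by linarith
 qed
 then have Um: "?m U <= m + 0"
  by (intro LIMSEQ_le_const[OF tendsto_add[OF tendsto_const inv_Suc(2)]]) auto
 have "emeasure lborel (miss U) = 0"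
 proof (rule ccontr)
  assume "emeasure lborel (miss U) ~= 0"
  then obtain ta where ta: "norm ta < de" "emeasure lborel {x:miss U. ta + x : S} ~= 0"
  by (rule positive_overlap[OF sets[OF U] _ S]) (use pos in "auto simp: miss_def")
  let ?A = "{x:miss U. ta + x : S}"
  have A: "?A : sets lborel" using sets[OF U] by measurable
  have fA: "emeasure lborel ?A < \<infinity>"
  by (rule le_less_trans[OF emeasure_mono fin[of U]]) (use sets[OF U] in auto)
  have I: "insert ta U : ?I" using U ta by auto
  have "miss U = miss (insert ta U) \<union> ?A" by (auto simp: miss_def)
  moreover have "measure lborel (miss (insert ta U) \<union> ?A) = ?m (insert ta U) + measure lborel ?A"
  by (rule measure_Union) (use sets[OF I] A fin[of "insert ta U"] fA in "auto simp: miss_def")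
  moreover have "0 < measure lborel ?A"
  using ta(2) fA by (simp add: measure_def enn2real_positive_iff zero_less_iff_neq_zero)
  moreover have "m <= ?m (insert ta U)" unfolding m_def by (rule cINF_lower[OF bdd I])
  ultimately show False using Um by simp
 qed
 then have "AE x in lborel. x ~: miss U" using sets[OF U] by (intro AE_not_in null_setsI)
 then have "AE x in lborel. x : E --> (EX ta:U. ta + x : S)" by eventually_elim (auto simp: miss_def)
 then show ?thesis using U that by blast
qed

text \<open>If no ball around a point of \<open>K\<close> carries a positive lower bound, each set
  {u < 1/(n+1)} has positive measure in each such ball. The exhausting translations for all n
  together form a countable family of small shifts along which u comes arbitrarily close to 0 at
  almost every point of \<open>K\<close>.\<close>

lemma vanishing_translates:
 fixes u :: "'a::euclidean_space => real"
 assumes um: "u : lmeas" and K: "bounded K" "K : sets borel" and de: "0 < de"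
  and van: "!!x c. x : K ==> 0 < c ==> \<not> (AL y. y : ball x de --> c <= u y)"
 obtains ta :: "nat => 'a" where "!!i. norm (ta i) < de"
  "AL x. x : K --> (ALL c>0. EX i. u (ta i + x) < c)"
proof -
 \<comment> \<open>The Fubini argument lives on Borel sets, so \<open>u\<close> is replaced by a
   Borel version.\<close>
 obtain u' where u': "u' : borel_measurable lborel" "AE x in lborel. u x = u' x"
  using completion_ex_borel_measurable_real[OF um] by (elim bexE) (rule that)
 have ae: "AL x. u x = u' x" using u'(2) by (rule AE_completion)
 define e where "e n = 1 / real (Suc n)" for n
 have e: "0 < e n" for n by (simp add: e_def)
 define S where "S n = {y. u' y < e n}" for n
 have S: "S n : sets lborel" for n
  using borel_measurable_less[OF u'(1) borel_measurable_const[of "e n"]] by (simp add: S_def)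
 have fK: "emeasure lborel K < \<infinity>" by (rule emeasure_bounded_finite[OF K(1)])
 have pos: "emeasure lborel (S n \<inter> ball x de) ~= 0" if x: "x : K" for n x
 proof
  assume "emeasure lborel (S n \<inter> ball x de) = 0"
  moreover have s: "S n \<inter> ball x de : sets lborel" using S by auto
  ultimately have "AE y in lborel. y ~: S n \<inter> ball x de" by (intro AE_not_in null_setsI)
  then have "AL y. y ~: S n \<inter> ball x de" by (rule AE_completion)
  with ae have "AL y. y : ball x de --> e n <= u y" by eventually_elim (auto simp: S_def)
  then show False using van[OF x e] by blast
 qed
 have "EX T. countable T & T <= ball 0 de & (AE x in lborel. x : K --> (EX ta:T. ta + x : S n))" for n
 proof -
  have "K : sets lborel" using K by simp
  show ?thesis
  proof (rule exhausting_translations[OF \<open>K : sets lborel\<close> fK S[of n] pos[of _ n]])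
  fix T assume "countable T" "T <= ball 0 de" "AE x in lborel. x : K --> (EX ta:T. ta + x : S n)"
  then show ?thesis by (intro exI[of _ T] conjI)
  qed
 qed
 then have "ALL n. EX T. countable T & T <= ball 0 de & (AE x in lborel. x : K --> (EX ta:T. ta + x : S n))" by (rule allI)
 from choice[OF this] obtain T where T': "ALL n. countable (T n) & T n <= ball 0 de & (AE x in lborel. x : K --> (EX ta:T n. ta + x : S n))"
  by (rule exE)
 have T: "countable (T n)" "T n <= ball 0 de" "AE x in lborel. x : K --> (EX ta:T n. ta + x : S n)" for n
  by (rule T'[rule_format, THEN conjunct1] T'[rule_format, THEN conjunct2, THEN conjunct1] T'[rule_format, THEN conjunct2, THEN conjunct2])+
 \<comment> \<open>The element 0 only guarantees that there is something to enumerate.\<close>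
 define U where "U = insert 0 (\<Union>n. T n)"
 have U: "countable U" "U ~= {}" "U <= ball 0 de" using T de by (auto simp: U_def)
 define ta where "ta = from_nat_into U"
 have rng: "range ta = U" unfolding ta_def by (rule range_from_nat_into[OF U(2,1)])
 have "AE x in lborel. ALL n. x : K --> (EX ta:T n. ta + x : S n)" unfolding AE_all_countable using T(3) by blast
 then have 1: "AL x. ALL n. x : K --> (EX ta:T n. ta + x : S n)" by (rule AE_completion)
 have 2: "AL x. ALL i. u (ta i + x) = u' (ta i + x)"
  unfolding AE_all_countable using AE_trans[OF ae] by blast
 have "AL x. x : K --> (ALL c>0. EX i. u (ta i + x) < c)" using 1 2
 proof eventually_elim
  case (elim x)
  show ?case
  proof (intro impI allI)
  fix c :: real assume x: "x : K" and c: "0 < c"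
  obtain n where n: "e n < c" using reals_Archimedean[OF c] by (auto simp: e_def inverse_eq_divide)
  obtain t where t: "t : T n" "t + x : S n" using elim(1) x by blast
  then have "t : range ta" unfolding rng U_def by blast
  then obtain i where "t = ta i" by blast
  then have "u (ta i + x) < c" using t n elim(2) by (auto simp: S_def)
  then show "EX i. u (ta i + x) < c" by blast
  qed
 qed
 moreover have "norm (ta i) < de" for i using U(3) rng by (auto simp: subset_eq)
 ultimately show ?thesis using that by blast
qed

lemma sob_min:
 assumes "sob Om p v1 g1" "sob Om p v2 g2" "0 < p"
 shows "sob Om p (%x. min (v1 x) (v2 x)) (%x. if v1 x < v2 x then g1 x else g2 x)"
proof -
 have "sob Om p (%x. v2 x - max (v2 x - v1 x - 0) 0) (%x. g2 x - (if 0 < v2 x - v1 x then g2 x - g1 x else 0))"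
  by (rule sob_diff[OF assms(2) sob_pos_part[OF sob_diff[OF assms(2,1,3)] assms(3) order_refl] assms(3)])
 moreover have "(%x. v2 x - max (v2 x - v1 x - 0) 0) = (%x. min (v1 x) (v2 x))" by (auto simp: fun_eq_iff)
 moreover have "(%x. g2 x - (if 0 < v2 x - v1 x then g2 x - g1 x else 0)) = (%x. if v1 x < v2 x then g1 x else g2 x)" by auto
 ultimately show ?thesis by simp
qed

section \<open>Positivity of a solution on compact parts of the domain\<close>

context solution_pair
begin

text \<open>The source of min(u, 1), expressed through its value: where the truncation is active the
  value is 1 and the source is 0.\<close>

definition "f1 t = (if t < 1 then f t else 0)"

lemma f1_nonneg: "0 <= f1 t" using f_nonneg by (simp add: f1_def)

lemma f1_measurable [measurable]: "f1 : borel_measurable borel" unfolding f1_def[abs_def] by measurable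

text \<open>The supersolution property holds only on \<open>Om'\<close>, where all translates stay
  in \<open>Om\<close>, while the minima are Sobolev functions on the larger set \<open>Om2\<close>
  containing all translated domains.\<close>

lemma min_translates_supersol:
 fixes ta :: "nat => 'a"
 assumes Om': "open Om'" "bounded Om'" and ta: "!!i x. x : Om' ==> ta i + x : Om"
  and big: "!!i. (%x. x - ta i) ` Om <= Om2"
 shows "EX v g. sob Om2 p v g & supersol Om' 1 p q g (%x. f1 (v x)) & (ALL x. v x = Min ((%i. min (u (ta i + x)) 1) ` {..k}))"
proof -
 have base: "sob Om2 p (%x. min (u (ta k + x)) 1) (%x. if 1 < u (ta k + x) then 0 else G (ta k + x))"
  "supersol Om' 1 p q (%x. if 1 < u (ta k + x) then 0 else G (ta k + x)) (%x. f1 (min (u (ta k + x)) 1))" for k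
 proof -
  show "sob Om2 p (%x. min (u (ta k + x)) 1) (%x. if 1 < u (ta k + x) then 0 else G (ta k + x))"
  by (rule sob_mono[OF sob_translation[OF sob_min_const[OF u(1) pp(1) zero_le_one], of "ta k"] big])
  have "supersol Om 1 p q (%x. if 1 < u x then 0 else G x) (%x. f1 (min (u x) 1))"
  by (rule supersol_source_mono[OF supersol_truncated[OF zero_less_one]]) (auto simp: f1_def f_nonneg)
  then show "supersol Om' 1 p q (%x. if 1 < u (ta k + x) then 0 else G (ta k + x)) (%x. f1 (min (u (ta k + x)) 1))"
  by (rule supersol_translation[OF _ ta]) measurable
 qed
 show ?thesis
 proof (induction k)
 case 0
 show ?case using base[of 0] by auto
next
 case (Suc k)
 obtain v g where v: "sob Om2 p v g" "supersol Om' 1 p q g (%x. f1 (v x))"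
  "!!x. v x = Min ((%i. min (u (ta i + x)) 1) ` {..k})" using Suc.IH by blast
 let ?b = "%x. min (u (ta (Suc k) + x)) 1" and ?g = "%x. if 1 < u (ta (Suc k) + x) then 0 else G (ta (Suc k) + x)"
 note b = base[of "Suc k"]
 have [measurable]: "v : lmeas" "?b : lmeas"
  using sob_meas[OF v(1)] sob_meas[OF b(1)] by auto
 have "supersol Om' 1 p q (%x. if v x < ?b x then g x else ?g x) (%x. if v x < ?b x then f1 (v x) else f1 (?b x))"
 proof (rule supersol_min[OF Om' q(1) pp(4) zero_le_one v(2) b(2), where c = 0 and Om' = Om2])
  show "grad_int Om' p g" "grad_int Om' p ?g" using sob_grad_int[OF v(1) pp(1)] sob_grad_int[OF b(1) pp(1)] Om' by auto
  show "sob Om2 p (%x. ?b x - v x - 0) (%x. ?g x - g x)" using sob_diff[OF b(1) v(1) pp(1)] by simp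
 qed (auto simp: f1_nonneg)
 moreover have "(%x. if v x < ?b x then f1 (v x) else f1 (?b x)) = (%x. f1 (min (v x) (?b x)))" by (auto simp: min_def)
 moreover have "min (v x) (?b x) = Min ((%i. min (u (ta i + x)) 1) ` {..Suc k})" for x
  unfolding atMost_Suc image_insert v(3) by (subst Min_insert) (auto simp: min.commute)
 ultimately show ?case using sob_min[OF v(1) b(1) pp(1)] by (intro exI conjI allI) auto
 qed
qed

definition "good x \<longleftrightarrow> (EX c>0. EX de>0. ball x de <= Om & (AL y. y : ball x de --> c <= u y))"

text \<open>Without a good point, minima of more and more translates tend to 0 almost everywhere on
  a neighbourhood of the support of \<open>ps\<close>. The error in \<open>picone_local\<close> then
  disappears, while the source of the minima below the level 1 is at least mu v^(q-1). The limit
  contradicts the strict Rayleigh inequality for \<open>ps\<close>.\<close>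

lemma good_somewhere:
 assumes ps: "c1c Om ps D" "!!x. ps x : {0..M}" and K: "!!x. 0 < ps x ==> norm (D x) powr p <= K * ps x powr (p - q)"
  and lt: "(LI x. norm (D x) powr q) < mu * (LI x. ps x powr q)"
 shows "EX x. good x"
proof (rule ccontr)
 assume no: "\<not> ?thesis"
 obtain S where S: "compact S" "S <= Om" "!!x. x ~: S ==> ps x = 0 & D x = 0" using ps(1) unfolding c1c_def by blast
 obtain e where e: "0 < e" "(\<Union>x\<in>S. ball x e) <= Om"
  using compact_subset_open_imp_ball_epsilon_subset[OF S(1) Om(1) S(2)] by blast
 \<comment> \<open>One half of the distance is spent on the neighbourhood \<open>Om'\<close> of the
   support, the other on the shifts.\<close>
 define de where "de = e / 2"
 have de: "0 < de" using e by (simp add: de_def)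
 define Om' where "Om' = (\<Union>x\<in>S. ball x de)"
 have near: "y : Om" if x: "x : Om'" and y: "dist x y < de" for x y
 proof -
  obtain z where z: "z : S" "dist z x < de" using x by (auto simp: Om'_def)
  have "dist z y < e" using dist_triangle[of z y x] z(2) y by (simp add: de_def)
  then have "y : ball z e" by simp
  with e(2) z(1) show ?thesis by blast
 qed
 have Om'sub: "Om' <= Om" using near de by force
 have o: "open Om'" unfolding Om'_def by (intro open_UN ballI open_ball)
 have b: "bounded Om'" using Om(2) Om'sub bounded_subset by blast
 have "S <= Om'" using de by (force simp: Om'_def)
 then have c': "c1c Om' ps D" using ps(1) S unfolding c1c_def by blast
 have mu0: "0 < mu"
 proof (rule ccontr)
  assume "\<not> 0 < mu"
  then have "mu = 0" using mu by simp
  then have "(LI x. norm (D x) powr q) < 0" using lt by simp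
  moreover have "0 <= (LI x. norm (D x) powr q)" by simp
  ultimately show False by linarith
 qed
 obtain ta :: "nat => 'a" where ta: "!!i. norm (ta i) < de"
  and van: "AL x. x : Om' --> (ALL c>0. EX i. u (ta i + x) < c)"
 proof (rule vanishing_translates[OF measurable_u(1) b borel_open[OF o] de])
  fix x c assume x: "x : Om'" and c: "(0::real) < c"
  have "ball x de <= Om" using near[OF x] by auto
  then show "\<not> (AL y. y : ball x de --> c <= u y)" using no c de unfolding good_def by blast
 qed (rule that)
 obtain L where L: "!!x. x : Om ==> norm x <= L" using Om(2) bounded_iff by blast
 define Om2 where "Om2 = (ball 0 (L + de + 1) :: 'a set)"
 have big: "(%x. x - ta i) ` Om <= Om2" for i
 proof
  fix y assume "y : (%x. x - ta i) ` Om"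
  then obtain x where x: "x : Om" "y = x - ta i" by blast
  then show "y : Om2" using L[OF x(1)] ta[of i] norm_triangle_ineq4[of x "ta i"] by (simp add: Om2_def)
 qed
 have shift: "ta i + x : Om" if "x : Om'" for i x using near[OF that, of "ta i + x"] ta[of i] by (simp add: dist_norm)
 have "ALL k. EX v. EX g. sob Om2 p v g & supersol Om' 1 p q g (%x. f1 (v x)) & (ALL x. v x = Min ((%i. min (u (ta i + x)) 1) ` {..k}))"
  by (rule allI, rule min_translates_supersol[OF o b _ big]) (rule shift)
 from choice[OF this] obtain v where "ALL k. EX g. sob Om2 p (v k) g & supersol Om' 1 p q g (%x. f1 (v k x)) & (ALL x. v k x = Min ((%i. min (u (ta i + x)) 1) ` {..k}))"
  by (rule exE)
 from choice[OF this] obtain g where vg: "ALL k. sob Om2 p (v k) (g k) & supersol Om' 1 p q (g k) (%x. f1 (v k x)) & (ALL x. v k x = Min ((%i. min (u (ta i + x)) 1) ` {..k}))"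
  by (rule exE)
 have v: "sob Om2 p (v k) (g k)" "supersol Om' 1 p q (g k) (%x. f1 (v k x))" "v k x = Min ((%i. min (u (ta i + x)) 1) ` {..k})" for k x
  using vg by blast+
 have v01: "v k x : {0..1}" for k x
 proof -
  have "0 <= v k x" unfolding v(3) by (rule Min.boundedI) (use u(2) in auto)
  moreover have "v k x <= min (u (ta 0 + x)) 1" unfolding v(3) by (rule Min_le) auto
  ultimately show ?thesis by auto
 qed
 have vpos: "AL x. x : Om' --> 0 < v k x" for k
 proof -
  have "AL x. ALL i. ta i + x : Om --> 0 < u (ta i + x)"
  unfolding AE_all_countable using AE_trans[OF u(3)] by blast
  then show ?thesis
  proof eventually_elim
  case (elim x)
  show ?case
  proof
  assume "x : Om'"
  then show "0 < v k x" unfolding v(3) using elim shift by (subst Min_gr_iff) auto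
  qed
  qed
 qed
 have vlim: "AL x. x : Om' --> (%k. v k x) ----> 0" using van
 proof eventually_elim
  case (elim x)
  show ?case
  proof
  assume x: "x : Om'"
  show "(%k. v k x) ----> 0"
  proof (rule LIMSEQ_I)
  fix r :: real assume "0 < r"
  then obtain i where i: "u (ta i + x) < r" using elim x by blast
  have "norm (v k x - 0) < r" if "k >= i" for k
  proof -
  have "v k x <= min (u (ta i + x)) 1" unfolding v(3) by (rule Min_le) (use that in auto)
  then show ?thesis using i v01[of k x] by simp
  qed
  then show "EX no. ALL n>=no. norm (v n x - 0) < r" by blast
  qed
  qed
 qed
 have [measurable]: "v k : lmeas" for k using sob_meas[OF v(1)] by auto
 have [measurable]: "ps : lmeas" using c1c_meas[OF ps(1)] by auto
 have [measurable]: "Om' : sets lebesgue" using o by simp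
 have ips: "lint (%x. ps x powr q)"
  using sob_intb(1)[OF c1c_sob[OF ps(1)], of q] q ps(2) by simp
 have ipsk: "lint (%x. indicator {x. v k x < 1} x * ps x powr q)" for k
  by (rule intb_bound[OF ips]) (auto simp: indicator_def)
 define C where "C = q * (q / (q - 1)) powr (p - 1) * K"
 have step: "mu * (LI x. indicator {x. v k x < 1} x * ps x powr q)
  <= (LI x. norm (D x) powr q) + C * (LI x. indicator Om' x * v k x powr (p - q))" for k
 proof -
  have "ennreal (mu * (LI x. indicator {x. v k x < 1} x * ps x powr q))
  = (NI x. ennreal (mu * (indicator {x. v k x < 1} x * ps x powr q)))"
  by (subst nn_eq_lint) (use ipsk mu in auto)
  also have "... <= (NI x. ennreal (f1 (v k x) * (ps x powr q * v k x powr (1 - q))))"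
  proof (rule nn_integral_mono_AE, use vpos[of k] in eventually_elim)
  fix x assume px: "x : Om' --> 0 < v k x"
  have "mu * (indicator {x. v k x < 1} x * ps x powr q) <= f1 (v k x) * (ps x powr q * v k x powr (1 - q))"
  proof (cases "x : Om' & v k x < 1")
  case True
  then have "mu * v k x powr (q - 1) <= f1 (v k x)" using lam_nonneg by (simp add: f1_def f_def)
  then have "mu * v k x powr (q - 1) * (ps x powr q * v k x powr (1 - q)) <= f1 (v k x) * (ps x powr q * v k x powr (1 - q))"
  by (intro mult_rm) auto
  moreover have "v k x powr (q - 1) * v k x powr (1 - q) = 1" using True px by (simp add: powr_add[symmetric])
  then have "mu * v k x powr (q - 1) * (ps x powr q * v k x powr (1 - q)) = mu * ps x powr q"
  by (metis (no_types) mult.assoc mult.left_commute mult.right_neutral)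
  ultimately show ?thesis using True by simp
  next
  case False
  then have "indicator {x. v k x < 1} x * ps x powr q = 0" using c' unfolding c1c_def by (auto simp: indicator_def)
  then have "mu * (indicator {x. v k x < 1} x * ps x powr q) = 0" by simp
  moreover have "0 <= f1 (v k x) * (ps x powr q * v k x powr (1 - q))" by (intro mult_nonneg_nonneg f1_nonneg powr_ge_zero)
  ultimately show ?thesis by linarith
  qed
  then show "ennreal (mu * (indicator {x. v k x < 1} x * ps x powr q)) <= ennreal (f1 (v k x) * (ps x powr q * v k x powr (1 - q)))"
  by (rule ennreal_leI)
  qed
  also have "... <= ennreal ((LI x. norm (D x) powr q) + C * (LI x. indicator Om' x * v k x powr (p - q)))"
  unfolding C_def
  by (rule picone_local[OF o b q v(1) v01 vpos v(2) _ _ c' ps(2) K]) (use f1_nonneg in auto)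
  finally have le: "ennreal (mu * (LI x. indicator {x. v k x < 1} x * ps x powr q))
  <= ennreal ((LI x. norm (D x) powr q) + C * (LI x. indicator Om' x * v k x powr (p - q)))" .
  have "0 <= C"
  proof -
  have "EX x. 0 < ps x"
  proof (rule ccontr)
  assume "\<not> ?thesis"
  then have "ps x = 0" for x using ps(2)[of x] by (force intro: antisym simp: not_less)
  then have "(LI x. norm (D x) powr q) < 0" using lt q by simp
  moreover have "0 <= (LI x. norm (D x) powr q)" by simp
  ultimately show False by linarith
  qed
  then obtain x where x: "0 < ps x" by blast
  have "0 <= K * ps x powr (p - q)" using K[OF x] powr_ge_zero order_trans by blast
  then have "0 <= K" using x by (simp add: zero_le_mult_iff)
  then show ?thesis unfolding C_def using q by simp
  qed
  then have "0 <= (LI x. norm (D x) powr q) + C * (LI x. indicator Om' x * v k x powr (p - q))"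
  by (intro add_nonneg_nonneg mult_nonneg_nonneg) auto
  then show ?thesis using le by (subst (asm) ennreal_le_iff)
 qed
 have l1: "(%k. LI x. indicator {x. v k x < 1} x * ps x powr q) ----> (LI x. ps x powr q)"
 proof (rule int_dom[OF _ _ ips])
  show "AL x. (%k. indicator {x. v k x < 1} x * ps x powr q) ----> ps x powr q" using vlim
  proof eventually_elim
  case (elim x)
  show ?case
  proof (cases "x : Om'")
  case True
  then have "\<forall>\<^sub>F k in sequentially. v k x < 1" using elim order_tendstoD(2)[of _ 0] by fastforce
  then have "\<forall>\<^sub>F k in sequentially. indicator {x. v k x < 1} x * ps x powr q = ps x powr q" by eventually_elim simp
  then show ?thesis by (rule tendsto_eventually)
  next
  case False
  then have "ps x = 0" using c' unfolding c1c_def by blast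
  then show ?thesis using q by simp
  qed
  qed
 qed (auto simp: indicator_def)
 have l2: "(%k. LI x. indicator Om' x * v k x powr (p - q)) ----> (LI x. (%x::'a. 0) x)"
 proof (rule int_dom[OF _ _ intb_indicator[OF o b]])
  show "AL x. (%k. indicator Om' x * v k x powr (p - q)) ----> 0" using vlim
  proof eventually_elim
  case (elim x)
  show ?case
  proof (cases "x : Om'")
  case True
  have "(%k. v k x powr (p - q)) ----> 0 powr (p - q)"
  proof (rule tendsto_powr2[OF _ tendsto_const])
  show "(%k. v k x) ----> 0" using elim True by blast
  show "\<forall>\<^sub>F k in sequentially. 0 <= v k x" using v01 by (intro always_eventually allI) auto
  qed (use q in simp)
  then show ?thesis using True q by simp
  qed simp
  qed
  show "AL x. norm (indicator Om' x * v k x powr (p - q)) <= indicator Om' x" for k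
  using v01[of k] q powr_mono2[of "p - q" "v k _" 1] by (auto simp: indicator_def)
 qed auto
 have "mu * (LI x. ps x powr q) <= (LI x. norm (D x) powr q) + C * (LI x. (%x::'a. 0) x)"
  by (rule LIMSEQ_le[OF tendsto_mult[OF tendsto_const l1] tendsto_add[OF tendsto_const tendsto_mult[OF tendsto_const l2]]])
  (use step in auto)
 then show False using lt by simp
qed

text \<open>A radial barrier around a good point, with its source concentrated where u >= c, lies
  below u and is positive throughout the ball: a strong maximum principle without Harnack's
  inequality.\<close>

lemma good_imp_bounds:
 assumes mu0: "0 < mu" and x': "good x'" and r: "ball x' r <= Om" "dist x x' < r"
 shows "good x"
proof -
 obtain c de where c: "0 < c" "0 < de" "AL y. y : ball x' de --> c <= u y" using x' unfolding good_def by blast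
 have fc: "0 < f c" unfolding f_def using mu0 c lam_nonneg by (intro add_nonneg_pos) auto
 define F where "F t = f c * max 0 (1 - t / de)" for t
 have r0: "0 < r" using r(2) zero_le_dist[of x x'] by linarith
 interpret W: barrier x' r 1 p q F
 proof
  show "contU F" unfolding F_def by (intro con_intros) (use c in auto)
  show "0 <= F t" for t using fc by (simp add: F_def)
  show "0 < F 0" using fc by (simp add: F_def)
 qed (use r0 q pp in auto)
 have "AL y. W.bar y <= u y"
 proof (rule W.bar_le_supersol[OF Om(1,2) r(1) u(1,2) supersol_u])
  show "AL y. y : ball x' r --> F (norm (y - x')) <= f (u y)" using c(3)
  proof eventually_elim
  case (elim y)
  show ?case
  proof (cases "y : ball x' de")
  case True
  have "F (norm (y - x')) <= f c * 1" unfolding F_def using fc c(2) by (intro mult_lm) auto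
  moreover have "f c <= f (u y)" using True elim c by (intro f_mono) auto
  ultimately show ?thesis by simp
  next
  case False
  then have "1 - norm (y - x') / de <= 0" using c(2) by (simp add: dist_norm norm_minus_commute)
  then show ?thesis using f_nonneg[of "u y"] by (simp add: F_def max_def)
  qed
  qed
 qed simp
 moreover have "0 < W.bar x" by (rule W.bar_pos) (use r in "simp add: dist_commute")
 moreover have "isCont W.bar x" using W.bar_continuous con_eq_at[OF open_UNIV] by blast
 ultimately obtain d where d: "0 < d" "!!y. dist y x < d ==> W.bar x / 2 < W.bar y"
 proof -
  assume *: "isCont W.bar x" "0 < W.bar x"
  then obtain d where d: "0 < d" "!!y. dist y x < d ==> dist (W.bar y) (W.bar x) < W.bar x / 2"
  unfolding continuous_at_eps_delta using half_gt_zero by blast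
  have "W.bar x / 2 < W.bar y" if "dist y x < d" for y
  proof -
  have "<|W.bar y - W.bar x|> < W.bar x / 2" using d(2)[OF that] by (simp add: dist_real_def)
  then show ?thesis by linarith
  qed
  with d(1) show ?thesis by (rule that)
 qed
 have xO: "x : ball x' r" using r by (simp add: dist_commute)
 then obtain d' where d': "0 < d'" "ball x d' <= ball x' r" by (rule openE[OF open_ball])
 have "AL y. y : ball x (min d d') --> W.bar x / 2 <= u y"
  using \<open>AL y. W.bar y <= u y\<close>
  by eventually_elim (use d(2) in "force simp: dist_commute")
 moreover have "ball x (min d d') <= Om" using d' r by auto
 ultimately show ?thesis unfolding good_def using d(1) d'(1) \<open>0 < W.bar x\<close>
  by (intro exI[of _ "W.bar x / 2"] exI[of _ "min d d'"] conjI) auto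
qed

text \<open>By \<open>good_imp_bounds\<close> the good points form an open and relatively closed
  set. The doubled radius ensures that a ball around a nearby good point still lies in the domain
  and contains the limit point.\<close>

lemma good_everywhere:
 assumes mu0: "0 < mu" and con: "connected Om" and g: "good x0" and x: "x : Om"
 shows "good x"
proof -
 define A where "A = {x. good x}"
 have AO: "A <= Om" unfolding A_def good_def by (force simp: subset_eq)
 have near: "good y" if x: "x : A" and yr: "ball y (2 * r) <= Om" "dist y x < r" for x y r
 proof (rule good_imp_bounds[OF mu0 _ _ yr(2)])
  show "good x" using x by (simp add: A_def)
  show "ball x r <= Om"
  proof
  fix z assume "z : ball x r"
  then have "dist y z < 2 * r" using dist_triangle[of y z x] yr(2) by simp
  then show "z : Om" using yr(1) by auto
  qed
 qed
 have r: "EX r>0. ball y (2 * r) <= Om" if "y : Om" for y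
 proof -
  obtain e where "0 < e" "ball y e <= Om" by (rule openE[OF Om(1) \<open>y : Om\<close>])
  then show ?thesis by (intro exI[of _ "e / 2"]) auto
 qed
 have oA: "open A" unfolding open_contains_ball
 proof
  fix y assume y: "y : A"
  then have "y : Om" using AO by blast
  then obtain e where e: "0 < e" "ball y e <= Om" by (rule openE[OF Om(1)])
  have "ball y e <= A"
  proof
  fix z assume "z : ball y e"
  then have "dist z y < e" by (simp add: dist_commute)
  moreover have "good y" using y by (simp add: A_def)
  ultimately have "good z" by (rule good_imp_bounds[OF mu0 _ e(2), rotated])
  then show "z : A" by (simp add: A_def)
  qed
  then show "EX e>0. ball y e <= A" using e by blast
 qed
 have oB: "open (Om - A)" unfolding open_contains_ball
 proof
  fix y assume y: "y : Om - A"
  then obtain r where r: "0 < r" "ball y (2 * r) <= Om" using r by blast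
  have "ball y r <= Om - A"
  proof
  fix z assume z: "z : ball y r"
  then have "z ~: A" using near[of z y r] r y by (auto simp: A_def)
  then show "z : Om - A" using z r by auto
  qed
  then show "EX e>0. ball y e <= Om - A" using r by blast
 qed
 have "A \<inter> Om = {} \<or> (Om - A) \<inter> Om = {}" by (rule connectedD[OF con oA oB]) auto
 moreover have "x0 : A \<inter> Om" using g AO by (auto simp: A_def)
 ultimately show ?thesis using x by (auto simp: A_def)
qed

text \<open>Provides the growth condition |D|^p <= K ps^(p-q). Near a zero the smoothed positive
  part of an approximant t behaves like t^2 / e and its gradient like t, so the condition compares
  t^p with t^(2(p-q)); it holds since p <= 2 q. Smoothing does not increase the gradient, so the
  strict inequality survives.\<close>

lemma nice_test_function:
 assumes ze: "sob Om p ze Z" "!!x. 0 <= ze x" and lt: "(LI x. norm (Z x) powr q) < mu * (LI x. ze x powr q)"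
  and pq: "p <= 2 * q"
 shows "EX x. good x"
proof -
 obtain Ph H l where 1: "!!n. c1c Om (Ph n) (H n)" "AL x. (%n. Ph n x) ----> ze x"
  "AL x. (%n. H n x) ----> Z x" "lint l" "!!x. 0 <= l x"
  "AL x. ALL n. pdens p (Ph n) (H n) x <= l x" "AL x. pdens p ze Z x <= l x"
  by (rule sob_dominated[OF ze(1) pp(1)]) (assumption | rule that)+
 define e where "e n = 1 / real (Suc n)" for n
 have e: "0 < e n" for n by (simp add: e_def)
 have e0: "e ----> 0" unfolding e_def[abs_def] by (rule inv_Suc)
 define ps where "ps n x = softpos 0 (e n) (Ph n x)" for n x
 define D where "D n x = softpos' 0 (e n) (Ph n x) *R H n x" for n x
 have c: "c1c Om (ps n) (D n)" for n unfolding ps_def D_def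
  by (rule c1c_compose[OF 1(1) softpos_has_derivative[OF e] continuous_softpos'[OF e]]) (simp add: softpos_def)
 have [measurable]: "Ph n : lmeas" "H n : lmeas" "ps n : lmeas"
  "D n : lmeas" for n
  using c1c_meas[OF 1(1)] c1c_meas[OF c] by auto
 have [measurable]: "ze : lmeas" "Z : lmeas" "Om : sets lebesgue"
  using sob_meas[OF ze(1)] Om(1) by auto
 have sp: "0 <= softpos 0 d t" "softpos 0 d t <= <|t|>" "<|softpos 0 d t - max t 0|> <= d" if "0 < d" for d t
 proof -
  show "0 <= softpos 0 d t" using that by (simp add: softpos_def)
  show "softpos 0 d t <= <|t|>" using that by (auto simp: softpos_def field_simps power2_eq_square)
  show "<|softpos 0 d t - max t 0|> <= d"
  proof (cases "0 < t")
  case True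
  have "max t 0 - softpos 0 d t = d * (t / (t + d))" using True that by (simp add: softpos_def field_simps power2_eq_square)
  moreover have "d * (t / (t + d)) <= d * 1" using True that by (intro mult_lm) auto
  moreover have "0 <= d * (t / (t + d))" using True that by simp
  ultimately show ?thesis by linarith
  qed (use that in "simp add: softpos_def")
 qed
 have out: "Ph n x = 0 & H n x = 0 & ps n x = 0" if "x ~: Om" for n x
  using 1(1)[of n] c[of n] that unfolding c1c_def by blast
 have ps0: "0 <= ps n x" for n x unfolding ps_def by (rule sp(1)[OF e])
 have il: "lint (%x. indicator Om x + l x)" using intb_indicator[OF Om(1,2)] 1(4) by simp
 have qle: "s powr q <= indicator Om x + l x" if "x ~: Om ==> s = 0" "0 <= s" "s powr p <= l x" for s x
 proof (cases "x : Om")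
  case True
  have "s powr q <= 1 + s powr p" using that(2) q by (intro powr_le_one_plus) auto
  then show ?thesis using that(3) True by simp
 qed (use that 1(5) q in simp)
 have l1: "(%n. LI x. ps n x powr q) ----> (LI x. ze x powr q)"
 proof (rule int_dom[OF _ _ il])
  show "AL x. (%n. ps n x powr q) ----> ze x powr q" using 1(2)
  proof eventually_elim
  case (elim x)
  have "(%n. ps n x - max (Ph n x) 0) ----> 0"
  by (rule Lim_null_comparison[OF _ e0]) (use sp(3)[OF e] in "simp add: ps_def")
  from tendsto_add[OF this tendsto_max[OF elim tendsto_const[of 0]]]
  have "(%n. ps n x) ----> ze x" using ze(2)[of x] by (simp add: max_def)
  then show ?case
  by (rule tendsto_powr2[OF _ tendsto_const]) (use sp(1)[OF e] q in "auto simp: ps_def")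
  qed
  show "AL x. norm (ps n x powr q) <= indicator Om x + l x" for n using 1(6)
  proof eventually_elim
  case (elim x)
  have "ps n x powr p <= <|Ph n x|> powr p" unfolding ps_def using sp(1,2)[OF e] pp by (intro powr_mono2) auto
  also have "... <= l x" using elim[rule_format, of n] by (simp add: pdens_def) (smt (verit) powr_ge_zero)
  finally have "ps n x powr q <= indicator Om x + l x"
  by (intro qle) (use out ps0 in auto)
  then show ?case by simp
  qed
 qed measurable
 have l2: "(%n. LI x. norm (H n x) powr q) ----> (LI x. norm (Z x) powr q)"
 proof (rule int_dom[OF _ _ il])
  show "AL x. (%n. norm (H n x) powr q) ----> norm (Z x) powr q" using 1(3)
  proof eventually_elim
  case (elim x)
  show ?case by (rule tendsto_powr2[OF tendsto_norm[OF elim] tendsto_const]) (use q in auto)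
  qed
  show "AL x. norm (norm (H n x) powr q) <= indicator Om x + l x" for n using 1(6)
  proof eventually_elim
  case (elim x)
  have "norm (H n x) powr p <= l x" using elim[rule_format, of n] by (simp add: pdens_def) (smt (verit) powr_ge_zero)
  then have "norm (H n x) powr q <= indicator Om x + l x" by (intro qle) (use out in auto)
  then show ?case by simp
  qed
 qed measurable
 have "(%n. mu * (LI x. ps n x powr q) - (LI x. norm (H n x) powr q))
  ----> mu * (LI x. ze x powr q) - (LI x. norm (Z x) powr q)"
  by (rule tendsto_diff[OF tendsto_mult[OF tendsto_const l1] l2])
 moreover have "0 < mu * (LI x. ze x powr q) - (LI x. norm (Z x) powr q)" using lt by simp
 ultimately have "\<forall>\<^sub>F n in sequentially. 0 < mu * (LI x. ps n x powr q) - (LI x. norm (H n x) powr q)"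
  by (rule order_tendstoD(1))
 then obtain n where n: "(LI x. norm (H n x) powr q) < mu * (LI x. ps n x powr q)"
  unfolding eventually_sequentially by (metis diff_gt_0_iff_gt order_refl)
 obtain S where S: "compact S" "!!x. x ~: S ==> Ph n x = 0 & H n x = 0" using 1(1)[of n] unfolding c1c_def by blast
 have cH: "contU (H n)" using 1(1)[of n] unfolding c1c_def by blast
 obtain b where b: "!!x. norm (H n x) <= b" using bdd_compact[OF cH S(1)] S(2) by blast
 obtain M where M: "!!x. norm (Ph n x) <= M" using bdd_compact[OF c1c_con[OF 1(1)] S(1)] S(2) by blast
 have b0: "0 <= b" using b[of undefined] norm_ge_zero order_trans by blast
 have s': "0 <= softpos' 0 (e n) t" "softpos' 0 (e n) t <= 1" for t using softpos'_bounds[OF e] by auto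
 show ?thesis
 proof (rule good_somewhere[OF c])
  show "ps n x : {0..M}" for x unfolding ps_def using sp(1,2)[OF e, of n "Ph n x"] M[of x] by auto
  \<comment> \<open>The factor 2 comes from the bound 2 t / (t + e n) for the slope of the smoothed
    positive part, and \<open>b\<close> bounds the gradient of the approximant.\<close>
  show "norm (D n x) powr p <= (2 powr p * e n powr (q - p) * b powr p) * ps n x powr (p - q)" if x: "0 < ps n x" for x
  proof -
  define t where "t = Ph n x"
  have t: "0 < t" using x by (auto simp: ps_def t_def softpos_def split: if_splits)
  have en: "0 < e n" by (rule e)
  have "softpos' 0 (e n) t = t * (t + 2 * e n) / (t + e n)^2"
  proof -
  have "(t + e n)^2 ~= 0" using t en by simp
  then have "1 - (e n)^2 / (t + e n)^2 = ((t + e n)^2 - (e n)^2) / (t + e n)^2" by (simp add: diff_divide_distrib)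
  also have "(t + e n)^2 - (e n)^2 = t * (t + 2 * e n)" by (simp add: power2_eq_square algebra_simps)
  finally show ?thesis using t by (simp add: softpos'_def)
  qed
  also have "... <= 2 * t * (t + e n) / (t + e n)^2" using t en by (intro divide_right_mono) (auto simp: algebra_simps)
  also have "... = 2 * t / (t + e n)" using t en by (simp add: power2_eq_square)
  finally have s: "softpos' 0 (e n) t <= 2 * t / (t + e n)" .
  have "norm (D n x) <= 2 * t / (t + e n) * b"
  proof -
  have "norm (D n x) = softpos' 0 (e n) t * norm (H n x)" using s'(1)[of t] by (simp add: D_def t_def)
  also have "... <= 2 * t / (t + e n) * b" by (intro mult_mono s b) (use t en in auto)
  finally show ?thesis .
  qed
  then have "norm (D n x) powr p <= (2 * t / (t + e n) * b) powr p" using pp by (intro powr_mono2) auto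
  also have "... = (2 powr p * b powr p) * (t powr p / (t + e n) powr p)"
  using t en b0 by (simp add: powr_mult powr_divide)
  \<comment> \<open>The last two factors form \<open>ps n x powr (p - q)\<close>; the first two are
    at most \<open>e n powr (q - p)\<close> because 2 q - p is nonnegative.\<close>
  also have "t powr p / (t + e n) powr p = t powr (2 * q - p) * (t + e n) powr (- q) * (t powr (2 * (p - q)) * (t + e n) powr (q - p))"
  proof -
  have 1: "t powr p / (t + e n) powr p = t powr p * (t + e n) powr (- p)" by (simp add: powr_minus_divide)
  have 2: "t powr p = t powr (2 * q - p) * t powr (2 * (p - q))" by (simp add: powr_add[symmetric])
  have 3: "(t + e n) powr (- p) = (t + e n) powr (- q) * (t + e n) powr (q - p)" by (simp add: powr_add[symmetric])
  show ?thesis by (subst 1, subst 2, subst 3) (simp only: mult_ac)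
  qed
  also have "t powr (2 * (p - q)) * (t + e n) powr (q - p) = ps n x powr (p - q)"
  proof -
  have "t\<^sup>2 powr (p - q) = t powr (2 * (p - q))" using t powr_powr[of t 2 "p - q"] by simp
  moreover have "(t + e n) powr (q - p) = 1 / (t + e n) powr (p - q)" using powr_minus_divide[of "t + e n" "p - q"] by simp
  ultimately show ?thesis using t en by (simp add: ps_def t_def[symmetric] softpos_def powr_divide)
  qed
  also have "(2 powr p * b powr p) * (t powr (2 * q - p) * (t + e n) powr (- q) * ps n x powr (p - q))
  <= (2 powr p * b powr p) * (e n powr (q - p) * ps n x powr (p - q))"
  proof (intro mult_lm mult_rm)
  have "t powr (2 * q - p) * (t + e n) powr (- q) <= (t + e n) powr (2 * q - p) * (t + e n) powr (- q)"
  using t en pq by (intro mult_rm powr_mono2) auto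
  also have "... = (t + e n) powr (q - p)" by (simp add: powr_add[symmetric])
  also have "... <= e n powr (q - p)" using t en q by (intro powr_mono2') auto
  finally show "t powr (2 * q - p) * (t + e n) powr (- q) <= e n powr (q - p)" .
  qed auto
  finally show ?thesis by (simp add: mult_ac)
  qed
  have "(LI x. norm (D n x) powr q) <= (LI x. norm (H n x) powr q)"
  proof (rule integral_mono)
  show "lint (%x. norm (D n x) powr q)" "lint (%x. norm (H n x) powr q)"
  using sob_intb(2)[OF c1c_sob[OF c], of q] sob_intb(2)[OF c1c_sob[OF 1(1)], of q] q by auto
  fix x
  have "norm (D n x) <= 1 * norm (H n x)" unfolding D_def using s'[of "Ph n x"] mult_rm[of "softpos' 0 (e n) (Ph n x)" 1 "norm (H n x)"] by simp
  then show "norm (D n x) powr q <= norm (H n x) powr q" using q by (intro powr_mono2) auto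
  qed
  then show "(LI x. norm (D n x) powr q) < mu * (LI x. ps n x powr q)" using n by linarith
 qed
qed

end

subsection \<open>Radial iteration below a solution in a ball\<close>

lemma radk_mono:
 assumes "contU F" "contU H" "!!s. 0 <= s ==> s <= r ==> F s <= H s" "0 <= r"
 shows "radk N F r <= radk N H r"
 unfolding radk_def
proof (rule integral_le[OF radk_intb[OF assms(1)] radk_intb[OF assms(2)]])
 fix ta :: real assume t: "ta : {0..1}"
 have "ta * r <= r" using t assms(4) mult_rm[of ta 1 r] by simp
 then show "ta ^ (N - 1) * F (ta * r) <= ta ^ (N - 1) * H (ta * r)"
  using t assms(3,4) by (intro mult_lm) auto
qed

locale ball_iter = solution_pair "ball c R" p q lam ph B mu u G
 for c :: "'a::euclidean_space" and R p q lam :: real and ph B mu u G +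
 fixes c0 de :: real
 assumes R: "0 < R" and pq1: "p <= q + 1" and mu0: "0 < mu"
  and c0: "0 < c0" "0 < de" and low: "AL y. y : ball c de --> c0 <= u y"
begin

text \<open>A continuous tent below the almost everywhere bound \<open>c0\<close> on the small ball;
  it vanishes outside, where nothing is known about u.\<close>

definition "v0 t = c0 * max 0 (1 - t / de)"

text \<open>The tent need not be a subsolution; taking the maximum with it at each step makes the
  sequence increase nevertheless. In the case of equality the maximum turns out to be inactive in
  the limit. Clipping the argument to [0, R] gives continuity on the whole line.\<close>

primrec vs :: "nat => real => real" where
 "vs 0 = v0"
| "vs (Suc n) = (%t. max (v0 t) (integral {min (max t 0) R..R} (%s. flow_inv 1 p q (s * radk DIM('a) (%t. f (vs n t)) s))))"

lemma v0_props: "contU v0" "0 <= v0 t" "0 < v0 0"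
 unfolding v0_def using c0 by (auto intro!: con_intros)

lemma f_pos: "0 < t ==> 0 < f t"
 unfolding f_def using mu0 lam_nonneg by (intro add_nonneg_pos) auto

lemma f_strict: "0 <= s ==> s < t ==> f s < f t"
 unfolding f_def using mu0 lam_nonneg q by (intro add_le_less_mono mult_lm mult_strict_left_mono powr_mono2 powr_less_mono2) auto

lemma f_continuous: "continuous_on {0..} f"
 unfolding f_def using q by (intro continuous_on_add continuous_on_mult continuous_on_powr' continuous_on_const continuous_on_id) auto

lemma f_vs_barrier:
 assumes "contU v" "!!t. 0 <= v t" "0 < v 0"
 shows "barrier R 1 p q (%t. f (v t))"
proof
 show "contU (%t. f (v t))" by (rule con_comp[OF f_continuous assms(1)]) (use assms(2) in auto)
qed (use R q pp f_nonneg f_pos assms in auto)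

lemma vs_props: "contU (vs n) & (ALL t. 0 <= vs n t) & 0 < vs n 0"
proof (induction n)
 case (Suc n)
 interpret b: barrier c R 1 p q "%t. f (vs n t)" by (rule f_vs_barrier) (use Suc in auto)
 have eq: "vs (Suc n) t = max (v0 t) (b.prof (min (max t 0) R))" for t by (simp add: b.prof_def b.slope_def[abs_def])
 have pc: "continuous_on {0..R} b.prof" by (rule DERIV_continuous_on[OF b.prof_derivative]) auto
 have "contU (%t. max (v0 t) (b.prof (min (max t 0) R)))"
  by (intro continuous_on_max v0_props con_comp[OF pc]) (use R in "auto intro!: con_intros")
 then have "contU (vs (Suc n))" unfolding eq[symmetric] .
 moreover have "0 <= vs (Suc n) t" for t unfolding eq using v0_props(2)[of t] by simp
 moreover have "0 < vs (Suc n) 0" unfolding eq using v0_props(3) by simp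
 ultimately show ?case by blast
qed (use v0_props in auto)

sublocale B: barrier c R 1 p q "%t. f (vs n t)" for n
 by (rule f_vs_barrier) (use vs_props[of n] in auto)

declare vs.simps [simp del]

lemma vs_Suc: "0 <= t ==> t <= R ==> vs (Suc n) t = max (v0 t) (B.prof n t)"
 by (simp add: vs.simps B.prof_def B.slope_def[abs_def])

lemma vs_nonneg [simp]: "0 <= vs n t" and vs_continuous: "contU (vs n)"
 using vs_props by blast+

lemma slope_mono:
 assumes "!!s. 0 <= s ==> s <= r ==> vs m s <= vs n s" "0 <= r"
 shows "B.slope m r <= B.slope n r"
proof -
 have "radk DIM('a) (%t. f (vs m t)) r <= radk DIM('a) (%t. f (vs n t)) r"
  by (rule radk_mono[OF B.F(1) B.F(1) _ assms(2)]) (use assms(1) in "auto intro!: f_mono")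
 then show ?thesis unfolding B.slope_def flow_inv_le_iff[OF B.pq] using assms(2) by (rule mult_lm)
qed

lemma prof_mono:
 assumes "!!s. 0 <= s ==> s <= R ==> vs m s <= vs n s" "0 <= r"
 shows "B.prof m r <= B.prof n r"
 unfolding B.prof_def by (rule integral_le[OF B.slope_integrable B.slope_integrable]) (use assms in "auto intro!: slope_mono")

lemma vs_step: "0 <= t ==> t <= R ==> vs n t <= vs (Suc n) t"
proof (induction n arbitrary: t)
 case 0
 then show ?case by (simp add: vs_Suc vs.simps(1))
next
 case (Suc n)
 have "B.prof n t <= B.prof (Suc n) t" by (rule prof_mono[OF Suc.IH Suc.prems(1)])
 then show ?case using Suc.prems by (simp add: vs_Suc max.coboundedI2)
qed

lemma prof_incseq: "0 <= r ==> incseq (%n. B.prof n r)"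
 by (rule incseq_SucI) (auto intro!: prof_mono vs_step)

lemma slope_incseq: "0 <= r ==> r <= R ==> incseq (%n. B.slope n r)"
 by (rule incseq_SucI) (auto intro!: slope_mono vs_step)

lemma bar_le_u: "AL x. ALL n. x : ball c R --> vs n (norm (x - c)) <= u x & B.bar n x <= u x"
proof -
 have v0: "AL x. x : ball c R --> v0 (norm (x - c)) <= u x" using low
 proof eventually_elim
  case (elim x)
  show ?case
  proof (cases "x : ball c de")
  case True
  have "v0 (norm (x - c)) <= c0 * 1" unfolding v0_def using c0 by (intro mult_lm) auto
  then show ?thesis using True elim by simp
  next
  case False
  then have "1 - norm (x - c) / de <= 0" using c0 by (simp add: dist_norm norm_minus_commute)
  then show ?thesis using u(2)[of x] by (simp add: v0_def max_def)
  qed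
 qed
 have bar: "AL x. B.bar n x <= u x" if "AL x. x : ball c R --> vs n (norm (x - c)) <= u x" for n
  by (rule B.bar_le_supersol[OF Om(1,2) order_refl u(1,2) supersol_u])
  (measurable, use that in eventually_elim, auto intro!: f_mono)
 have vs: "AL x. x : ball c R --> vs n (norm (x - c)) <= u x" for n
 proof (induction n)
  case 0
  then show ?case using v0 by (simp add: vs.simps)
 next
  case (Suc n)
  show ?case using v0 bar[OF Suc]
  by eventually_elim (auto simp: vs_Suc B.bar_def dist_norm norm_minus_commute)
 qed
 show ?thesis unfolding AE_all_countable
 proof
  fix n show "AL x. x : ball c R --> vs n (norm (x - c)) <= u x & B.bar n x <= u x"
  using vs[of n] bar[OF vs[of n]] by eventually_elim auto
 qed
qed

text \<open>Some point of the ball of radius r satisfies all the countably many comparisons at once.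
  There u has a finite value, and the profiles decrease outwards.\<close>

lemma prof_bounded:
 assumes r: "0 < r" "r < R" shows "EX M. ALL n. B.prof n r <= M"
proof -
 have "EX x:ball c r. ALL n. x : ball c R --> vs n (norm (x - c)) <= u x & B.bar n x <= u x"
 proof (rule ccontr)
  assume no: "\<not> ?thesis"
  have "AL x. x ~: ball c r" using bar_le_u by eventually_elim (use no in blast)
  then have "ball c r : null_sets lebesgue" using AE_iff_null_sets[of "ball c r" lebesgue] by simp
  then show False using open_not_negligible[OF open_ball, of c r] r by (simp add: negligible_iff_null_sets)
 qed
 then obtain x where x: "x : ball c r" "x : ball c R --> B.bar n x <= u x" for n by blast
 have nx: "norm (x - c) < r" using x by (simp add: dist_norm norm_minus_commute)
 have "B.prof n r <= u x" for n
 proof -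
  have "B.prof n r < B.prof n (norm (x - c))" by (rule B.prof_strict_decreasing) (use nx r in auto)
  moreover have "B.bar n x <= u x" using x(2)[of n] nx r by (simp add: dist_norm norm_minus_commute)
  ultimately show ?thesis using nx r by (simp add: B.bar_def)
 qed
 then show ?thesis by blast
qed

definition "mass n t = integral {0..t} (%s. s ^ (DIM('a) - 1) * f (vs n s))"

lemma mass_con: "continuous_on A (%s. s ^ (DIM('a) - 1) * f (vs n s))"
 by (intro con_intros con_sub[OF B.F(1)]) auto

lemma flow_slope_mass:
 assumes t: "0 < t" shows "flow 1 p q (B.slope n t) * t ^ (DIM('a) - 1) = mass n t"
proof -
 have N: "1 <= DIM('a)" using DIM_ge_Suc0[where 'a = 'a] by simp
 have "flow 1 p q (B.slope n t) * t ^ (DIM('a) - 1) = (t * t ^ (DIM('a) - 1)) * radk DIM('a) (%t. f (vs n t)) t"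
  unfolding B.flow_slope by (simp only: mult_ac)
 also have "t * t ^ (DIM('a) - 1) = t ^ DIM('a)" using power_minus_mult[OF DIM_positive[where 'a = 'a], of t] by (simp only: mult.commute)
 also have "t ^ DIM('a) * radk DIM('a) (%t. f (vs n t)) t = mass n t"
  unfolding mass_def by (rule radk_times_power[OF B.F(1) N]) (use t in simp)
 finally show ?thesis .
qed

lemma mass_mono:
 assumes "0 <= s" "s <= t" shows "mass n s <= mass n t"
 unfolding mass_def using assms f_nonneg
 by (intro integral_subset_le intb_cont mass_con) auto

text \<open>The slope cannot be large at \<open>r\<close> without being large on all of \<open>{r..R}\<close>.\<close>

lemma mass_bound:
 assumes r: "0 < r" "r < R" shows "mass n r <= R ^ (DIM('a) - 1) * flow 1 p q (B.prof n r / (R - r))"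
proof -
 let ?N = "DIM('a) - 1"
 define et where "et = flow_inv 1 p q (mass n r / R ^ ?N)"
 have m0: "0 <= mass n r" using mass_mono[of 0 r n] r by (simp add: mass_def)
 have "et <= B.slope n s" if s: "s : {r..R}" for s
 proof -
  have s0: "0 < s" using s r by simp
  have "mass n r <= mass n s" by (rule mass_mono) (use s r in auto)
  also have "... = flow 1 p q (B.slope n s) * s ^ ?N" by (rule flow_slope_mass[OF s0, symmetric])
  also have "... <= flow 1 p q (B.slope n s) * R ^ ?N"
  using s s0 B.slope_nonneg[of s n] by (intro mult_lm power_mono) (auto simp: flow_def)
  finally have "mass n r / R ^ ?N <= flow 1 p q (B.slope n s)" using R by (simp add: divide_le_eq)
  then have "et <= flow_inv 1 p q (flow 1 p q (B.slope n s))" unfolding et_def flow_inv_le_iff[OF B.pq] .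
  then show ?thesis unfolding flow_inv_flow[OF B.pq] .
 qed
 then have "integral {r..R} (%s. et) <= B.prof n r"
  unfolding B.prof_def by (intro integral_le integrable_const_ivl B.slope_integrable)
 then have "et * (R - r) <= B.prof n r" using r by (simp add: mult.commute)
 then have "et <= B.prof n r / (R - r)" using r by (simp add: pos_le_divide_eq)
 then have "flow 1 p q et <= flow 1 p q (B.prof n r / (R - r))"
  using strict_mono_less_eq[OF flow_strict_mono[OF B.pq]] by blast
 then show ?thesis unfolding et_def flow_flow_inv[OF B.pq] using R by (simp add: divide_le_eq mult.commute)
qed

text \<open>Since u is not known to be bounded, the limits might blow up at the centre; they are
  used on the open interval (0, R) only.\<close>

definition "W r = lim (%n. B.prof n r)"
definition "y r = lim (%n. B.slope n r)"

context
 fixes r :: real assumes r: "0 < r" "r < R"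
begin

lemma W_lim: "(%n. B.prof n r) ----> W r"
proof -
 obtain M where "!!n. B.prof n r <= M" using prof_bounded[OF r] by blast
 then obtain l where "(%n. B.prof n r) ----> l" using incseq_convergent[OF prof_incseq, of r M] r by (metis less_imp_le)
 then show ?thesis unfolding W_def by (simp add: limI)
qed

lemma prof_le_W: "B.prof n r <= W r"
 by (rule incseq_le[OF prof_incseq W_lim]) (use r in simp)

lemma W_pos: "0 < W r"
 using prof_le_W[of 0] B.prof_pos[of r 0] r by simp

lemma mass_bound': "mass n r <= R ^ (DIM('a) - 1) * flow 1 p q (W r / (R - r))"
proof -
 have "B.prof n r / (R - r) <= W r / (R - r)" using prof_le_W r by (intro divide_right_mono) auto
 then have "flow 1 p q (B.prof n r / (R - r)) <= flow 1 p q (W r / (R - r))"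
  using strict_mono_less_eq[OF flow_strict_mono[OF B.pq]] by blast
 then have "R ^ (DIM('a) - 1) * flow 1 p q (B.prof n r / (R - r)) <= R ^ (DIM('a) - 1) * flow 1 p q (W r / (R - r))"
  using R by (intro mult_lm) auto
 then show ?thesis using mass_bound[OF r, of n] by linarith
qed

lemma slope_bound:
 assumes s: "0 < s" "s <= r"
 shows "B.slope n s <= flow_inv 1 p q (R ^ (DIM('a) - 1) * flow 1 p q (W r / (R - r)) / s ^ (DIM('a) - 1))"
proof -
 have "flow 1 p q (B.slope n s) * s ^ (DIM('a) - 1) <= R ^ (DIM('a) - 1) * flow 1 p q (W r / (R - r))"
  unfolding flow_slope_mass[OF s(1)] using mass_mono[of s r n] mass_bound'[of n] s by simp
 then have "flow 1 p q (B.slope n s) <= R ^ (DIM('a) - 1) * flow 1 p q (W r / (R - r)) / s ^ (DIM('a) - 1)"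
  using s by (simp add: pos_le_divide_eq)
 then have "flow_inv 1 p q (flow 1 p q (B.slope n s)) <= flow_inv 1 p q (R ^ (DIM('a) - 1) * flow 1 p q (W r / (R - r)) / s ^ (DIM('a) - 1))"
  unfolding flow_inv_le_iff[OF B.pq] .
 then show ?thesis unfolding flow_inv_flow[OF B.pq] .
qed

lemma y_lim: "(%n. B.slope n r) ----> y r"
proof -
 obtain l where "(%n. B.slope n r) ----> l"
  using incseq_convergent[OF slope_incseq, of r] slope_bound[OF r(1) order_refl] r by (metis less_imp_le)
 then show ?thesis unfolding y_def by (simp add: limI)
qed

lemma y_pos: "0 < y r"
 using incseq_le[OF slope_incseq y_lim, of 0] B.slope_pos[OF r(1), of 0] r by simp

lemma vs_lim: "(%n. vs n r) ----> max (v0 r) (W r)"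
proof -
 have "(%n. vs (Suc n) r) ----> max (v0 r) (W r)"
  using r by (simp add: vs_Suc) (intro tendsto_max tendsto_const W_lim)
 then show ?thesis by (rule LIMSEQ_imp_Suc)
qed

lemma vs_le: "vs n r <= max (v0 r) (W r)"
 by (rule incseq_le[OF _ vs_lim], rule incseq_SucI) (use r vs_step in auto)

lemma mass_lim: "(%n. mass n r) ----> flow 1 p q (y r) * r ^ (DIM('a) - 1)"
proof -
 have "isCont (flow 1 p q) (y r)"
  using flow_continuous[OF B.pq] y_pos by (intro continuous_on_interior[of "{0..}"]) auto
 then have "(%n. flow 1 p q (B.slope n r)) ----> flow 1 p q (y r)" using isCont_lim[OF _ y_lim] by blast
 then show ?thesis unfolding flow_slope_mass[OF r(1), symmetric] by (intro tendsto_mult tendsto_const)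
qed

end

lemma W_antimono:
 assumes "0 < s" "s <= t" "t < R" shows "W t <= W s"
proof (cases "s = t")
 case False
 show ?thesis by (rule LIMSEQ_le[OF W_lim W_lim]) (use assms False B.prof_strict_decreasing[of s t] in "auto intro!: exI[of _ 0] less_imp_le")
qed simp

lemma W_diff:
 assumes st: "0 < s" "s <= t" "t < R" shows "(y has_integral W s - W t) {s..t}"
proof -
 define M where "M = flow_inv 1 p q (R ^ (DIM('a) - 1) * flow 1 p q (W t / (R - t)) / s ^ (DIM('a) - 1))"
 have flw: "0 <= flow 1 p q (W t / (R - t))" using W_pos[of t] st by (simp add: flow_def)
 have b: "norm (B.slope n x) <= M" if x: "x : {s..t}" for n x
 proof -
  have "B.slope n x <= flow_inv 1 p q (R ^ (DIM('a) - 1) * flow 1 p q (W t / (R - t)) / x ^ (DIM('a) - 1))"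
  by (rule slope_bound) (use st x in auto)
  also have "... <= M" unfolding M_def flow_inv_le_iff[OF B.pq]
  using x st R flw by (intro divide_left_mono power_mono mult_nonneg_nonneg mult_pos_pos) auto
  finally show ?thesis using B.slope_nonneg[of x n] x st by simp
 qed
 have l: "(%n. B.slope n x) ----> y x" if "x : {s..t}" for x by (rule y_lim) (use that st in auto)
 have 1: "y integrable_on {s..t}" "(%n. integral {s..t} (B.slope n)) ----> integral {s..t} y"
  by (rule dominated_convergence[OF B.slope_integrable integrable_const_ivl b l]; assumption)+
 have "integral {s..t} (B.slope n) = B.prof n s - B.prof n t" for n using B.prof_diff[of s t n] st by simp
 then have "(%n. B.prof n s - B.prof n t) ----> integral {s..t} y" using 1(2) by simp
 moreover have "(%n. B.prof n s - B.prof n t) ----> W s - W t" by (intro tendsto_diff W_lim) (use st in auto)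
 ultimately have "integral {s..t} y = W s - W t" by (rule LIMSEQ_unique)
 then show ?thesis using 1(1) by (metis integrable_integral)
qed

text \<open>The radial equation of the limit is stated for increments, because near the centre the
  iterates have no bound uniform in n.\<close>

lemma mass_limit_diff:
 assumes st: "0 < s" "s <= t" "t < R"
 shows "((%x. x ^ (DIM('a) - 1) * f (max (v0 x) (W x))) has_integral
  flow 1 p q (y t) * t ^ (DIM('a) - 1) - flow 1 p q (y s) * s ^ (DIM('a) - 1)) {s..t}"
proof -
 let ?g = "%x. x ^ (DIM('a) - 1) * f (max (v0 x) (W x))"
 have b: "norm (x ^ (DIM('a) - 1) * f (vs n x)) <= R ^ (DIM('a) - 1) * f (max c0 (W s))" if x: "x : {s..t}" for n x
 proof -
  have "v0 x <= c0 * 1" unfolding v0_def using x st c0 by (intro mult_lm) auto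
  then have "vs n x <= max c0 (W s)" using vs_le[of x n] W_antimono[of s x] x st by (auto simp: max_def split: if_splits)
  then have "f (vs n x) <= f (max c0 (W s))" by (intro f_mono) auto
  moreover have "x ^ (DIM('a) - 1) <= R ^ (DIM('a) - 1)" using x st by (intro power_mono) auto
  ultimately have "x ^ (DIM('a) - 1) * f (vs n x) <= R ^ (DIM('a) - 1) * f (max c0 (W s))"
  using f_nonneg x st R by (intro mult_mono) auto
  moreover have "0 <= x ^ (DIM('a) - 1) * f (vs n x)" using f_nonneg x st by simp
  ultimately show ?thesis by simp
 qed
 have l: "(%n. x ^ (DIM('a) - 1) * f (vs n x)) ----> ?g x" if x: "x : {s..t}" for x
 proof -
  have "0 < max (v0 x) (W x)" using W_pos[of x] x st by auto
  then have "isCont f (max (v0 x) (W x))" using f_continuous by (intro continuous_on_interior[of "{0..}"]) auto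
  then have "(%n. f (vs n x)) ----> f (max (v0 x) (W x))"
  using isCont_lim[OF _ vs_lim[of x]] x st by auto
  then show ?thesis by (intro tendsto_mult tendsto_const)
 qed
 have i: "(%x. x ^ (DIM('a) - 1) * f (vs n x)) integrable_on {a..b}" for n a b
  by (rule intb_cont[OF mass_con])
 have 1: "?g integrable_on {s..t}" "(%n. integral {s..t} (%x. x ^ (DIM('a) - 1) * f (vs n x))) ----> integral {s..t} ?g"
  by (rule dominated_convergence[OF i integrable_const_ivl b l]; assumption)+
 have "integral {s..t} (%x. x ^ (DIM('a) - 1) * f (vs n x)) = mass n t - mass n s" for n
  unfolding mass_def using hk_combine[OF _ st(2) i, of 0 n] st by simp
 then have "(%n. mass n t - mass n s) ----> integral {s..t} ?g" using 1(2) by simp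
 moreover have "(%n. mass n t - mass n s) ----> flow 1 p q (y t) * t ^ (DIM('a) - 1) - flow 1 p q (y s) * s ^ (DIM('a) - 1)"
  by (intro tendsto_diff mass_lim) (use st in auto)
 ultimately have eq: "integral {s..t} ?g = flow 1 p q (y t) * t ^ (DIM('a) - 1) - flow 1 p q (y s) * s ^ (DIM('a) - 1)" by (rule LIMSEQ_unique)
 show ?thesis using integrable_integral[OF 1(1)] unfolding eq .
qed

lemma interior_limits:
 assumes "!!s t. 0 < s ==> s <= t ==> t < R ==> (h has_integral H t - H s) {s..t}"
 shows "continuous_on {0<..<R} (H :: real => real)"
 unfolding con_eq_at[OF open_greaterThanLessThan]
proof
 fix x assume x: "x : {0<..<R}"
 let ?a = "x / 2" and ?b = "(x + R) / 2"
 have ab: "0 < ?a" "?a < x" "x < ?b" "?b < R" using x by (auto simp: field_simps)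
 have i: "h integrable_on {?a..?b}" using assms[of ?a ?b] ab by auto
 have "continuous_on {?a..?b} (%t. H ?a + integral {?a..t} h)"
  by (intro con_intros indefinite_integral_continuous_1 i)
 then have "continuous_on {?a..?b} H"
 proof (rule continuous_on_eq)
  show "H ?a + integral {?a..t} h = H t" if "t : {?a..?b}" for t
  using integral_unique[OF assms[of ?a t]] ab that by simp
 qed
 then show "isCont H x" by (rule continuous_on_interior) (use ab in auto)
qed

lemma W_continuous: "continuous_on {0<..<R} W"
proof -
 have "continuous_on {0<..<R} (%t. - W t)"
  by (rule interior_limits[of y]) (use W_diff in simp)
 then show ?thesis using continuous_on_minus by fastforce
qed

lemma y_continuous: "continuous_on {0<..<R} y"
proof -
 have c: "continuous_on {0<..<R} (%t. flow 1 p q (y t) * t ^ (DIM('a) - 1))"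
  by (rule interior_limits[OF mass_limit_diff])
 have "continuous_on {0<..<R} (%t. flow_inv 1 p q (flow 1 p q (y t) * t ^ (DIM('a) - 1) / t ^ (DIM('a) - 1)))"
  by (rule con_comp[OF flow_inv_continuous[OF B.pq] continuous_on_divide[OF c continuous_on_power[OF continuous_on_id]]]) auto
 then show ?thesis by (rule continuous_on_eq) (simp add: flow_inv_flow[OF B.pq])
qed

text \<open>The gradients of the iterates and of ph are both nonpositive multiples of x - c, so
  their angle is acute and \<open>core\<close> is nonnegative. The limit source f(max(v0, W)) is at
  least f(W); equality removes this surplus, giving v0 <= W, and matches the logarithmic
  derivatives. Continuity carries both from almost every point to every radius.\<close>

lemma picone_limit:
 assumes V: "radial_eigen TYPE('a) R p p La V"
  and B: "AL x. x : ball c R -->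
  (ph x / barrier.bar c R 0 p p (%t. La * V t powr (p - 1)) x) *R barrier.bar_grad c R 0 p p (%t. La * V t powr (p - 1)) x = B x"
  and ge: "(LI x. norm (B x) powr q) <= mu * (LI x. ph x powr q)"
  and r: "0 < r" "r < R"
 shows "v0 r <= W r" "y r / W r = barrier.slope TYPE('a) 0 p p (%t. La * V t powr (p - 1)) r / V r"
proof -
 interpret V: radial_eigen c R p p La V by (rule V)
 define n where "n x = norm (x - c)" for x
 have inb: "x : ball c R \<longleftrightarrow> n x < R" for x by (simp add: n_def dist_norm norm_minus_commute)
 have n_cont: "continuous_on A n" for A unfolding n_def by (intro con_intros)
 have Bb: "AL x. B x = (ph x / V.bar x) *R V.bar_grad x"
  using B ph_zero_outside by eventually_elim (metis div_0 scaleR_zero_left)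
 have P: "picone_eigen (ball c R) 1 p q (B.prof k 0) (B.bar k) ph (%x. f (vs k (n x))) (B.bar_grad k) B lam" for k
 proof
  show "supersol (ball c R) 1 p q (B.bar_grad k) (%x. f (vs k (n x)))" unfolding n_def by (rule B.bar_supersol) simp
  show "(%x. f (vs k (n x))) : lmeas"
  by (rule con_meas, rule con_comp[OF B.F(1) n_cont]) auto
  show "AL x. ALL s>0. 0 <= core p q (s *R B.bar_grad k x) (B x)" using Bb
  proof eventually_elim
  case (elim x)
  show ?case
  proof (intro allI impI core_nonneg_acute q pq1)
  fix s :: real assume s: "0 < s"
  show "0 <= (s *R B.bar_grad k x) *. B x"
  proof (cases "n x < R")
  case True
  have "0 <= s * (B.slope k (n x) / n x) * ((ph x / V.bar x) * (V.slope (n x) / n x)) * ((x - c) *. (x - c))"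
  using s ph(2)[of x] B.slope_nonneg[of "n x" k] V.slope_nonneg[of "n x"] V.bar_nonneg[of x]
  by (intro mult_nonneg_nonneg divide_nonneg_nonneg inner_ge_zero) (auto simp: n_def)
  then show ?thesis using True by (simp add: elim B.bar_grad_def V.bar_grad_def n_def mult_ac)
  qed (simp add: B.bar_grad_def n_def)
  qed
  qed
  show "(LI x. fl p (B x) *. h x) <= (LI x. lam * (ph x powr (p - 1) * w x))"
  if "sob (ball c R) p w h" for w h using eig_supersol_form[OF that] .
 qed (use q pp pq1 B.bar_sob[OF pp(1)] B.bar_nonneg B.bar_le B.bar_pos f_nonneg ph lam_nonneg in auto)
 define S where "S = ball c R - {c}"
 have S: "x : S \<longleftrightarrow> x : ball c R & x ~= c" for x by (auto simp: S_def)
 have AEc: "AL x. x ~= c" using AE_not_in[of "{c}" lebesgue] by (simp add: negligible_iff_null_sets[symmetric])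
 have nn: "0 < n x & n x < R" if "x : S" for x using that inb[of x] S by (auto simp: n_def)
 let ?H = "%x. - (y (n x) / n x) *R (x - c)" and ?L = "%x. f (max (v0 (n x)) (W (n x)))"
 have lim: "AL x. x : ball c R --> 0 < W (n x) & (%k. B.bar k x) ----> W (n x)
  & (%k. B.bar_grad k x) ----> ?H x & (%k. f (vs k (n x))) ----> ?L x & f (W (n x)) <= ?L x"
  using AEc
 proof eventually_elim
  case (elim x)
  show ?case
  proof
  assume x: "x : ball c R"
  then have nx: "0 < n x" "n x < R" using nn elim S by auto
  have Wp: "0 < W (n x)" by (rule W_pos[OF nx])
  have cf: "isCont f t" if "0 < t" for t using f_continuous that by (intro continuous_on_interior[of "{0..}"]) auto
  have "(%k. f (vs k (n x))) ----> ?L x"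
  by (rule isCont_lim[OF cf vs_lim[OF nx]]) (use Wp in auto)
  moreover have "(%k. B.bar k x) ----> W (n x)" using W_lim[OF nx] nx by (simp add: B.bar_def n_def)
  moreover have "(%k. - (B.slope k (n x) / n x) *R (x - c)) ----> ?H x"
  by (intro tendsto_intros y_lim[OF nx]) (use nx in auto)
  then have "(%k. B.bar_grad k x) ----> ?H x" using nx by (simp add: B.bar_grad_def n_def)
  ultimately show "0 < W (n x) & (%k. B.bar k x) ----> W (n x)
  & (%k. B.bar_grad k x) ----> ?H x & (%k. f (vs k (n x))) ----> ?L x & f (W (n x)) <= ?L x"
  using Wp f_mono[of "W (n x)" "max (v0 (n x)) (W (n x))"] by simp
  qed
 qed
 have vu: "AL x. ALL k. B.bar k x <= u x"
  using bar_le_u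
 proof eventually_elim
  case (elim x)
  then show ?case using u(2)[of x] by (cases "x : ball c R") (auto simp: B.bar_def dist_norm norm_minus_commute)
 qed
 have ae: "AL x. x : S --> max (v0 (n x)) (W (n x)) = W (n x) & y (n x) / W (n x) = V.slope (n x) / V (n x)"
  using picone_sequence(2)[OF P vu lim ge] ph(3) Bb
 proof eventually_elim
  case (elim x)
  show ?case
  proof
  assume x: "x : S"
  then have nx: "0 < n x" "n x < R" and xb: "x : ball c R" using nn S by auto
  have Wp: "0 < W (n x)" by (rule W_pos[OF nx])
  have ph: "0 < ph x" using elim xb by simp
  have m: "max (v0 (n x)) (W (n x)) = W (n x)"
  using f_strict[of "W (n x)" "max (v0 (n x)) (W (n x))"] Wp elim(1) xb by force
  have "(ph x / W (n x)) *R ?H x = (ph x / V.bar x) *R V.bar_grad x" using elim xb by simp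
  then have "(ph x / n x * (y (n x) / W (n x))) *R (x - c) = (ph x / n x * (V.slope (n x) / V (n x))) *R (x - c)"
  using nx V.bar_eq[OF xb] by (simp add: V.bar_grad_def n_def mult.commute)
  moreover have "x - c ~= 0" "ph x / n x ~= 0" using x S ph nx by auto
  ultimately show "max (v0 (n x)) (W (n x)) = W (n x) & y (n x) / W (n x) = V.slope (n x) / V (n x)"
  using m unfolding scaleR_cancel_right mult_cancel_left by blast
  qed
 qed
 have oS: "open S" unfolding S_def by (intro open_Diff) auto
 have nS: "n ` S <= {0<..<R}" using nn by auto
 have comp: "continuous_on S (%x. h (n x))" if "continuous_on {0<..<R} h" for h :: "real => real"
  by (rule con_comp[OF that n_cont nS])
 have c1: "continuous_on {0<..<R} (%t. max (v0 t) (W t))"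
  by (intro continuous_on_max W_continuous con_sub[OF v0_props(1)]) auto
 have c2: "continuous_on {0<..<R} (%t. y t / W t)"
  by (intro continuous_on_divide W_continuous y_continuous ballI) (use W_pos in force)
 have nzV: "V t ~= 0" if "t : {0<..<R}" for t using V.V_pos[of t] that by auto
 have c3: "continuous_on {0<..<R} (%t. V.slope t / V t)"
  by (intro continuous_on_divide con_sub[OF V.slope_con] con_sub[OF V.V(1)] ballI nzV) auto
 obtain i :: 'a where i: "i : Basis" using nonempty_Basis by blast
 have n: "n (c + r *R i) = r" using i r by (simp add: n_def)
 have "c + r *R i : ball c R" by (simp only: inb n r)
 moreover have "c + r *R i ~= c" using r i by (simp add: nonzero_Basis)
 ultimately have x: "c + r *R i : S" unfolding S by blast
 have "max (v0 (n (c + r *R i))) (W (n (c + r *R i))) = W (n (c + r *R i))"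
  by (rule AE_eq_continuous[OF oS comp[OF c1] comp[OF W_continuous] _ x]) (use ae in eventually_elim, blast)
 then show "v0 r <= W r" unfolding n by (metis max.cobounded1)
 have "y (n (c + r *R i)) / W (n (c + r *R i)) = V.slope (n (c + r *R i)) / V (n (c + r *R i))"
  by (rule AE_eq_continuous[OF oS comp[OF c2] comp[OF c3] _ x]) (use ae in eventually_elim, blast)
 then show "y r / W r = V.slope r / V r" unfolding n .
qed

lemma W_DERIV:
 assumes r: "0 < r" "r < R" shows "(W has_real_derivative - y r) (at r)"
proof -
 let ?a = "r / 2" and ?b = "(r + R) / 2"
 have ab: "0 < ?a" "?a < r" "r < ?b" "?b < R" using r by (auto simp: field_simps)
 have "continuous_on {?a..?b} y" by (rule con_sub[OF y_continuous]) (use ab in auto)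
 from integral_has_vector_derivative[OF this, of r] ab
 have "((%t. integral {?a..t} y) has_real_derivative y r) (at r)"
  by (simp add: real_vec_deriv at_within_interior[of r "{?a..?b}"])
 then have "((%t. W ?a - integral {?a..t} y) has_real_derivative - y r) (at r)" by (auto intro!: deriv_eqs)
 then show ?thesis
 proof (rule has_field_derivative_transform_within_open[of _ _ _ "{?a<..<?b}"])
  fix t assume "t : {?a<..<?b}"
  then show "W ?a - integral {?a..t} y = W t" using integral_unique[OF W_diff[of ?a t]] ab by simp
 qed (use ab in auto)
qed

text \<open>Equal logarithmic derivatives give W = C V, so the limit is bounded at the centre after
  all and its radial equation holds from 0 on. Subtracting the p-equation of V leaves a q-equation
  for the same V, which \<open>radial_two_exponents\<close> forbids.\<close>

theorem no_equality:
 assumes N: "2 <= DIM('a)" and V: "radial_eigen TYPE('a) R p p lam V"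
  and B: "AL x. x : ball c R -->
  (ph x / barrier.bar c R 0 p p (%t. lam * V t powr (p - 1)) x) *R barrier.bar_grad c R 0 p p (%t. lam * V t powr (p - 1)) x = B x"
  and ge: "(LI x. norm (B x) powr q) <= mu * (LI x. ph x powr q)"
 shows False
proof -
 interpret V: radial_eigen c R p p lam V by (rule V)
 let ?N = "DIM('a) - 1"
 note lim = picone_limit[OF V B ge]
 define C where "C = W (R / 2) / V (R / 2)"
 have mid: "0 < R / 2" "R / 2 < R" using R by auto
 have C: "0 < C" unfolding C_def using W_pos[OF mid] V.V_pos[of "R/2"] mid by simp
 have WV: "W r = C * V r" if r: "0 < r" "r < R" for r
 proof -
  have "ln (W r) - ln (V r) = ln (W (R / 2)) - ln (V (R / 2))"
  proof (rule DERIV_isconst3[of 0 R r "R / 2" "%t. ln (W t) - ln (V t)"])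
  fix t assume t: "t : {0<..<R}"
  then have "((%t. ln (W t)) has_real_derivative - (y t / W t)) (at t)"
  using W_pos[of t] by (auto intro!: deriv_eqs W_DERIV)
  from DERIV_diff[OF this V.ln_V_derivative] show "((%t. ln (W t) - ln (V t)) has_real_derivative 0) (at t)"
  using lim(2)[of t] t by simp
  qed (use R r mid in auto)
  then have "ln (W r / V r) = ln C" unfolding C_def using W_pos[OF r] V.V_pos[of r] W_pos[OF mid] V.V_pos[of "R/2"] r mid by (simp add: ln_div)
  then have "W r / V r = C" using W_pos[OF r] V.V_pos[of r] r C by simp
  then show ?thesis using V.V_pos[of r] r by (simp add: field_simps)
 qed
 have y: "y r = C * V.slope r" if r: "0 < r" "r < R" for r
  using lim(2)[OF r] WV[OF r] V.V_pos[of r] r C by (simp add: field_simps)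
 define g where "g x = x ^ ?N * f (C * V x)" for x
 have gc: "continuous_on A g" for A unfolding g_def
  by (intro con_intros con_comp[OF f_continuous] con_sub[OF V.V(1)]) (use C V.V(2) in auto)
 have gi: "g integrable_on {a..b}" for a b by (rule intb_cont[OF gc])
 \<comment> \<open>The defect in the integrated equation of C V. It is constant on (0, R) because
   only increments were known, and continuity at 0, where it vanishes, identifies the
   constant.\<close>
 define H where "H s = flow 1 p q (C * V.slope s) * s ^ ?N - integral {0..s} g" for s
 have Hc: "H s = H t" if st: "0 < s" "s <= t" "t < R" for s t
 proof -
  have yy: "y s = C * V.slope s" "y t = C * V.slope t" by (rule y; use st in linarith)+
  have "integral {s..t} (%x. x ^ ?N * f (max (v0 x) (W x))) = flow 1 p q (C * V.slope t) * t ^ ?N - flow 1 p q (C * V.slope s) * s ^ ?N"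
  using integral_unique[OF mass_limit_diff[OF st]] unfolding yy .
  moreover have "integral {s..t} (%x. x ^ ?N * f (max (v0 x) (W x))) = integral {s..t} g"
  proof (rule integral_cong)
  fix x assume "x : {s..t}"
  then have "0 < x" "x < R" using st by auto
  then have "max (v0 x) (W x) = C * V x" using lim(1)[of x] WV[of x] by (simp add: max_def)
  then show "x ^ ?N * f (max (v0 x) (W x)) = g x" by (simp add: g_def)
  qed
  moreover have "integral {0..s} g + integral {s..t} g = integral {0..t} g"
  by (rule hk_combine[OF _ _ gi]) (use st in auto)
  ultimately show ?thesis unfolding H_def by linarith
 qed
 have H0: "H t = 0" if t: "0 < t" "t < R" for t
 proof -
  have 1: "continuous_on {0..R} (%s. C * V.slope s)"
  by (intro continuous_on_mult continuous_on_const con_sub[OF V.slope_con]) simp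
  have 2: "continuous_on {0..R} (%s. flow 1 p q (C * V.slope s))"
  proof (rule con_comp[where g = "flow 1 p q" and t = "{0..}"])
  show "continuous_on {0..} (flow 1 p q)" by (rule flow_continuous[OF q(1) pp(4) zero_le_one])
  show "(%s. C * V.slope s) ` {0..R} <= {0..}"
  proof (rule image_subsetI)
  fix s assume "s : {0..R}"
  then show "C * V.slope s : {0..}" using C V.slope_nonneg[of s] by simp
  qed
  qed (rule 1)
  have 3: "continuous_on {0..R} (%s. s ^ ?N)" by (intro con_intros)
  have 4: "continuous_on {0..R} (%s. integral {0..s} g)" by (rule indefinite_integral_continuous_1) (rule gi)
  have "continuous_on {0..R} H" unfolding H_def by (rule continuous_on_diff[OF continuous_on_mult[OF 2 3] 4])
  then have "(H \<longlongrightarrow> H 0) (at 0 within {0..R})" using R by (simp add: continuous_on_def)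
  then have l: "(H \<longlongrightarrow> H 0) (at_right 0)" using R by (simp add: at_within_Icc_at_right)
  have "\<forall>\<^sub>F s in at_right 0. H s = H t"
  using eventually_at_right_real[OF t(1)] by eventually_elim (use Hc t in auto)
  then have "(H \<longlongrightarrow> H t) (at_right 0)" by (rule tendsto_eventually)
  then have "H t = H 0" by (rule tendsto_unique[OF trivial_limit_at_right_real _ l])
  also have "H 0 = 0" using N by (simp add: H_def)
  finally show ?thesis .
 qed
 show False
 proof (rule radial_two_exponents[OF N q R V.V(1,2) V.V_R _ V.La mu0 V.slope_pos])
  fix t assume t: "0 < t" "t < R"
  let ?P = "integral {0..t} (%s. s ^ ?N * V s powr (p - 1))" and ?Q = "integral {0..t} (%s. s ^ ?N * V s powr (q - 1))"
  show P: "V.slope t powr (p - 1) * t ^ ?N = lam * ?P" by (rule V.slope_mass[OF t(1)])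
  have c: "(%s. s ^ ?N * V s powr (r - 1)) integrable_on {0..t}" if "1 < r" for r
  by (intro intb_cont continuous_on_mult continuous_on_powr' con_intros con_sub[OF V.V(1)])
  (use V.V(2) that in auto)
  have "integral {0..t} g = integral {0..t} (%s. lam * C powr (p - 1) * (s ^ ?N * V s powr (p - 1)) + mu * C powr (q - 1) * (s ^ ?N * V s powr (q - 1)))"
  using C V.V(2) by (intro integral_cong) (simp add: g_def f_def powr_mult algebra_simps)
  also have "... = lam * C powr (p - 1) * ?P + mu * C powr (q - 1) * ?Q"
  by (subst integral_add) (use c q pp in "auto intro!: integrable_on_mult_right")
  finally have "flow 1 p q (C * V.slope t) * t ^ ?N = C powr (p - 1) * (lam * ?P) + mu * C powr (q - 1) * ?Q"
  using H0[OF t] by (simp add: H_def)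
  moreover have "flow 1 p q (C * V.slope t) * t ^ ?N = C powr (p - 1) * (V.slope t powr (p - 1) * t ^ ?N) + C powr (q - 1) * (V.slope t powr (q - 1) * t ^ ?N)"
  proof -
  have "\<not> C * V.slope t < 0" using mult_pos_pos[OF C V.slope_pos[OF t(1)]] by linarith
  then have "flow 1 p q (C * V.slope t) = (C * V.slope t) powr (p - 1) + (C * V.slope t) powr (q - 1)" by (simp only: flow_def if_False mult_1)
  then show ?thesis using C V.slope_pos[OF t(1)] by (simp only: powr_mult distrib_right mult.assoc)
  qed
  ultimately have "C powr (q - 1) * (V.slope t powr (q - 1) * t ^ ?N) = mu * C powr (q - 1) * ?Q" unfolding P by linarith
  then have "C powr (q - 1) * (V.slope t powr (q - 1) * t ^ ?N) = C powr (q - 1) * (mu * ?Q)" by (simp only: mult_ac)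
  then show "V.slope t powr (q - 1) * t ^ ?N = mu * ?Q" using C unfolding mult_cancel_left by simp
 qed (use V.V(3) in simp)
qed

end

text \<open>Comparing Rayleigh quotients in both directions identifies the radial eigenvalue with
  lam, so ph has the logarithmic gradient of the radial eigenfunction. Assuming mu is too large, a
  strict Rayleigh inequality supplies the lower bound for u that starts the iteration, and the
  iteration ends in a contradiction.\<close>

lemma (in solution_pair) mu_lt_of_ball:
 assumes ball: "Om = ball c R" and N: "2 <= DIM('a)" and pq1: "p <= q + 1"
  and minim: "!!w h. sob Om p w h ==> (!!x. 0 <= w x) ==>
  lam * (LI x. w x powr p) <= (LI x. norm (h x) powr p)"
 shows "mu * (LI x. ph x powr q) < (LI x. norm (B x) powr q)"
proof (rule ccontr)
 assume "\<not> ?thesis"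
 then have ge: "(LI x. norm (B x) powr q) <= mu * (LI x. ph x powr q)" by simp
 have R: "0 < R" using Om(3) unfolding ball by (metis ball_eq_empty not_le)
 obtain V La where V: "radial_eigen TYPE('a) R p p La V" by (rule radial_exists[OF R pp(2) order_refl])
 obtain V2 La2 where V2: "radial_eigen TYPE('a) R p q La2 V2" by (rule radial_exists[OF R q(1) pp(4)])
 interpret V: radial_eigen c R p p La V by (rule V)
 interpret Q: radial_eigen c R p q La2 V2 by (rule V2)
 note phb = ph(1)[unfolded ball]
 have ip: "0 < (LI x. ph x powr p)" using ph_powr(2)[of p] pp by simp
 have "La <= lam" using V.picone_terms(1)[OF phb ph(2)] ip unfolding rayleigh_p by simp
 moreover have "lam <= La"
 proof -
  have s: "sob Om p V.bar V.bar_grad" unfolding ball by (rule V.bar_sob[OF pp(1)])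
  have "0 < (LI x. V.bar x powr p)"
  by (rule integral_powr_pos(2)[OF s V.bar_nonneg]) (use V.bar_pos pp in "auto simp: ball")
  then show ?thesis using minim[OF s V.bar_nonneg] unfolding V.rayleigh_bar by simp
 qed
 ultimately have La: "La = lam" by simp
 have Bp: "AL x. x : ball c R --> (ph x / V.bar x) *R V.bar_grad x = B x"
  by (rule V.picone_terms(2)[OF phb ph(2)]) (simp add: rayleigh_p La)
 have q2: "p <= 2 * q" using pq1 q by simp
 have "EX x. good x"
 proof (cases "(LI x. norm (B x) powr q) < mu * (LI x. ph x powr q)")
  case True
  then show ?thesis by (rule nice_test_function[OF ph(1,2) _ q2])
 next
  \<comment> \<open>In the case of equality ph itself gives no strict inequality. The radial
    q-eigenfunction does: its eigenvalue is at most mu, and equality would give it the logarithmic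
    gradient of the p-eigenfunction.\<close>
  case False
  then have eq: "(LI x. norm (B x) powr q) = mu * (LI x. ph x powr q)" using ge by simp
  have iq: "0 < (LI x. ph x powr q)" using ph_powr(2)[of q] pp by simp
  have "La2 <= mu" using Q.picone_terms(1)[OF phb ph(2)] iq unfolding eq by simp
  moreover have "La2 ~= mu"
  proof
  assume m: "La2 = mu"
  have Bq: "AL x. x : ball c R --> (ph x / Q.bar x) *R Q.bar_grad x = B x"
  by (rule Q.picone_terms(2)[OF phb ph(2)]) (simp add: eq m)
  have "AL x. x : ball c R --> (1 / V.bar x) *R V.bar_grad x = (1 / Q.bar x) *R Q.bar_grad x"
  using Bp Bq ph(3)
  proof eventually_elim
  case (elim x)
  show ?case
  proof
  assume x: "x : ball c R"
  then have "ph x *R ((1 / V.bar x) *R V.bar_grad x) = ph x *R ((1 / Q.bar x) *R Q.bar_grad x)"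
  using elim by simp
  then show "(1 / V.bar x) *R V.bar_grad x = (1 / Q.bar x) *R Q.bar_grad x"
  using elim(3) x ball unfolding scaleR_cancel_left by auto
  qed
  qed
  then show False by (rule radial_eigen_distinct[OF V V2 N q(2)])
  qed
  ultimately have lt: "La2 < mu" by simp
  have s: "sob Om p Q.bar Q.bar_grad" unfolding ball by (rule Q.bar_sob[OF pp(1)])
  have "0 < (LI x. Q.bar x powr q)"
  by (rule integral_powr_pos(2)[OF s Q.bar_nonneg]) (use Q.bar_pos pp in "auto simp: ball")
  then have "(LI x. norm (Q.bar_grad x) powr q) < mu * (LI x. Q.bar x powr q)"
  unfolding Q.rayleigh_bar using lt by simp
  then show ?thesis by (rule nice_test_function[OF s Q.bar_nonneg _ q2])
 qed
 then obtain x0 where x0: "good x0" by blast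
 have mu0: "0 < mu"
 proof -
  have "0 < La2 * (LI x. ph x powr q)" using Q.La ph_powr(2)[of q] pp by simp
  also have "... <= mu * (LI x. ph x powr q)" using Q.picone_terms(1)[OF phb ph(2)] ge by simp
  finally show ?thesis using mu by (simp add: zero_less_mult_iff)
 qed
 have "good c" by (rule good_everywhere[OF mu0 _ x0]) (use R in "auto simp: ball connected_ball")
 then obtain c0 de where c0: "0 < c0" "0 < de" "AL y. y : ball c de --> c0 <= u y" unfolding good_def by blast
 interpret I: ball_iter c R p q lam ph B mu u G c0 de
  by (intro ball_iter.intro ball_iter_axioms.intro, unfold ball[symmetric]) (unfold_locales, (fact R pq1 mu0 c0)+)
 show False by (rule I.no_equality[OF N V[unfolded La] Bp[unfolded La] ge])
qed

text \<open>Both nonexistence claims follow from one statement about a given positive solution with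
  parameter at least the critical quotient: the parameter must equal this quotient and the domain
  cannot be a ball.\<close>

theorem theorem3p2_aux:
 fixes Om :: "'a::euclidean_space set"
 assumes N: "2 <= DIM('a)" and dom: "smooth_bounded_domain Om" and q: "1 < q" "q < p"
  and eig: "first_eigenfunction Om p ph" and pos: "positive_in Om ph"
  and hyp: "p : Iset q \<or> p <= q + 1 & is_N_ball Om"
  and sol: "weak_solution Om p q \<mu> u" "positive_in Om u" and mu: "beta_star Om q ph <= \<mu>"
 shows "\<mu> = beta_star Om q ph" "\<not> is_N_ball Om"
proof -
 have Om: "open Om" "bounded Om" "Om ~= {}" using dom by (auto simp: smooth_bounded_domain_def)
 have p: "1 < p" "0 < p" using q by auto
 have Omm: "Om : sets lebesgue" using Om by simp
 have phW: "ph : W01p Om p" using eig by (simp add: first_eigenfunction_def)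
 have uW: "u : W01p Om p" using sol by (simp add: weak_solution_def)
 obtain v B where v: "sob Om p v B" "!!x. 0 <= v x" "AL x. x : Om --> 0 < v x"
  "AL x. x : Om --> ph x = v x" "AL x. x : Om --> weak_grad Om ph x = B x"
  using positive_W01p_pair[OF phW pos Om(1) p(1)] by blast
 obtain z G where z: "sob Om p z G" "!!x. 0 <= z x" "AL x. x : Om --> 0 < z x"
  "AL x. x : Om --> u x = z x" "AL x. x : Om --> weak_grad Om u x = G x"
  using positive_W01p_pair[OF uW sol(2) Om(1) p(1)] by blast
 have meas: "v : lmeas" "B : lmeas" "z : lmeas" "G : lmeas"
  using sob_meas[OF v(1)] sob_meas[OF z(1)] by auto
 let ?l = "lambda1 Om p"
 have test: "w : W01p Om p" if "sob Om p w h" for w h by (rule sob_W01p(1)[OF that Om(1,2) p(1)])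
 interpret E: eigen_pair Om p q ?l v B
 proof
  fix w h assume s: "sob Om p w h"
  have "r_laplacian_form Om p ph w = ?l * r_power_form Om p ph w"
  using eig test[OF s] by (simp add: first_eigenfunction_def)
  then show "(LI x. fl p (B x) *. h x) = ?l * (LI x. v x powr (p - 1) * w x)"
  unfolding r_laplacian_form_eq[OF s Om(1,2) p(1) meas(2) v(5)] r_power_form_eq[OF s Om(1) p(1) meas(1) v(4,2)] .
 qed (fact Om q v)+
 have LO: "(LINT x|lebesgue_on Om. k (F x)) = (LI x. k (H x))"
  if "AL x. x : Om --> F x = H x" "AL x. x ~: Om --> k (H x) = 0" "(%x. k (H x)) : lmeas"
  for k :: "'b => real" and F H :: "'a => 'b"
 proof -
  have ae: "AL x. k (H x) = indicator Om x *R k (F x)"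
  using that(1,2) by eventually_elim (auto simp: indicator_def)
  show ?thesis unfolding LINT_lebesgue_on[OF Omm]
  by (rule integral_cong_AE[symmetric, OF that(3) meas_AE[OF that(3) ae] ae])
 qed
 have beta: "beta_star Om q ph = (LI x. norm (B x) powr q) / (LI x. v x powr q)"
 proof -
  have "(LINT x|lebesgue_on Om. norm (weak_grad Om ph x) powr q) = (LI x. norm (B x) powr q)"
  by (rule LO[OF v(5)]) (use E.ph_zero_outside q meas in auto)
  moreover have "(LINT x|lebesgue_on Om. ph x powr q) = (LI x. v x powr q)"
  by (rule LO[OF v(4)]) (use E.ph_zero_outside q meas in auto)
  ultimately show ?thesis by (simp add: beta_star_def)
 qed
 have iq: "0 < (LI x. v x powr q)" using E.ph_powr(2)[of q] q by simp
 \<comment> \<open>The quotient of two nonnegative integrals is nonnegative; the sign of the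
   parameter is what makes the source increasing.\<close>
 have mu0: "0 <= \<mu>" using mu unfolding beta by (rule order_trans[rotated]) (intro divide_nonneg_nonneg; simp)
 interpret S: solution_pair Om p q ?l v B \<mu> z G
 proof
  fix w h assume s: "sob Om p w h"
  have gi: "grad_int Om p G" by (rule sob_grad_int[OF z(1) p(2) Omm])
  have gq: "lint (%x. fl q (G x) *. h x)" "lint (%x. fl p (G x) *. h x)"
  proof -
  show "lint (%x. fl p (G x) *. h x)" by (rule fl_dominated[OF Om(1,2) p(1) gi s])
  have "lint (%x. flux 0 p q (G x) *. h x)"
  by (rule flux_dominated[OF Om(1,2) q(1) less_imp_le[OF q(2)] order_refl gi s])
  then show "lint (%x. fl q (G x) *. h x)" by (simp add: flux_def)
  qed
  have "r_laplacian_form Om p u w + r_laplacian_form Om q u w = ?l * r_power_form Om p u w + \<mu> * r_power_form Om q u w"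
  using sol(1) test[OF s] by (simp add: weak_solution_def)
  then show "(LI x. flux 1 p q (G x) *. h x) = ?l * (LI x. z x powr (p - 1) * w x) + \<mu> * (LI x. z x powr (q - 1) * w x)"
  unfolding r_laplacian_form_eq[OF s Om(1,2) p(1) meas(4) z(5)] r_power_form_eq[OF s Om(1) p(1) meas(3) z(4,2)]
  using gq by (simp add: flux_def inner_add_left)
 qed (fact mu0 z)+
 have minim: "?l * (LI x. w x powr p) <= (LI x. norm (h x) powr p)"
  if s: "sob Om p w h" and w: "!!x. 0 <= w x" for w h
 proof (cases "(LI x. w x powr p) = 0")
  case False
  then have ip: "0 < (LI x. w x powr p)" by (simp add: less_le)
  have m: "w : lmeas" "h : lmeas" using sob_meas[OF s] by auto
  have g: "AL x. x : Om --> weak_grad Om w x = h x" by (rule sob_W01p(2)[OF s Om(1,2) p(1)])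
  have o: "AL x. x ~: Om --> w x = 0 & h x = 0" by (rule sob_outside[OF s p(2)])
  have "(LINT x|lebesgue_on Om. norm (weak_grad Om w x) powr p) = (LI x. norm (h x) powr p)"
  by (rule LO[OF g]) (use o p m in "auto elim: eventually_mono")
  moreover have "(LINT x|lebesgue_on Om. <|w x|> powr p) = (LI x. <|w x|> powr p)"
  by (rule LO) (use o p m in "auto elim: eventually_mono")
  ultimately have rq: "rayleigh_quotient Om p w = (LI x. norm (h x) powr p) / (LI x. w x powr p)"
  using w by (simp add: rayleigh_quotient_def)
  have ne: "\<not> (AE x in lebesgue_on Om. w x = 0)"
  proof
  assume "AE x in lebesgue_on Om. w x = 0"
  then have "AL x. x : Om --> w x = 0" unfolding AE_lebesgue_on_iff[OF Omm] .
  then have "AL x. w x powr p = 0" using o by eventually_elim auto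
  then have "(LI x. w x powr p) = 0" by (rule integral_eq_zero_AE)
  then show False using ip by simp
  qed
  have "?l <= rayleigh_quotient Om p w" unfolding lambda1_def
  proof (rule cInf_lower)
  show "bdd_below {rayleigh_quotient Om p u |u. u : W01p Om p & \<not> (AE x in lebesgue_on Om. u x = 0)}"
  by (rule bdd_belowI[of _ 0]) (auto simp: rayleigh_quotient_def intro!: divide_nonneg_nonneg)
  qed (use test[OF s] ne in blast)
  then show ?thesis unfolding rq using ip by (simp add: pos_le_divide_eq)
 qed simp
 have pq1: "p <= q + 1" using hyp Iset_le by blast
 have lt: "\<not> is_N_ball Om"
 proof
  assume "is_N_ball Om"
  then obtain c R where "Om = ball c R" unfolding is_N_ball_def by blast
  from S.mu_lt_of_ball[OF this N pq1 minim]
  show False using mu iq unfolding beta by (simp add: pos_divide_le_eq)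
 qed
 then show "\<not> is_N_ball Om" .
 have "\<mu> * (LI x. v x powr q) <= (LI x. norm (B x) powr q)"
  by (rule S.mu_le_of_core[OF pq1 core_nonneg_Iset[OF q]]) (use hyp lt in blast)
 then show "\<mu> = beta_star Om q ph" using mu iq unfolding beta by (simp add: pos_divide_le_eq pos_le_divide_eq field_simps)
qed

theorem theorem3p2:
  fixes \<Omega> :: "(real ^ 'n) set" and p q :: real and \<phi>\<^sub>p :: "real ^ 'n \<Rightarrow> real"
  assumes "CARD('n) \<ge> 2"
    and "smooth_bounded_domain \<Omega>"
    and "1 < q" and "q < p"
    and "first_eigenfunction \<Omega> p \<phi>\<^sub>p" and "positive_in \<Omega> \<phi>\<^sub>p"
    and "Lp_norm \<Omega> p (weak_grad \<Omega> \<phi>\<^sub>p) = 1"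
    and "p \<in> Iset q \<or> (p \<le> q + 1 \<and> is_N_ball \<Omega>)"
  shows "(\<forall>\<mu> > beta_star \<Omega> q \<phi>\<^sub>p. \<not> (\<exists>u. weak_solution \<Omega> p q \<mu> u \<and> positive_in \<Omega> u)) \<and>
    (p < q + 1 \<and> is_N_ball \<Omega> \<longrightarrow>
       \<not> (\<exists>u. weak_solution \<Omega> p q (beta_star \<Omega> q \<phi>\<^sub>p) u \<and> positive_in \<Omega> u))"
proof -
 have N: "2 \<le> DIM(real ^ 'n)" using assms(1) by simp
 note aux = theorem3p2_aux[OF N assms(2-6,8)]
 show ?thesis
 proof (intro conjI allI impI notI)
  fix \<mu> assume "beta_star \<Omega> q \<phi>\<^sub>p < \<mu>" "EX u. weak_solution \<Omega> p q \<mu> u \<and> positive_in \<Omega> u"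
  then show False using aux(1) by (metis less_imp_le less_irrefl)
 next
  assume "p < q + 1 \<and> is_N_ball \<Omega>" "EX u. weak_solution \<Omega> p q (beta_star \<Omega> q \<phi>\<^sub>p) u \<and> positive_in \<Omega> u"
  then show False using aux(2) order_refl by blast
 qed
qed

end
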